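(* Let $\Omega$ be a Borel space, $S:\Omega\to\Omega$ an invertible bimeasurable transformation, $\mu$ an $S$-ergodic (in particular $S$-invariant) probability measure on $\Omega$, and $f:\Omega\to\mathbb{D}$ a measurable function for which there is a constant $C<1$ with $|f|\le C$ $\mu$-almost everywhere. Let $\{\mathcal{E}_\omega\}_{\omega\in\Omega}$ be the associated ergodic family of extended CMV matrices with Verblunsky coefficients $\alpha_n(\omega)=f(S^n\omega)$, $n\in\mathbb{Z}$. Let $\nu_\omega$ be the spectral measure of $\mathcal{E}_\omega$ with respect to $\delta_0$, $k$ the density of states measure of the family, $\gamma$ the Lyapunov exponent, and $\mathcal{Z}=\{z\in\mathbb{C}:\gamma(z)=0\}$. Let $\nu_\omega^{(\mathrm{ac})}$ and $k^{(\mathrm{ac})}$ denote the densities of the absolutely continuous parts of $\nu_\omega$ and $k$ on the unit circle $\partial\mathbb{D}$. Then for Lebesgue-almost every $z\in\mathcal{Z}\cap\partial\mathbb{D}$ (with respect to arc length on $\partial\mathbb{D}$), $$k^{(\mathrm{ac})}(z)=\int_\Omega \nu_\omega^{(\mathrm{ac})}(z)\,d\mu(\omega).$$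
   Context: $\mathbb{D}=\{z\in\mathbb{C}:|z|<1\}$ and $\partial\mathbb{D}$ is the unit circle. **Extended CMV matrices.** Given $\alpha=(\alpha_n)_{n\in\mathbb{Z}}$ with $\alpha_n\in\mathbb{D}$, put $\rho_n=\sqrt{1-|\alpha_n|^2}$. The extended CMV matrix $\mathcal{E}_\alpha$ is the unitary operator on $\ell^2(\mathbb{Z})$ whose matrix, in the standard basis $(\delta_n)_{n\in\mathbb{Z}}$, has for every $j\in\mathbb{Z}$ the following entries in columns $2j-1,\,2j,\,2j+1,\,2j+2$ (all other entries in these rows being $0$): - row $2j$: $\ \overline{\alpha_{2j}}\rho_{2j-1},\ -\overline{\alpha_{2j}}\alpha_{2j-1},\ \overline{\alpha_{2j+1}}\rho_{2j},\ \rho_{2j+1}\rho_{2j}$; - row $2j+1$: $\ \rho_{2j}\rho_{2j-1},\ -\rho_{2j}\alpha_{2j-1},\ -\overline{\alpha_{2j+1}}\alpha_{2j},\ -\rho_{2j+1}\alpha_{2j}$. **Ergodic family.** $\mathcal{E}_\omega=\mathcal{E}_{\alpha(\omega)}$ with $\alpha_n(\omega)=f(S^n\omega)$. **Spectral measure.** $\nu_\omega$ is the Borel probability measure on $\partial\mathbb{D}$ with $\langle\delta_0,g(\mathcal{E}_\omega)\delta_0\rangle=\int_{\partial\mathbb{D}}g\,d\nu_\omega$ for all continuous $g$ on $\partial\mathbb{D}$. **Density of states measure.** $k$ is the Borel probability measure on $\partial\mathbb{D}$ with $\int g\,dk=\int_\Omega\langle\delta_0,g(\mathcal{E}_\omega)\delta_0\rangle\,d\mu(\omega)$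 for all continuous $g$ on $\partial\mathbb{D}$. **Densities.** $\nu_\omega^{(\mathrm{ac})}$ and $k^{(\mathrm{ac})}$ are the Radon–Nikodym densities, with respect to arc length $d\theta$ on $\partial\mathbb{D}$, of the absolutely continuous parts in the Lebesgue decompositions of $\nu_\omega$ and $k$. The function $(\omega,z)\mapsto\nu_\omega^{(\mathrm{ac})}(z)$ is taken jointly measurable; for example $\nu_\omega^{(\mathrm{ac})}(e^{i\theta})=\lim_{r\uparrow1}\frac{1}{2\pi}\mathrm{Re}\int_{\partial\mathbb{D}}\frac{\tau+re^{i\theta}}{\tau-re^{i\theta}}\,d\nu_\omega(\tau)$ where this limit exists and is finite, and $0$ elsewhere. **Lyapunov exponent.** For $z\in\mathbb{C}$, $n\ge1$, let $$A_z^n(\omega)=T_{n-1}(\omega)\cdots T_0(\omega),\qquad T_j(\omega)=\frac{1}{\rho_j(\omega)}\begin{bmatrix} z & -\overline{\alpha_j(\omega)}\\ -\alpha_j(\omega)z & 1\end{bmatrix},\qquad \rho_j(\omega)=\sqrt{1-|\alpha_j(\omega)|^2},$$ and $\gamma(z)=\lim_{n\to\infty}\frac1n\int_\Omega\log\|A_z^n(\omega)\|\,d\mu(\omega)$. *)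

theory Defs
  imports "HOL-Probability.Probability"
begin

text \<open>Integer iterates of a bijection of \<^term>\<open>X\<close> onto itself; used both for the
  transformation of the base space and for integer powers of a unitary operator.\<close>

definition int_iterate :: "'a set \<Rightarrow> ('a \<Rightarrow> 'a) \<Rightarrow> int \<Rightarrow> 'a \<Rightarrow> 'a" where
  "int_iterate X T k x =
     (if 0 \<le> k then (T ^^ nat k) x else (inv_into X T ^^ nat (- k)) x)"

definition bimeasurable_bij :: "'a measure \<Rightarrow> ('a \<Rightarrow> 'a) \<Rightarrow> bool" where
  "bimeasurable_bij M S \<longleftrightarrow>
     bij_betw S (space M) (space M) \<and> S \<in> measurable M M \<and>
     inv_into (space M) S \<in> measurable M M"

definition ergodic :: "'a measure \<Rightarrow> ('a \<Rightarrow> 'a) \<Rightarrow> bool" where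
  "ergodic M S \<longleftrightarrow>
     S \<in> measurable M M \<and> distr M M S = M \<and>
     (\<forall>A \<in> sets M. S -` A \<inter> space M = A \<longrightarrow> measure M A = 0 \<or> measure M A = 1)"


text \<open>The Hilbert space of square-summable two-sided complex sequences.  Operators on it are
  plain functions on sequences, of which only the restriction to \<open>ell2\<close> matters.\<close>

definition ell2 :: "(int \<Rightarrow> complex) set" where
  "ell2 = {x. (\<lambda>n. (cmod (x n))\<^sup>2) summable_on UNIV}"

definition ell2_norm :: "(int \<Rightarrow> complex) \<Rightarrow> real" where
  "ell2_norm x = sqrt (\<Sum>\<^sub>\<infinity>n. (cmod (x n))\<^sup>2)"

definition ell2_inner :: "(int \<Rightarrow> complex) \<Rightarrow> (int \<Rightarrow> complex) \<Rightarrow> complex" where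
  "ell2_inner x y = (\<Sum>\<^sub>\<infinity>n. cnj (x n) * y n)"

definition basis_vec :: "int \<Rightarrow> int \<Rightarrow> complex" where
  "basis_vec m n = (if n = m then 1 else 0)"


text \<open>Laurent polynomials \<open>\<Sum>k=-N..N. c k * z^k\<close>, evaluated at a point of the unit circle and at a
  unitary operator.\<close>

definition laurent_fun :: "nat \<Rightarrow> (int \<Rightarrow> complex) \<Rightarrow> complex \<Rightarrow> complex" where
  "laurent_fun N c z = (\<Sum>k = - int N..int N. c k * z powi k)"

definition laurent_op ::
    "nat \<Rightarrow> (int \<Rightarrow> complex) \<Rightarrow> ((int \<Rightarrow> complex) \<Rightarrow> int \<Rightarrow> complex) \<Rightarrow> (int \<Rightarrow> complex) \<Rightarrow> int \<Rightarrow> complex"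
  where
  "laurent_op N c U x = (\<lambda>n. \<Sum>k = - int N..int N. c k * int_iterate ell2 U k x n)"

text \<open>Continuous functional calculus of a unitary operator \<open>U\<close>: \<open>cfc U g\<close> is the operator-norm limit
  of \<open>p(U)\<close> as the Laurent polynomial \<open>p\<close> tends to \<open>g\<close> uniformly on the unit circle.  The value
  \<open>0\<close> outside \<open>ell2\<close> only serves to make the operator unique as a HOL function.\<close>

definition cfc ::
    "((int \<Rightarrow> complex) \<Rightarrow> int \<Rightarrow> complex) \<Rightarrow> (complex \<Rightarrow> complex) \<Rightarrow> (int \<Rightarrow> complex) \<Rightarrow> int \<Rightarrow> complex"
  where
  "cfc U g = (THE T.
     (\<forall>x \<in> ell2. T x \<in> ell2) \<and>
     (\<forall>x. x \<notin> ell2 \<longrightarrow> T x = (\<lambda>_. 0)) \<and>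
     (\<forall>\<epsilon>>0. \<exists>\<delta>>0. \<forall>N c.
        (\<forall>z \<in> sphere 0 1. cmod (laurent_fun N c z - g z) \<le> \<delta>) \<longrightarrow>
        (\<forall>x \<in> ell2. ell2_norm (\<lambda>n. laurent_op N c U x n - T x n) \<le> \<epsilon> * ell2_norm x)))"


definition rho :: "complex \<Rightarrow> real" where
  "rho a = sqrt (1 - (cmod a)\<^sup>2)"

definition cmv_entry :: "(int \<Rightarrow> complex) \<Rightarrow> int \<Rightarrow> int \<Rightarrow> complex" where
  "cmv_entry \<alpha> r c =
    (let j = r div 2; \<rho> = (\<lambda>n. complex_of_real (rho (\<alpha> n))) in
     if r = 2 * j then
       (if c = 2 * j - 1 then cnj (\<alpha> (2 * j)) * \<rho> (2 * j - 1)
        else if c = 2 * j then - cnj (\<alpha> (2 * j)) * \<alpha> (2 * j - 1)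
        else if c = 2 * j + 1 then cnj (\<alpha> (2 * j + 1)) * \<rho> (2 * j)
        else if c = 2 * j + 2 then \<rho> (2 * j + 1) * \<rho> (2 * j)
        else 0)
     else
       (if c = 2 * j - 1 then \<rho> (2 * j) * \<rho> (2 * j - 1)
        else if c = 2 * j then - \<rho> (2 * j) * \<alpha> (2 * j - 1)
        else if c = 2 * j + 1 then - cnj (\<alpha> (2 * j + 1)) * \<alpha> (2 * j)
        else if c = 2 * j + 2 then - \<rho> (2 * j + 1) * \<alpha> (2 * j)
        else 0))"

definition ext_cmv :: "(int \<Rightarrow> complex) \<Rightarrow> (int \<Rightarrow> complex) \<Rightarrow> int \<Rightarrow> complex" where
  "ext_cmv \<alpha> x = (\<lambda>r. \<Sum>\<^sub>\<infinity>c. cmv_entry \<alpha> r c * x c)"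

definition verblunsky :: "'a measure \<Rightarrow> ('a \<Rightarrow> 'a) \<Rightarrow> ('a \<Rightarrow> complex) \<Rightarrow> 'a \<Rightarrow> int \<Rightarrow> complex" where
  "verblunsky M S f \<omega> n = f (int_iterate (space M) S n \<omega>)"


definition circle_borel :: "complex measure" where
  "circle_borel = restrict_space borel (sphere 0 1)"

definition arc_length :: "complex measure" where
  "arc_length = distr (restrict_space lborel {0..<2 * pi}) circle_borel cis"

definition is_spectral_measure ::
    "((int \<Rightarrow> complex) \<Rightarrow> int \<Rightarrow> complex) \<Rightarrow> complex measure \<Rightarrow> bool" where
  "is_spectral_measure U \<nu> \<longleftrightarrow>
     prob_space \<nu> \<and> sets \<nu> = sets circle_borel \<and>
     (\<forall>g. continuous_on (sphere 0 1) g \<longrightarrow>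
        ell2_inner (basis_vec 0) (cfc U g (basis_vec 0)) = (\<integral>z. g z \<partial>\<nu>))"

definition is_density_of_states ::
    "'a measure \<Rightarrow> ('a \<Rightarrow> (int \<Rightarrow> complex) \<Rightarrow> int \<Rightarrow> complex) \<Rightarrow> complex measure \<Rightarrow> bool" where
  "is_density_of_states M E k \<longleftrightarrow>
     prob_space k \<and> sets k = sets circle_borel \<and>
     (\<forall>g. continuous_on (sphere 0 1) g \<longrightarrow>
        (\<integral>z. g z \<partial>k) = (\<integral>\<omega>. ell2_inner (basis_vec 0) (cfc (E \<omega>) g (basis_vec 0)) \<partial>M))"

text \<open>\<open>h\<close> is a version of the density of the absolutely continuous part in the Lebesgue
  decomposition \<open>\<nu> = h d\<theta> + \<sigma>\<close>, with \<open>\<sigma>\<close> concentrated on an arc-length null set.\<close>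

definition is_ac_density :: "complex measure \<Rightarrow> (complex \<Rightarrow> real) \<Rightarrow> bool" where
  "is_ac_density \<nu> h \<longleftrightarrow>
     h \<in> borel_measurable circle_borel \<and> (\<forall>z \<in> sphere 0 1. 0 \<le> h z) \<and>
     (\<exists>\<sigma> B. sets \<sigma> = sets circle_borel \<and>
        B \<in> null_sets arc_length \<and> emeasure \<sigma> (space \<sigma> - B) = 0 \<and>
        (\<forall>A \<in> sets circle_borel.
           emeasure \<nu> A = emeasure (density arc_length (\<lambda>z. ennreal (h z))) A + emeasure \<sigma> A))"


definition szego_matrix :: "complex \<Rightarrow> complex \<Rightarrow> complex^2^2" where
  "szego_matrix z a = (1 / rho a) *\<^sub>R vector [vector [z, - cnj a], vector [- a * z, 1]]"

primrec szego_cocycle :: "(int \<Rightarrow> complex) \<Rightarrow> complex \<Rightarrow> nat \<Rightarrow> complex^2^2" where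
  "szego_cocycle \<alpha> z 0 = mat 1"
| "szego_cocycle \<alpha> z (Suc n) = szego_matrix z (\<alpha> (int n)) ** szego_cocycle \<alpha> z n"

definition lyapunov_exponent :: "'a measure \<Rightarrow> ('a \<Rightarrow> int \<Rightarrow> complex) \<Rightarrow> complex \<Rightarrow> real" where
  "lyapunov_exponent M \<alpha> z =
     lim (\<lambda>n. 1 / real n * (\<integral>\<omega>. ln (onorm (\<lambda>v. szego_cocycle (\<alpha> \<omega>) z n *v v)) \<partial>M))"

end

theory Submission
  imports Defs "HOL-Complex_Analysis.Complex_Analysis"
begin

text \<open>The Caratheodory function of the spectral measure of \<open>\<delta>\<^sub>0\<close> is \<open>F = (1 + s t) / (1 - s t)\<close>, where \<open>s\<close> and
  \<open>t\<close> are the Schur functions of the right and left half lines, so that \<open>|F| \<le> 4 / (1 - |s|\<^sup>2)\<close>.  Kotani's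
  inequality bounds the mean of \<open>1 / (1 - |s|\<^sup>2)\<close> at \<open>r \<zeta>\<close> by \<open>2 \<gamma>(r \<zeta>) / (1 - r)\<close> (with \<open>\<gamma>\<close> suitably normalised
  inside the disc).  If \<open>\<gamma>(\<zeta>) = 0\<close> and the Poisson integral of \<open>k\<close> is bounded along the radius to \<open>\<zeta>\<close>, which
  happens for almost every \<open>\<zeta>\<close>, then a finite-difference form of the Thouless formula gives
  \<open>\<gamma>(r \<zeta>) = O(1 - r)\<close>.  Hence the mean of \<open>|F(r \<zeta>)|\<close> is bounded in \<open>r\<close>, for almost every \<open>\<zeta>\<close> with \<open>\<gamma>(\<zeta>) = 0\<close>.

  Let \<open>G\<close> be the closed set of points of the circle where this bound is at most \<open>B\<close>.  Replacing \<open>F\<close> by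
  \<open>(1 + \<kappa> s t) / (1 - \<kappa> s t)\<close> with \<open>\<kappa> < 1\<close> allows passing to boundary values by bounded convergence, while the mass
  lost in the gaps of \<open>G\<close> near a closed set \<open>A \<subseteq> G\<close> is controlled, uniformly in \<open>\<kappa>\<close>, by \<open>B\<close> times the length of the gaps.
  On \<open>G\<close> itself the limit \<open>\<kappa> \<rightarrow> 1\<close> is dominated.  Therefore no singular mass is left on \<open>G\<close>:
  \<open>k(A)\<close> is at most the integral over \<open>A\<close> of the mean of the densities.  The reverse inequality holds
  for every closed set.\<close>

section \<open>Schur functions\<close>

text \<open>The free inequality is that \<open>k_ac\<close> is at least the mean of the densities.
  Equality can fail in general: singular parts whose supports move with \<omega> may average to an
  absolutely continuous measure, as under localization. The mean of the real part of
  \<open>F\<close> cannot detect this, since it is the Poisson integral of \<open>k\<close> and is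
  bounded along almost every radius whatever \<gamma> is; the information is in the mean of
  \<open>|F|\<close>. Yet a bound on that mean is no domination, so radial limits and means cannot
  be exchanged at once. The damping by \<kappa> separates the difficulties: the damped function is
  at most \<open>2 / (1 - \<kappa>)\<close>, which permits the radial limit at fixed \<kappa>, and
  at most \<open>4 / |1 - s t|\<close> for all \<kappa>, whose boundary value is integrable over
  \<open>G\<close> by Fatou's lemma.

  Classical inputs are replaced by one-sided ones. The exponent enters only through upper bounds on
  its radial increments. Boundary values are taken along a single sequence of radii that serves
  almost every pair of boundary point and \<omega>, and for them only the inequality
  \<open>Re F \<le> 2 * pi * \<nu>_ac\<close> is shown.\<close>

definition schur_step :: "complex \<Rightarrow> complex \<Rightarrow> complex \<Rightarrow> complex" where
  "schur_step z b w = z * (b + w) / (1 + cnj b * w)"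

primrec schur_iter :: "(nat \<Rightarrow> complex) \<Rightarrow> complex \<Rightarrow> nat \<Rightarrow> complex \<Rightarrow> complex" where
  "schur_iter \<beta> z 0 w = w"
| "schur_iter \<beta> z (Suc n) w = schur_iter \<beta> z n (schur_step z (\<beta> n) w)"

text \<open>Because \<open>schur_step\<close> carries its factor \<open>z\<close> outside the
  Moebius map, this is \<open>z\<close> times the Schur function with Schur parameters
  \<open>\<beta>\<close>; it vanishes at \<open>0\<close>.\<close>

definition schur_lim :: "(nat \<Rightarrow> complex) \<Rightarrow> complex \<Rightarrow> complex" where
  "schur_lim \<beta> z = lim (\<lambda>n. schur_iter \<beta> z n 0)"

section \<open>Moebius maps of the disc and the convergence of the Schur algorithm\<close>

lemma moebius_norm_identity:
  "(cmod (1 + cnj b * w))\<^sup>2 - (cmod (b + w))\<^sup>2 = (1 - (cmod b)\<^sup>2) * (1 - (cmod w)\<^sup>2)"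
  unfolding cmod_power2 by (simp add: algebra_simps power2_eq_square)

lemma moebius_denom_nonzero:
  assumes "cmod b < 1" "cmod w \<le> 1"
  shows "1 + cnj b * w \<noteq> 0"
proof
  assume "1 + cnj b * w = 0"
  then have "cmod (cnj b * w) = 1"
    by (metis add_eq_0_iff2 norm_minus_cancel norm_one)
  moreover have "cmod (cnj b * w) < 1"
    using assms by (metis complex_mod_cnj mult.right_neutral mult_left_mono norm_ge_zero norm_mult
        order_le_less_trans)
  ultimately show False by simp
qed

lemma moebius_one_minus_norm:
  assumes "cmod b < 1" "cmod w \<le> 1"
  shows "1 - (cmod ((b + w) / (1 + cnj b * w)))\<^sup>2 =
         (1 - (cmod b)\<^sup>2) * (1 - (cmod w)\<^sup>2) / (cmod (1 + cnj b * w))\<^sup>2"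
  using moebius_denom_nonzero[OF assms] moebius_norm_identity[of b w]
  by (simp add: norm_divide power_divide field_simps)

lemma norm_moebius_le_1:
  assumes "cmod b < 1" "cmod w \<le> 1"
  shows "cmod ((b + w) / (1 + cnj b * w)) \<le> 1"
proof -
  have "0 \<le> (1 - (cmod b)\<^sup>2) * (1 - (cmod w)\<^sup>2) / (cmod (1 + cnj b * w))\<^sup>2"
    using assms by (auto intro!: divide_nonneg_nonneg mult_nonneg_nonneg simp: power_le_one)
  then have "(cmod ((b + w) / (1 + cnj b * w)))\<^sup>2 \<le> 1"
    using moebius_one_minus_norm[OF assms] by linarith
  then show ?thesis
    by (simp add: power_le_one_iff)
qed

lemma norm_schur_step_le:
  assumes "cmod b < 1" "cmod w \<le> 1"
  shows "cmod (schur_step z b w) \<le> cmod z"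
  using mult_left_mono[OF norm_moebius_le_1[OF assms], of "cmod z"]
  by (simp add: schur_step_def norm_mult norm_divide)

lemma schur_step_diff:
  assumes "cmod b < 1" "cmod w \<le> 1" "cmod w' \<le> 1"
  shows "schur_step z b w - schur_step z b w' =
     z * of_real (1 - (cmod b)\<^sup>2) * (w - w') / ((1 + cnj b * w) * (1 + cnj b * w'))"
proof -
  have e: "of_real (1 - (cmod b)\<^sup>2) = 1 - b * cnj b"
    by (simp only: of_real_diff of_real_1 complex_norm_square)
  show ?thesis
    unfolding e schur_step_def
    using moebius_denom_nonzero[OF assms(1,2)] moebius_denom_nonzero[OF assms(1,3)]
    by (simp add: field_simps)
qed

text \<open>The squared Euclidean distance divided by the two defects is a function of the hyperbolic
  distance, which Moebius maps preserve; only the factor \<open>z\<close> contracts.\<close>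

lemma schur_step_contraction:
  assumes "cmod b < 1" "cmod w < 1" "cmod w' < 1" "cmod z \<le> 1"
  shows "(cmod (schur_step z b w - schur_step z b w'))\<^sup>2 / ((1 - (cmod (schur_step z b w))\<^sup>2) * (1 - (cmod (schur_step z b w'))\<^sup>2))
     \<le> (cmod z)\<^sup>2 * ((cmod (w - w'))\<^sup>2 / ((1 - (cmod w)\<^sup>2) * (1 - (cmod w')\<^sup>2)))"
proof -
  define d where "d = cmod (1 + cnj b * w)"
  define d' where "d' = cmod (1 + cnj b * w')"
  define q where "q = 1 - (cmod b)\<^sup>2"
  have dp: "d > 0" "d' > 0"
    using moebius_denom_nonzero assms unfolding d_def d'_def by (auto simp: less_imp_le)
  have q: "q > 0" using assms(1) by (simp add: q_def power_less_one_iff)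
  have p: "1 - (cmod w)\<^sup>2 > 0" "1 - (cmod w')\<^sup>2 > 0"
    using assms by (simp_all add: power_less_one_iff)
  have ge: "1 - (cmod (schur_step z b v))\<^sup>2 \<ge> q * (1 - (cmod v)\<^sup>2) / (cmod (1 + cnj b * v))\<^sup>2"
    if v: "cmod v < 1" for v
  proof -
    have "(cmod (schur_step z b v))\<^sup>2 = (cmod z)\<^sup>2 * (cmod ((b + v) / (1 + cnj b * v)))\<^sup>2"
      by (simp add: schur_step_def norm_mult norm_divide power_mult_distrib power_divide)
    also have "\<dots> \<le> 1 * (cmod ((b + v) / (1 + cnj b * v)))\<^sup>2"
      using assms(4) by (intro mult_right_mono) (auto simp: power_le_one)
    finally show ?thesis
      using moebius_one_minus_norm[OF assms(1) less_imp_le[OF v]] unfolding q_def by linarith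
  qed
  have n: "(cmod (schur_step z b w - schur_step z b w'))\<^sup>2 = (cmod z)\<^sup>2 * q\<^sup>2 * (cmod (w - w'))\<^sup>2 / (d\<^sup>2 * d'\<^sup>2)"
  proof -
    have "cmod (schur_step z b w - schur_step z b w') = cmod z * q * cmod (w - w') / (d * d')"
      using q assms
      by (subst schur_step_diff)
         (auto simp: norm_mult norm_divide d_def d'_def q_def simp del: of_real_diff of_real_power)
    then show ?thesis by (simp add: power_mult_distrib power_divide)
  qed
  have "(cmod (schur_step z b w - schur_step z b w'))\<^sup>2 / ((1 - (cmod (schur_step z b w))\<^sup>2) * (1 - (cmod (schur_step z b w'))\<^sup>2))
    \<le> ((cmod z)\<^sup>2 * q\<^sup>2 * (cmod (w - w'))\<^sup>2 / (d\<^sup>2 * d'\<^sup>2)) / ((q * (1 - (cmod w)\<^sup>2) / d\<^sup>2) * (q * (1 - (cmod w')\<^sup>2) / d'\<^sup>2))"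
    unfolding n
  proof (rule divide_left_mono)
    have g: "0 < q * (1 - (cmod w)\<^sup>2) / d\<^sup>2" "0 < q * (1 - (cmod w')\<^sup>2) / d'\<^sup>2"
      using q p dp by simp_all
    note g' = ge[OF assms(2), folded d_def] ge[OF assms(3), folded d'_def]
    show "q * (1 - (cmod w)\<^sup>2) / d\<^sup>2 * (q * (1 - (cmod w')\<^sup>2) / d'\<^sup>2)
      \<le> (1 - (cmod (schur_step z b w))\<^sup>2) * (1 - (cmod (schur_step z b w'))\<^sup>2)"
      using g g' by (intro mult_mono) linarith+
    have "0 < 1 - (cmod (schur_step z b w))\<^sup>2" "0 < 1 - (cmod (schur_step z b w'))\<^sup>2"
      using g g' by linarith+
    then show "0 < (1 - (cmod (schur_step z b w))\<^sup>2) * (1 - (cmod (schur_step z b w'))\<^sup>2) *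
        (q * (1 - (cmod w)\<^sup>2) / d\<^sup>2 * (q * (1 - (cmod w')\<^sup>2) / d'\<^sup>2))"
      using g by (meson mult_pos_pos)
  qed (use q in simp)
  also have "\<dots> = (cmod z)\<^sup>2 * ((cmod (w - w'))\<^sup>2 / ((1 - (cmod w)\<^sup>2) * (1 - (cmod w')\<^sup>2)))"
  proof -
    have "a * q\<^sup>2 * c / (d\<^sup>2 * d'\<^sup>2) / (q * u / d\<^sup>2 * (q * v / d'\<^sup>2)) = a * (c / (u * v))"
      if "u > 0" "v > 0" for a c u v :: real
      using that dp q by (simp add: field_simps power2_eq_square)
    from this[OF p] show ?thesis .
  qed
  finally show ?thesis .
qed

lemma norm_schur_iter_less_1:
  assumes "\<And>j. cmod (\<beta> j) < 1" "cmod z < 1" "cmod w < 1"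
  shows "cmod (schur_iter \<beta> z n w) < 1"
  using assms(3)
proof (induction n arbitrary: w)
  case (Suc n)
  have "cmod (schur_step z (\<beta> n) w) < 1"
    using norm_schur_step_le[of "\<beta> n" w z] assms(1)[of n] assms(2) Suc.prems by linarith
  then show ?case using Suc.IH by simp
qed simp

lemma schur_iter_Suc_shift:
  "schur_iter \<beta> z (Suc n) w = schur_step z (\<beta> 0) (schur_iter (\<lambda>j. \<beta> (Suc j)) z n w)"
  by (induction n arbitrary: w) auto

lemma schur_iter_add:
  "schur_iter \<beta> z (n + m) w = schur_iter \<beta> z n (schur_iter (\<lambda>j. \<beta> (n + j)) z m w)"
  by (induction m arbitrary: w) auto

lemma norm_schur_iter_le:
  assumes "\<And>j. cmod (\<beta> j) < 1" "cmod z < 1" "cmod w \<le> cmod z"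
  shows "cmod (schur_iter \<beta> z n w) \<le> cmod z"
  using assms(3)
proof (induction n arbitrary: w)
  case (Suc n)
  have "cmod (schur_step z (\<beta> n) w) \<le> cmod z"
    using assms(2) Suc.prems by (intro norm_schur_step_le assms(1)) simp
  then show ?case using Suc.IH by simp
qed simp

lemma schur_iter_contraction:
  assumes b: "\<And>j. cmod (\<beta> j) < 1" and z: "cmod z < 1" and w: "cmod w < 1" "cmod w' < 1"
  shows "(cmod (schur_iter \<beta> z n w - schur_iter \<beta> z n w'))\<^sup>2
     \<le> ((cmod z)\<^sup>2)^n * ((cmod (w - w'))\<^sup>2 / ((1 - (cmod w)\<^sup>2) * (1 - (cmod w')\<^sup>2)))"
  using w
proof (induction n arbitrary: w w')
  case 0
  have p: "1 - (cmod w)\<^sup>2 > 0" "1 - (cmod w')\<^sup>2 > 0"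
    using 0 by (simp_all add: power_less_one_iff)
  have "(1 - (cmod w)\<^sup>2) * (1 - (cmod w')\<^sup>2) \<le> 1 * 1"
    using p by (intro mult_mono) auto
  then have "(cmod (w - w'))\<^sup>2 / 1 \<le> (cmod (w - w'))\<^sup>2 / ((1 - (cmod w)\<^sup>2) * (1 - (cmod w')\<^sup>2))"
    using p by (intro divide_left_mono) auto
  then show ?case by simp
next
  case (Suc n)
  let ?a = "schur_step z (\<beta> n) w" and ?a' = "schur_step z (\<beta> n) w'"
  have "cmod ?a < 1" "cmod ?a' < 1"
    using Suc.prems b[of n] z norm_schur_step_le[of "\<beta> n" w z] norm_schur_step_le[of "\<beta> n" w' z]
    by linarith+
  then have "(cmod (schur_iter \<beta> z (Suc n) w - schur_iter \<beta> z (Suc n) w'))\<^sup>2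
     \<le> ((cmod z)\<^sup>2)^n * ((cmod (?a - ?a'))\<^sup>2 / ((1 - (cmod ?a)\<^sup>2) * (1 - (cmod ?a')\<^sup>2)))"
    using Suc.IH by simp
  also have "\<dots> \<le> ((cmod z)\<^sup>2)^n * ((cmod z)\<^sup>2 * ((cmod (w - w'))\<^sup>2 / ((1 - (cmod w)\<^sup>2) * (1 - (cmod w')\<^sup>2))))"
    using Suc.prems b z by (intro mult_left_mono schur_step_contraction) auto
  finally show ?case by (simp add: mult_ac)
qed

text \<open>Starting values in the disc of radius \<open>|z|\<close> have defects at least
  \<open>1 - |z|^2\<close>, so the hyperbolic contraction becomes a Euclidean geometric rate,
  uniform in \<open>\<beta>\<close> and locally uniform in \<open>z\<close>.\<close>

lemma schur_iter_close:
  assumes b: "\<And>j. cmod (\<beta> j) < 1" and z: "cmod z < 1" and w: "cmod w \<le> cmod z" "cmod w' \<le> cmod z"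
  shows "cmod (schur_iter \<beta> z n w - schur_iter \<beta> z n w') \<le> cmod z ^ n * (2 / (1 - (cmod z)\<^sup>2))"
proof (rule power2_le_imp_le)
  have p: "0 < 1 - (cmod z)\<^sup>2" using z by (simp add: power_less_one_iff)
  have "(cmod (schur_iter \<beta> z n w - schur_iter \<beta> z n w'))\<^sup>2
     \<le> ((cmod z)\<^sup>2)^n * ((cmod (w - w'))\<^sup>2 / ((1 - (cmod w)\<^sup>2) * (1 - (cmod w')\<^sup>2)))"
    using assms by (intro schur_iter_contraction) auto
  also have "\<dots> \<le> ((cmod z)\<^sup>2)^n * (2\<^sup>2 / ((1 - (cmod z)\<^sup>2) * (1 - (cmod z)\<^sup>2)))"
  proof (intro mult_left_mono frac_le mult_mono power_mono)
    show "cmod (w - w') \<le> 2"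
      using w z norm_triangle_ineq4[of w w'] by linarith
    show "1 - (cmod z)\<^sup>2 \<le> 1 - (cmod w)\<^sup>2" "1 - (cmod z)\<^sup>2 \<le> 1 - (cmod w')\<^sup>2"
      using w by (auto intro!: power_mono)
    then show "0 \<le> 1 - (cmod w)\<^sup>2" using p by linarith
  qed (use p in auto)
  also have "\<dots> = (cmod z ^ n * (2 / (1 - (cmod z)\<^sup>2)))\<^sup>2"
    by (simp add: power_mult_distrib power_divide power_mult[symmetric] mult.commute power2_eq_square[of "1 - _"])
  finally show "(cmod (schur_iter \<beta> z n w - schur_iter \<beta> z n w'))\<^sup>2 \<le> \<dots>" .
  show "0 \<le> cmod z ^ n * (2 / (1 - (cmod z)\<^sup>2))" using p by simp
qed

lemma schur_iter_close_0:
  assumes b: "\<And>j. cmod (\<beta> j) < 1" and z: "cmod z < 1" and "n \<le> m"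
  shows "cmod (schur_iter \<beta> z m 0 - schur_iter \<beta> z n 0) \<le> cmod z ^ n * (2 / (1 - (cmod z)\<^sup>2))"
proof -
  have m: "m = n + (m - n)" using assms by simp
  show ?thesis
    by (subst m, subst schur_iter_add, rule schur_iter_close)
       (use assms in \<open>auto intro!: norm_schur_iter_le\<close>)
qed

lemma schur_lim:
  assumes b: "\<And>j. cmod (\<beta> j) < 1" and z: "cmod z < 1"
  shows "(\<lambda>n. schur_iter \<beta> z n 0) \<longlonglongrightarrow> schur_lim \<beta> z"
proof -
  have lim0: "(\<lambda>n. cmod z ^ n * (2 / (1 - (cmod z)\<^sup>2))) \<longlonglongrightarrow> 0"
    using z by (intro tendsto_mult_left_zero LIMSEQ_realpow_zero) auto
  have "Cauchy (\<lambda>n. schur_iter \<beta> z n 0)"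
  proof (rule metric_CauchyI)
    fix e :: real assume "e > 0"
    then obtain N where N: "cmod z ^ N * (2 / (1 - (cmod z)\<^sup>2)) < e / 2"
      using order_tendstoD(2)[OF lim0, of "e/2"] by (auto simp: eventually_sequentially)
    show "\<exists>M. \<forall>m\<ge>M. \<forall>n\<ge>M. dist (schur_iter \<beta> z m 0) (schur_iter \<beta> z n 0) < e"
    proof (intro exI allI impI)
      fix m n assume "N \<le> m" "N \<le> n"
      have "dist (schur_iter \<beta> z m 0) (schur_iter \<beta> z N 0) < e / 2"
           "dist (schur_iter \<beta> z n 0) (schur_iter \<beta> z N 0) < e / 2"
        using schur_iter_close_0[of \<beta>, OF b z \<open>N \<le> m\<close>] schur_iter_close_0[of \<beta>, OF b z \<open>N \<le> n\<close>] N
        unfolding dist_norm by linarith+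
      then show "dist (schur_iter \<beta> z m 0) (schur_iter \<beta> z n 0) < e"
        by (rule dist_triangle_half_l)
    qed
  qed
  then show ?thesis
    unfolding schur_lim_def by (simp add: Cauchy_convergent_iff convergent_LIMSEQ_iff)
qed

lemma norm_schur_lim_le:
  assumes b: "\<And>j. cmod (\<beta> j) < 1" and z: "cmod z < 1"
  shows "cmod (schur_lim \<beta> z) \<le> cmod z"
  by (rule LIMSEQ_le_const2[OF tendsto_norm[OF schur_lim[OF assms]]])
     (use assms in \<open>auto intro!: norm_schur_iter_le\<close>)

lemma schur_lim_rate:
  assumes b: "\<And>j. cmod (\<beta> j) < 1" and z: "cmod z < 1"
  shows "cmod (schur_lim \<beta> z - schur_iter \<beta> z n 0) \<le> cmod z ^ n * (2 / (1 - (cmod z)\<^sup>2))"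
  by (rule LIMSEQ_le_const2[OF tendsto_norm[OF tendsto_diff[OF schur_lim[OF assms] tendsto_const]]])
     (use assms schur_iter_close_0 in blast)

lemma schur_lim_unfold:
  assumes b: "\<And>j. cmod (\<beta> j) < 1" and z: "cmod z < 1"
  shows "schur_lim \<beta> z = schur_step z (\<beta> 0) (schur_lim (\<lambda>j. \<beta> (Suc j)) z)"
proof (rule LIMSEQ_unique)
  show "(\<lambda>n. schur_iter \<beta> z (Suc n) 0) \<longlonglongrightarrow> schur_lim \<beta> z"
    by (rule LIMSEQ_Suc[OF schur_lim[OF assms]])
  have "cmod (schur_lim (\<lambda>j. \<beta> (Suc j)) z) \<le> 1"
    using norm_schur_lim_le[of "\<lambda>j. \<beta> (Suc j)", OF b z] z by simp
  then show "(\<lambda>n. schur_iter \<beta> z (Suc n) 0) \<longlonglongrightarrow> schur_step z (\<beta> 0) (schur_lim (\<lambda>j. \<beta> (Suc j)) z)"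
    unfolding schur_iter_Suc_shift schur_step_def
    by (intro tendsto_intros schur_lim b z moebius_denom_nonzero)
qed

text \<open>Each member of a bounded chain is \<open>schur_iter\<close> started from the tail of the
  chain, and the iterates forget their starting point. This is how a decaying solution of the Szego
  recursion is recognised as a Schur function.\<close>

lemma schur_chain_unique:
  assumes b: "\<And>j. cmod (\<beta> j) < 1" and z: "cmod z < 1"
    and chain: "\<And>j. \<sigma> j = schur_step z (\<beta> j) (\<sigma> (Suc j))" and le: "\<And>j. cmod (\<sigma> j) \<le> 1"
  shows "\<sigma> 0 = schur_lim \<beta> z"
proof (rule LIMSEQ_unique)
  have s: "\<sigma> 0 = schur_iter \<beta> z n (\<sigma> n)" for n
  proof (induction n)
    case (Suc n)
    then show ?case using chain[of n] by (metis schur_iter.simps(2))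
  qed simp
  \<comment> \<open>One step maps the closed unit disc into the disc of radius \<open>|z|\<close>,
    where the starting values for \<open>schur_iter_close\<close> have to lie.\<close>
  have r: "cmod (\<sigma> n) \<le> cmod z" for n
    by (subst chain) (rule norm_schur_step_le[OF b le])
  have "(\<lambda>n. schur_iter \<beta> z n 0 - \<sigma> 0) \<longlonglongrightarrow> 0"
  proof (rule Lim_null_comparison)
    show "\<forall>\<^sub>F n in sequentially. cmod (schur_iter \<beta> z n 0 - \<sigma> 0) \<le> cmod z ^ n * (2 / (1 - (cmod z)\<^sup>2))"
      by (rule always_eventually, rule allI, subst s, rule schur_iter_close) (use b z r in auto)
    show "(\<lambda>n. cmod z ^ n * (2 / (1 - (cmod z)\<^sup>2))) \<longlonglongrightarrow> 0"
      using z by (intro tendsto_mult_left_zero LIMSEQ_realpow_zero) auto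
  qed
  then show "(\<lambda>n. schur_iter \<beta> z n 0) \<longlonglongrightarrow> \<sigma> 0"
    by (rule LIM_zero_cancel)
qed (rule schur_lim[OF b z])

lemma holomorphic_schur_iter:
  assumes b: "\<And>j. cmod (\<beta> j) < 1"
  shows "(\<lambda>z. schur_iter \<beta> z n 0) holomorphic_on ball 0 1"
  using b
proof (induction n arbitrary: \<beta>)
  case (Suc n)
  have "cmod (schur_iter (\<lambda>j. \<beta> (Suc j)) z n 0) \<le> 1" if "cmod z < 1" for z
    using norm_schur_iter_less_1[of "\<lambda>j. \<beta> (Suc j)" z 0 n] Suc.prems that by simp
  then show ?case
    unfolding schur_iter_Suc_shift schur_step_def
    by (intro holomorphic_intros Suc.IH Suc.prems moebius_denom_nonzero) auto
qed simp

lemma holomorphic_schur_lim: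
  assumes b: "\<And>j. cmod (\<beta> j) < 1"
  shows "schur_lim \<beta> holomorphic_on ball 0 1"
proof (rule holomorphic_uniform_sequence[where f = "\<lambda>n z. schur_iter \<beta> z n 0"])
  fix x :: complex assume x: "x \<in> ball 0 1"
  define d where "d = (1 - cmod x) / 2"
  define R where "R = cmod x + d"
  have d: "0 < d" "R < 1" "0 \<le> R" using x by (auto simp: d_def R_def field_simps)
  have sub: "cmod y \<le> R" if "y \<in> cball x d" for y
    using that norm_triangle_ineq[of x "y - x"] by (simp add: R_def dist_norm norm_minus_commute)
  have "uniform_limit (cball x d) (\<lambda>n z. schur_iter \<beta> z n 0) (schur_lim \<beta>) sequentially"
  proof (rule uniform_limitI)
    fix e :: real assume "e > 0"
    have "(\<lambda>n. R ^ n * (2 / (1 - R\<^sup>2))) \<longlonglongrightarrow> 0"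
      using d by (intro tendsto_mult_left_zero LIMSEQ_realpow_zero) auto
    then have "\<forall>\<^sub>F n in sequentially. R ^ n * (2 / (1 - R\<^sup>2)) < e"
      using \<open>e > 0\<close> by (rule order_tendstoD(2))
    then show "\<forall>\<^sub>F n in sequentially. \<forall>y\<in>cball x d. dist (schur_iter \<beta> y n 0) (schur_lim \<beta> y) < e"
    proof (eventually_elim, intro ballI)
      fix n y assume lt: "R ^ n * (2 / (1 - R\<^sup>2)) < e" and y: "y \<in> cball x d"
      have "cmod (schur_lim \<beta> y - schur_iter \<beta> y n 0) \<le> cmod y ^ n * (2 / (1 - (cmod y)\<^sup>2))"
        using sub[OF y] d by (intro schur_lim_rate b) auto
      also have "\<dots> \<le> R ^ n * (2 / (1 - R\<^sup>2))"
        using sub[OF y] d by (intro mult_mono power_mono frac_le diff_left_mono)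
          (auto simp: power_less_one_iff intro!: power_le_one)
      finally show "dist (schur_iter \<beta> y n 0) (schur_lim \<beta> y) < e"
        using lt by (simp add: dist_norm norm_minus_commute)
    qed
  qed
  moreover have "cball x d \<subseteq> ball 0 1" using sub d by force
  ultimately show "\<exists>d. 0 < d \<and> cball x d \<subseteq> ball 0 1 \<and>
      uniform_limit (cball x d) (\<lambda>n z. schur_iter \<beta> z n 0) (schur_lim \<beta>) sequentially"
    using d by blast
qed (use b in \<open>auto intro!: holomorphic_schur_iter\<close>)

text \<open>Cauchy's inequality on discs of radius \<open>(1 - R) / 2\<close>. It makes
  \<open>schur_plus\<close> Lipschitz in \<open>z\<close>, which turns the error in the radial
  increments of the Lyapunov exponent into a quadratic one.\<close>

lemma bounded_holomorphic_Lipschitz: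
  assumes f: "f holomorphic_on ball 0 1" and le: "\<And>z. cmod z < 1 \<Longrightarrow> cmod (f z) \<le> 1"
    and R: "R < 1" and z: "cmod z \<le> R" "cmod z' \<le> R"
  shows "cmod (f z - f z') \<le> 2 / (1 - R) * cmod (z - z')"
proof (rule field_differentiable_bound[where S = "cball 0 R" and f' = "deriv f"])
  fix x :: complex assume x: "x \<in> cball 0 R"
  then show "(f has_field_derivative deriv f x) (at x within cball 0 R)"
    using R f by (intro holomorphic_derivI[of f "ball 0 1"] has_field_derivative_at_within) auto
  define d where "d = (1 - R) / 2"
  have d: "d > 0" using R by (simp add: d_def)
  have sub: "cball x d \<subseteq> ball 0 1"
  proof
    fix y assume "y \<in> cball x d"
    then have "cmod y \<le> R + d"
      using x norm_triangle_ineq[of x "y - x"] by (simp add: dist_norm norm_minus_commute)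
    then show "y \<in> ball 0 1" using R by (simp add: d_def field_simps)
  qed
  have "cmod ((deriv ^^ 1) f x) \<le> fact 1 * 1 / d ^ 1"
  proof (rule Cauchy_inequality)
    show "f holomorphic_on ball x d"
      using f sub ball_subset_cball by (meson holomorphic_on_subset order_trans)
    show "continuous_on (cball x d) f"
      using f sub by (meson holomorphic_on_imp_continuous_on holomorphic_on_subset)
    fix y assume "cmod (x - y) = d"
    then have "y \<in> cball x d" by (simp add: dist_norm)
    then show "cmod (f y) \<le> 1" using sub le by auto
  qed (fact d)
  then show "cmod (deriv f x) \<le> 2 / (1 - R)"
    by (simp add: d_def)
qed (use z in auto)

section \<open>Arc length and the Poisson formula\<close>

lemma space_circle_borel [simp]: "space circle_borel = sphere 0 1"
  by (simp add: circle_borel_def space_restrict_space)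

lemma sets_arc_length [simp, measurable_cong]: "sets arc_length = sets circle_borel"
  by (simp add: arc_length_def)

lemma space_arc_length [simp]: "space arc_length = sphere 0 1"
  by (simp add: arc_length_def)

lemma borel_measurable_circle_continuous:
  "continuous_on (sphere 0 1) g \<Longrightarrow> g \<in> borel_measurable circle_borel"
  unfolding circle_borel_def by (rule borel_measurable_continuous_on_restrict)

lemma borel_measurable_circle_borel: "g \<in> borel_measurable borel \<Longrightarrow> g \<in> borel_measurable circle_borel"
  unfolding circle_borel_def by (rule measurable_restrict_space1)

lemma borel_measurable_arc_length: "borel_measurable arc_length = borel_measurable circle_borel"
  by (rule measurable_cong_sets) auto

lemma sets_circle_borel_iff: "A \<in> sets circle_borel \<longleftrightarrow> A \<in> sets borel \<and> A \<subseteq> sphere 0 1"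
  unfolding circle_borel_def by (subst sets_restrict_space_iff) auto

lemma measurable_cis_circle [measurable]: "cis \<in> measurable (restrict_space lborel A) circle_borel"
  unfolding circle_borel_def
  by (rule measurable_restrict_space2)
     (auto intro!: measurable_restrict_space1 borel_measurable_continuous_onI continuous_intros)

lemma emeasure_arc_length:
  assumes "A \<in> sets circle_borel"
  shows "emeasure arc_length A = emeasure lborel (cis -` A \<inter> {0..<2 * pi})"
proof -
  have m: "cis -` A \<in> sets borel"
    using assms by (intro measurable_sets_borel[of cis borel] borel_measurable_continuous_onI continuous_intros)
      (auto simp: sets_circle_borel_iff)
  have "emeasure arc_length A = emeasure (restrict_space lborel {0..<2 * pi}) (cis -` A \<inter> {0..<2 * pi})"
    unfolding arc_length_def using assms by (subst emeasure_distr) (auto simp: space_restrict_space)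
  also have "\<dots> = emeasure lborel (cis -` A \<inter> {0..<2 * pi})"
    by (rule emeasure_restrict_space) auto
  finally show ?thesis .
qed

lemma emeasure_arc_length_space: "emeasure arc_length (sphere 0 1) = ennreal (2 * pi)"
  by (subst emeasure_arc_length) (auto simp: sets_circle_borel_iff vimage_def)

interpretation arc: finite_measure arc_length
  by standard (simp add: emeasure_arc_length_space)

lemma measure_arc_length_space: "measure arc_length (sphere 0 1) = 2 * pi"
  by (simp add: measure_def emeasure_arc_length_space)

lemma integrable_arc_bounded:
  fixes g :: "complex \<Rightarrow> 'b::{banach, second_countable_topology}"
  assumes "g \<in> borel_measurable circle_borel" "\<And>z. cmod z = 1 \<Longrightarrow> norm (g z) \<le> B"
  shows "integrable arc_length g"
  using assms by (intro arc.integrable_const_bound[where B=B]) auto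

lemma integrable_arc_continuous:
  fixes g :: "complex \<Rightarrow> 'b::{banach, second_countable_topology}"
  assumes "continuous_on (sphere 0 1) g"
  shows "integrable arc_length g"
proof -
  have "bounded (g ` sphere 0 1)"
    by (intro compact_imp_bounded compact_continuous_image assms) simp
  then obtain B where "\<And>z. cmod z = 1 \<Longrightarrow> norm (g z) \<le> B"
    by (force simp: bounded_iff)
  then show ?thesis
    by (intro integrable_arc_bounded borel_measurable_circle_continuous assms)
qed

lemma has_integral_arc_length:
  fixes g :: "complex \<Rightarrow> complex"
  assumes g: "continuous_on (sphere 0 1) g"
  shows "((\<lambda>t. g (cis t)) has_integral (\<integral>z. g z \<partial>arc_length)) {0..2 * pi}"
proof -
  have c: "continuous_on {0..2 * pi} (\<lambda>t. g (cis t))"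
    by (rule continuous_on_compose2[OF g]) (auto intro!: continuous_intros)
  have "(\<integral>z. g z \<partial>arc_length) = (\<integral>t. g (cis t) \<partial>restrict_space lborel {0..<2 * pi})"
    unfolding arc_length_def
    by (rule integral_distr) (auto intro!: borel_measurable_circle_continuous g)
  also have "\<dots> = (\<integral>t. indicator {0..<2 * pi} t *\<^sub>R g (cis t) \<partial>lborel)"
    by (rule integral_restrict_space) auto
  also have "\<dots> = (\<integral>t. indicator {0..2 * pi} t *\<^sub>R g (cis t) \<partial>lborel)"
    by (rule integral_discrete_difference[where X = "{2 * pi}"]) (auto simp: indicator_def)
  also have "\<dots> = integral {0..2 * pi} (\<lambda>t. g (cis t))"
    using set_borel_integral_eq_integral(2)[OF borel_integrable_atLeastAtMost'[OF c]]
    by (simp add: set_lebesgue_integral_def)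
  finally show ?thesis
    using integrable_continuous_real[OF c] by (simp add: has_integral_integral)
qed

section \<open>Orthogonality of the powers on the circle and Parseval's identity\<close>

lemma integral_arc_powi: "(\<integral>z. z powi n \<partial>arc_length) = (if n = 0 then 2 * pi else 0)"
proof (cases "n = 0")
  case True
  then show ?thesis by (simp add: measure_arc_length_space scaleR_conv_of_real)
next
  case False
  have c: "continuous_on (sphere 0 1) (\<lambda>z::complex. z powi n)"
    by (auto intro!: continuous_intros)
  have e: "cis t powi n = cis (of_int n * t)" for t
    by (rule cis_power_int)
  define G where "G t = cis (of_int n * t) / (\<i> * of_int n)" for t :: real
  have "((\<lambda>t. cis (of_int n * t)) has_integral (G (2 * pi) - G 0)) {0..2 * pi}"
  proof (rule fundamental_theorem_of_calculus)
    fix t :: real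
    show "(G has_vector_derivative cis (of_int n * t)) (at t within {0..2 * pi})"
      unfolding G_def cis_conv_exp
      using False
      by (auto intro!: has_vector_derivative_real_field[of "\<lambda>w. exp (\<i> * (of_int n * w)) / (\<i> * of_int n)", simplified] derivative_eq_intros
          simp: mult_ac complex_i_mult_minus)
  qed simp
  moreover have "G (2 * pi) = G 0"
    unfolding G_def using cis_multiple_2pi[of "of_int n"] by (simp add: mult_ac)
  ultimately have "((\<lambda>t. cis (of_int n * t)) has_integral 0) {0..2 * pi}" by simp
  then show ?thesis
    using has_integral_arc_length[OF c] False unfolding e by (simp add: has_integral_unique)
qed

lemma parseval_finite:
  fixes d :: "int \<Rightarrow> complex"
  assumes "finite J"
  shows "(\<integral>z. (cmod (\<Sum>j\<in>J. d j * z powi j))\<^sup>2 \<partial>arc_length) = 2 * pi * (\<Sum>j\<in>J. (cmod (d j))\<^sup>2)"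
proof -
  have int: "integrable arc_length (\<lambda>z::complex. z powi n)" for n
    by (rule integrable_arc_continuous) (auto intro!: continuous_intros)
  have "complex_of_real (\<integral>z. (cmod (\<Sum>j\<in>J. d j * z powi j))\<^sup>2 \<partial>arc_length)
      = (\<integral>z. complex_of_real ((cmod (\<Sum>j\<in>J. d j * z powi j))\<^sup>2) \<partial>arc_length)"
    by (simp only: integral_complex_of_real)
  also have "\<dots> = (\<integral>z. (\<Sum>j\<in>J. \<Sum>i\<in>J. d j * cnj (d i) * z powi (j - i)) \<partial>arc_length)"
  proof (intro Bochner_Integration.integral_cong refl)
    fix z :: complex assume "z \<in> space arc_length"
    then have zz: "z * cnj z = 1"
      using complex_norm_square[of z] by simp
    then have z: "z \<noteq> 0" "cnj z = inverse z"
      using inverse_unique[OF zz] by auto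
    have c: "cnj (z powi i) = z powi (-i)" for i
      using z by (cases "i \<ge> 0") (auto simp: power_int_def power_inverse)
    have "complex_of_real ((cmod (\<Sum>j\<in>J. d j * z powi j))\<^sup>2) =
        (\<Sum>j\<in>J. d j * z powi j) * (\<Sum>i\<in>J. cnj (d i) * z powi (-i))"
      unfolding complex_norm_square cnj_sum complex_cnj_mult c ..
    also have "\<dots> = (\<Sum>j\<in>J. \<Sum>i\<in>J. d j * cnj (d i) * z powi (j - i))"
      unfolding sum_product
      by (intro sum.cong refl) (simp add: power_int_diff z power_int_minus divide_inverse)
    finally show "complex_of_real ((cmod (\<Sum>j\<in>J. d j * z powi j))\<^sup>2) = \<dots>" .
  qed
  also have "\<dots> = (\<Sum>j\<in>J. \<Sum>i\<in>J. d j * cnj (d i) * (\<integral>z. z powi (j - i) \<partial>arc_length))"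
    by (simp add: Bochner_Integration.integral_sum int)
  also have "\<dots> = (\<Sum>j\<in>J. \<Sum>i\<in>J. if i = j then d j * cnj (d j) * (2 * pi) else 0)"
    by (intro sum.cong refl) (auto simp: integral_arc_powi)
  also have "\<dots> = complex_of_real (2 * pi * (\<Sum>j\<in>J. (cmod (d j))\<^sup>2))"
    using assms by (simp add: sum_distrib_left complex_norm_square[symmetric] mult_ac del: of_real_power)
  finally show ?thesis by (simp only: of_real_eq_iff)
qed

lemma parseval_series:
  fixes a :: "nat \<Rightarrow> complex"
  assumes a: "summable (\<lambda>n. norm (a n))"
  shows "summable (\<lambda>n. (cmod (a n))\<^sup>2)"
    and "(\<integral>z. (cmod (\<Sum>n. a n * z ^ n))\<^sup>2 \<partial>arc_length) = 2 * pi * (\<Sum>n. (cmod (a n))\<^sup>2)"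
proof -
  have fin: "(\<integral>z. (cmod (\<Sum>n<N. a n * z ^ n))\<^sup>2 \<partial>arc_length) = 2 * pi * (\<Sum>n<N. (cmod (a n))\<^sup>2)" for N
  proof -
    have "(\<Sum>j\<in>int ` {..<N}. a (nat j) * z powi j) = (\<Sum>n<N. a n * z ^ n)" for z
      by (subst sum.reindex) (auto intro!: sum.cong simp: inj_on_def)
    moreover have "(\<Sum>j\<in>int ` {..<N}. (cmod (a (nat j)))\<^sup>2) = (\<Sum>n<N. (cmod (a n))\<^sup>2)"
      by (subst sum.reindex) (auto simp: inj_on_def)
    ultimately show ?thesis
      using parseval_finite[of "int ` {..<N}" "\<lambda>j. a (nat j)"] by simp
  qed
  define A where "A = (\<Sum>n. norm (a n))"
  have nrm: "norm (a n * z ^ n) = norm (a n)" if "cmod z = 1" for n z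
    using that by (simp add: norm_mult norm_power)
  have bd: "cmod (\<Sum>n<N. a n * z ^ n) \<le> A" if "cmod z = 1" for N z
    using norm_sum[of "\<lambda>n. a n * z ^ n" "{..<N}"] sum_le_suminf[OF a, of "{..<N}"] nrm[OF that]
    by (simp add: A_def)
  have lim: "(\<lambda>N. \<integral>z. (cmod (\<Sum>n<N. a n * z ^ n))\<^sup>2 \<partial>arc_length) \<longlonglongrightarrow>
      (\<integral>z. (cmod (\<Sum>n. a n * z ^ n))\<^sup>2 \<partial>arc_length)"
  proof (rule integral_dominated_convergence[where w = "\<lambda>_. A\<^sup>2"])
    show "AE z in arc_length. (\<lambda>N. (cmod (\<Sum>n<N. a n * z ^ n))\<^sup>2) \<longlonglongrightarrow> (cmod (\<Sum>n. a n * z ^ n))\<^sup>2"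
    proof (rule AE_I2)
      fix z assume "z \<in> space arc_length"
      then have "summable (\<lambda>n. a n * z ^ n)"
        by (intro summable_norm_cancel[OF summable_cong[THEN iffD2, OF _ a]]) (auto simp: nrm)
      then show "(\<lambda>N. (cmod (\<Sum>n<N. a n * z ^ n))\<^sup>2) \<longlonglongrightarrow> (cmod (\<Sum>n. a n * z ^ n))\<^sup>2"
        by (intro tendsto_intros summable_LIMSEQ)
    qed
    show "AE z in arc_length. norm ((cmod (\<Sum>n<N. a n * z ^ n))\<^sup>2) \<le> A\<^sup>2" for N
      using bd by (intro AE_I2) (auto intro!: power_mono)
    show "(\<lambda>z. (cmod (\<Sum>n. a n * z ^ n))\<^sup>2) \<in> borel_measurable arc_length"
      unfolding borel_measurable_arc_length by (intro borel_measurable_circle_borel) measurable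
    show "(\<lambda>z. (cmod (\<Sum>n<N. a n * z ^ n))\<^sup>2) \<in> borel_measurable arc_length" for N
      unfolding borel_measurable_arc_length by (intro borel_measurable_circle_borel) measurable
  qed simp
  have b: "\<And>n. (cmod (a n))\<^sup>2 \<le> A * cmod (a n)"
  proof -
    fix n
    have "cmod (a n) \<le> A" using sum_le_suminf[OF a, of "{n}"] by (simp add: A_def)
    then show "(cmod (a n))\<^sup>2 \<le> A * cmod (a n)"
      unfolding power2_eq_square by (intro mult_right_mono) auto
  qed
  show s: "summable (\<lambda>n. (cmod (a n))\<^sup>2)"
    by (rule summable_comparison_test'[OF summable_mult[OF a, of A], of 0]) (simp add: b)
  have "(\<lambda>N. 2 * pi * (\<Sum>n<N. (cmod (a n))\<^sup>2)) \<longlonglongrightarrow> 2 * pi * (\<Sum>n. (cmod (a n))\<^sup>2)"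
    by (intro tendsto_intros summable_LIMSEQ s)
  then show "(\<integral>z. (cmod (\<Sum>n. a n * z ^ n))\<^sup>2 \<partial>arc_length) = 2 * pi * (\<Sum>n. (cmod (a n))\<^sup>2)"
    using lim unfolding fin by (rule LIMSEQ_unique[rotated])
qed

definition poisson :: "complex \<Rightarrow> complex \<Rightarrow> real" where
  "poisson z \<zeta> = (1 - (cmod z)\<^sup>2) / (cmod (\<zeta> - z))\<^sup>2"

text \<open>On the circle the kernel is the sum of \<open>\<zeta> / (\<zeta> - z)\<close> and
  \<open>cnj z * \<zeta> / (1 - cnj z * \<zeta>)\<close>. The first summand gives Cauchy's formula;
  the second gives a holomorphic contour integrand and hence \<open>0\<close>. The dilation by
  \<open>r < 1\<close> makes the integrand holomorphic beyond the closed disc, so no boundary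
  behaviour of \<open>f\<close> enters.\<close>

lemma poisson_formula:
  fixes f :: "complex \<Rightarrow> complex"
  assumes f: "f holomorphic_on ball 0 1" and r: "0 \<le> r" "r < 1" and z: "cmod z < 1"
  shows "(\<integral>\<zeta>. poisson z \<zeta> * f (of_real r * \<zeta>) \<partial>arc_length) = 2 * pi * f (of_real r * z)"
proof -
  define g where "g = (\<lambda>w. f (of_real r * w))"
  obtain R where R: "1 < R" "r * R < 1"
  proof (cases "r = 0")
    case True then show ?thesis using that[of 2] by simp
  next
    case False
    then have "1 < 1 / r" using r by simp
    then obtain R where "1 < R" "R < 1 / r" using dense by blast
    then show ?thesis using that[of R] False r by (simp add: field_simps)
  qed
  have sub: "of_real r * w \<in> ball 0 1" if "w \<in> ball 0 R" for w :: complex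
    using that r R mult_left_mono[of "cmod w" R r] by (simp add: norm_mult)
  have g: "g holomorphic_on ball 0 R"
    unfolding g_def
    by (rule holomorphic_on_compose_gen[OF _ f, unfolded o_def]) (use sub in \<open>auto intro!: holomorphic_intros\<close>)
  have gc: "continuous_on (sphere 0 1) g"
    by (rule continuous_on_subset[OF holomorphic_on_imp_continuous_on[OF g]]) (use R in auto)
  have cb: "cball 0 1 \<subseteq> ball (0::complex) R" using R by auto
  \<comment> \<open>On the unit circle \<open>d\<zeta> = \<i> \<zeta> d\<theta>\<close>, which
    translates contour integrals into integrals against arc length.\<close>
  have link: "I = \<i> * (\<integral>\<zeta>. h \<zeta> * \<zeta> \<partial>arc_length)"
    if "(h has_contour_integral I) (circlepath 0 1)" "continuous_on (sphere 0 1) h" for h I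
  proof -
    have "((\<lambda>t. h (cis t) * \<i> * cis t) has_integral I) {0..2 * pi}"
      using that(1) has_contour_integral_part_circlepath_iff[of 0 "2*pi" h I 0 1] by (simp add: circlepath_def)
    moreover have "((\<lambda>t. h (cis t) * \<i> * cis t) has_integral (\<integral>\<zeta>. h \<zeta> * \<i> * \<zeta> \<partial>arc_length)) {0..2 * pi}"
      by (rule has_integral_arc_length) (intro continuous_intros that)
    ultimately have "I = (\<integral>\<zeta>. \<i> * (h \<zeta> * \<zeta>) \<partial>arc_length)"
      by (simp add: mult_ac has_integral_unique)
    then show ?thesis by simp
  qed
  have nz2: "1 - cnj z * \<zeta> \<noteq> 0" if "cmod \<zeta> \<le> 1" for \<zeta>
  proof -
    have "cmod (cnj z * \<zeta>) < 1"
      using mult_left_mono[OF that, of "cmod z"] z by (simp add: norm_mult)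
    then show ?thesis by auto
  qed
  have c1: "continuous_on (sphere 0 1) (\<lambda>u. g u / (u - z))"
    by (intro continuous_intros gc) (use z in auto)
  have c2: "continuous_on (sphere 0 1) (\<lambda>u. g u * (cnj z / (1 - cnj z * u)))"
    by (intro continuous_intros gc) (use nz2 in auto)
  have "((\<lambda>u. g u / (u - z)) has_contour_integral (2 * of_real pi * \<i> * g z)) (circlepath 0 1)"
    using z R cb by (intro Cauchy_integral_circlepath_simple holomorphic_on_subset[OF g]) auto
  from link[OF this c1] have I1: "(\<integral>\<zeta>. g \<zeta> / (\<zeta> - z) * \<zeta> \<partial>arc_length) = 2 * of_real pi * g z"
    by (simp add: mult_ac)
  have "((\<lambda>u. g u * (cnj z / (1 - cnj z * u))) has_contour_integral 0) (circlepath 0 1)"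
  proof (rule Cauchy_theorem_convex_simple[where S = "cball 0 1"])
    show "(\<lambda>u. g u * (cnj z / (1 - cnj z * u))) holomorphic_on cball 0 1"
      using nz2 by (intro holomorphic_intros holomorphic_on_subset[OF g cb]) auto
  qed auto
  from link[OF this c2] have I2: "(\<integral>\<zeta>. g \<zeta> * (cnj z / (1 - cnj z * \<zeta>)) * \<zeta> \<partial>arc_length) = 0"
    by simp
  have "(\<integral>\<zeta>. poisson z \<zeta> * f (of_real r * \<zeta>) \<partial>arc_length) =
    (\<integral>\<zeta>. g \<zeta> / (\<zeta> - z) * \<zeta> + g \<zeta> * (cnj z / (1 - cnj z * \<zeta>)) * \<zeta> \<partial>arc_length)"
  proof (intro Bochner_Integration.integral_cong refl)
    fix \<zeta> assume "\<zeta> \<in> space arc_length"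
    then have \<zeta>: "cmod \<zeta> = 1" by simp
    then have c: "\<zeta> * cnj \<zeta> = 1" by (simp add: complex_norm_square[symmetric])
    have n1: "\<zeta> - z \<noteq> 0" "1 - cnj z * \<zeta> \<noteq> 0" "\<zeta> \<noteq> 0" using \<zeta> z nz2[of \<zeta>] by auto
    have d: "(\<zeta> - z) * (1 - cnj z * \<zeta>) = \<zeta> * of_real ((cmod (\<zeta> - z))\<^sup>2)"
      unfolding complex_norm_square using c by (simp add: algebra_simps)
    have "complex_of_real (poisson z \<zeta>) = (1 - z * cnj z) / of_real ((cmod (\<zeta> - z))\<^sup>2)"
      unfolding poisson_def by (simp add: complex_norm_square del: of_real_power)
    also have "\<dots> = (1 - z * cnj z) * \<zeta> / ((\<zeta> - z) * (1 - cnj z * \<zeta>))"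
      unfolding d using n1 by simp
    also have "\<dots> = \<zeta> / (\<zeta> - z) + cnj z / (1 - cnj z * \<zeta>) * \<zeta>"
      using n1 by (simp add: field_simps)
    finally show "complex_of_real (poisson z \<zeta>) * f (of_real r * \<zeta>) =
       g \<zeta> / (\<zeta> - z) * \<zeta> + g \<zeta> * (cnj z / (1 - cnj z * \<zeta>)) * \<zeta>"
      by (simp add: g_def algebra_simps)
  qed
  also have "\<dots> = (\<integral>\<zeta>. g \<zeta> / (\<zeta> - z) * \<zeta> \<partial>arc_length) + (\<integral>\<zeta>. g \<zeta> * (cnj z / (1 - cnj z * \<zeta>)) * \<zeta> \<partial>arc_length)"
    by (intro Bochner_Integration.integral_add integrable_arc_continuous continuous_intros gc)
       (use z nz2 in auto)
  finally show ?thesis using I1 I2 by (simp add: g_def)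
qed

section \<open>Unitary operators on square-summable sequences\<close>

lemma rho_pos: "cmod a < 1 \<Longrightarrow> 0 < rho a"
  by (simp add: rho_def power_less_one_iff)

lemma rho_squared: "cmod a < 1 \<Longrightarrow> (rho a)\<^sup>2 = 1 - (cmod a)\<^sup>2"
  by (simp add: rho_def power_le_one)

lemma rho_squared_complex: "cmod a < 1 \<Longrightarrow> complex_of_real (rho a) * complex_of_real (rho a) = 1 - a * cnj a"
  by (metis complex_norm_square of_real_1 of_real_diff of_real_mult power2_eq_square rho_squared)

lemma rho_cnj [simp]: "rho (cnj a) = rho a"
  by (simp add: rho_def)

lemma rho_minus [simp]: "rho (- a) = rho a"
  by (simp add: rho_def)

text \<open>The form \<open>|a|\<^sup>2 - |b|\<^sup>2\<close> is nonincreasing along solutions, so a solution that tends to \<open>0\<close>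
  stays in the cone \<open>|b| \<le> |a|\<close>; the ratio \<open>b / a\<close> is then a chain of Schur iterates.\<close>

lemma decaying_szego_solution:
  fixes a b \<beta> :: "nat \<Rightarrow> complex"
  assumes \<beta>: "\<And>j. cmod (\<beta> j) < 1" and z: "z \<noteq> 0" "cmod z < 1"
    and ra: "\<And>j. rho (\<beta> j) * a (Suc j) = z * a j - cnj (\<beta> j) * b j"
    and rb: "\<And>j. rho (\<beta> j) * b (Suc j) = b j - \<beta> j * z * a j"
    and a0: "a \<longlonglongrightarrow> 0" and b0: "b \<longlonglongrightarrow> 0"
  shows "b 0 = schur_lim \<beta> z * a 0"
proof -
  define Q where "Q j = (cmod (a j))\<^sup>2 - (cmod (b j))\<^sup>2" for j
  have form: "(cmod (u - cnj c * v))\<^sup>2 - (cmod (v - c * u))\<^sup>2 = (1 - (cmod c)\<^sup>2) * ((cmod u)\<^sup>2 - (cmod v)\<^sup>2)"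
    for u v c
    unfolding cmod_power2 by (simp add: algebra_simps power2_eq_square)
  have QS: "Q (Suc j) = (cmod (z * a j))\<^sup>2 - (cmod (b j))\<^sup>2" for j
  proof -
    have "(rho (\<beta> j))\<^sup>2 * Q (Suc j) = (cmod (rho (\<beta> j) * a (Suc j)))\<^sup>2 - (cmod (rho (\<beta> j) * b (Suc j)))\<^sup>2"
      by (simp add: Q_def norm_mult power_mult_distrib algebra_simps)
    also have "\<dots> = (rho (\<beta> j))\<^sup>2 * ((cmod (z * a j))\<^sup>2 - (cmod (b j))\<^sup>2)"
      unfolding ra rb using form[of "z * a j" "\<beta> j" "b j"] \<beta>[of j] by (simp add: rho_squared mult.assoc)
    finally show ?thesis using rho_pos[OF \<beta>, of j] by simp
  qed
  have "Q (Suc j) \<le> Q j" for j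
  proof -
    have "(cmod (z * a j))\<^sup>2 \<le> (cmod (a j))\<^sup>2"
      using z mult_right_mono[of "cmod z" 1 "cmod (a j)"] by (intro power_mono) (auto simp: norm_mult)
    then show ?thesis using QS[of j] by (simp add: Q_def)
  qed
  then have "decseq Q" by (rule decseq_SucI)
  moreover have "Q \<longlonglongrightarrow> (cmod 0)\<^sup>2 - (cmod 0)\<^sup>2"
    unfolding Q_def by (intro tendsto_intros a0 b0)
  ultimately have Q: "0 \<le> Q j" for j
    using decseq_ge[of Q 0 j] by simp
  then have le: "cmod (b j) \<le> cmod (a j)" for j
    using Q[of j] by (simp add: Q_def abs_le_square_iff[symmetric])
  show ?thesis
  proof (cases "a 0 = 0")
    case True
    then show ?thesis using le[of 0] by simp
  next
    case False
    \<comment> \<open>The recursion matrix has determinant \<open>z\<close>, so if the pair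
      \<open>(a, b)\<close> vanished at \<open>Suc j\<close> it would already vanish at
      \<open>j\<close>.\<close>
    have nz: "a j \<noteq> 0" for j
    proof (induction j)
      case (Suc j)
      show ?case
      proof
        assume *: "a (Suc j) = 0"
        then have "b (Suc j) = 0" using le[of "Suc j"] by simp
        then have eqs: "z * a j = cnj (\<beta> j) * b j" "b j = \<beta> j * (z * a j)"
          using ra[of j] rb[of j] * by (auto simp: mult.assoc)
        then have "b j = \<beta> j * cnj (\<beta> j) * b j" by (metis mult.assoc)
        then have "(1 - \<beta> j * cnj (\<beta> j)) * b j = 0" by (simp add: algebra_simps)
        moreover have "1 - \<beta> j * cnj (\<beta> j) \<noteq> 0"
          using rho_squared_complex[OF \<beta>, of j] rho_pos[OF \<beta>, of j] by auto
        ultimately have "b j = 0" by simp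
        then show False using eqs(1) Suc z by simp
      qed
    qed (fact False)
    have "(\<lambda>j. b j / a j) 0 = schur_lim \<beta> z"
    proof (rule schur_chain_unique[OF \<beta> z(2)])
      fix j
      show "cmod (b j / a j) \<le> 1" using le[of j] nz[of j] by (simp add: norm_divide)
      have r: "complex_of_real (rho (\<beta> j)) \<noteq> 0" using rho_pos[OF \<beta>, of j] by simp
      have n: "1 - \<beta> j * cnj (\<beta> j) \<noteq> 0"
        using rho_squared_complex[OF \<beta>, of j] r by auto
      \<comment> \<open>\<open>e1\<close> and \<open>e2\<close> run the recursion backwards, which
        presents the ratio at \<open>j\<close> as the Schur step of the ratio at
        \<open>Suc j\<close>.\<close>
      have e1: "rho (\<beta> j) * (\<beta> j * a (Suc j) + b (Suc j)) = (1 - \<beta> j * cnj (\<beta> j)) * b j"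
      proof -
        have "rho (\<beta> j) * (\<beta> j * a (Suc j) + b (Suc j)) = \<beta> j * (rho (\<beta> j) * a (Suc j)) + rho (\<beta> j) * b (Suc j)"
          by (simp add: algebra_simps)
        then show ?thesis unfolding ra rb by (simp add: algebra_simps)
      qed
      have e2: "rho (\<beta> j) * (a (Suc j) + cnj (\<beta> j) * b (Suc j)) = (1 - \<beta> j * cnj (\<beta> j)) * (z * a j)"
      proof -
        have "rho (\<beta> j) * (a (Suc j) + cnj (\<beta> j) * b (Suc j)) = rho (\<beta> j) * a (Suc j) + cnj (\<beta> j) * (rho (\<beta> j) * b (Suc j))"
          by (simp add: algebra_simps)
        then show ?thesis unfolding ra rb by (simp add: algebra_simps)
      qed
      have "schur_step z (\<beta> j) (b (Suc j) / a (Suc j)) =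
          z * (\<beta> j * a (Suc j) + b (Suc j)) / (a (Suc j) + cnj (\<beta> j) * b (Suc j))"
      proof -
        have "\<beta> j + b (Suc j) / a (Suc j) = (\<beta> j * a (Suc j) + b (Suc j)) / a (Suc j)"
          "1 + cnj (\<beta> j) * (b (Suc j) / a (Suc j)) = (a (Suc j) + cnj (\<beta> j) * b (Suc j)) / a (Suc j)"
          using nz[of "Suc j"] by (simp_all add: field_simps)
        then show ?thesis using nz[of "Suc j"] by (simp add: schur_step_def)
      qed
      also have "\<dots> = z * (rho (\<beta> j) * (\<beta> j * a (Suc j) + b (Suc j))) / (rho (\<beta> j) * (a (Suc j) + cnj (\<beta> j) * b (Suc j)))"
        using r by simp
      also have "\<dots> = b j / a j"
        unfolding e1 e2 using n z nz[of j] by simp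
      finally show "b j / a j = schur_step z (\<beta> j) (b (Suc j) / a (Suc j))" by simp
    qed
    then show ?thesis using False by (simp add: field_simps)
  qed
qed

section \<open>Square-summable sequences and the functional calculus of Laurent polynomials\<close>

lemma has_sum_finite_sum:
  fixes f :: "'i \<Rightarrow> 'a \<Rightarrow> real"
  assumes "finite J" "\<And>j. j \<in> J \<Longrightarrow> f j summable_on A"
  shows "((\<lambda>n. \<Sum>j\<in>J. f j n) has_sum (\<Sum>j\<in>J. infsum (f j) A)) A"
  using assms by (induction J rule: finite_induct) (auto intro!: has_sum_add)

lemma ell2_add: "x \<in> ell2 \<Longrightarrow> y \<in> ell2 \<Longrightarrow> (\<lambda>n. x n + y n) \<in> ell2"
proof -
  assume x: "x \<in> ell2" and y: "y \<in> ell2"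
  have "(\<lambda>n. 2 * (cmod (x n))\<^sup>2 + 2 * (cmod (y n))\<^sup>2) summable_on UNIV"
    using x y by (intro summable_on_add summable_on_cmult_right) (auto simp: ell2_def)
  then show ?thesis
    unfolding ell2_def mem_Collect_eq
  proof (rule summable_on_comparison_test)
    fix n
    have "(cmod (x n + y n))\<^sup>2 \<le> (cmod (x n) + cmod (y n))\<^sup>2"
      by (intro power_mono norm_triangle_ineq) auto
    also have "\<dots> \<le> 2 * (cmod (x n))\<^sup>2 + 2 * (cmod (y n))\<^sup>2"
      using sum_squares_ge_zero[of "cmod (x n) - cmod (y n)" 0] by (simp add: power2_eq_square algebra_simps)
    finally show "(cmod (x n + y n))\<^sup>2 \<le> 2 * (cmod (x n))\<^sup>2 + 2 * (cmod (y n))\<^sup>2" .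
  qed auto
qed

lemma ell2_scale: "x \<in> ell2 \<Longrightarrow> (\<lambda>n. c * x n) \<in> ell2"
  unfolding ell2_def by (auto simp: norm_mult power_mult_distrib intro!: summable_on_cmult_right)

lemma ell2_zero: "(\<lambda>n. 0) \<in> ell2"
  by (simp add: ell2_def)

lemma ell2_sum: "finite K \<Longrightarrow> (\<And>k. k \<in> K \<Longrightarrow> X k \<in> ell2) \<Longrightarrow> (\<lambda>n. \<Sum>k\<in>K. c k * X k n) \<in> ell2"
  by (induction K rule: finite_induct) (auto intro!: ell2_add ell2_scale simp: ell2_zero)

lemma ell2_diff: "x \<in> ell2 \<Longrightarrow> y \<in> ell2 \<Longrightarrow> (\<lambda>n. x n - y n) \<in> ell2"
  using ell2_add[of x "\<lambda>n. - 1 * y n"] ell2_scale[of y "-1"] by simp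

lemma ell2_norm_nonneg: "0 \<le> ell2_norm x"
  by (simp add: ell2_norm_def infsum_nonneg)

lemma ell2_norm_squared: "(ell2_norm x)\<^sup>2 = (\<Sum>\<^sub>\<infinity>n. (cmod (x n))\<^sup>2)"
  by (simp add: ell2_norm_def infsum_nonneg)

lemma sum_le_ell2_norm: "x \<in> ell2 \<Longrightarrow> finite F \<Longrightarrow> (\<Sum>n\<in>F. (cmod (x n))\<^sup>2) \<le> (ell2_norm x)\<^sup>2"
  unfolding ell2_norm_squared by (rule finite_sum_le_infsum) (auto simp: ell2_def)

lemma norm_le_ell2_norm: "x \<in> ell2 \<Longrightarrow> cmod (x n) \<le> ell2_norm x"
  using sum_le_ell2_norm[of x "{n}"] ell2_norm_nonneg[of x] by (simp add: abs_le_square_iff[symmetric])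

lemma ell2I:
  assumes "\<And>F. finite F \<Longrightarrow> (\<Sum>n\<in>F. (cmod (x n))\<^sup>2) \<le> b\<^sup>2" and "0 \<le> b"
  shows "x \<in> ell2" and "ell2_norm x \<le> b"
proof -
  show x: "x \<in> ell2"
    unfolding ell2_def mem_Collect_eq
    by (rule nonneg_bdd_above_summable_on) (use assms in \<open>auto intro!: bdd_aboveI[of _ "b\<^sup>2"]\<close>)
  have "(ell2_norm x)\<^sup>2 \<le> b\<^sup>2"
    unfolding ell2_norm_squared using x
    by (intro infsum_le_finite_sums) (auto simp: ell2_def assms)
  then show "ell2_norm x \<le> b"
    using assms(2) by (rule power2_le_imp_le)
qed

lemma basis_vec_ell2: "basis_vec m \<in> ell2" and norm_basis_vec: "ell2_norm (basis_vec m) \<le> 1"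
proof -
  have "(\<Sum>n\<in>F. (cmod (basis_vec m n))\<^sup>2) \<le> 1\<^sup>2" if "finite F" for F
  proof -
    have "(\<Sum>n\<in>F. (cmod (basis_vec m n))\<^sup>2) = (\<Sum>n\<in>F. if n = m then 1 else 0)"
      by (intro sum.cong) (auto simp: basis_vec_def)
    then show ?thesis using that by simp
  qed
  then show "basis_vec m \<in> ell2" "ell2_norm (basis_vec m) \<le> 1"
    using ell2I[of "basis_vec m" 1] by auto
qed

lemma ell2_inner_basis: "ell2_inner (basis_vec m) v = v m"
proof -
  have "ell2_inner (basis_vec m) v = infsum (\<lambda>n. v n) {m}"
    unfolding ell2_inner_def by (rule infsum_cong_neutral) (auto simp: basis_vec_def)
  then show ?thesis by simp
qed

text \<open>Linearity is phrased for finite combinations indexed by integers because it is applied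
  to Laurent polynomials in \<open>U\<close>. Nothing is said about \<open>U\<close> off
  \<open>ell2\<close>.\<close>

locale ell2_unitary =
  fixes U :: "(int \<Rightarrow> complex) \<Rightarrow> int \<Rightarrow> complex"
  assumes mem: "x \<in> ell2 \<Longrightarrow> U x \<in> ell2"
    and isom: "x \<in> ell2 \<Longrightarrow> ell2_norm (U x) = ell2_norm x"
    and bij: "bij_betw U ell2 ell2"
    and linear: "finite (K :: int set) \<Longrightarrow> (\<And>k. k \<in> K \<Longrightarrow> X k \<in> ell2) \<Longrightarrow>
      U (\<lambda>n. \<Sum>k\<in>K. c k * X k n) = (\<lambda>n. \<Sum>k\<in>K. c k * U (X k) n)"
begin

abbreviation pw :: "int \<Rightarrow> (int \<Rightarrow> complex) \<Rightarrow> int \<Rightarrow> complex" where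
  "pw k x \<equiv> int_iterate ell2 U k x"

lemma inv_mem: "x \<in> ell2 \<Longrightarrow> inv_into ell2 U x \<in> ell2"
  using bij by (metis bij_betw_def inv_into_into)

lemma U_inv: "x \<in> ell2 \<Longrightarrow> U (inv_into ell2 U x) = x"
  using bij by (metis bij_betw_def f_inv_into_f)

lemma pw_mem: "x \<in> ell2 \<Longrightarrow> pw k x \<in> ell2"
proof -
  assume x: "x \<in> ell2"
  have "(U ^^ n) x \<in> ell2" "(inv_into ell2 U ^^ n) x \<in> ell2" for n
    by (induction n) (auto intro: x mem inv_mem)
  then show ?thesis by (simp add: int_iterate_def)
qed

lemma pw_0 [simp]: "pw 0 x = x"
  by (simp add: int_iterate_def)

lemma U_pw: "x \<in> ell2 \<Longrightarrow> U (pw k x) = pw (k + 1) x"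
proof -
  assume x: "x \<in> ell2"
  show ?thesis
  proof (cases "k \<ge> 0")
    case True
    then have "nat (k + 1) = Suc (nat k)" by simp
    then show ?thesis using True by (simp add: int_iterate_def)
  next
    case False
    then have s: "nat (- k) = Suc (nat (- (k + 1)))" by simp
    have "pw k x = inv_into ell2 U ((inv_into ell2 U ^^ nat (- (k + 1))) x)"
      using False unfolding int_iterate_def s by simp
    moreover have "(inv_into ell2 U ^^ nat (- (k + 1))) x = pw (k + 1) x"
      using False by (cases "k = -1") (auto simp: int_iterate_def)
    ultimately show ?thesis using U_inv pw_mem[OF x] by simp
  qed
qed

lemma norm_pw: "x \<in> ell2 \<Longrightarrow> ell2_norm (pw k x) = ell2_norm x"
proof -
  assume x: "x \<in> ell2"
  have step: "ell2_norm (pw (k + 1) x) = ell2_norm (pw k x)" for k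
    using isom[OF pw_mem[OF x, of k]] U_pw[OF x, of k] by simp
  show ?thesis
  proof (induction k rule: int_induct[where k = 0])
    case (step1 i)
    then show ?case using step[of i] by simp
  next
    case (step2 i)
    then show ?case using step[of "i - 1"] by simp
  qed simp
qed

lemma funpow_laurent_op:
  assumes x: "x \<in> ell2"
  shows "(U ^^ j) (laurent_op N c U x) = (\<lambda>n. \<Sum>k = - int N..int N. c k * pw (k + int j) x n)"
proof (induction j)
  case (Suc j)
  then show ?case
    using linear[of "{- int N..int N}" "\<lambda>k. pw (k + int j) x" c] pw_mem[OF x]
    by (simp add: U_pw[OF x] add_ac)
qed (simp add: laurent_op_def)

lemma laurent_op_mem: "x \<in> ell2 \<Longrightarrow> laurent_op N c U x \<in> ell2"
  unfolding laurent_op_def by (intro ell2_sum pw_mem) auto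

end

text \<open>Convolution with \<open>c\<close> becomes multiplication by a Laurent polynomial on the
  circle, where Parseval's identity applies. The sequence \<open>a\<close> is cut to
  \<open>{0..<m}\<close>, and the left side keeps only indices at distance \<open>N\<close> from
  both ends, where the convolution does not see the cut.\<close>

lemma laurent_convolution_bound:
  fixes a :: "int \<Rightarrow> complex"
  assumes le: "\<And>z. z \<in> sphere 0 1 \<Longrightarrow> cmod (laurent_fun N c z) \<le> \<delta>"
  shows "(\<Sum>j\<in>{int N..<int m - int N}. (cmod (\<Sum>k = - int N..int N. c k * a (j + k)))\<^sup>2)
    \<le> \<delta>\<^sup>2 * (\<Sum>j\<in>{0..<int m}. (cmod (a j))\<^sup>2)"
proof -
  define a' where "a' i = (if 0 \<le> i \<and> i < int m then a i else 0)" for i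
  define d where "d j = (\<Sum>k = - int N..int N. c k * a' (j + k))" for j
  define J where "J = {- int N..<int m + int N}"
  have shift: "(\<Sum>j\<in>J. a' (j + k) * w powi j) = w powi (-k) * (\<Sum>i\<in>{0..<int m}. a i * w powi i)"
    if k: "k \<in> {- int N..int N}" and w: "w \<noteq> 0" for k w
  proof -
    have "(\<Sum>j\<in>J. a' (j + k) * w powi j) = (\<Sum>i\<in>(\<lambda>j. j + k) ` J. a' i * w powi (i - k))"
      by (subst sum.reindex) (auto simp: inj_on_def)
    also have "\<dots> = (\<Sum>i\<in>{0..<int m}. a' i * w powi (i - k))"
    proof (rule sum.mono_neutral_right)
      show "{0..<int m} \<subseteq> (\<lambda>j. j + k) ` J"
      proof
        fix i assume "i \<in> {0..<int m}"
        then show "i \<in> (\<lambda>j. j + k) ` J"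
          using k by (intro image_eqI[of _ _ "i - k"]) (auto simp: J_def)
      qed
    qed (auto simp: a'_def J_def)
    also have "\<dots> = (\<Sum>i\<in>{0..<int m}. w powi (-k) * (a i * w powi i))"
      using w by (intro sum.cong) (auto simp: a'_def power_int_diff power_int_minus field_simps)
    finally show ?thesis by (simp add: sum_distrib_left)
  qed
  \<comment> \<open>The convolution sums \<open>a (j + k)\<close> rather than
    \<open>a (j - k)\<close>, hence the evaluation of the symbol at
    \<open>inverse w\<close>.\<close>
  have prod: "(\<Sum>j\<in>J. d j * w powi j) = laurent_fun N c (inverse w) * (\<Sum>i\<in>{0..<int m}. a i * w powi i)"
    if w: "w \<noteq> 0" for w
  proof -
    have "(\<Sum>j\<in>J. d j * w powi j) = (\<Sum>j\<in>J. \<Sum>k = - int N..int N. c k * (a' (j + k) * w powi j))"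
      by (simp add: d_def sum_distrib_right mult.assoc)
    also have "\<dots> = (\<Sum>k = - int N..int N. c k * (\<Sum>j\<in>J. a' (j + k) * w powi j))"
      by (subst sum.swap) (simp add: sum_distrib_left)
    also have "\<dots> = (\<Sum>k = - int N..int N. c k * (w powi (-k) * (\<Sum>i\<in>{0..<int m}. a i * w powi i)))"
      using shift[OF _ w] by (intro sum.cong) auto
    finally show ?thesis
      by (simp add: laurent_fun_def sum_distrib_right mult.assoc power_int_minus power_int_inverse)
  qed
  have "2 * pi * (\<Sum>j\<in>J. (cmod (d j))\<^sup>2) = (\<integral>w. (cmod (\<Sum>j\<in>J. d j * w powi j))\<^sup>2 \<partial>arc_length)"
    by (subst parseval_finite) (auto simp: J_def)
  also have "\<dots> \<le> (\<integral>w. \<delta>\<^sup>2 * (cmod (\<Sum>i\<in>{0..<int m}. a i * w powi i))\<^sup>2 \<partial>arc_length)"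
  proof (rule integral_mono)
    fix w assume "w \<in> space arc_length"
    then have w: "cmod w = 1" "w \<noteq> 0" by auto
    then have "cmod (laurent_fun N c (inverse w)) \<le> \<delta>"
      by (intro le) (simp add: norm_inverse)
    then show "(cmod (\<Sum>j\<in>J. d j * w powi j))\<^sup>2 \<le> \<delta>\<^sup>2 * (cmod (\<Sum>i\<in>{0..<int m}. a i * w powi i))\<^sup>2"
      unfolding prod[OF w(2)] norm_mult power_mult_distrib by (intro mult_right_mono power_mono) auto
  qed (auto intro!: integrable_arc_continuous continuous_intros)
  also have "\<dots> = 2 * pi * (\<delta>\<^sup>2 * (\<Sum>i\<in>{0..<int m}. (cmod (a i))\<^sup>2))"
    by (simp add: parseval_finite)
  finally have *: "(\<Sum>j\<in>J. (cmod (d j))\<^sup>2) \<le> \<delta>\<^sup>2 * (\<Sum>i\<in>{0..<int m}. (cmod (a i))\<^sup>2)"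
    by simp
  have "(\<Sum>j\<in>{int N..<int m - int N}. (cmod (\<Sum>k = - int N..int N. c k * a (j + k)))\<^sup>2)
    = (\<Sum>j\<in>{int N..<int m - int N}. (cmod (d j))\<^sup>2)"
    unfolding d_def by (intro sum.cong refl arg_cong[where f = "\<lambda>u. (cmod u)\<^sup>2"]) (auto simp: a'_def)
  also have "\<dots> \<le> (\<Sum>j\<in>J. (cmod (d j))\<^sup>2)"
    by (intro sum_mono2) (auto simp: J_def)
  finally show ?thesis using * by simp
qed

context ell2_unitary
begin

text \<open>Transference instead of the spectral theorem: in each coordinate \<open>n\<close> the
  orbit \<open>j \<mapsto> pw j x n\<close> is a scalar sequence obeying the convolution bound.
  Summing over \<open>n\<close>, and using that the powers of \<open>U\<close> preserve norms,
  leaves \<open>m - 2 * N\<close> copies of the squared norm on the left against \<open>m\<close>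
  copies on the right; the ratio tends to \<open>1\<close> as \<open>m\<close> grows.\<close>

lemma von_neumann_inequality:
  assumes le: "\<And>z. z \<in> sphere 0 1 \<Longrightarrow> cmod (laurent_fun N c z) \<le> \<delta>" and x: "x \<in> ell2"
  shows "ell2_norm (laurent_op N c U x) \<le> \<delta> * ell2_norm x"
proof -
  define y where "y = laurent_op N c U x"
  have y: "y \<in> ell2" unfolding y_def by (rule laurent_op_mem[OF x])
  have \<delta>: "0 \<le> \<delta>" using le[of 1] norm_ge_zero[of "laurent_fun N c 1"] by (simp del: norm_ge_zero)
  have pj: "pw (int j) y = (\<lambda>n. \<Sum>k = - int N..int N. c k * pw (int j + k) x n)" for j
    using funpow_laurent_op[OF x, of j N c] by (simp add: y_def int_iterate_def add.commute)
  have sm: "(\<lambda>n. (cmod (pw j v n))\<^sup>2) summable_on UNIV" if "v \<in> ell2" for j v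
    using pw_mem[OF that] by (simp add: ell2_def)
  have ineq: "real (m - 2 * N) * (ell2_norm y)\<^sup>2 \<le> \<delta>\<^sup>2 * (real m * (ell2_norm x)\<^sup>2)" for m
  proof -
    have l: "((\<lambda>n. \<Sum>j\<in>{int N..<int m - int N}. (cmod (pw j y n))\<^sup>2) has_sum
      (\<Sum>j\<in>{int N..<int m - int N}. \<Sum>\<^sub>\<infinity>n. (cmod (pw j y n))\<^sup>2)) UNIV"
      by (rule has_sum_finite_sum) (auto intro: sm y)
    have r: "((\<lambda>n. \<delta>\<^sup>2 * (\<Sum>j\<in>{0..<int m}. (cmod (pw j x n))\<^sup>2)) has_sum
      (\<delta>\<^sup>2 * (\<Sum>j\<in>{0..<int m}. \<Sum>\<^sub>\<infinity>n. (cmod (pw j x n))\<^sup>2))) UNIV"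
      by (intro has_sum_cmult_right has_sum_finite_sum) (auto intro: sm x)
    have "(\<Sum>j\<in>{int N..<int m - int N}. \<Sum>\<^sub>\<infinity>n. (cmod (pw j y n))\<^sup>2)
      \<le> \<delta>\<^sup>2 * (\<Sum>j\<in>{0..<int m}. \<Sum>\<^sub>\<infinity>n. (cmod (pw j x n))\<^sup>2)"
    proof (rule has_sum_mono[OF l r])
      fix n
      have "(\<Sum>j\<in>{int N..<int m - int N}. (cmod (pw j y n))\<^sup>2) =
         (\<Sum>j\<in>{int N..<int m - int N}. (cmod (\<Sum>k = - int N..int N. c k * pw (j + k) x n))\<^sup>2)"
      proof (intro sum.cong refl)
        fix j assume "j \<in> {int N..<int m - int N}"
        then have "j = int (nat j)" by auto
        then show "(cmod (pw j y n))\<^sup>2 = (cmod (\<Sum>k = - int N..int N. c k * pw (j + k) x n))\<^sup>2"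
          using pj[of "nat j"] by metis
      qed
      then show "(\<Sum>j\<in>{int N..<int m - int N}. (cmod (pw j y n))\<^sup>2) \<le> \<delta>\<^sup>2 * (\<Sum>j\<in>{0..<int m}. (cmod (pw j x n))\<^sup>2)"
        using laurent_convolution_bound[where N = N and c = c and m = m and a = "\<lambda>j. pw j x n", OF le] by simp
    qed
    moreover have "card {int N..<int m - int N} = m - 2 * N" "card {0..<int m} = m"
      by auto
    ultimately show ?thesis
      unfolding ell2_norm_squared[symmetric] norm_pw[OF x] norm_pw[OF y] by (simp only: sum_constant)
  qed
  have "(ell2_norm y)\<^sup>2 \<le> (\<delta> * ell2_norm x)\<^sup>2"
  proof (rule ccontr)
    assume "\<not> (ell2_norm y)\<^sup>2 \<le> (\<delta> * ell2_norm x)\<^sup>2"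
    then have e: "0 < (ell2_norm y)\<^sup>2 - (\<delta> * ell2_norm x)\<^sup>2" by linarith
    obtain m :: nat where m: "real m * ((ell2_norm y)\<^sup>2 - (\<delta> * ell2_norm x)\<^sup>2) > real (2 * N) * (ell2_norm y)\<^sup>2"
      using reals_Archimedean3[OF e] by blast
    have "(real m - real (2 * N)) * (ell2_norm y)\<^sup>2 \<le> real (m - 2 * N) * (ell2_norm y)\<^sup>2"
      by (intro mult_right_mono) auto
    then have "(real m - real (2 * N)) * (ell2_norm y)\<^sup>2 \<le> real m * (\<delta> * ell2_norm x)\<^sup>2"
      using ineq[of m] by (simp add: power_mult_distrib mult_ac)
    then show False using m by (simp add: algebra_simps)
  qed
  then show ?thesis
    unfolding y_def[symmetric]
    by (rule power2_le_imp_le) (intro mult_nonneg_nonneg \<delta> ell2_norm_nonneg)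
qed

text \<open>\<open>cfc\<close> is a definite description, so existence and uniqueness both have to
  be shown. For existence \<open>\<delta> = \<epsilon>\<close> works by von Neumann's inequality;
  for uniqueness the defining property is tested with the Laurent polynomial itself, whose distance
  to \<open>g\<close> is \<open>0\<close>.\<close>

lemma cfc_laurent:
  assumes g: "\<And>z. z \<in> sphere 0 1 \<Longrightarrow> g z = laurent_fun N c z" and x: "x \<in> ell2"
  shows "cfc U g x = laurent_op N c U x"
proof -
  let ?T = "\<lambda>x. if x \<in> ell2 then laurent_op N c U x else (\<lambda>_. 0)"
  have "cfc U g = ?T"
    unfolding cfc_def
  proof (rule the_equality)
    have "ell2_norm (\<lambda>n. laurent_op N' c' U x n - laurent_op N c U x n) \<le> \<epsilon> * ell2_norm x"
      if c': "\<forall>z\<in>sphere 0 1. cmod (laurent_fun N' c' z - g z) \<le> \<epsilon>" and x: "x \<in> ell2" for \<epsilon> N' c' x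
    proof -
      \<comment> \<open>Padding coefficients with zeros to the common degree makes the difference of
        the two Laurent polynomials a single one.\<close>
      define N1 where "N1 = max N N'"
      define c1 where "c1 k = (if \<bar>k\<bar> \<le> int N' then c' k else 0) - (if \<bar>k\<bar> \<le> int N then c k else 0)" for k
      have split: "(\<Sum>k = - int N1..int N1. c1 k * h k) =
         (\<Sum>k = - int N'..int N'. c' k * h k) - (\<Sum>k = - int N..int N. c k * h k)" for h :: "int \<Rightarrow> complex"
      proof -
        have "(\<Sum>k = - int N1..int N1. (if \<bar>k\<bar> \<le> int M then e k else 0) * h k) = (\<Sum>k = - int M..int M. e k * h k)"
          if "M \<le> N1" for M e
          using that by (intro sum.mono_neutral_cong_right) auto
        from this[of N' c'] this[of N c] show ?thesis
          by (simp add: c1_def left_diff_distrib sum_subtractf N1_def)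
      qed
      have "ell2_norm (laurent_op N1 c1 U x) \<le> \<epsilon> * ell2_norm x"
        by (rule von_neumann_inequality[OF _ x]) (use c' g in \<open>auto simp: laurent_fun_def split\<close>)
      then show ?thesis by (simp add: laurent_op_def split)
    qed
    then show "(\<forall>x\<in>ell2. ?T x \<in> ell2) \<and> (\<forall>x. x \<notin> ell2 \<longrightarrow> ?T x = (\<lambda>_. 0)) \<and>
      (\<forall>\<epsilon>>0. \<exists>\<delta>>0. \<forall>N c. (\<forall>z\<in>sphere 0 1. cmod (laurent_fun N c z - g z) \<le> \<delta>) \<longrightarrow>
        (\<forall>x\<in>ell2. ell2_norm (\<lambda>n. laurent_op N c U x n - ?T x n) \<le> \<epsilon> * ell2_norm x))"
      using laurent_op_mem by auto
  next
    fix T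
    assume T: "(\<forall>x\<in>ell2. T x \<in> ell2) \<and> (\<forall>x. x \<notin> ell2 \<longrightarrow> T x = (\<lambda>_. 0)) \<and>
      (\<forall>\<epsilon>>0. \<exists>\<delta>>0. \<forall>N c. (\<forall>z\<in>sphere 0 1. cmod (laurent_fun N c z - g z) \<le> \<delta>) \<longrightarrow>
        (\<forall>x\<in>ell2. ell2_norm (\<lambda>n. laurent_op N c U x n - T x n) \<le> \<epsilon> * ell2_norm x))"
    have "T x = laurent_op N c U x" if x: "x \<in> ell2" for x
    proof
      fix n
      have le: "ell2_norm (\<lambda>n. laurent_op N c U x n - T x n) \<le> \<epsilon> * ell2_norm x" if "\<epsilon> > 0" for \<epsilon>
      proof -
        obtain \<delta> where "\<delta> > 0" and \<delta>: "\<forall>N c. (\<forall>z\<in>sphere 0 1. cmod (laurent_fun N c z - g z) \<le> \<delta>) \<longrightarrow>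
          (\<forall>x\<in>ell2. ell2_norm (\<lambda>n. laurent_op N c U x n - T x n) \<le> \<epsilon> * ell2_norm x)"
          using T \<open>\<epsilon> > 0\<close> by blast
        have "\<forall>z\<in>sphere 0 1. cmod (laurent_fun N c z - g z) \<le> \<delta>"
          using g \<open>\<delta> > 0\<close> by simp
        then show ?thesis using \<delta> x by blast
      qed
      have "ell2_norm (\<lambda>n. laurent_op N c U x n - T x n) \<le> 0"
      proof (rule field_le_epsilon)
        fix e :: real assume e: "e > 0"
        have "ell2_norm (\<lambda>n. laurent_op N c U x n - T x n) \<le> e / (ell2_norm x + 1) * ell2_norm x"
          using e ell2_norm_nonneg[of x] by (intro le divide_pos_pos) auto
        also have "\<dots> \<le> e"
          using e ell2_norm_nonneg[of x] by (simp add: field_simps)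
        finally show "ell2_norm (\<lambda>n. laurent_op N c U x n - T x n) \<le> 0 + e" by simp
      qed
      moreover have "cmod (laurent_op N c U x n - T x n) \<le> ell2_norm (\<lambda>n. laurent_op N c U x n - T x n)"
        using T x laurent_op_mem[OF x] norm_le_ell2_norm[of "\<lambda>n. laurent_op N c U x n - T x n" n]
        by (auto intro!: ell2_diff)
      ultimately show "T x n = laurent_op N c U x n"
        using norm_ge_zero[of "laurent_op N c U x n - T x n"]
        by (metis order_trans norm_le_zero_iff right_minus_eq)
    qed
    then show "T = ?T" using T by auto
  qed
  then show ?thesis using x by simp
qed

lemma spectral_moment:
  assumes "is_spectral_measure U \<nu>"
  shows "(\<integral>z. z powi k \<partial>\<nu>) = pw k (basis_vec 0) 0"
proof -
  define c where "c j = (if j = k then 1 else 0::complex)" for j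
  have K: "k \<in> {- int (nat \<bar>k\<bar>)..int (nat \<bar>k\<bar>)}" by auto
  have sum: "(\<Sum>j = - int (nat \<bar>k\<bar>)..int (nat \<bar>k\<bar>). c j * h j) = h k" for h :: "int \<Rightarrow> complex"
  proof -
    have "(\<Sum>j = - int (nat \<bar>k\<bar>)..int (nat \<bar>k\<bar>). c j * h j) =
        (\<Sum>j = - int (nat \<bar>k\<bar>)..int (nat \<bar>k\<bar>). if j = k then h j else 0)"
      by (intro sum.cong) (auto simp: c_def)
    also have "\<dots> = h k" using K by (subst sum.delta) auto
    finally show ?thesis .
  qed
  have "continuous_on (sphere 0 1) (\<lambda>z::complex. z powi k)"
    by (auto intro!: continuous_intros)
  then have "(\<integral>z. z powi k \<partial>\<nu>) = cfc U (\<lambda>z. z powi k) (basis_vec 0) 0"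
    using assms ell2_inner_basis[of 0 "cfc U (\<lambda>z. z powi k) (basis_vec 0)"]
    by (simp add: is_spectral_measure_def)
  also have "cfc U (\<lambda>z. z powi k) (basis_vec 0) = laurent_op (nat \<bar>k\<bar>) c U (basis_vec 0)"
    by (rule cfc_laurent) (simp_all only: laurent_fun_def sum basis_vec_ell2)
  finally show ?thesis by (simp only: laurent_op_def sum)
qed

end

section \<open>The resolvent of an extended CMV matrix\<close>

text \<open>\<open>cmv_block \<alpha> True\<close> and \<open>cmv_block \<alpha> False\<close> are the factors \<open>\<L>\<close> and \<open>\<M>\<close> of
  the CMV matrix: direct sums of \<open>2 \<times> 2\<close> unitary blocks starting at even, respectively odd, indices.\<close>

definition cmv_block :: "(int \<Rightarrow> complex) \<Rightarrow> bool \<Rightarrow> (int \<Rightarrow> complex) \<Rightarrow> int \<Rightarrow> complex" where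
  "cmv_block \<alpha> e x n =
    (if even n = e then cnj (\<alpha> n) * x n + complex_of_real (rho (\<alpha> n)) * x (n + 1)
     else complex_of_real (rho (\<alpha> (n - 1))) * x (n - 1) - \<alpha> (n - 1) * x n)"

lemma ext_cmv_eq_blocks: "ext_cmv \<alpha> x = cmv_block \<alpha> True (cmv_block \<alpha> False x)"
proof
  fix r :: int
  define j where "j = r div 2"
  have "ext_cmv \<alpha> x r = infsum (\<lambda>c. cmv_entry \<alpha> r c * x c) {2*j-1, 2*j, 2*j+1, 2*j+2}"
    unfolding ext_cmv_def
    by (rule infsum_cong_neutral) (auto simp: cmv_entry_def Let_def j_def)
  also have "\<dots> = cmv_entry \<alpha> r (2*j-1) * x (2*j-1) + cmv_entry \<alpha> r (2*j) * x (2*j)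
      + cmv_entry \<alpha> r (2*j+1) * x (2*j+1) + cmv_entry \<alpha> r (2*j+2) * x (2*j+2)"
    by simp
  also have "\<dots> = cmv_block \<alpha> True (cmv_block \<alpha> False x) r"
  proof (cases "even r")
    case True
    then have r: "r = 2 * j" by (simp add: j_def)
    show ?thesis unfolding r by (simp add: cmv_entry_def Let_def cmv_block_def algebra_simps)
  next
    case False
    then have r: "r = 2 * j + 1" by (simp add: j_def)
    show ?thesis unfolding r by (simp add: cmv_entry_def Let_def cmv_block_def algebra_simps)
  qed
  finally show "ext_cmv \<alpha> x r = cmv_block \<alpha> True (cmv_block \<alpha> False x) r" .
qed

lemma cmv_block_sum:
  "cmv_block \<alpha> e (\<lambda>n. \<Sum>k\<in>K. c k * X k n) = (\<lambda>n. \<Sum>k\<in>K. c k * cmv_block \<alpha> e (X k) n)"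
proof
  fix n
  show "cmv_block \<alpha> e (\<lambda>n. \<Sum>k\<in>K. c k * X k n) n = (\<Sum>k\<in>K. c k * cmv_block \<alpha> e (X k) n)"
    unfolding cmv_block_def
    by (cases "even n = e")
       (simp_all add: sum_distrib_left sum.distrib[symmetric] sum_subtractf[symmetric] right_diff_distrib
         distrib_left mult.left_commute)
qed

lemma cmv_block_sums:
  fixes x :: "int \<Rightarrow> complex"
  assumes "\<And>m. (\<lambda>n. z ^ n * Y n m) sums x m"
  shows "(\<lambda>n. z ^ n * cmv_block \<alpha> e (Y n) m) sums cmv_block \<alpha> e x m"
proof (cases "even m = e")
  case True
  have "(\<lambda>n. cnj (\<alpha> m) * (z ^ n * Y n m) + rho (\<alpha> m) * (z ^ n * Y n (m + 1))) sums
      (cnj (\<alpha> m) * x m + rho (\<alpha> m) * x (m + 1))"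
    by (intro sums_add sums_mult assms)
  then show ?thesis using True by (simp add: cmv_block_def algebra_simps)
next
  case False
  have "(\<lambda>n. rho (\<alpha> (m - 1)) * (z ^ n * Y n (m - 1)) - \<alpha> (m - 1) * (z ^ n * Y n m)) sums
      (rho (\<alpha> (m - 1)) * x (m - 1) - \<alpha> (m - 1) * x m)"
    by (intro sums_diff sums_mult assms)
  then show ?thesis using False by (simp add: cmv_block_def algebra_simps)
qed

context
  fixes \<alpha> :: "int \<Rightarrow> complex"
  assumes \<alpha>: "\<And>n. cmod (\<alpha> n) < 1"
begin

text \<open>Each \<open>2 \<times> 2\<close> block is a symmetric unitary matrix, so conjugating its
  entries inverts it; the inverse is again a \<open>cmv_block\<close>.\<close>

lemma cmv_block_inverse: "cmv_block (\<lambda>n. cnj (\<alpha> n)) e (cmv_block \<alpha> e x) = x"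
proof
  fix n
  show "cmv_block (\<lambda>n. cnj (\<alpha> n)) e (cmv_block \<alpha> e x) n = x n"
  proof (cases "even n = e")
    case True
    then have "cmv_block (\<lambda>n. cnj (\<alpha> n)) e (cmv_block \<alpha> e x) n =
       (\<alpha> n * cnj (\<alpha> n) + complex_of_real (rho (\<alpha> n)) * rho (\<alpha> n)) * x n"
      by (auto simp: cmv_block_def algebra_simps)
    then show ?thesis by (simp add: rho_squared_complex[OF \<alpha>])
  next
    case False
    then have "cmv_block (\<lambda>n. cnj (\<alpha> n)) e (cmv_block \<alpha> e x) n =
       (\<alpha> (n-1) * cnj (\<alpha> (n-1)) + complex_of_real (rho (\<alpha> (n-1))) * rho (\<alpha> (n-1))) * x n"
      by (auto simp: cmv_block_def algebra_simps)
    then show ?thesis by (simp add: rho_squared_complex[OF \<alpha>])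
  qed
qed

lemma cmv_block_isometry_pair:
  assumes "even n = e"
  shows "(cmod (cmv_block \<alpha> e x n))\<^sup>2 + (cmod (cmv_block \<alpha> e x (n + 1)))\<^sup>2 = (cmod (x n))\<^sup>2 + (cmod (x (n + 1)))\<^sup>2"
proof -
  have r: "(rho (\<alpha> n))\<^sup>2 = 1 - (cmod (\<alpha> n))\<^sup>2" by (rule rho_squared[OF \<alpha>])
  have "(cmod (cnj a * u + of_real p * v))\<^sup>2 + (cmod (of_real p * u - a * v))\<^sup>2 =
     ((cmod a)\<^sup>2 + p\<^sup>2) * ((cmod u)\<^sup>2 + (cmod v)\<^sup>2)" for a u v p
    unfolding cmod_power2 by (simp add: algebra_simps power2_eq_square)
  from this[of "\<alpha> n" "x n" "rho (\<alpha> n)" "x (n+1)"] show ?thesis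
    using assms r by (auto simp: cmv_block_def)
qed

text \<open>Whole blocks preserve sums of squares, so a finite index set is enlarged to a union of
  blocks. Since the inverse has the same form, this inequality applied twice yields isometry in
  \<open>cmv_block_unitary\<close>.\<close>

lemma cmv_block_norm_le:
  assumes x: "x \<in> ell2"
  shows "cmv_block \<alpha> e x \<in> ell2" "ell2_norm (cmv_block \<alpha> e x) \<le> ell2_norm x"
proof -
  have pairs: "(\<Sum>n\<in>{m..<m + 2 * int N}. (cmod (cmv_block \<alpha> e x n))\<^sup>2) = (\<Sum>n\<in>{m..<m + 2 * int N}. (cmod (x n))\<^sup>2)"
    if "even m = e" for m N
  proof (induction N)
    case (Suc N)
    have "{m..<m + 2 * int (Suc N)} = insert (m + 2 * int N + 1) (insert (m + 2 * int N) {m..<m + 2 * int N})"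
      by auto
    then show ?case
      using Suc cmv_block_isometry_pair[of "m + 2 * int N" e x] that by simp
  qed simp
  have "(\<Sum>n\<in>F. (cmod (cmv_block \<alpha> e x n))\<^sup>2) \<le> (ell2_norm x)\<^sup>2" if F: "finite F" for F
  proof -
    obtain m0 where m0: "\<And>n. n \<in> F \<Longrightarrow> \<bar>n\<bar> \<le> int m0"
    proof
      fix n assume "n \<in> F"
      then have "nat \<bar>n\<bar> \<le> Max (insert 0 ((\<lambda>n. nat \<bar>n\<bar>) ` F))" using F by (intro Max_ge) auto
      then show "\<bar>n\<bar> \<le> int (Max (insert 0 ((\<lambda>n. nat \<bar>n\<bar>) ` F)))" by linarith
    qed
    \<comment> \<open>The window starts at an index of the parity of the blocks, so no block is cut
      at either end.\<close>
    define m where "m = (if e then - 2 * int m0 else - 2 * int m0 - 1)"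
    have e: "even m = e" by (auto simp: m_def)
    have "F \<subseteq> {m..<m + 2 * int (2 * m0 + 2)}"
      using m0 by (force simp: m_def)
    then have "(\<Sum>n\<in>F. (cmod (cmv_block \<alpha> e x n))\<^sup>2) \<le> (\<Sum>n\<in>{m..<m + 2 * int (2 * m0 + 2)}. (cmod (cmv_block \<alpha> e x n))\<^sup>2)"
      by (intro sum_mono2) auto
    also have "\<dots> \<le> (ell2_norm x)\<^sup>2"
      unfolding pairs[OF e] by (intro sum_le_ell2_norm x) simp
    finally show ?thesis .
  qed
  then show "cmv_block \<alpha> e x \<in> ell2" "ell2_norm (cmv_block \<alpha> e x) \<le> ell2_norm x"
    using ell2I[of "cmv_block \<alpha> e x" "ell2_norm x"] ell2_norm_nonneg by blast+
qed

end

lemma cmv_block_unitary: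
  assumes \<alpha>: "\<And>n. cmod (\<alpha> n) < 1"
  shows "x \<in> ell2 \<Longrightarrow> ell2_norm (cmv_block \<alpha> e x) = ell2_norm x"
    and "bij_betw (cmv_block \<alpha> e) ell2 ell2"
proof -
  have c: "\<And>n. cmod (cnj (\<alpha> n)) < 1" using \<alpha> by simp
  have inv2: "cmv_block \<alpha> e (cmv_block (\<lambda>n. cnj (\<alpha> n)) e x) = x" for x
    using cmv_block_inverse[of "\<lambda>n. cnj (\<alpha> n)", OF c, of e x] by simp
  show "bij_betw (cmv_block \<alpha> e) ell2 ell2"
    by (rule bij_betw_byWitness[where f' = "cmv_block (\<lambda>n. cnj (\<alpha> n)) e"])
       (auto simp: inv2 cmv_block_inverse[OF \<alpha>] intro!: cmv_block_norm_le \<alpha> c)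
  assume x: "x \<in> ell2"
  show "ell2_norm (cmv_block \<alpha> e x) = ell2_norm x"
  proof (rule order_antisym)
    show "ell2_norm (cmv_block \<alpha> e x) \<le> ell2_norm x"
      by (rule cmv_block_norm_le(2)[OF \<alpha> x])
    have "ell2_norm (cmv_block (\<lambda>n. cnj (\<alpha> n)) e (cmv_block \<alpha> e x)) \<le> ell2_norm (cmv_block \<alpha> e x)"
      by (rule cmv_block_norm_le(2)[OF c cmv_block_norm_le(1)[OF \<alpha> x]])
    then show "ell2_norm x \<le> ell2_norm (cmv_block \<alpha> e x)"
      by (simp only: cmv_block_inverse[OF \<alpha>])
  qed
qed

lemma ell2_unitary_ext_cmv:
  assumes \<alpha>: "\<And>n. cmod (\<alpha> n) < 1"
  shows "ell2_unitary (ext_cmv \<alpha>)"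
proof
  fix x assume x: "x \<in> ell2"
  note m = cmv_block_norm_le(1)[OF \<alpha>]
  show "ext_cmv \<alpha> x \<in> ell2" unfolding ext_cmv_eq_blocks by (intro m x)
  show "ell2_norm (ext_cmv \<alpha> x) = ell2_norm x"
    unfolding ext_cmv_eq_blocks using cmv_block_unitary(1)[OF \<alpha>] m x by simp
next
  have "ext_cmv \<alpha> = cmv_block \<alpha> True \<circ> cmv_block \<alpha> False"
    by (auto simp: ext_cmv_eq_blocks)
  then show "bij_betw (ext_cmv \<alpha>) ell2 ell2"
    by (simp only: bij_betw_trans[OF cmv_block_unitary(2)[of \<alpha>, OF \<alpha>] cmv_block_unitary(2)[of \<alpha>, OF \<alpha>]])
next
  fix K :: "int set" and X :: "int \<Rightarrow> int \<Rightarrow> complex" and c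
  show "ext_cmv \<alpha> (\<lambda>n. \<Sum>k\<in>K. c k * X k n) = (\<lambda>n. \<Sum>k\<in>K. c k * ext_cmv \<alpha> (X k) n)"
    unfolding ext_cmv_eq_blocks cmv_block_sum ..
qed

section \<open>Schur functions of the two half lines and the diagonal Green function\<close>

definition schur_plus :: "(int \<Rightarrow> complex) \<Rightarrow> complex \<Rightarrow> int \<Rightarrow> complex" where
  "schur_plus \<alpha> z n = schur_lim (\<lambda>j. \<alpha> (n + int j)) z"

definition schur_back :: "(int \<Rightarrow> complex) \<Rightarrow> complex \<Rightarrow> int \<Rightarrow> complex" where
  "schur_back \<alpha> z n = schur_lim (\<lambda>j. - cnj (\<alpha> (n - 1 - int j))) z"

text \<open>This is \<open>schur_back\<close> divided by \<open>z\<close> (see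
  \<open>schur_back_eq\<close>), written with one Moebius step carried out so that it makes sense at
  \<open>z = 0\<close>.\<close>

definition schur_minus :: "(int \<Rightarrow> complex) \<Rightarrow> complex \<Rightarrow> int \<Rightarrow> complex" where
  "schur_minus \<alpha> z n =
     (schur_back \<alpha> z (n - 1) - cnj (\<alpha> (n - 1))) / (1 - \<alpha> (n - 1) * schur_back \<alpha> z (n - 1))"

definition schur_prod :: "(int \<Rightarrow> complex) \<Rightarrow> complex \<Rightarrow> complex" where
  "schur_prod \<alpha> z = schur_plus \<alpha> z 0 * schur_minus \<alpha> z 0"

context
  fixes \<alpha> :: "int \<Rightarrow> complex" and z :: complex
  assumes \<alpha>: "\<And>n. cmod (\<alpha> n) < 1" and z: "cmod z < 1"
begin

lemma norm_schur_plus_le: "cmod (schur_plus \<alpha> z n) \<le> cmod z"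
  unfolding schur_plus_def by (rule norm_schur_lim_le[OF \<alpha> z])

lemma norm_schur_back_le: "cmod (schur_back \<alpha> z n) \<le> cmod z"
  unfolding schur_back_def
  by (rule norm_schur_lim_le) (simp_all only: \<alpha> z norm_minus_cancel complex_mod_cnj)

lemma schur_plus_step: "schur_plus \<alpha> z n = schur_step z (\<alpha> n) (schur_plus \<alpha> z (n + 1))"
proof -
  have "n + int (Suc j) = n + 1 + int j" for j by simp
  then show ?thesis
    unfolding schur_plus_def by (subst schur_lim_unfold) (simp_all only: \<alpha> z of_nat_0 add_0_right)
qed

lemma schur_back_step: "schur_back \<alpha> z (n + 1) = schur_step z (- cnj (\<alpha> n)) (schur_back \<alpha> z n)"
proof -
  have "n + 1 - 1 - int (Suc j) = n - 1 - int j" "n + 1 - 1 - int 0 = n" for j by simp_all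
  then show ?thesis
    unfolding schur_back_def
    by (subst schur_lim_unfold) (simp_all only: \<alpha> z norm_minus_cancel complex_mod_cnj)
qed

lemma schur_back_eq: "schur_back \<alpha> z n = z * schur_minus \<alpha> z n"
  using schur_back_step[of "n - 1"] by (simp add: schur_minus_def schur_step_def)

lemma norm_schur_minus_le: "cmod (schur_minus \<alpha> z n) \<le> 1"
proof -
  have "cmod ((- cnj (\<alpha> (n - 1)) + schur_back \<alpha> z (n - 1)) / (1 + cnj (- cnj (\<alpha> (n - 1))) * schur_back \<alpha> z (n - 1))) \<le> 1"
    by (rule norm_moebius_le_1) (use \<alpha> z order_trans[OF norm_schur_back_le less_imp_le[OF z]] in auto)
  then show ?thesis by (simp add: schur_minus_def)
qed

lemma norm_schur_prod_le: "cmod (schur_prod \<alpha> z) \<le> cmod (schur_plus \<alpha> z 0)"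
  unfolding schur_prod_def norm_mult by (rule mult_left_le[OF norm_schur_minus_le norm_ge_zero])

lemma norm_schur_prod_less: "cmod (schur_prod \<alpha> z) < 1"
  by (rule le_less_trans[OF norm_schur_prod_le le_less_trans[OF norm_schur_plus_le z]])

end

text \<open>\<open>x\<close> is the resolvent vector at \<open>basis_vec 0\<close>; with the two
  block factors separated its equation becomes one relation per block. Up to powers of
  \<open>z\<close>, the values \<open>x' / z\<close> and \<open>y\<close>, taken alternately to the
  right, and \<open>y\<close> and \<open>z * x\<close>, taken alternately to the left, are first
  components of decaying Szego solutions. Each half line then gives one relation between
  \<open>x 0\<close> and \<open>y 0\<close> through its Schur function, and the two relations
  determine \<open>x 0\<close>.\<close>

lemma resolvent_eq_schur_prod:
  fixes x y :: "int \<Rightarrow> complex"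
  assumes \<alpha>: "\<And>n. cmod (\<alpha> n) < 1" and z: "z \<noteq> 0" "cmod z < 1"
    and y: "y = cmv_block \<alpha> False x"
    and Ly: "\<And>n. cmv_block \<alpha> True y n = z * x n + basis_vec 0 n"
    and bdx: "\<And>n. cmod (x n) \<le> B" and bdy: "\<And>n. cmod (y n) \<le> B"
  shows "1 + z * x 0 = 1 / (1 - schur_prod \<alpha> z)"
proof -
  have r: "complex_of_real (rho (\<alpha> n)) * complex_of_real (rho (\<alpha> n)) = 1 - \<alpha> n * cnj (\<alpha> n)" for n
    by (rule rho_squared_complex[OF \<alpha>])
  then have r': "complex_of_real (rho (\<alpha> n) * rho (\<alpha> n)) = 1 - \<alpha> n * cnj (\<alpha> n)" for n
    by simp
  have odd_block: "rho (\<alpha> n) * x (n + 1) = y n - cnj (\<alpha> n) * x n" "rho (\<alpha> n) * y (n + 1) = x n - \<alpha> n * y n"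
    "rho (\<alpha> n) * x n = y (n + 1) + \<alpha> n * x (n + 1)" "rho (\<alpha> n) * y n = x (n + 1) + cnj (\<alpha> n) * y (n + 1)"
    if n: "odd n" for n
  proof -
    have a: "y n = cnj (\<alpha> n) * x n + rho (\<alpha> n) * x (n + 1)" "y (n + 1) = rho (\<alpha> n) * x n - \<alpha> n * x (n + 1)"
      using n by (auto simp: y cmv_block_def)
    show "rho (\<alpha> n) * x (n + 1) = y n - cnj (\<alpha> n) * x n" "rho (\<alpha> n) * x n = y (n + 1) + \<alpha> n * x (n + 1)"
      using a by (auto simp: algebra_simps)
    have "rho (\<alpha> n) * y (n + 1) = (rho (\<alpha> n) * rho (\<alpha> n)) * x n - \<alpha> n * (rho (\<alpha> n) * x (n + 1))"
      unfolding a by (simp add: algebra_simps)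
    also have "\<dots> = x n - \<alpha> n * y n" unfolding a r' by (simp add: algebra_simps)
    finally show "rho (\<alpha> n) * y (n + 1) = x n - \<alpha> n * y n" .
    have "rho (\<alpha> n) * y n = cnj (\<alpha> n) * (rho (\<alpha> n) * x n) + (rho (\<alpha> n) * rho (\<alpha> n)) * x (n + 1)"
      unfolding a by (simp add: algebra_simps)
    also have "\<dots> = x (n + 1) + cnj (\<alpha> n) * y (n + 1)" unfolding a r' by (simp add: algebra_simps)
    finally show "rho (\<alpha> n) * y n = x (n + 1) + cnj (\<alpha> n) * y (n + 1)" .
  qed
  \<comment> \<open>The source at site \<open>0\<close> is absorbed into \<open>x'\<close>, which
    makes the relations of the even blocks homogeneous. It is felt by the right half line only;
    everywhere else \<open>x'\<close> is \<open>z * x\<close>.\<close>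
  define x' where "x' n = z * x n + basis_vec 0 n" for n
  have even_block: "rho (\<alpha> n) * y (n + 1) = x' n - cnj (\<alpha> n) * y n" "rho (\<alpha> n) * x' (n + 1) = y n - \<alpha> n * x' n"
    "rho (\<alpha> n) * y n = x' (n + 1) + \<alpha> n * y (n + 1)" "rho (\<alpha> n) * x' n = y (n + 1) + cnj (\<alpha> n) * x' (n + 1)"
    if n: "even n" for n
  proof -
    have a: "x' n = cnj (\<alpha> n) * y n + rho (\<alpha> n) * y (n + 1)" "x' (n + 1) = rho (\<alpha> n) * y n - \<alpha> n * y (n + 1)"
      using n Ly[of n] Ly[of "n + 1"] by (auto simp: x'_def cmv_block_def)
    show "rho (\<alpha> n) * y (n + 1) = x' n - cnj (\<alpha> n) * y n" "rho (\<alpha> n) * y n = x' (n + 1) + \<alpha> n * y (n + 1)"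
      using a by (auto simp: algebra_simps)
    have "rho (\<alpha> n) * x' (n + 1) = (rho (\<alpha> n) * rho (\<alpha> n)) * y n - \<alpha> n * (rho (\<alpha> n) * y (n + 1))"
      unfolding a by (simp add: algebra_simps)
    also have "\<dots> = y n - \<alpha> n * x' n" unfolding a r' by (simp add: algebra_simps)
    finally show "rho (\<alpha> n) * x' (n + 1) = y n - \<alpha> n * x' n" .
    have "rho (\<alpha> n) * x' n = cnj (\<alpha> n) * (rho (\<alpha> n) * y n) + (rho (\<alpha> n) * rho (\<alpha> n)) * y (n + 1)"
      unfolding a by (simp add: algebra_simps)
    also have "\<dots> = y (n + 1) + cnj (\<alpha> n) * x' (n + 1)" unfolding a r' by (simp add: algebra_simps)
    finally show "rho (\<alpha> n) * x' n = y (n + 1) + cnj (\<alpha> n) * x' (n + 1)" .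
  qed
  have x'nz: "x' n = z * x n" if "n \<noteq> 0" for n
    using that by (simp add: x'_def basis_vec_def)
  have B: "0 \<le> B" using bdx[of 0] norm_ge_zero[of "x 0"] by linarith
  \<comment> \<open>One factor \<open>z\<close> for every two sites is the weight that turns the
    block relations into the Szego recursion. It also forces decay, so boundedness of
    \<open>x\<close> and \<open>y\<close> is enough.\<close>
  have dec: "(\<lambda>j. z ^ (j div 2) * u j) \<longlonglongrightarrow> 0" if u: "\<And>j. cmod (u j) \<le> B'" for u B'
  proof (rule Lim_null_comparison)
    show "\<forall>\<^sub>F j in sequentially. norm (z ^ (j div 2) * u j) \<le> cmod z ^ (j div 2) * B'"
      by (intro always_eventually allI) (simp add: norm_mult norm_power mult_left_mono u)
    have "filterlim (\<lambda>j::nat. j div 2) at_top sequentially"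
      unfolding filterlim_at_top eventually_sequentially
    proof
      fix Z :: nat
      show "\<exists>N. \<forall>n\<ge>N. Z \<le> n div 2"
        by (intro exI[of _ "2 * Z"]) auto
    qed
    then show "(\<lambda>j. cmod z ^ (j div 2) * B') \<longlonglongrightarrow> 0"
      using z by (intro tendsto_mult_left_zero filterlim_compose[OF LIMSEQ_realpow_zero]) auto
  qed
  \<comment> \<open>The summand \<open>1 / cmod z\<close> accounts for the source in
    \<open>x' 0 / z\<close>.\<close>
  define B' where "B' = B + 1 / cmod z"
  have B': "B \<le> B'" "cmod (z * x n) \<le> B'" "cmod (z * y n) \<le> B'" for n
  proof -
    show "B \<le> B'" by (simp add: B'_def)
    have "cmod z * cmod (x n) \<le> 1 * B" "cmod z * cmod (y n) \<le> 1 * B"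
      by (rule mult_mono; use z bdx[of n] bdy[of n] B in simp)+
    then show "cmod (z * x n) \<le> B'" "cmod (z * y n) \<le> B'"
      using \<open>B \<le> B'\<close> unfolding norm_mult by linarith+
  qed
  have "(\<lambda>j. z ^ (j div 2) * (if even j then y (int j) else x' (int j))) 0 =
    schur_lim (\<lambda>j. \<alpha> (0 + int j)) z * (\<lambda>j. z ^ (j div 2) * (if even j then x' (int j) / z else y (int j))) 0"
  proof (rule decaying_szego_solution)
    fix j
    show "rho (\<alpha> (0 + int j)) * (z ^ (Suc j div 2) * (if even (Suc j) then x' (int (Suc j)) / z else y (int (Suc j)))) =
       z * (z ^ (j div 2) * (if even j then x' (int j) / z else y (int j))) -
       cnj (\<alpha> (0 + int j)) * (z ^ (j div 2) * (if even j then y (int j) else x' (int j)))"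
    proof (cases "even j")
      case True
      then have "Suc j div 2 = j div 2" by simp
      then show ?thesis
        using True arg_cong[OF even_block(1)[of "int j"], of "times (z ^ (j div 2))"] arg_cong[OF even_block(1)[of "int j"], of "times (z ^ Suc (j div 2))"] z(1) by (simp add: algebra_simps)
    next
      case False
      then have "Suc j div 2 = Suc (j div 2)" by simp
      moreover have "x' (int j) = z * x (int j)" "x' (1 + int j) = z * x (1 + int j)"
        using False x'nz by (auto simp: odd_pos)
      ultimately show ?thesis
        using False arg_cong[OF odd_block(1)[of "int j"], of "times (z ^ (j div 2))"] arg_cong[OF odd_block(1)[of "int j"], of "times (z ^ Suc (j div 2))"] z(1) by (simp add: algebra_simps)
    qed
    show "rho (\<alpha> (0 + int j)) * (z ^ (Suc j div 2) * (if even (Suc j) then y (int (Suc j)) else x' (int (Suc j)))) =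
       z ^ (j div 2) * (if even j then y (int j) else x' (int j)) -
       \<alpha> (0 + int j) * z * (z ^ (j div 2) * (if even j then x' (int j) / z else y (int j)))"
    proof (cases "even j")
      case True
      then have "Suc j div 2 = j div 2" by simp
      then show ?thesis
        using True arg_cong[OF even_block(2)[of "int j"], of "times (z ^ (j div 2))"] arg_cong[OF even_block(2)[of "int j"], of "times (z ^ Suc (j div 2))"] z(1) by (simp add: algebra_simps)
    next
      case False
      then have "Suc j div 2 = Suc (j div 2)" by simp
      moreover have "x' (int j) = z * x (int j)"
        using False x'nz by (auto simp: odd_pos)
      ultimately show ?thesis
        using False arg_cong[OF odd_block(2)[of "int j"], of "times (z ^ (j div 2))"] arg_cong[OF odd_block(2)[of "int j"], of "times (z ^ Suc (j div 2))"] z(1) by (simp add: algebra_simps)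
    qed
  next
    have x'z: "cmod (x' n / z) \<le> B'" for n
    proof -
      have "x' n / z = x n + basis_vec 0 n / z" using z(1) by (simp add: x'_def field_simps)
      then have "cmod (x' n / z) \<le> cmod (x n) + cmod (basis_vec 0 n / z)"
        by (simp only: norm_triangle_ineq)
      moreover have "cmod (basis_vec 0 n / z) \<le> 1 / cmod z"
        by (simp add: basis_vec_def norm_divide)
      ultimately show ?thesis
        using bdx[of n] unfolding B'_def by linarith
    qed
    show "(\<lambda>j. z ^ (j div 2) * (if even j then x' (int j) / z else y (int j))) \<longlonglongrightarrow> 0"
      by (rule dec[of _ B']) (use x'z order_trans[OF bdy B'(1)] in auto)
    have "cmod (x' n) \<le> cmod (x' n / z)" for n
      using z by (simp add: norm_divide divide_simps mult_left_le)
    then show "(\<lambda>j. z ^ (j div 2) * (if even j then y (int j) else x' (int j))) \<longlonglongrightarrow> 0"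
      by (intro dec[of _ B']) (use x'z order_trans[OF bdy B'(1)] in \<open>auto intro: order_trans\<close>)
  qed (use \<alpha> z in auto)
  then have right: "y 0 = schur_plus \<alpha> z 0 * (x' 0 / z)"
    by (simp add: schur_plus_def)
  have "(\<lambda>j. z ^ (j div 2) * (z * (if even j then x (- int j) else y (- int j)))) 0 =
    schur_lim (\<lambda>j. - cnj (\<alpha> (0 - 1 - int j))) z * (\<lambda>j. z ^ (j div 2) * (if even j then y (- int j) else z * x (- int j))) 0"
  proof (rule decaying_szego_solution)
    fix j :: nat
    define n where "n = - 1 - int j"
    have n1: "- int j = n + 1" "- int (Suc j) = n" "0 - 1 - int j = n" by (auto simp: n_def)
    have par: "even n \<longleftrightarrow> odd j" by (simp add: n_def)
    show "rho (- cnj (\<alpha> (0 - 1 - int j))) * (z ^ (Suc j div 2) * (if even (Suc j) then y (- int (Suc j)) else z * x (- int (Suc j)))) =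
       z * (z ^ (j div 2) * (if even j then y (- int j) else z * x (- int j))) -
       cnj (- cnj (\<alpha> (0 - 1 - int j))) * (z ^ (j div 2) * (z * (if even j then x (- int j) else y (- int j))))"
      unfolding n1
    proof (cases "even j")
      case True
      then have "Suc j div 2 = j div 2" by simp
      then show "rho (- cnj (\<alpha> n)) * (z ^ (Suc j div 2) * (if even (Suc j) then y n else z * x n)) =
       z * (z ^ (j div 2) * (if even j then y (n + 1) else z * x (n + 1))) -
       cnj (- cnj (\<alpha> n)) * (z ^ (j div 2) * (z * (if even j then x (n + 1) else y (n + 1))))"
        using True arg_cong[OF odd_block(3)[of n], of "times (z ^ (j div 2))"] arg_cong[OF odd_block(3)[of n], of "times (z ^ Suc (j div 2))"] par by (simp add: algebra_simps)
    next
      case False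
      then have "Suc j div 2 = Suc (j div 2)" by simp
      moreover have "x' (n + 1) = z * x (n + 1)"
        using False x'nz by (auto simp: n_def odd_pos)
      ultimately show "rho (- cnj (\<alpha> n)) * (z ^ (Suc j div 2) * (if even (Suc j) then y n else z * x n)) =
       z * (z ^ (j div 2) * (if even j then y (n + 1) else z * x (n + 1))) -
       cnj (- cnj (\<alpha> n)) * (z ^ (j div 2) * (z * (if even j then x (n + 1) else y (n + 1))))"
        using False arg_cong[OF even_block(3)[of n], of "times (z ^ (j div 2))"] arg_cong[OF even_block(3)[of n], of "times (z ^ Suc (j div 2))"] par by (simp add: algebra_simps)
    qed
    show "rho (- cnj (\<alpha> (0 - 1 - int j))) * (z ^ (Suc j div 2) * (z * (if even (Suc j) then x (- int (Suc j)) else y (- int (Suc j))))) =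
       z ^ (j div 2) * (z * (if even j then x (- int j) else y (- int j))) -
       - cnj (\<alpha> (0 - 1 - int j)) * z * (z ^ (j div 2) * (if even j then y (- int j) else z * x (- int j)))"
      unfolding n1
    proof (cases "even j")
      case True
      then have "Suc j div 2 = j div 2" by simp
      then show "rho (- cnj (\<alpha> n)) * (z ^ (Suc j div 2) * (z * (if even (Suc j) then x n else y n))) =
       z ^ (j div 2) * (z * (if even j then x (n + 1) else y (n + 1))) -
       - cnj (\<alpha> n) * z * (z ^ (j div 2) * (if even j then y (n + 1) else z * x (n + 1)))"
        using True arg_cong[OF odd_block(4)[of n], of "times (z ^ (j div 2))"] arg_cong[OF odd_block(4)[of n], of "times (z ^ Suc (j div 2))"] par by (simp add: algebra_simps)
    next
      case False
      then have s: "Suc j div 2 = Suc (j div 2)" by simp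
      have e: "x' (n + 1) = z * x (n + 1)" "x' n = z * x n"
        using False x'nz by (auto simp: n_def odd_pos)
      have "rho (\<alpha> n) * (z * x n) = y (n + 1) + cnj (\<alpha> n) * (z * x (n + 1))"
        using False even_block(4)[of n] par unfolding e by simp
      from arg_cong[OF this, of "times (z ^ Suc (j div 2))"]
      show "rho (- cnj (\<alpha> n)) * (z ^ (Suc j div 2) * (z * (if even (Suc j) then x n else y n))) =
       z ^ (j div 2) * (z * (if even j then x (n + 1) else y (n + 1))) -
       - cnj (\<alpha> n) * z * (z ^ (j div 2) * (if even j then y (n + 1) else z * x (n + 1)))"
        using False s by (simp add: algebra_simps)
    qed
  next
    show "(\<lambda>j. z ^ (j div 2) * (if even j then y (- int j) else z * x (- int j))) \<longlonglongrightarrow> 0"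
      by (rule dec[of _ B']) (use B' order_trans[OF bdy B'(1)] in auto)
    show "(\<lambda>j. z ^ (j div 2) * (z * (if even j then x (- int j) else y (- int j)))) \<longlonglongrightarrow> 0"
      by (rule dec[of _ B']) (use B' in auto)
  qed (use \<alpha> z in auto)
  then have left: "z * x 0 = schur_back \<alpha> z 0 * y 0"
    by (simp add: schur_back_def)
  have "x 0 = schur_minus \<alpha> z 0 * y 0"
    using left schur_back_eq[OF \<alpha> z(2), where n = 0] z(1) by simp
  then have "z * x 0 = schur_prod \<alpha> z * x' 0"
    using right z(1) by (simp add: schur_prod_def)
  then have eq: "schur_prod \<alpha> z * (1 + z * x 0) = z * x 0"
    by (simp add: x'_def basis_vec_def add.commute)
  have "(1 + z * x 0) * (1 - schur_prod \<alpha> z) = 1 + z * x 0 - schur_prod \<alpha> z * (1 + z * x 0)"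
    by (simp add: algebra_simps)
  also have "\<dots> = 1" unfolding eq by simp
  finally have "(1 + z * x 0) * (1 - schur_prod \<alpha> z) = 1" .
  moreover have "1 - schur_prod \<alpha> z \<noteq> 0"
    using norm_schur_prod_less[of \<alpha>, OF \<alpha> z(2)] by auto
  ultimately show ?thesis using nonzero_eq_divide_eq by blast
qed

text \<open>The resolvent vector is built coordinatewise as a power series in \<open>z\<close> whose
  coefficients are negative powers of the operator applied to \<open>basis_vec 0\<close>. The
  integrand is expanded in the same powers, and both sides agree by \<open>spectral_moment\<close>.
  The point \<open>z = 0\<close> is separate because the half-line argument divides by
  \<open>z\<close>.\<close>

lemma spectral_measure_schur_prod:
  assumes \<alpha>: "\<And>n. cmod (\<alpha> n) < 1" and sp: "is_spectral_measure (ext_cmv \<alpha>) \<nu>" and z: "cmod z < 1"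
  shows "(\<integral>\<tau>. \<tau> / (\<tau> - z) \<partial>\<nu>) = 1 / (1 - schur_prod \<alpha> z)"
proof -
  interpret ell2_unitary "ext_cmv \<alpha>" by (rule ell2_unitary_ext_cmv[OF \<alpha>])
  interpret \<nu>: prob_space \<nu> using sp by (simp add: is_spectral_measure_def)
  have sets: "sets \<nu> = sets circle_borel" and space: "space \<nu> = sphere 0 1"
    using sp sets_eq_imp_space_eq[of \<nu> circle_borel] by (auto simp: is_spectral_measure_def)
  have meas: "g \<in> borel_measurable \<nu>" if "continuous_on (sphere 0 1) g" for g :: "complex \<Rightarrow> complex"
    using borel_measurable_circle_continuous[OF that] measurable_cong_sets[OF sets refl] by blast
  show ?thesis
  proof (cases "z = 0")
    case True
    have "schur_prod \<alpha> 0 = 0"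
      using norm_schur_plus_le[of \<alpha> 0 0] \<alpha> by (simp add: schur_prod_def)
    moreover have "(\<integral>\<tau>. \<tau> / (\<tau> - 0) \<partial>\<nu>) = (\<integral>\<tau>. 1 \<partial>\<nu>)"
      by (intro Bochner_Integration.integral_cong) (auto simp: space)
    ultimately show ?thesis using True by (simp add: \<nu>.prob_space)
  next
    case False
    define X where "X n = pw (- int n - 1) (basis_vec 0)" for n
    have d0: "basis_vec 0 \<in> ell2" by (rule basis_vec_ell2)
    have bd: "cmod (pw k (basis_vec 0) m) \<le> 1" for k m
      using norm_le_ell2_norm[OF pw_mem[OF d0, of k], of m] norm_pw[OF d0, of k] norm_basis_vec[of 0] by linarith
    have geo: "summable (\<lambda>n. cmod z ^ n)" using z by simp
    have sums: "(\<lambda>n. z ^ n * X n m) sums (\<Sum>n. z ^ n * X n m)" for m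
    proof (rule summable_sums, rule summable_comparison_test'[OF geo, of 0])
      show "norm (z ^ n * X n m) \<le> cmod z ^ n" for n
        using mult_left_mono[OF bd, of "cmod z ^ n"] by (simp add: norm_mult norm_power X_def)
    qed
    define x where "x m = (\<Sum>n. z ^ n * X n m)" for m
    define y where "y = cmv_block \<alpha> False x"
    have sy: "(\<lambda>n. z ^ n * cmv_block \<alpha> False (X n) m) sums y m" for m
      unfolding y_def x_def by (rule cmv_block_sums[OF sums])
    have "(\<lambda>n. z ^ n * cmv_block \<alpha> True (cmv_block \<alpha> False (X n)) m) sums cmv_block \<alpha> True y m" for m
      by (rule cmv_block_sums[OF sy])
    moreover have UX: "cmv_block \<alpha> True (cmv_block \<alpha> False (X n)) = pw (- int n) (basis_vec 0)" for n
      using U_pw[OF d0, of "- int n - 1"] by (simp add: X_def ext_cmv_eq_blocks)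
    ultimately have s1: "(\<lambda>n. z ^ n * pw (- int n) (basis_vec 0) m) sums cmv_block \<alpha> True y m" for m
      by simp
    have "(\<lambda>n. z ^ Suc n * pw (- int (Suc n)) (basis_vec 0) m) sums (z * x m)" for m
    proof -
      have "(\<lambda>n. z * (z ^ n * X n m)) sums (z * x m)"
        unfolding x_def by (intro sums_mult sums)
      moreover have "- int (Suc n) = - int n - 1" for n by simp
      ultimately show ?thesis by (simp only: X_def power_Suc mult.assoc)
    qed
    from sums_Suc[OF this] have s2: "(\<lambda>n. z ^ n * pw (- int n) (basis_vec 0) m) sums (z * x m + basis_vec 0 m)" for m
      by simp
    have Ly: "cmv_block \<alpha> True y m = z * x m + basis_vec 0 m" for m
      using sums_unique2[OF s1 s2] .
    define B where "B = 1 / (1 - cmod z)"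
    have sB: "(\<lambda>n. cmod z ^ n) sums B" unfolding B_def using z by (intro geometric_sums) simp
    have bdd: "cmod v \<le> B" if "(\<lambda>n. z ^ n * Y n) sums v" "\<And>n. cmod (Y n) \<le> 1" for v Y
    proof -
      have "cmod (z ^ n * Y n) \<le> cmod z ^ n" for n
        using mult_left_mono[OF that(2), of "cmod z ^ n"] by (simp add: norm_mult norm_power)
      then show ?thesis using norm_sums_le[OF that(1) sB] by simp
    qed
    have "cmod (x m) \<le> B" for m
      unfolding x_def by (rule bdd[OF sums]) (simp add: X_def bd)
    moreover have "cmod (y m) \<le> B" for m
    proof (rule bdd[OF sy])
      fix n
      have X: "X n \<in> ell2" unfolding X_def by (rule pw_mem[OF d0])
      have "cmod (cmv_block \<alpha> False (X n) m) \<le> ell2_norm (cmv_block \<alpha> False (X n))"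
        by (intro norm_le_ell2_norm cmv_block_norm_le \<alpha> X)
      also have "\<dots> \<le> ell2_norm (X n)" by (intro cmv_block_norm_le \<alpha> X)
      also have "\<dots> \<le> 1" unfolding X_def norm_pw[OF d0] by (rule norm_basis_vec)
      finally show "cmod (cmv_block \<alpha> False (X n) m) \<le> 1" .
    qed
    ultimately have main: "1 + z * x 0 = 1 / (1 - schur_prod \<alpha> z)"
      using resolvent_eq_schur_prod[OF \<alpha> False z y_def Ly] by blast
    have int: "integrable \<nu> (\<lambda>\<tau>. \<tau> powi k)" for k
    proof (rule \<nu>.integrable_const_bound[where B = 1])
      show "(\<lambda>\<tau>. \<tau> powi k) \<in> borel_measurable \<nu>"
        by (rule meas) (auto intro!: continuous_intros)
    qed (auto simp: space norm_power_int)
    have "(\<lambda>n. \<integral>\<tau>. z ^ n * \<tau> powi (- int n) \<partial>\<nu>) sums (\<integral>\<tau>. (\<Sum>n. z ^ n * \<tau> powi (- int n)) \<partial>\<nu>)"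
    proof (rule sums_integral)
      show "integrable \<nu> (\<lambda>\<tau>. z ^ n * \<tau> powi (- int n))" for n
        by (intro integrable_mult_right int)
      have nrm: "norm (z ^ n * \<tau> powi (- int n)) = cmod z ^ n" if "\<tau> \<in> space \<nu>" for \<tau> n
        using that by (auto simp: space norm_mult norm_power norm_power_int)
      show "AE \<tau> in \<nu>. summable (\<lambda>n. norm (z ^ n * \<tau> powi (- int n)))"
        by (rule AE_I2) (use geo nrm in simp)
      have "(\<integral>\<tau>. norm (z ^ n * \<tau> powi (- int n)) \<partial>\<nu>) = cmod z ^ n" for n
      proof -
        have "(\<integral>\<tau>. norm (z ^ n * \<tau> powi (- int n)) \<partial>\<nu>) = (\<integral>\<tau>. cmod z ^ n \<partial>\<nu>)"
          using nrm by (intro Bochner_Integration.integral_cong) auto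
        then show ?thesis by (simp add: \<nu>.prob_space)
      qed
      then show "summable (\<lambda>n. \<integral>\<tau>. norm (z ^ n * \<tau> powi (- int n)) \<partial>\<nu>)" using geo by simp
    qed
    moreover have "(\<integral>\<tau>. z ^ n * \<tau> powi (- int n) \<partial>\<nu>) = z ^ n * pw (- int n) (basis_vec 0) 0" for n
      using spectral_moment[OF sp, of "- int n"] by simp
    ultimately have "(\<lambda>n. z ^ n * pw (- int n) (basis_vec 0) 0) sums (\<integral>\<tau>. (\<Sum>n. z ^ n * \<tau> powi (- int n)) \<partial>\<nu>)"
      by (simp only:)
    from sums_unique2[OF this s2[of 0]]
    have "(\<integral>\<tau>. (\<Sum>n. z ^ n * \<tau> powi (- int n)) \<partial>\<nu>) = z * x 0 + 1"
      by (simp add: basis_vec_def)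
    moreover have "(\<integral>\<tau>. (\<Sum>n. z ^ n * \<tau> powi (- int n)) \<partial>\<nu>) = (\<integral>\<tau>. \<tau> / (\<tau> - z) \<partial>\<nu>)"
    proof (intro Bochner_Integration.integral_cong refl)
      fix \<tau> assume "\<tau> \<in> space \<nu>"
      then have t: "cmod \<tau> = 1" "\<tau> \<noteq> 0" by (auto simp: space)
      have "(\<lambda>n. (z / \<tau>) ^ n) sums (1 / (1 - z / \<tau>))"
        using z t by (intro geometric_sums) (simp add: norm_divide)
      moreover have "(z / \<tau>) ^ n = z ^ n * \<tau> powi (- int n)" for n
        by (simp add: power_divide power_int_minus field_simps)
      moreover have "1 / (1 - z / \<tau>) = \<tau> / (\<tau> - z)"
        using t z by (simp add: field_simps)
      ultimately show "(\<Sum>n. z ^ n * \<tau> powi (- int n)) = \<tau> / (\<tau> - z)"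
        by (simp add: sums_iff)
    qed
    ultimately show ?thesis using main by (simp add: add.commute)
  qed
qed

section \<open>Poisson integrals of measures\<close>

lemma cis_surj_circle:
  assumes "cmod \<xi> = 1"
  obtains a where "0 \<le> a" "a < 2 * pi" "\<xi> = cis a"
  using Arg2pi[of \<xi>] assms that[of "Arg2pi \<xi>"] by (auto simp: cis_conv_exp is_Arg_def)

lemma norm_cis_diff: "cmod (cis a - cis b) = 2 * \<bar>sin ((a - b) / 2)\<bar>"
proof -
  have "cis a - cis b = cis b * (cis (a - b) - 1)"
    by (simp add: right_diff_distrib cis_mult)
  then have "cmod (cis a - cis b) = cmod (exp (\<i> * of_real (a - b)) - 1)"
    by (simp add: norm_mult cis_conv_exp)
  then show ?thesis by (simp only: dist_exp_i_1)
qed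

lemma abs_sin_ge_half:
  assumes "\<bar>x\<bar> \<le> pi / 2"
  shows "\<bar>x\<bar> / 2 \<le> \<bar>sin x\<bar>"
proof -
  have "\<bar>sin x - (\<Sum>m<3. sin_coeff m * x ^ m)\<bar> \<le> inverse (fact 3) * \<bar>x\<bar> ^ 3"
    by (rule Maclaurin_sin_bound)
  then have "\<bar>sin x - x\<bar> \<le> \<bar>x\<bar> ^ 3 / 6"
    by (simp add: numeral_eq_Suc sin_coeff_def field_simps)
  then have "\<bar>x\<bar> - \<bar>x\<bar> ^ 3 / 6 \<le> \<bar>sin x\<bar>" by linarith
  moreover have "\<bar>x\<bar> ^ 3 \<le> 3 * \<bar>x\<bar>"
  proof -
    have "\<bar>x\<bar> \<le> 1.6" using assms pi_less_4 pi_approx by (auto simp: pi_approx)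
    then have "\<bar>x\<bar> * \<bar>x\<bar> \<le> 1.6 * 1.6" by (intro mult_mono) auto
    then have "(\<bar>x\<bar> * \<bar>x\<bar>) * \<bar>x\<bar> \<le> 3 * \<bar>x\<bar>" by (intro mult_right_mono) auto
    then show ?thesis by (simp add: power3_eq_cube)
  qed
  ultimately show ?thesis by linarith
qed

lemma circle_ball_sets: "ball \<xi> h \<inter> sphere 0 1 \<in> sets circle_borel"
  by (auto simp: sets_circle_borel_iff)

lemma arc_ball_lower:
  assumes "cmod \<xi> = 1" "0 < h" "h \<le> 1"
  shows "ennreal h \<le> emeasure arc_length (ball \<xi> h \<inter> sphere 0 1)"
proof -
  obtain a where a: "0 \<le> a" "a < 2 * pi" "\<xi> = cis a" using cis_surj_circle[OF assms(1)] .
  \<comment> \<open>An arc on one side of \<xi> suffices; the side is chosen so that the parameter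
    interval stays within \<open>{0..<2 * pi}\<close>.\<close>
  define I where "I = (if a < pi then {a..<a + h} else {a - h<..a})"
  have hp: "h < pi" using assms pi_gt3 by linarith
  have "emeasure lborel I = ennreal h" unfolding I_def using assms by simp
  moreover have "I \<subseteq> cis -` (ball \<xi> h \<inter> sphere 0 1) \<inter> {0..<2 * pi}"
  proof
    fix t assume t: "t \<in> I"
    then have "\<bar>a - t\<bar> < h" by (auto simp: I_def split: if_splits)
    moreover have "cmod (cis a - cis t) \<le> \<bar>a - t\<bar>"
      using abs_sin_x_le_abs_x[of "(a - t) / 2"] unfolding norm_cis_diff by (simp add: abs_divide)
    moreover have "0 \<le> t" "t < 2 * pi" using t a hp by (auto simp: I_def split: if_splits)
    ultimately show "t \<in> cis -` (ball \<xi> h \<inter> sphere 0 1) \<inter> {0..<2 * pi}"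
      using a by (auto simp: dist_norm)
  qed
  moreover have "cis -` (ball \<xi> h \<inter> sphere 0 1) \<inter> {0..<2 * pi} \<in> sets lborel"
    unfolding sets_lborel
    by (intro sets.Int measurable_sets_borel[of cis borel] borel_measurable_continuous_onI continuous_intros) auto
  ultimately show ?thesis
    unfolding emeasure_arc_length[OF circle_ball_sets] by (metis emeasure_mono)
qed

lemma arc_ball_upper:
  assumes "cmod \<xi> = 1" "0 < h"
  shows "emeasure arc_length (ball \<xi> h \<inter> sphere 0 1) \<le> ennreal (12 * h)"
proof -
  obtain a where a: "0 \<le> a" "a < 2 * pi" "\<xi> = cis a" using cis_surj_circle[OF assms(1)] .
  \<comment> \<open>Parameters of nearby points may differ from \<open>a\<close> by a full turn.
    Three intervals of length \<open>4 * h\<close> cover all cases, whence the constant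
    \<open>12\<close>.\<close>
  define J where "J c = {c - 2 * h..c + 2 * h}" for c :: real
  have close: "\<bar>d\<bar> \<le> 2 * h" if "cmod (cis a - cis t) < h" "\<bar>d\<bar> \<le> pi" "d = a - t + 2 * pi * of_int m" for d t m
  proof -
    have "cis (t - 2 * pi * of_int m) = cis t"
      using cis_multiple_2pi[of "of_int m"] by (simp add: cis_divide[symmetric])
    then have "2 * \<bar>sin (d / 2)\<bar> < h"
      using that(1) norm_cis_diff[of a "t - 2 * pi * of_int m"] unfolding that(3)
      by (simp add: algebra_simps)
    moreover have "\<bar>d / 2\<bar> / 2 \<le> \<bar>sin (d / 2)\<bar>" using that by (intro abs_sin_ge_half) auto
    ultimately show ?thesis by linarith
  qed
  have "cis -` (ball \<xi> h \<inter> sphere 0 1) \<inter> {0..<2 * pi} \<subseteq> J a \<union> (J (a - 2 * pi) \<union> J (a + 2 * pi))"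
  proof
    fix t assume "t \<in> cis -` (ball \<xi> h \<inter> sphere 0 1) \<inter> {0..<2 * pi}"
    then have t: "cmod (cis a - cis t) < h" "0 \<le> t" "t < 2 * pi" using a by (auto simp: dist_norm)
    consider "\<bar>a - t\<bar> \<le> pi" | "a - t > pi" | "a - t < - pi" by linarith
    then show "t \<in> J a \<union> (J (a - 2 * pi) \<union> J (a + 2 * pi))"
    proof cases
      case 1
      have "\<bar>a - t\<bar> \<le> 2 * h" by (rule close[OF t(1) 1, where m = 0]) simp
      then have "t \<in> J a" unfolding J_def by simp linarith
      then show ?thesis by blast
    next
      case 2
      then have "\<bar>a - t - 2 * pi\<bar> \<le> pi" using t(2) a(2) by linarith
      then have "\<bar>a - t - 2 * pi\<bar> \<le> 2 * h" by (rule close[OF t(1), where m = "-1"]) simp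
      then have "t \<in> J (a - 2 * pi)" unfolding J_def by simp linarith
      then show ?thesis by blast
    next
      case 3
      then have "\<bar>a - t + 2 * pi\<bar> \<le> pi" using t(3) a(1) by linarith
      then have "\<bar>a - t + 2 * pi\<bar> \<le> 2 * h" by (rule close[OF t(1), where m = 1]) simp
      then have "t \<in> J (a + 2 * pi)" unfolding J_def by simp linarith
      then show ?thesis by blast
    qed
  qed
  then have "emeasure arc_length (ball \<xi> h \<inter> sphere 0 1) \<le> emeasure lborel (J a \<union> (J (a - 2 * pi) \<union> J (a + 2 * pi)))"
    unfolding emeasure_arc_length[OF circle_ball_sets] by (intro emeasure_mono) (auto simp: J_def)
  also have "\<dots> \<le> emeasure lborel (J a) + (emeasure lborel (J (a - 2 * pi)) + emeasure lborel (J (a + 2 * pi)))"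
    by (intro order_trans[OF emeasure_subadditive] add_left_mono) (auto simp: J_def)
  also have "\<dots> = ennreal (12 * h)"
    using assms by (simp add: J_def ennreal_plus[symmetric] del: ennreal_plus)
  finally show ?thesis .
qed

section \<open>Bounds for the Poisson kernel and a maximal inequality\<close>

lemma poisson_nonneg: "cmod z \<le> 1 \<Longrightarrow> 0 \<le> poisson z \<zeta>"
  by (simp add: poisson_def power_le_one)

lemma poisson_far:
  assumes "cmod \<zeta> = 1" "cmod \<tau> = 1" "0 \<le> r" "r < 1" "0 < d" "d \<le> cmod (\<tau> - \<zeta>)"
  shows "poisson (of_real r * \<zeta>) \<tau> \<le> 8 * (1 - r) / d\<^sup>2"
proof -
  have "1 - r \<le> cmod (\<tau> - of_real r * \<zeta>)"
    using norm_triangle_ineq2[of \<tau> "of_real r * \<zeta>"] assms by (simp add: norm_mult)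
  moreover have "cmod (\<tau> - \<zeta>) \<le> cmod (\<tau> - of_real r * \<zeta>) + (1 - r)"
  proof -
    have "\<tau> - \<zeta> = (\<tau> - of_real r * \<zeta>) - of_real (1 - r) * \<zeta>" by (simp add: algebra_simps)
    then have "cmod (\<tau> - \<zeta>) \<le> cmod (\<tau> - of_real r * \<zeta>) + cmod (of_real (1 - r) * \<zeta>)"
      by (simp only: norm_triangle_ineq4)
    then show ?thesis using assms by (simp add: norm_mult del: of_real_diff)
  qed
  \<comment> \<open>The larger of \<open>1 - r\<close> and \<open>d - (1 - r)\<close> is at least
    \<open>d / 2\<close>, so no relation between \<open>d\<close> and \<open>1 - r\<close> is
    needed.\<close>
  ultimately have "d / 2 \<le> cmod (\<tau> - of_real r * \<zeta>)" using assms by linarith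
  then have "(d / 2)\<^sup>2 \<le> (cmod (\<tau> - of_real r * \<zeta>))\<^sup>2" using assms by (intro power_mono) auto
  moreover have "1 - (cmod (of_real r * \<zeta>))\<^sup>2 \<le> 2 * (1 - r)"
  proof -
    have "0 \<le> (1 - r)\<^sup>2" by simp
    then show ?thesis using assms by (simp add: norm_mult power2_eq_square algebra_simps)
  qed
  ultimately have "poisson (of_real r * \<zeta>) \<tau> \<le> 2 * (1 - r) / (d / 2)\<^sup>2"
    unfolding poisson_def using assms by (intro frac_le) auto
  then show ?thesis by (simp add: power_divide)
qed

lemma poisson_le:
  assumes "cmod \<zeta> = 1" "cmod \<tau> = 1" "0 \<le> r" "r < 1"
  shows "poisson (of_real r * \<zeta>) \<tau> \<le> 2 / (1 - r)"
proof -
  have "1 - r \<le> cmod (\<tau> - of_real r * \<zeta>)"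
    using norm_triangle_ineq2[of \<tau> "of_real r * \<zeta>"] assms by (simp add: norm_mult)
  then have "(1 - r)\<^sup>2 \<le> (cmod (\<tau> - of_real r * \<zeta>))\<^sup>2" using assms by (intro power_mono) auto
  moreover have "1 - (cmod (of_real r * \<zeta>))\<^sup>2 \<le> 2 * (1 - r)"
  proof -
    have "0 \<le> (1 - r)\<^sup>2" by simp
    then show ?thesis using assms by (simp add: norm_mult power2_eq_square algebra_simps)
  qed
  ultimately have "poisson (of_real r * \<zeta>) \<tau> \<le> 2 * (1 - r) / (1 - r)\<^sup>2"
    unfolding poisson_def using assms by (intro frac_le) auto
  also have "\<dots> = 2 / (1 - r)"
  proof -
    have *: "2 * x / x\<^sup>2 = 2 / x" if "x > 0" for x :: real using that by (simp add: power2_eq_square)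
    have "0 < 1 - r" using assms by simp
    from *[OF this] show ?thesis .
  qed
  finally show ?thesis .
qed

lemma poisson_symmetric:
  assumes "cmod \<zeta> = 1" "cmod \<tau> = 1"
  shows "poisson (of_real r * \<zeta>) \<tau> = poisson (of_real r * \<tau>) \<zeta>"
proof -
  have "cmod (u - of_real r * v) = cmod (v - of_real r * u)" if "cmod u = 1" "cmod v = 1" for u v
  proof -
    have uv: "u * cnj u = 1" "v * cnj v = 1"
      using that complex_norm_square[of u] complex_norm_square[of v] by auto
    have "u - of_real r * v = u * v * cnj (v - of_real r * u)"
      using uv by (simp add: algebra_simps)
    then have "cmod (u - of_real r * v) = cmod (u * v) * cmod (cnj (v - of_real r * u))"
      by (simp only: norm_mult)
    then show ?thesis using that by (simp add: norm_mult del: complex_cnj_diff)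
  qed
  from this[OF assms(2,1)] show ?thesis using assms by (simp add: poisson_def norm_mult)
qed

lemma poisson_continuous:
  assumes "cmod z < 1"
  shows "continuous_on (sphere 0 1) (poisson z)"
  unfolding poisson_def using assms by (intro continuous_intros) auto

text \<open>The weak-type maximal inequality, obtained from Vitali's covering lemma, bounds the mass
  of arcs centred at almost every point by a multiple of their radius. Summing the kernel over
  dyadic annuli converts this into a bound along the whole radius.\<close>

lemma AE_poisson_bounded:
  assumes k: "finite_measure k" "sets k = sets circle_borel"
  shows "AE \<zeta> in arc_length. \<exists>N. \<forall>r. 0 \<le> r \<and> r < 1 \<longrightarrow> (\<integral>\<^sup>+\<tau>. ennreal (poisson (of_real r * \<zeta>) \<tau>) \<partial>k) \<le> ennreal N"
proof -
  interpret k: finite_measure k by fact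
  have spk: "space k = sphere 0 1" using sets_eq_imp_space_eq[OF k(2)] by simp
  define K where "K = measure k (space k)"
  define Bl where "Bl \<zeta> h = ball \<zeta> h \<inter> sphere 0 1" for \<zeta> :: complex and h
  have Blk [measurable]: "Bl \<zeta> h \<in> sets k" "Bl \<zeta> h \<in> sets arc_length" for \<zeta> h
    unfolding Bl_def using circle_ball_sets k(2) by auto
  \<comment> \<open>The set of centres of heavy arcs is only enclosed in a small measurable set
    \<open>W\<close>, so its own measurability never matters. The constant is
    \<open>60 = 5 * 12\<close>, from Vitali's dilation by \<open>5\<close> and
    \<open>arc_ball_upper\<close>.\<close>
  have cover: "\<exists>W\<in>sets arc_length. {\<zeta>. cmod \<zeta> = 1 \<and> (\<exists>h>0. real N * h < measure k (Bl \<zeta> h))} \<subseteq> W \<and>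
      emeasure arc_length W \<le> ennreal (60 * K / real N)" if N: "N > 0" for N :: nat
  proof -
    define S where "S = {\<zeta>. cmod \<zeta> = 1 \<and> (\<exists>h>0. real N * h < measure k (Bl \<zeta> h))}"
    define h where "h \<zeta> = (SOME h. 0 < h \<and> real N * h < measure k (Bl \<zeta> h))" for \<zeta>
    have h: "0 < h \<zeta>" "real N * h \<zeta> < measure k (Bl \<zeta> (h \<zeta>))" if "\<zeta> \<in> S" for \<zeta>
      using that someI_ex[of "\<lambda>h. 0 < h \<and> real N * h < measure k (Bl \<zeta> h)"] by (auto simp: S_def h_def)
    have hb: "h \<zeta> \<le> K / real N" if "\<zeta> \<in> S" for \<zeta>
    proof -
      have "real N * h \<zeta> \<le> K"
        using h(2)[OF that] k.bounded_measure[of "Bl \<zeta> (h \<zeta>)"] by (simp add: K_def)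
      then show ?thesis using N by (simp add: field_simps)
    qed
    obtain C where C: "countable C" "C \<subseteq> S"
      "pairwise (\<lambda>i j. disjnt (ball i (h i)) (ball j (h j))) C" "S \<subseteq> (\<Union>i\<in>C. ball i (5 * h i))"
      by (rule Vitali_covering_lemma_balls[where S = S and K = S and a = "\<lambda>i. i" and r = h and B = "K / real N"]) (use h hb in auto)
    define E where "E = to_nat_on C ` C"
    define p where "p = from_nat_into C"
    have pC: "p n \<in> C" "to_nat_on C (p n) = n" if "n \<in> E" for n
      using that C(1) by (auto simp: E_def p_def)
    define X where "X c n = (if n \<in> E then Bl (p n) (c * h (p n)) else {})" for c n
    have X [measurable]: "X c n \<in> sets k" "X c n \<in> sets arc_length" for c n 
      by (auto simp: X_def k(2) Bl_def circle_ball_sets)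
    have disj: "disjoint_family (X 1)"
      unfolding disjoint_family_on_def
    proof (intro ballI impI)
      fix m n :: nat assume "m \<noteq> n"
      show "X 1 m \<inter> X 1 n = {}"
      proof (cases "m \<in> E \<and> n \<in> E")
        case True
        then have "p m \<noteq> p n" using pC \<open>m \<noteq> n\<close> by metis
        then have "disjnt (ball (p m) (h (p m))) (ball (p n) (h (p n)))"
          using C(3) pC True by (auto simp: pairwise_def)
        then show ?thesis by (auto simp: X_def Bl_def disjnt_def)
      qed (auto simp: X_def)
    qed
    have "S \<subseteq> (\<Union>n. X 5 n)"
    proof
      fix \<zeta> assume \<zeta>: "\<zeta> \<in> S"
      then obtain i where i: "i \<in> C" "\<zeta> \<in> ball i (5 * h i)" using C(4) by auto
      then have "p (to_nat_on C i) = i" "to_nat_on C i \<in> E" using C(1) by (auto simp: p_def E_def)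
      then have "\<zeta> \<in> X 5 (to_nat_on C i)" using i \<zeta> by (auto simp: X_def Bl_def S_def)
      then show "\<zeta> \<in> (\<Union>n. X 5 n)" by blast
    qed
    moreover have "emeasure arc_length (\<Union>n. X 5 n) \<le> ennreal (60 * K / real N)"
    proof -
      have le: "emeasure arc_length (X 5 n) \<le> ennreal (60 / real N) * emeasure k (X 1 n)" for n
      proof (cases "n \<in> E")
        case True
        then have pS: "p n \<in> S" using pC C(2) by auto
        have "emeasure arc_length (X 5 n) = emeasure arc_length (ball (p n) (5 * h (p n)) \<inter> sphere 0 1)"
          using True by (simp add: X_def Bl_def)
        also have "\<dots> \<le> ennreal (12 * (5 * h (p n)))"
          by (rule arc_ball_upper) (use pS h(1)[OF pS] in \<open>simp_all add: S_def\<close>)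
        also have "\<dots> \<le> ennreal (60 / real N * measure k (X 1 n))"
          using h(2)[OF pS] N True by (intro ennreal_leI) (simp add: X_def field_simps)
        also have "\<dots> = ennreal (60 / real N) * emeasure k (X 1 n)"
          unfolding k.emeasure_eq_measure by (rule ennreal_mult) auto
        finally show ?thesis .
      qed (simp add: X_def)
      have "emeasure arc_length (\<Union>n. X 5 n) \<le> (\<Sum>n. emeasure arc_length (X 5 n))"
        by (rule emeasure_subadditive_countably) (use X(2) in blast)
      also have "\<dots> \<le> (\<Sum>n. ennreal (60 / real N) * emeasure k (X 1 n))"
        by (intro suminf_le le) auto
      also have "\<dots> = ennreal (60 / real N) * emeasure k (\<Union>n. X 1 n)"
        by (simp add: suminf_emeasure disj image_subset_iff)
      also have "\<dots> \<le> ennreal (60 / real N) * emeasure k (space k)"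
        by (intro mult_left_mono emeasure_space) auto
      also have "\<dots> = ennreal (60 * K / real N)"
        by (simp add: ennreal_mult[symmetric] k.emeasure_eq_measure K_def)
      finally show ?thesis .
    qed
    moreover have "(\<Union>n. X 5 n) \<in> sets arc_length"
      using X(2) by (intro sets.countable_UN) blast
    ultimately show ?thesis unfolding S_def by blast
  qed
  then have "\<forall>N::nat. \<exists>W. 0 < N \<longrightarrow> W \<in> sets arc_length \<and>
      {\<zeta>. cmod \<zeta> = 1 \<and> (\<exists>h>0. real N * h < measure k (Bl \<zeta> h))} \<subseteq> W \<and>
      emeasure arc_length W \<le> ennreal (60 * K / real N)"
    by blast
  from choice[OF this] obtain W where W: "\<And>N::nat. N > 0 \<Longrightarrow> W N \<in> sets arc_length"
    "\<And>N::nat. N > 0 \<Longrightarrow> {\<zeta>. cmod \<zeta> = 1 \<and> (\<exists>h>0. real N * h < measure k (Bl \<zeta> h))} \<subseteq> W N"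
    "\<And>N::nat. N > 0 \<Longrightarrow> emeasure arc_length (W N) \<le> ennreal (60 * K / real N)"
    by blast
  define Z where "Z = (\<Inter>N. W (Suc N))"
  have Zs: "Z \<in> sets arc_length" unfolding Z_def using W(1) by auto
  have "emeasure arc_length Z = 0"
  proof -
    have "(\<lambda>N. ennreal (60 * K / real (Suc N))) \<longlonglongrightarrow> ennreal 0"
      by (intro tendsto_ennrealI LIMSEQ_Suc[OF lim_const_over_n])
    moreover have "emeasure arc_length Z \<le> ennreal (60 * K / real (Suc N))" for N
    proof -
      have "emeasure arc_length Z \<le> emeasure arc_length (W (Suc N))"
        using W(1) by (intro emeasure_mono) (auto simp: Z_def)
      also note W(3)[of "Suc N"]
      finally show ?thesis by simp
    qed
    ultimately have "emeasure arc_length Z \<le> ennreal 0"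
      by (intro LIMSEQ_le_const) auto
    then show ?thesis by simp
  qed
  then have "AE \<zeta> in arc_length. \<zeta> \<notin> Z"
    using Zs by (intro AE_not_in) (auto simp: null_sets_def)
  with AE_space show ?thesis
  proof (eventually_elim)
    case (elim \<zeta>)
      have \<zeta>: "cmod \<zeta> = 1" using elim(1) by simp
      from elim(2) obtain N where "\<zeta> \<notin> W (Suc N)" by (auto simp: Z_def)
      define c where "c = real (Suc N)"
      have c: "measure k (Bl \<zeta> h) \<le> c * h" if "h > 0" for h
      proof -
        have "\<not> c * h < measure k (Bl \<zeta> h)"
          using W(2)[of "Suc N"] \<open>\<zeta> \<notin> W (Suc N)\<close> \<zeta> that unfolding c_def by blast
        then show ?thesis by simp
      qed
      show ?case
      proof (intro exI[of _ "64 * c"] allI impI)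
        fix r :: real assume "0 \<le> r \<and> r < 1"
        then have r: "0 \<le> r" "r < 1" by auto
        define s where "s = 1 - r"
        have s: "s > 0" using r by (simp add: s_def)
        \<comment> \<open>On the annulus from \<open>2 ^ (j - 1) * s\<close> to
          \<open>2 ^ j * s\<close>, \<open>poisson_far\<close> gives
          \<open>8 / (4 ^ (j - 1) * s)\<close>, which is \<open>32 / (4 ^ j * s)\<close>. The arc
          has mass at most \<open>c * 2 ^ j * s\<close>, and the resulting geometric series sums to
          \<open>64 * c\<close>.\<close>
        have pt: "ennreal (poisson (of_real r * \<zeta>) \<tau>) \<le> (\<Sum>j. ennreal (32 / (4 ^ j * s)) * indicator (Bl \<zeta> (2 ^ j * s)) \<tau>)"
          if \<tau>: "cmod \<tau> = 1" for \<tau>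
        proof -
          have ex: "\<exists>j. cmod (\<tau> - \<zeta>) < 2 ^ j * s"
            using real_arch_pow[of 2 "cmod (\<tau> - \<zeta>) / s"] s by (auto simp: field_simps)
          define j where "j = (LEAST j. cmod (\<tau> - \<zeta>) < 2 ^ j * s)"
          have j: "cmod (\<tau> - \<zeta>) < 2 ^ j * s" unfolding j_def using ex by (rule LeastI_ex)
          have "poisson (of_real r * \<zeta>) \<tau> \<le> 32 / (4 ^ j * s)"
          proof (cases j)
            case 0
            have "poisson (of_real r * \<zeta>) \<tau> \<le> 2 / s" unfolding s_def by (intro poisson_le \<zeta> \<tau> r)
            also have "\<dots> \<le> 32 / s" using s by (simp add: divide_right_mono)
            finally show ?thesis using 0 by simp
          next
            case (Suc i)
            have "2 ^ i * s \<le> cmod (\<tau> - \<zeta>)"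
              using not_less_Least[of i "\<lambda>j. cmod (\<tau> - \<zeta>) < 2 ^ j * s"] Suc by (simp add: j_def)
            then have "poisson (of_real r * \<zeta>) \<tau> \<le> 8 * (1 - r) / (2 ^ i * s)\<^sup>2"
              using s by (intro poisson_far \<zeta> \<tau> r) auto
            also have "\<dots> = 8 / (4 ^ i * s)"
              using s by (simp add: s_def[symmetric] power2_eq_square power_mult_distrib[symmetric] field_simps)
            also have "\<dots> = 32 / (4 ^ j * s)" using Suc by simp
            finally show ?thesis .
          qed
          then have "ennreal (poisson (of_real r * \<zeta>) \<tau>) \<le> ennreal (32 / (4 ^ j * s)) * indicator (Bl \<zeta> (2 ^ j * s)) \<tau>"
            using j \<tau> by (auto simp: Bl_def dist_norm norm_minus_commute intro!: ennreal_leI)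
          also have "\<dots> \<le> (\<Sum>j. ennreal (32 / (4 ^ j * s)) * indicator (Bl \<zeta> (2 ^ j * s)) \<tau>)"
            using sum_le_suminf[of "\<lambda>j. ennreal (32 / (4 ^ j * s)) * indicator (Bl \<zeta> (2 ^ j * s)) \<tau>" "{j}"]
            by (simp only: summableI finite.intros sum.insert finite.emptyI sum.empty add_0_right zero_le empty_iff not_False_eq_True)
          finally show ?thesis .
        qed
        have "(\<integral>\<^sup>+\<tau>. ennreal (poisson (of_real r * \<zeta>) \<tau>) \<partial>k) \<le>
           (\<integral>\<^sup>+\<tau>. (\<Sum>j. ennreal (32 / (4 ^ j * s)) * indicator (Bl \<zeta> (2 ^ j * s)) \<tau>) \<partial>k)"
          by (rule nn_integral_mono) (use pt spk in auto)
        also have "\<dots> = (\<Sum>j. ennreal (32 / (4 ^ j * s)) * emeasure k (Bl \<zeta> (2 ^ j * s)))"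
          by (simp add: nn_integral_suminf nn_integral_cmult_indicator)
        also have "\<dots> \<le> (\<Sum>j. ennreal (32 * c * (1 / 2) ^ j))"
        proof (intro suminf_le)
          fix j
          have "ennreal (32 / (4 ^ j * s)) * emeasure k (Bl \<zeta> (2 ^ j * s)) = ennreal (32 / (4 ^ j * s) * measure k (Bl \<zeta> (2 ^ j * s)))"
            unfolding k.emeasure_eq_measure by (rule ennreal_mult[symmetric]) (use s in auto)
          also have "\<dots> \<le> ennreal (32 / (4 ^ j * s) * (c * (2 ^ j * s)))"
            using s by (intro ennreal_leI mult_left_mono c) auto
          also have "32 / (4 ^ j * s) * (c * (2 ^ j * s)) = 32 * c * (1 / 2) ^ j"
          proof -
            have "(4::real) ^ j = 2 ^ j * 2 ^ j" by (simp add: power_mult_distrib[symmetric])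
            then show ?thesis using s by (simp add: field_simps power_divide)
          qed
          finally show "ennreal (32 / (4 ^ j * s)) * emeasure k (Bl \<zeta> (2 ^ j * s)) \<le> ennreal (32 * c * (1 / 2) ^ j)" .
        qed auto
        also have "\<dots> = ennreal (\<Sum>j. 32 * c * (1 / 2) ^ j)"
          by (intro suminf_ennreal2 summable_mult summable_geometric) (auto simp: c_def)
        also have "(\<Sum>j. 32 * c * (1 / 2) ^ j) = 64 * c"
          by (subst suminf_mult) (auto simp: suminf_geometric intro!: summable_geometric)
        finally show "(\<integral>\<^sup>+\<tau>. ennreal (poisson (of_real r * \<zeta>) \<tau>) \<partial>k) \<le> ennreal (64 * c)" .
      qed
  qed
qed

text \<open>By inner regularity, the part of \<open>G\<close> where \<open>v < u\<close> would
  contain a compact set of positive length if it were not null. Closed test sets are what the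
  comparisons of measures provide, since there one passes to the limit along shrinking
  neighbourhoods.\<close>

lemma AE_le_of_closed_integrals:
  assumes [measurable]: "u \<in> borel_measurable circle_borel" "v \<in> borel_measurable circle_borel" "G \<in> sets circle_borel"
    and fin: "(\<integral>\<^sup>+\<zeta>. u \<zeta> \<partial>arc_length) < \<infinity>"
    and le: "\<And>A. closed A \<Longrightarrow> A \<subseteq> G \<Longrightarrow> (\<integral>\<^sup>+\<zeta>\<in>A. u \<zeta> \<partial>arc_length) \<le> (\<integral>\<^sup>+\<zeta>\<in>A. v \<zeta> \<partial>arc_length)"
  shows "AE \<zeta> in arc_length. \<zeta> \<in> G \<longrightarrow> u \<zeta> \<le> v \<zeta>"
proof (rule ccontr)
  assume neg: "\<not> ?thesis"
  define D where "D = {\<zeta> \<in> space circle_borel. \<zeta> \<in> G \<and> v \<zeta> < u \<zeta>}"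
  have D [measurable]: "D \<in> sets circle_borel" unfolding D_def by measurable
  have GS: "G \<subseteq> sphere 0 1" using assms(3) by (simp add: sets_circle_borel_iff)
  have "emeasure arc_length D \<noteq> 0"
  proof
    assume "emeasure arc_length D = 0"
    then have "AE \<zeta> in arc_length. \<zeta> \<notin> D" using D by (intro AE_not_in) (auto simp: null_sets_def)
    then have "AE \<zeta> in arc_length. \<zeta> \<in> G \<longrightarrow> u \<zeta> \<le> v \<zeta>"
      by eventually_elim (use GS in \<open>auto simp: D_def not_less\<close>)
    with neg show False by simp
  qed
  \<comment> \<open>Arc length as a Borel measure on the plane, the setting of inner
    regularity.\<close>
  define m where "m = distr arc_length borel (\<lambda>x. x)"
  have meas: "(\<lambda>x. x) \<in> measurable arc_length borel"
    unfolding measurable_cong_sets[OF sets_arc_length refl] circle_borel_def by (rule measurable_restrict_space1) simp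
  have m: "emeasure m A = emeasure arc_length A" if "A \<in> sets borel" "A \<subseteq> sphere 0 1" for A
    unfolding m_def using that meas by (subst emeasure_distr) (auto intro!: arg_cong[where f = "emeasure arc_length"])
  have Db: "D \<in> sets borel" "D \<subseteq> sphere 0 1" using D by (auto simp: sets_circle_borel_iff)
  have "emeasure m D = (SUP K\<in>{K. K \<subseteq> D \<and> compact K}. emeasure m K)"
  proof (rule inner_regular)
    show "emeasure m (space m) \<noteq> \<infinity>"
      unfolding m_def using meas by (subst emeasure_distr) (auto simp: emeasure_arc_length_space)
  qed (use Db in \<open>auto simp: m_def\<close>)
  moreover have "emeasure m D > 0"
    using \<open>emeasure arc_length D \<noteq> 0\<close> m[OF Db] by (simp add: zero_less_iff_neq_zero)
  ultimately obtain K where K: "K \<subseteq> D" "compact K" "0 < emeasure m K"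
    by (auto simp: less_SUP_iff)
  have Kb: "K \<in> sets borel" "K \<subseteq> sphere 0 1" using K Db by (auto intro: borel_compact)
  then have Ks [measurable]: "K \<in> sets circle_borel" by (simp add: sets_circle_borel_iff)
  have "(\<integral>\<^sup>+\<zeta>\<in>K. v \<zeta> \<partial>arc_length) < (\<integral>\<^sup>+\<zeta>\<in>K. u \<zeta> \<partial>arc_length)"
  proof (rule nn_integral_less)
    have "(\<integral>\<^sup>+\<zeta>\<in>K. v \<zeta> \<partial>arc_length) \<le> (\<integral>\<^sup>+\<zeta>. u \<zeta> \<partial>arc_length)"
      using K(1) by (intro nn_integral_mono) (auto simp: D_def indicator_def less_imp_le)
    then show "(\<integral>\<^sup>+\<zeta>\<in>K. v \<zeta> \<partial>arc_length) \<noteq> \<infinity>" using fin by auto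
    show "AE \<zeta> in arc_length. v \<zeta> * indicator K \<zeta> \<le> u \<zeta> * indicator K \<zeta>"
      using K(1) by (intro AE_I2) (auto simp: D_def indicator_def less_imp_le)
    show "\<not> (AE \<zeta> in arc_length. u \<zeta> * indicator K \<zeta> \<le> v \<zeta> * indicator K \<zeta>)"
    proof
      assume "AE \<zeta> in arc_length. u \<zeta> * indicator K \<zeta> \<le> v \<zeta> * indicator K \<zeta>"
      then have "AE \<zeta> in arc_length. \<zeta> \<notin> K"
        by eventually_elim (use K(1) in \<open>auto simp: D_def indicator_def split: if_splits\<close>)
      then have "emeasure arc_length K = 0"
        using AE_iff_measurable[of K arc_length "\<lambda>\<zeta>. \<zeta> \<notin> K"] Ks Kb(2)
        by (auto simp: subset_iff Collect_conj_eq)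
      then show False using K(3) m[OF Kb] by simp
    qed
  qed measurable
  moreover have "(\<integral>\<^sup>+\<zeta>\<in>K. u \<zeta> \<partial>arc_length) \<le> (\<integral>\<^sup>+\<zeta>\<in>K. v \<zeta> \<partial>arc_length)"
    using K by (intro le compact_imp_closed) (auto simp: D_def)
  ultimately show False by simp
qed

section \<open>The Szego cocycle\<close>

text \<open>\<open>lyapunov_exponent\<close> is defined through \<open>lim\<close>, whose value
  carries information only if the sequence converges. Subadditivity supplies convergence, so a
  vanishing exponent is a genuine limit.\<close>

lemma fekete_convergent:
  fixes u :: "nat \<Rightarrow> real"
  assumes nn: "\<And>n. 0 \<le> u n" and sub: "\<And>m n. u (m + n) \<le> u m + u n"
  shows "convergent (\<lambda>n. 1 / real n * u n)"
proof -
  define L where "L = (INF n\<in>{1..}. u n / real n)"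
  have bdd: "bdd_below ((\<lambda>n. u n / real n) ` {1..})"
    by (rule bdd_belowI[of _ 0]) (auto simp: nn)
  have lower: "L \<le> u n / real n" if "n \<ge> 1" for n
    unfolding L_def using that by (intro cINF_lower bdd) auto
  have mult: "u (q * m) \<le> real q * u m" if "q \<ge> 1" for q m
    using that
  proof (induction q rule: nat_induct_at_least)
    case (Suc q)
    have "u (Suc q * m) \<le> u m + u (q * m)" using sub[of m "q * m"] by simp
    also have "\<dots> \<le> u m + real q * u m" using Suc.IH by simp
    finally show ?case by (simp add: algebra_simps)
  qed simp
  have "(\<lambda>n. 1 / real n * u n) \<longlonglongrightarrow> L"
  proof (rule LIMSEQ_I)
    fix e :: real assume e: "0 < e"
    obtain m where m: "m \<ge> 1" "u m / real m < L + e / 2"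
      using cINF_less_iff[OF _ bdd, of "L + e / 2"] e unfolding L_def by auto
    define B where "B = (\<Sum>i<m. u i) + u m"
    have B: "u r \<le> B" if "r < m" for r
      using member_le_sum[of r "{..<m}" u] that nn by (simp add: B_def add_increasing2)
    obtain n0 :: nat where n0: "2 * B / e < real n0" using reals_Archimedean2 by blast
    show "\<exists>no. \<forall>n\<ge>no. norm (1 / real n * u n - L) < e"
    proof (intro exI[of _ "max (max n0 m) 1"] allI impI)
      fix n assume n: "max (max n0 m) 1 \<le> n"
      define q where "q = n div m"
      define r where "r = n mod m"
      have nq: "n = q * m + r" by (simp add: q_def r_def)
      have q1: "q \<ge> 1" using n m by (simp add: q_def div_greater_zero_iff Suc_le_eq)
      have "u n \<le> u (q * m) + u r" unfolding nq by (rule sub)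
      also have "\<dots> \<le> real q * u m + B"
        using mult[OF q1] B[of r] m by (intro add_mono) (auto simp: r_def)
      finally have un: "u n \<le> real q * u m + B" .
      have "real q * u m = real (q * m) * (u m / real m)" using m by simp
      also have "\<dots> \<le> real n * (u m / real m)"
        using nq nn[of m] by (intro mult_right_mono) auto
      also have "\<dots> \<le> real n * (L + e / 2)" using m by (intro mult_left_mono) auto
      finally have "u n \<le> real n * (L + e / 2) + B" using un by linarith
      moreover have "B < real n * (e / 2)"
      proof -
        have "2 * B / e < real n" using n0 n by linarith
        then show ?thesis using e by (simp add: field_simps)
      qed
      ultimately have "u n < real n * (L + e)" by (simp add: algebra_simps)
      then have "u n / real n < L + e" using n by (simp add: field_simps)
      then show "norm (1 / real n * u n - L) < e"
        using lower[of n] n by simp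
    qed
  qed
  then show ?thesis by (rule convergentI)
qed

text \<open>Cutting the interval into \<open>n\<close> equal pieces divides the total quadratic
  error by \<open>n\<close>. A difference inequality thus acts as a bound on a derivative, with
  \<open>K\<close> of any size.\<close>

lemma quadratic_error_telescope:
  fixes g :: "real \<Rightarrow> real"
  assumes "a \<le> b" and "\<And>x y. a \<le> x \<Longrightarrow> x < y \<Longrightarrow> y \<le> b \<Longrightarrow> g x - g y \<le> c * (y - x) + K * (y - x)\<^sup>2"
  shows "g a - g b \<le> c * (b - a)"
proof (cases "a = b")
  case False
  then have ab: "a < b" using assms by simp
  have bound: "g a - g b \<le> c * (b - a) + K * (b - a)\<^sup>2 * inverse (real (Suc n))" for n
  proof -
    define N where "N = Suc n"
    define d where "d = (b - a) / real N"
    have d: "d > 0" using ab by (simp add: d_def N_def)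
    have Nd: "real N * d = b - a" by (simp add: d_def N_def)
    define x where "x i = a + real i * d" for i
    have "g (x i) - g (x (Suc i)) \<le> c * d + K * d\<^sup>2" if "i < N" for i
    proof -
      have "real (Suc i) * d \<le> real N * d" using that d by (intro mult_right_mono) auto
      then have "x (Suc i) \<le> b" unfolding x_def Nd by simp
      then have "g (x i) - g (x (Suc i)) \<le> c * (x (Suc i) - x i) + K * (x (Suc i) - x i)\<^sup>2"
        using d by (intro assms(2)) (auto simp: x_def)
      then show ?thesis by (simp add: x_def algebra_simps)
    qed
    then have "(\<Sum>i<N. g (x i) - g (x (Suc i))) \<le> (\<Sum>i<N. c * d + K * d\<^sup>2)"
      by (intro sum_mono) auto
    moreover have "(\<Sum>i<N. g (x i) - g (x (Suc i))) = g (x 0) - g (x N)"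
      by (rule sum_lessThan_telescope')
    moreover have "x 0 = a" "x N = b" using Nd by (auto simp: x_def)
    moreover have "(\<Sum>i<N. c * d + K * d\<^sup>2) = c * (b - a) + K * (b - a)\<^sup>2 * inverse (real N)"
    proof -
      have "(\<Sum>i<N. c * d + K * d\<^sup>2) = c * (real N * d) + K * ((real N * d) * d)"
        by (simp add: algebra_simps power2_eq_square)
      then show ?thesis unfolding Nd by (simp add: d_def power2_eq_square divide_inverse mult_ac)
    qed
    ultimately show ?thesis by (simp add: N_def)
  qed
  have "(\<lambda>n. c * (b - a) + K * (b - a)\<^sup>2 * inverse (real (Suc n))) \<longlonglongrightarrow> c * (b - a) + K * (b - a)\<^sup>2 * 0"
    by (intro tendsto_intros LIMSEQ_inverse_real_of_nat)
  then show ?thesis using LIMSEQ_le_const[of _ _ "g a - g b"] bound by fastforce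
qed simp

section \<open>Norms and determinants of the transfer matrices\<close>

lemma norm_complex_vec2: "norm (v :: complex^2) = sqrt ((cmod (v $ 1))\<^sup>2 + (cmod (v $ 2))\<^sup>2)"
  by (simp add: norm_vec_def L2_set_def UNIV_2)

lemma matvec2: "((A :: complex^2^2) *v v) $ i = A $ i $ 1 * v $ 1 + A $ i $ 2 * v $ 2"
  by (simp add: matrix_vector_mult_def UNIV_2)

lemma bounded_linear_matvec: "bounded_linear (\<lambda>v. (A :: complex^2^2) *v v)"
  by (rule linear_conv_bounded_linear[THEN iffD1]) (auto intro!: linearI simp: vec_eq_iff matvec2 algebra_simps)

text \<open>In singular values: \<open>|det A| = \<sigma>\<^sub>1 \<sigma>\<^sub>2\<close>, \<open>\<sigma>\<^sub>1 = \<parallel>A\<parallel>\<close> and \<open>\<sigma>\<^sub>2 \<parallel>v\<parallel> \<le> \<parallel>A v\<parallel>\<close>.\<close>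

lemma det_times_norm_le_onorm:
  fixes A :: "complex^2^2"
  shows "cmod (det A) * norm v \<le> onorm (\<lambda>v. A *v v) * norm (A *v v)"
proof (cases "v = 0")
  case False
  \<comment> \<open>\<open>w\<close> is orthogonal to \<open>v\<close> and of the same length, so
    together they span area \<open>|v|^2\<close>, which \<open>A\<close> multiplies by its
    determinant.\<close>
  define w :: "complex^2" where "w = vector [- cnj (v $ 2), cnj (v $ 1)]"
  have w: "w $ 1 = - cnj (v $ 2)" "w $ 2 = cnj (v $ 1)" by (simp_all add: w_def)
  have nw: "norm w = norm v" by (simp add: norm_complex_vec2 w add.commute)
  have wedge: "cmod (x $ 1 * y $ 2 - x $ 2 * y $ 1) \<le> norm x * norm y" for x y :: "complex^2"
  proof -
    have "cmod (x $ 1 * y $ 2 - x $ 2 * y $ 1) \<le> cmod (x $ 1) * cmod (y $ 2) + cmod (x $ 2) * cmod (y $ 1)"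
      by (metis norm_mult norm_triangle_ineq4)
    also have "\<dots> \<le> norm x * norm y"
    proof (rule power2_le_imp_le)
      have "0 \<le> (cmod (x $ 1) * cmod (y $ 1) - cmod (x $ 2) * cmod (y $ 2))\<^sup>2" by simp
      then show "(cmod (x $ 1) * cmod (y $ 2) + cmod (x $ 2) * cmod (y $ 1))\<^sup>2 \<le> (norm x * norm y)\<^sup>2"
        unfolding norm_complex_vec2 power_mult_distrib by (simp add: power2_eq_square algebra_simps)
    qed simp
    finally show ?thesis .
  qed
  have vw: "v $ 1 * w $ 2 - v $ 2 * w $ 1 = of_real ((norm v)\<^sup>2)"
  proof -
    have "(norm v)\<^sup>2 = (cmod (v $ 1))\<^sup>2 + (cmod (v $ 2))\<^sup>2" by (simp add: norm_complex_vec2)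
    then show ?thesis unfolding w by (simp only: of_real_add complex_norm_square) simp
  qed
  have "(A *v v) $ 1 * (A *v w) $ 2 - (A *v v) $ 2 * (A *v w) $ 1 = det A * (v $ 1 * w $ 2 - v $ 2 * w $ 1)"
    by (simp add: matvec2 det_2 algebra_simps)
  then have "cmod (det A) * (norm v)\<^sup>2 = cmod ((A *v v) $ 1 * (A *v w) $ 2 - (A *v v) $ 2 * (A *v w) $ 1)"
    unfolding vw by (simp add: norm_mult norm_power)
  also have "\<dots> \<le> norm (A *v v) * norm (A *v w)" by (rule wedge)
  also have "\<dots> \<le> norm (A *v v) * (onorm (\<lambda>v. A *v v) * norm v)"
    using onorm[OF bounded_linear_matvec, of A w] by (intro mult_left_mono) (auto simp: nw)
  finally have "(cmod (det A) * norm v) * norm v \<le> (onorm (\<lambda>v. A *v v) * norm (A *v v)) * norm v"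
    by (simp add: power2_eq_square mult_ac)
  then show ?thesis using False by simp
qed simp

lemma det_le_onorm_squared: "cmod (det (A :: complex^2^2)) \<le> (onorm (\<lambda>v. A *v v))\<^sup>2"
proof -
  define v :: "complex^2" where "v = vector [1, 0]"
  have nv: "norm v = 1" by (simp add: norm_complex_vec2 v_def)
  have "cmod (det A) \<le> onorm (\<lambda>v. A *v v) * norm (A *v v)"
    using det_times_norm_le_onorm[of A v] nv by simp
  also have "\<dots> \<le> onorm (\<lambda>v. A *v v) * onorm (\<lambda>v. A *v v)"
    using onorm[OF bounded_linear_matvec, of A v] nv
    by (intro mult_left_mono onorm_pos_le[OF bounded_linear_matvec]) simp
  finally show ?thesis by (simp add: power2_eq_square)
qed

lemma onorm_matmul_le:
  fixes A B :: "complex^2^2"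
  shows "onorm (\<lambda>v. (A ** B) *v v) \<le> onorm (\<lambda>v. A *v v) * onorm (\<lambda>v. B *v v)"
  using onorm_compose[OF bounded_linear_matvec bounded_linear_matvec, of A B]
  by (simp add: o_def matrix_vector_mul_assoc)

lemma continuous_onorm_matrix: "continuous_on UNIV (\<lambda>A :: complex^2^2. onorm (\<lambda>v. A *v v))"
proof -
  have eq: "onorm (\<lambda>v. A *v v) = norm (Blinfun (\<lambda>v. A *v v))" for A :: "complex^2^2"
    by (simp add: norm_blinfun.rep_eq bounded_linear_Blinfun_apply bounded_linear_matvec)
  have "linear (\<lambda>A :: complex^2^2. Blinfun (\<lambda>v. A *v v))"
  proof (intro linearI blinfun_eqI)
    fix A B :: "complex^2^2" and c :: real and i :: "complex^2"
    show "blinfun_apply (Blinfun (\<lambda>v. (A + B) *v v)) i =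
        blinfun_apply (Blinfun (\<lambda>v. A *v v) + Blinfun (\<lambda>v. B *v v)) i"
      by (simp only: bounded_linear_Blinfun_apply bounded_linear_matvec blinfun.add_left)
         (simp add: vec_eq_iff matvec2 algebra_simps)
    show "blinfun_apply (Blinfun (\<lambda>v. (c *\<^sub>R A) *v v)) i = blinfun_apply (c *\<^sub>R Blinfun (\<lambda>v. A *v v)) i"
      by (simp only: bounded_linear_Blinfun_apply bounded_linear_matvec blinfun.scaleR_left)
         (simp add: vec_eq_iff matvec2 algebra_simps)
  qed
  then show ?thesis unfolding eq by (intro continuous_on_norm linear_continuous_on linear_conv_bounded_linear[THEN iffD1])
qed

lemma szego_matrix_entries:
  "szego_matrix z a $ 1 $ 1 = z / rho a" "szego_matrix z a $ 1 $ 2 = - cnj a / rho a"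
  "szego_matrix z a $ 2 $ 1 = - a * z / rho a" "szego_matrix z a $ 2 $ 2 = 1 / rho a"
  unfolding szego_matrix_def vector_scaleR_component by (simp_all add: scaleR_conv_of_real)

lemma det_szego_matrix: "cmod a < 1 \<Longrightarrow> det (szego_matrix z a) = z"
proof -
  assume a: "cmod a < 1"
  have "det (szego_matrix z a) = z * (1 - a * cnj a) / (complex_of_real (rho a) * complex_of_real (rho a))"
    by (simp add: det_2 szego_matrix_entries diff_divide_distrib right_diff_distrib mult_ac)
  then show ?thesis using rho_pos[OF a] by (simp add: rho_squared_complex[OF a, symmetric])
qed

lemma det_szego_cocycle: "(\<And>n. cmod (\<alpha> n) < 1) \<Longrightarrow> det (szego_cocycle \<alpha> z n) = z ^ n"
  by (induction n) (simp_all add: det_mul det_szego_matrix)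

lemma szego_cocycle_add:
  "szego_cocycle \<alpha> z (m + n) = szego_cocycle (\<lambda>j. \<alpha> (j + int m)) z n ** szego_cocycle \<alpha> z m"
  by (induction n) (simp_all add: matrix_mul_assoc add.commute)

lemma onorm_szego_matrix_le:
  assumes a: "cmod a < 1" and z: "cmod z \<le> 1"
  shows "onorm (\<lambda>v. szego_matrix z a *v v) \<le> 2 / rho a"
proof (rule onorm_le)
  fix v :: "complex^2"
  have r: "rho a > 0" by (rule rho_pos[OF a])
  define B where "B = (cmod (v $ 1) + cmod (v $ 2)) / rho a"
  have c: "cmod ((szego_matrix z a *v v) $ i) \<le> B" for i
  proof -
    have p: "cmod (u * x + t * y) \<le> cmod x + cmod y" if "cmod u \<le> 1" "cmod t \<le> 1" for u t x y
    proof -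
      have "cmod (u * x + t * y) \<le> cmod u * cmod x + cmod t * cmod y"
        by (metis norm_mult norm_triangle_ineq)
      also have "\<dots> \<le> 1 * cmod x + 1 * cmod y" using that by (intro add_mono mult_right_mono) auto
      finally show ?thesis by simp
    qed
    have az: "cmod (- a * z) \<le> 1" using a z mult_mono[of "cmod a" 1 "cmod z" 1] by (simp add: norm_mult)
    have "(szego_matrix z a *v v) $ 1 = (z * v $ 1 + (- cnj a) * v $ 2) / rho a"
      "(szego_matrix z a *v v) $ 2 = ((- a * z) * v $ 1 + 1 * v $ 2) / rho a"
      by (simp_all add: matvec2 szego_matrix_entries diff_divide_distrib)
    then have "cmod ((szego_matrix z a *v v) $ 1) \<le> B" "cmod ((szego_matrix z a *v v) $ 2) \<le> B"
      using p[of z "- cnj a" "v $ 1" "v $ 2"] p[of "- a * z" 1 "v $ 1" "v $ 2"] a z az r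
      unfolding B_def by (simp_all add: norm_divide divide_right_mono)
    then show ?thesis using exhaust_2[of i] by auto
  qed
  have B0: "0 \<le> B" using r by (simp add: B_def)
  have "norm (szego_matrix z a *v v) \<le> sqrt (B\<^sup>2 + B\<^sup>2)"
    unfolding norm_complex_vec2 using c by (intro real_sqrt_le_mono add_mono power_mono) auto
  also have "\<dots> \<le> 2 / rho a * norm v"
  proof (rule real_le_lsqrt)
    have "0 \<le> (cmod (v $ 1) - cmod (v $ 2))\<^sup>2" by simp
    then have "(cmod (v $ 1) + cmod (v $ 2))\<^sup>2 \<le> 2 * (norm v)\<^sup>2"
      by (simp add: norm_complex_vec2 power2_eq_square algebra_simps)
    then have "2 * (cmod (v $ 1) + cmod (v $ 2))\<^sup>2 / (rho a)\<^sup>2 \<le> 4 * (norm v)\<^sup>2 / (rho a)\<^sup>2"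
      by (intro divide_right_mono) auto
    then show "B\<^sup>2 + B\<^sup>2 \<le> (2 / rho a * norm v)\<^sup>2"
      by (simp add: B_def power_divide power_mult_distrib)
  qed (use r in simp)
  finally show "norm (szego_matrix z a *v v) \<le> 2 / rho a * norm v" .
qed

text \<open>The factor by which one Szego matrix scales the direction
  \<open>(1, schur_plus)\<close>, see \<open>szego_matrix_schur_plus\<close>. That direction is the
  one the cocycle contracts, so the logarithm of the factor encodes the exponent inside the
  disc.\<close>

definition szego_multiplier :: "(int \<Rightarrow> complex) \<Rightarrow> complex \<Rightarrow> int \<Rightarrow> complex" where
  "szego_multiplier \<alpha> z n = z * complex_of_real (rho (\<alpha> n)) / (1 + cnj (\<alpha> n) * schur_plus \<alpha> z (n + 1))"

context
  fixes \<alpha> :: "int \<Rightarrow> complex" and z :: complex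
  assumes \<alpha>: "\<And>n. cmod (\<alpha> n) < 1" and z: "cmod z < 1"
begin

lemma norm_schur_plus_le1: "cmod (schur_plus \<alpha> z n) \<le> 1"
  using norm_schur_plus_le[of \<alpha> z n, OF \<alpha> z] z by linarith

lemma plus_denom_nonzero: "1 + cnj (\<alpha> n) * schur_plus \<alpha> z m \<noteq> 0"
  by (rule moebius_denom_nonzero[OF \<alpha> norm_schur_plus_le1])

lemma szego_matrix_schur_plus:
  "szego_matrix z (\<alpha> n) *v vector [1, schur_plus \<alpha> z n] =
   szego_multiplier \<alpha> z n *s vector [1, schur_plus \<alpha> z (n + 1)]"
proof -
  define s where "s = schur_plus \<alpha> z (n + 1)"
  define r where "r = complex_of_real (rho (\<alpha> n))"
  have r: "r \<noteq> 0" "r * r = 1 - \<alpha> n * cnj (\<alpha> n)"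
    using rho_pos[OF \<alpha>, of n] rho_squared_complex[OF \<alpha>, of n] by (auto simp: r_def)
  have d: "1 + cnj (\<alpha> n) * s \<noteq> 0" unfolding s_def by (rule plus_denom_nonzero)
  have s0: "schur_plus \<alpha> z n = z * (\<alpha> n + s) / (1 + cnj (\<alpha> n) * s)"
    unfolding schur_plus_step[of \<alpha> z n, OF \<alpha> z] schur_step_def s_def ..
  have e1: "z - cnj (\<alpha> n) * schur_plus \<alpha> z n = z * (r * r) / (1 + cnj (\<alpha> n) * s)"
    unfolding s0 r(2) using d by (simp add: field_simps)
  have e2: "schur_plus \<alpha> z n - \<alpha> n * z = z * (r * r) * s / (1 + cnj (\<alpha> n) * s)"
    unfolding s0 r(2) using d by (simp add: field_simps)
  have m: "szego_multiplier \<alpha> z n = z * r / (1 + cnj (\<alpha> n) * s)"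
    by (simp add: szego_multiplier_def r_def s_def)
  have "(szego_matrix z (\<alpha> n) *v vector [1, schur_plus \<alpha> z n]) $ 1 = (z - cnj (\<alpha> n) * schur_plus \<alpha> z n) / r"
    "(szego_matrix z (\<alpha> n) *v vector [1, schur_plus \<alpha> z n]) $ 2 = (schur_plus \<alpha> z n - \<alpha> n * z) / r"
    by (simp_all add: matvec2 szego_matrix_entries r_def[symmetric] diff_divide_distrib)
  then show ?thesis
    unfolding vec_eq_iff forall_2 e1 e2 using r(1) by (simp add: m s_def[symmetric])
qed

lemma szego_cocycle_schur_plus:
  "szego_cocycle \<alpha> z n *v vector [1, schur_plus \<alpha> z 0] =
   (\<Prod>j<n. szego_multiplier \<alpha> z (int j)) *s vector [1, schur_plus \<alpha> z (int n)]"
proof (induction n)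
  case (Suc n)
  have "szego_cocycle \<alpha> z (Suc n) *v vector [1, schur_plus \<alpha> z 0] =
    szego_matrix z (\<alpha> (int n)) *v (szego_cocycle \<alpha> z n *v vector [1, schur_plus \<alpha> z 0])"
    by (simp add: matrix_vector_mul_assoc)
  also have "\<dots> = (\<Prod>j<n. szego_multiplier \<alpha> z (int j)) *s (szego_matrix z (\<alpha> (int n)) *v vector [1, schur_plus \<alpha> z (int n)])"
    unfolding Suc by (simp add: vec_eq_iff matvec2 algebra_simps)
  also have "\<dots> = (\<Prod>j<Suc n. szego_multiplier \<alpha> z (int j)) *s vector [1, schur_plus \<alpha> z (int (Suc n))]"
    unfolding szego_matrix_schur_plus by (simp add: vec_eq_iff add.commute)
  finally show ?case .
qed simp

text \<open>A Szego matrix sends \<open>(a, b)\<close> to a pair whose form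
  \<open>|a|^2 - |b|^2\<close> equals \<open>|z a|^2 - |b|^2\<close> of the original. Evaluated on
  the contracted direction, this relation is what Kotani's inequality takes the logarithm
  of.\<close>

lemma szego_multiplier_norm_identity:
  "(cmod (szego_multiplier \<alpha> z n))\<^sup>2 * (1 - (cmod (schur_plus \<alpha> z (n + 1)))\<^sup>2) = (cmod z)\<^sup>2 - (cmod (schur_plus \<alpha> z n))\<^sup>2"
proof -
  define s where "s = schur_plus \<alpha> z (n + 1)"
  define q where "q = (cmod ((\<alpha> n + s) / (1 + cnj (\<alpha> n) * s)))\<^sup>2"
  have "schur_plus \<alpha> z n = z * ((\<alpha> n + s) / (1 + cnj (\<alpha> n) * s))"
    unfolding schur_plus_step[of \<alpha> z n, OF \<alpha> z] schur_step_def s_def by simp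
  then have s0: "(cmod (schur_plus \<alpha> z n))\<^sup>2 = (cmod z)\<^sup>2 * q"
    by (simp only: norm_mult power_mult_distrib q_def)
  have q: "1 - q = (rho (\<alpha> n))\<^sup>2 * (1 - (cmod s)\<^sup>2) / (cmod (1 + cnj (\<alpha> n) * s))\<^sup>2"
    unfolding q_def rho_squared[OF \<alpha>] by (rule moebius_one_minus_norm[OF \<alpha>]) (unfold s_def, rule norm_schur_plus_le1)
  have "(cmod (szego_multiplier \<alpha> z n))\<^sup>2 * (1 - (cmod s)\<^sup>2) = (cmod z)\<^sup>2 * (1 - q)"
    unfolding q by (simp add: szego_multiplier_def s_def[symmetric] norm_mult norm_divide power_mult_distrib power_divide)
  then show ?thesis unfolding s0 s_def[symmetric] by (simp add: algebra_simps)
qed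

lemma szego_multiplier_bounds:
  shows "cmod (szego_multiplier \<alpha> z n) \<le> 1 / (1 - cmod z)"
    and "cmod z * rho (\<alpha> n) / 2 \<le> cmod (szego_multiplier \<alpha> z n)"
proof -
  define s where "s = schur_plus \<alpha> z (n + 1)"
  have s: "cmod (cnj (\<alpha> n) * s) \<le> cmod z"
    using mult_mono[of "cmod (\<alpha> n)" 1 "cmod s" "cmod z"] \<alpha>[of n] norm_schur_plus_le[of \<alpha> z "n + 1", OF \<alpha> z]
    by (simp add: norm_mult s_def)
  have r: "0 < rho (\<alpha> n)" "rho (\<alpha> n) \<le> 1" using rho_pos[OF \<alpha>, of n] by (auto simp: rho_def)
  have lo: "1 - cmod z \<le> cmod (1 + cnj (\<alpha> n) * s)"
    using s norm_triangle_ineq2[of 1 "- (cnj (\<alpha> n) * s)"] by simp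
  have hi: "cmod (1 + cnj (\<alpha> n) * s) \<le> 2"
    using s z norm_triangle_ineq[of 1 "cnj (\<alpha> n) * s"] by simp
  have m: "cmod (szego_multiplier \<alpha> z n) = cmod z * rho (\<alpha> n) / cmod (1 + cnj (\<alpha> n) * s)"
    using r by (simp add: szego_multiplier_def s_def norm_mult norm_divide)
  have zr: "cmod z * rho (\<alpha> n) \<le> 1" using mult_mono[of "cmod z" 1 "rho (\<alpha> n)" 1] z r by simp
  show "cmod (szego_multiplier \<alpha> z n) \<le> 1 / (1 - cmod z)"
    unfolding m using lo z zr r by (intro frac_le) auto
  show "cmod z * rho (\<alpha> n) / 2 \<le> cmod (szego_multiplier \<alpha> z n)"
    unfolding m using lo hi z r by (intro divide_left_mono mult_pos_pos) (auto intro: mult_nonneg_nonneg)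
qed

end

text \<open>Discrete form of the derivative of the Lyapunov exponent: wedging the decaying solution at \<open>z'\<close>
  with the growing one at \<open>z\<close> leaves a coboundary and the diagonal Green function.\<close>

lemma szego_wronskian_identity:
  fixes n :: int
  assumes \<alpha>: "\<And>n. cmod (\<alpha> n) < 1" and z: "cmod z < 1" "cmod z' < 1"
  defines "\<mu> \<equiv> (1 - \<alpha> n * schur_back \<alpha> z n) / complex_of_real (rho (\<alpha> n))"
  shows "szego_multiplier \<alpha> z' n * \<mu> * (1 - schur_plus \<alpha> z' (n + 1) * schur_minus \<alpha> z (n + 1)) =
    z * (1 - schur_plus \<alpha> z' n * schur_minus \<alpha> z n) + (z' - z)" and "\<mu> \<noteq> 0"
proof -
  \<comment> \<open>\<open>\<mu>\<close> is the multiplier at \<open>z\<close> of the growing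
    direction \<open>(schur_minus, 1)\<close>, and \<open>1 - s * t\<close> is the determinant of
    the directions \<open>(1, s)\<close> and \<open>(t, 1)\<close>. For \<open>z' = z\<close> the
    identity says that a Szego matrix has determinant \<open>z\<close>; the extra
    \<open>z' - z\<close> comes from using different spectral parameters for the two
    directions.\<close>
  define s where "s = schur_plus \<alpha> z' (n + 1)"
  define r where "r = complex_of_real (rho (\<alpha> n))"
  define p where "p = schur_back \<alpha> z n"
  define a where "a = \<alpha> n"
  have r: "r \<noteq> 0" "r * r = 1 - a * cnj a"
    using rho_pos[OF \<alpha>, of n] rho_squared_complex[OF \<alpha>, of n] by (auto simp: r_def a_def)
  have d: "1 + cnj a * s \<noteq> 0" unfolding s_def a_def by (rule plus_denom_nonzero[of \<alpha>, OF \<alpha> z(2)])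
  have "cmod p \<le> 1" using norm_schur_back_le[of \<alpha> z n, OF \<alpha> z(1)] z by (simp add: p_def)
  then have pd: "1 - a * p \<noteq> 0"
    using moebius_denom_nonzero[of "- cnj a" p] \<alpha>[of n] by (simp add: a_def)
  then show "\<mu> \<noteq> 0" unfolding \<mu>_def using r(1) by (simp add: p_def r_def a_def)
  have t1: "schur_minus \<alpha> z (n + 1) = (p - cnj a) / (1 - a * p)"
    by (simp add: schur_minus_def p_def a_def)
  have zt: "z * schur_minus \<alpha> z n = p" using schur_back_eq[of \<alpha> z n, OF \<alpha> z(1)] by (simp add: p_def)
  have s0: "schur_plus \<alpha> z' n = z' * (a + s) / (1 + cnj a * s)"
    unfolding schur_plus_step[of \<alpha> z' n, OF \<alpha> z(2)] schur_step_def s_def a_def ..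
  have "szego_multiplier \<alpha> z' n * \<mu> * (1 - s * schur_minus \<alpha> z (n + 1)) =
     (z' * r / (1 + cnj a * s)) * ((1 - a * p) / r) * ((1 - a * p - s * (p - cnj a)) / (1 - a * p))"
  proof -
    have "szego_multiplier \<alpha> z' n = z' * r / (1 + cnj a * s)"
      by (simp only: szego_multiplier_def s_def r_def a_def)
    moreover have "\<mu> = (1 - a * p) / r" by (simp only: \<mu>_def r_def a_def p_def)
    moreover have "1 - s * schur_minus \<alpha> z (n + 1) = (1 - a * p - s * (p - cnj a)) / (1 - a * p)"
      unfolding t1 using pd by (simp add: diff_divide_distrib[of "1 - a * p"])
    ultimately show ?thesis by (simp only:)
  qed
  also have "\<dots> = z' * (1 - a * p - s * (p - cnj a)) / (1 + cnj a * s)"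
    using r(1) pd by simp
  also have "\<dots> = z' - z' * (a + s) / (1 + cnj a * s) * p"
    using d by (simp add: field_simps)
  also have "\<dots> = z' - schur_plus \<alpha> z' n * (z * schur_minus \<alpha> z n)"
    unfolding zt s0 ..
  also have "\<dots> = z * (1 - schur_plus \<alpha> z' n * schur_minus \<alpha> z n) + (z' - z)"
    by (simp add: algebra_simps)
  finally show "szego_multiplier \<alpha> z' n * \<mu> * (1 - schur_plus \<alpha> z' (n + 1) * schur_minus \<alpha> z (n + 1)) =
    z * (1 - schur_plus \<alpha> z' n * schur_minus \<alpha> z n) + (z' - z)"
    by (simp only: s_def)
qed

text \<open>With \<open>B = (r^2 - q) / (r * (1 - q))\<close> the right side is
  \<open>- ln B\<close>, which is at least \<open>1 - B\<close>. For \<open>q\<close> the squared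
  modulus of \<open>schur_plus\<close>, the last logarithm is supplied by the multiplier
  identity.\<close>

lemma ln_kotani_bound:
  fixes r q :: real
  assumes "0 < r" "r < 1" "0 \<le> q" "q < r\<^sup>2"
  shows "(1 - r) / (1 - q) \<le> ln r + ln (1 - q) - ln (r\<^sup>2 - q)"
proof -
  have q1: "q < 1" using assms power_less_one_iff[of r 2] by (simp add: less_trans)
  define B where "B = (r\<^sup>2 - q) / (r * (1 - q))"
  have B: "B > 0" unfolding B_def using assms q1 by simp
  have "1 - B = (1 - r) * (r + q) / (r * (1 - q))"
    unfolding B_def using assms q1 by (simp add: field_simps power2_eq_square)
  moreover have "(1 - r) / (1 - q) \<le> (1 - r) * (r + q) / (r * (1 - q))"
  proof -
    have "(1 - r) / (1 - q) = (1 - r) * r / (r * (1 - q))" using assms by simp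
    also have "\<dots> \<le> (1 - r) * (r + q) / (r * (1 - q))"
      using assms q1 by (intro divide_right_mono mult_left_mono) auto
    finally show ?thesis .
  qed
  ultimately have "(1 - r) / (1 - q) \<le> 1 - B" by simp
  also have "\<dots> \<le> - ln B" using ln_le_minus_one[OF B] by simp
  also have "\<dots> = ln r + ln (1 - q) - ln (r\<^sup>2 - q)"
    unfolding B_def using assms q1 by (simp add: ln_div ln_mult)
  finally show ?thesis .
qed

text \<open>Applying \<open>ln x \<le> x - 1\<close> to the squared modulus gives an upper bound of
  second order without any smallness of \<open>y\<close>.\<close>

lemma ln_norm_one_plus_le: "y \<noteq> -1 \<Longrightarrow> ln (cmod (1 + y)) \<le> Re y + (cmod y)\<^sup>2 / 2"
proof -
  assume "y \<noteq> -1"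
  then have p: "0 < cmod (1 + y)" by (metis add.inverse_inverse add_eq_0_iff2 zero_less_norm_iff)
  have "2 * ln (cmod (1 + y)) = ln ((cmod (1 + y))\<^sup>2)" using p by (simp add: ln_realpow)
  also have "\<dots> \<le> (cmod (1 + y))\<^sup>2 - 1" using p by (intro ln_le_minus_one) simp
  also have "\<dots> = 2 * Re y + (cmod y)\<^sup>2"
    unfolding cmod_power2 by (simp add: power2_eq_square algebra_simps)
  finally show ?thesis by simp
qed

section \<open>Measurability of Schur functions and covariance under the shift\<close>

lemma borel_measurable_cnj [measurable]: "cnj \<in> borel_measurable borel"
  by (intro borel_measurable_continuous_onI continuous_intros)

lemma borel_measurable_rho [measurable]: "rho \<in> borel_measurable borel"
  unfolding rho_def by measurable

lemma measurable_schur_iter: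
  assumes [measurable]: "\<And>j. \<beta> j \<in> borel_measurable N" "z \<in> borel_measurable N" "w \<in> borel_measurable N"
  shows "(\<lambda>x. schur_iter (\<lambda>j. \<beta> j x) (z x) n (w x)) \<in> borel_measurable N"
  using assms(3)
proof (induction n arbitrary: w)
  case (Suc n)
  note [measurable] = Suc.prems
  have "(\<lambda>x. schur_step (z x) (\<beta> n x) (w x)) \<in> borel_measurable N"
    unfolding schur_step_def by measurable
  then show ?case using Suc.IH by simp
qed simp

lemma measurable_schur_lim:
  assumes [measurable]: "\<And>j. \<beta> j \<in> borel_measurable N" "z \<in> borel_measurable N"
    and "\<And>j x. x \<in> space N \<Longrightarrow> cmod (\<beta> j x) < 1" "\<And>x. x \<in> space N \<Longrightarrow> cmod (z x) < 1"
  shows "(\<lambda>x. schur_lim (\<lambda>j. \<beta> j x) (z x)) \<in> borel_measurable N"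
proof (rule borel_measurable_LIMSEQ_metric)
  show "(\<lambda>x. schur_iter (\<lambda>j. \<beta> j x) (z x) n 0) \<in> borel_measurable N" for n
    by (rule measurable_schur_iter) measurable
  show "(\<lambda>n. schur_iter (\<lambda>j. \<beta> j x) (z x) n 0) \<longlonglongrightarrow> schur_lim (\<lambda>j. \<beta> j x) (z x)" if "x \<in> space N" for x
    by (rule schur_lim) (use assms(3,4) that in auto)
qed

lemma schur_plus_shift: "schur_plus (\<lambda>n. \<alpha> (n + 1)) z n = schur_plus \<alpha> z (n + 1)"
  by (simp add: schur_plus_def add_ac)

lemma schur_back_shift: "schur_back (\<lambda>n. \<alpha> (n + 1)) z n = schur_back \<alpha> z (n + 1)"
proof -
  have "n - 1 - int j + 1 = n + 1 - 1 - int j" for j by simp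
  then show ?thesis unfolding schur_back_def by (simp only:)
qed

lemma schur_minus_shift: "schur_minus (\<lambda>n. \<alpha> (n + 1)) z n = schur_minus \<alpha> z (n + 1)"
proof -
  have "n - 1 + 1 = n + 1 - 1" by simp
  then show ?thesis unfolding schur_minus_def schur_back_shift by (simp only:)
qed

lemma matmul2: "((A :: complex^2^2) ** B) $ i $ j = A $ i $ 1 * B $ 1 $ j + A $ i $ 2 * B $ 2 $ j"
  by (simp add: matrix_matrix_mult_def UNIV_2)

lemma norm_scalar_vec2: "norm (c *s (v :: complex^2)) = cmod c * norm v"
proof -
  have "(cmod (c * v $ 1))\<^sup>2 + (cmod (c * v $ 2))\<^sup>2 = (cmod c)\<^sup>2 * ((cmod (v $ 1))\<^sup>2 + (cmod (v $ 2))\<^sup>2)"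
    by (simp add: norm_mult power_mult_distrib distrib_left)
  then show ?thesis by (simp add: norm_complex_vec2 real_sqrt_mult)
qed

lemma borel_measurable_matrix2:
  fixes A :: "'b \<Rightarrow> complex^2^2"
  assumes "\<And>i j. (\<lambda>x. A x $ i $ j) \<in> borel_measurable N"
  shows "A \<in> borel_measurable N"
  unfolding borel_measurable_euclidean_space[of A]
proof
  fix b :: "complex^2^2" assume "b \<in> Basis"
  then obtain i j and c :: complex where b: "b = axis i (axis j c)"
    by (auto simp: Basis_vec_def)
  have "(\<lambda>x. A x $ i $ j \<bullet> c) \<in> borel_measurable N"
    using assms[of i j] by (intro borel_measurable_inner) auto
  then show "(\<lambda>x. A x \<bullet> b) \<in> borel_measurable N"
    by (simp add: b inner_axis)
qed

section \<open>Kotani theory\<close>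

locale cmv_system = prob_space M for M :: "'a measure" +
  fixes S :: "'a \<Rightarrow> 'a" and f :: "'a \<Rightarrow> complex" and C :: real
  assumes bimeas: "bimeasurable_bij M S" and invariant: "distr M M S = M"
    and f_meas: "f \<in> borel_measurable M" and f_less: "\<And>\<omega>. \<omega> \<in> space M \<Longrightarrow> cmod (f \<omega>) < 1"
    and C: "C < 1" and f_le: "AE \<omega> in M. cmod (f \<omega>) \<le> C"
begin

abbreviation al :: "'a \<Rightarrow> int \<Rightarrow> complex" where "al \<equiv> verblunsky M S f"

lemma S_meas [measurable]: "S \<in> measurable M M"
  using bimeas by (simp add: bimeasurable_bij_def)

lemma S_space: "\<omega> \<in> space M \<Longrightarrow> S \<omega> \<in> space M"
  using measurable_space[OF S_meas] .

lemma iterate_meas [measurable]: "int_iterate (space M) S n \<in> measurable M M"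
proof -
  have I: "inv_into (space M) S \<in> measurable M M" using bimeas by (simp add: bimeasurable_bij_def)
  have "(S ^^ m) \<in> measurable M M" "(inv_into (space M) S ^^ m) \<in> measurable M M" for m
    by (induction m) (auto intro: measurable_comp S_meas I simp: id_def)
  then show ?thesis by (cases "0 \<le> n") (auto simp: int_iterate_def[abs_def])
qed

lemma iterate_shift:
  assumes "\<omega> \<in> space M"
  shows "int_iterate (space M) S n (S \<omega>) = int_iterate (space M) S (n + 1) \<omega>"
proof (cases "0 \<le> n")
  case True
  then have "nat (n + 1) = Suc (nat n)" by simp
  then show ?thesis using True by (simp add: int_iterate_def funpow_swap1)
next
  case False
  have "inj_on S (space M)" using bimeas by (simp add: bimeasurable_bij_def bij_betw_def)
  then have i: "inv_into (space M) S (S \<omega>) = \<omega>" using assms by (rule inv_into_f_f)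
  have s: "nat (- n) = Suc (nat (- (n + 1)))" using False by simp
  have "int_iterate (space M) S n (S \<omega>) = (inv_into (space M) S ^^ nat (- (n + 1))) \<omega>"
    using False by (simp only: int_iterate_def s funpow_Suc_right o_def i if_False)
  moreover have "int_iterate (space M) S (n + 1) \<omega> = (inv_into (space M) S ^^ nat (- (n + 1))) \<omega>"
    using False by (cases "n = -1") (auto simp: int_iterate_def)
  ultimately show ?thesis by simp
qed

lemma al_less: "\<omega> \<in> space M \<Longrightarrow> cmod (al \<omega> n) < 1"
  unfolding verblunsky_def by (rule f_less[OF measurable_space[OF iterate_meas]])

lemma al_shift: "\<omega> \<in> space M \<Longrightarrow> al (S \<omega>) = (\<lambda>n. al \<omega> (n + 1))"
  by (simp add: verblunsky_def iterate_shift fun_eq_iff)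

lemma al_meas [measurable]: "(\<lambda>\<omega>. al \<omega> n) \<in> borel_measurable M"
  unfolding verblunsky_def using f_meas by (rule measurable_compose[OF iterate_meas])

lemma integral_shift:
  fixes g :: "'a \<Rightarrow> real"
  assumes "g \<in> borel_measurable M"
  shows "(\<integral>\<omega>. g (S \<omega>) \<partial>M) = (\<integral>\<omega>. g \<omega> \<partial>M)"
  using integral_distr[OF S_meas assms] invariant by simp

lemma AE_al_le: "AE \<omega> in M. cmod (al \<omega> (int j)) \<le> C"
proof (induction j)
  case 0
  then show ?case using f_le by (simp add: verblunsky_def int_iterate_def)
next
  case (Suc j)
  then have "AE \<omega> in distr M M S. cmod (al \<omega> (int j)) \<le> C" by (simp only: invariant)
  from AE_distrD[OF S_meas this] AE_space show ?case
    by eventually_elim (simp add: al_shift add.commute)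
qed

lemma C_nonneg: "0 \<le> C"
proof -
  have "\<exists>\<omega>. cmod (f \<omega>) \<le> C"
  proof (rule ccontr)
    assume "\<nexists>\<omega>. cmod (f \<omega>) \<le> C"
    then have "AE \<omega> in M. False" using f_le by simp
    then show False using AE_False prob_space_axioms by simp
  qed
  then show ?thesis by (metis norm_ge_zero order_trans)
qed

definition rC :: real where "rC = sqrt (1 - C\<^sup>2)"

lemma rC_pos: "0 < rC"
  using C C_nonneg by (simp add: rC_def power_less_one_iff)

lemma rho_ge_rC: "cmod a \<le> C \<Longrightarrow> rC \<le> rho a"
  unfolding rC_def rho_def by (intro real_sqrt_le_mono diff_left_mono power_mono) auto

lemma measurable_schur_plus:
  assumes om [measurable]: "om \<in> measurable N M" and z [measurable]: "z \<in> borel_measurable N"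
    and lt: "\<And>x. x \<in> space N \<Longrightarrow> cmod (z x) < 1"
  shows "(\<lambda>x. schur_plus (al (om x)) (z x) n) \<in> borel_measurable N"
  unfolding schur_plus_def
proof (rule measurable_schur_lim)
  show "(\<lambda>x. al (om x) (n + int j)) \<in> borel_measurable N" for j
    by (rule measurable_compose[OF om al_meas])
  show "x \<in> space N \<Longrightarrow> cmod (al (om x) (n + int j)) < 1" for j x
    by (rule al_less[OF measurable_space[OF om]])
qed (use lt in auto)

lemma measurable_schur_minus:
  assumes om [measurable]: "om \<in> measurable N M" and z [measurable]: "z \<in> borel_measurable N"
    and lt: "\<And>x. x \<in> space N \<Longrightarrow> cmod (z x) < 1"
  shows "(\<lambda>x. schur_minus (al (om x)) (z x) n) \<in> borel_measurable N"
proof -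
  have al [measurable]: "(\<lambda>x. al (om x) m) \<in> borel_measurable N" for m
    by (rule measurable_compose[OF om al_meas])
  have [measurable]: "(\<lambda>x. schur_back (al (om x)) (z x) m) \<in> borel_measurable N" for m
    unfolding schur_back_def
  proof (rule measurable_schur_lim)
    show "(\<lambda>x. - cnj (al (om x) (m - 1 - int j))) \<in> borel_measurable N" for j by measurable
    show "x \<in> space N \<Longrightarrow> cmod (- cnj (al (om x) (m - 1 - int j))) < 1" for j x
      using al_less[OF measurable_space[OF om]] by simp
  qed (use lt in auto)
  show ?thesis unfolding schur_minus_def by measurable
qed

lemma measurable_schur_prod:
  assumes om: "om \<in> measurable N M" and z: "z \<in> borel_measurable N"
    and lt: "\<And>x. x \<in> space N \<Longrightarrow> cmod (z x) < 1"
  shows "(\<lambda>x. schur_prod (al (om x)) (z x)) \<in> borel_measurable N"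
  unfolding schur_prod_def
  by (intro borel_measurable_times measurable_schur_plus measurable_schur_minus om z lt)

lemma meas_plus [measurable]: "cmod z < 1 \<Longrightarrow> (\<lambda>\<omega>. schur_plus (al \<omega>) z n) \<in> borel_measurable M"
  by (rule measurable_schur_plus[of "\<lambda>x. x" M "\<lambda>_. z"]) auto

lemma meas_minus [measurable]: "cmod z < 1 \<Longrightarrow> (\<lambda>\<omega>. schur_minus (al \<omega>) z n) \<in> borel_measurable M"
  by (rule measurable_schur_minus[of "\<lambda>x. x" M "\<lambda>_. z"]) auto

lemma meas_prod [measurable]: "cmod z < 1 \<Longrightarrow> (\<lambda>\<omega>. schur_prod (al \<omega>) z) \<in> borel_measurable M"
  by (rule measurable_schur_prod[of "\<lambda>x. x" M "\<lambda>_. z"]) auto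

lemma meas_mult [measurable]: "cmod z < 1 \<Longrightarrow> (\<lambda>\<omega>. szego_multiplier (al \<omega>) z n) \<in> borel_measurable M"
  unfolding szego_multiplier_def by measurable

lemma multiplier_shift:
  "\<omega> \<in> space M \<Longrightarrow> szego_multiplier (al (S \<omega>)) z n = szego_multiplier (al \<omega>) z (n + 1)"
  unfolding szego_multiplier_def al_shift schur_plus_shift by simp

text \<open>The bound \<open>C < 1\<close> enters through \<open>rC\<close>: it keeps the
  multipliers away from \<open>0\<close>, so that for fixed \<open>z\<close> their logarithms are
  essentially bounded.\<close>

lemma AE_ln_multiplier_bound:
  assumes z: "z \<noteq> 0" "cmod z < 1"
  shows "AE \<omega> in M. \<bar>ln (cmod (szego_multiplier (al \<omega>) z (int j)))\<bar> \<le> \<bar>ln (cmod z * rC / 2)\<bar> + \<bar>ln (1 / (1 - cmod z))\<bar>"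
    and "AE \<omega> in M. 0 < cmod (szego_multiplier (al \<omega>) z (int j))"
proof -
  have ev: "AE \<omega> in M. cmod z * rC / 2 \<le> cmod (szego_multiplier (al \<omega>) z (int j)) \<and>
      cmod (szego_multiplier (al \<omega>) z (int j)) \<le> 1 / (1 - cmod z)"
    using AE_al_le[of j] AE_space
  proof eventually_elim
    case (elim \<omega>)
    have lt: "\<And>n. cmod (al \<omega> n) < 1" using al_less elim by simp
    have "cmod z * rC / 2 \<le> cmod z * rho (al \<omega> (int j)) / 2"
      using rho_ge_rC[OF elim(1)] by (simp add: mult_left_mono)
    then show ?case
      using szego_multiplier_bounds[of "al \<omega>" z "int j", OF lt z(2)] by linarith
  qed
  have p: "0 < cmod z * rC / 2" using z rC_pos by simp
  from ev show "AE \<omega> in M. 0 < cmod (szego_multiplier (al \<omega>) z (int j))"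
    by eventually_elim (use p in linarith)
  from ev show "AE \<omega> in M. \<bar>ln (cmod (szego_multiplier (al \<omega>) z (int j)))\<bar> \<le> \<bar>ln (cmod z * rC / 2)\<bar> + \<bar>ln (1 / (1 - cmod z))\<bar>"
  proof eventually_elim
    case (elim \<omega>)
    then have q: "0 < cmod (szego_multiplier (al \<omega>) z (int j))" using p by linarith
    have "ln (cmod z * rC / 2) \<le> ln (cmod (szego_multiplier (al \<omega>) z (int j)))"
      using elim p q by simp
    moreover have "ln (cmod (szego_multiplier (al \<omega>) z (int j))) \<le> ln (1 / (1 - cmod z))"
      using elim p q z by (subst ln_le_cancel_iff) auto
    ultimately show ?case by linarith
  qed
qed

lemma integrable_ln_multiplier:
  assumes z: "z \<noteq> 0" "cmod z < 1"
  shows "integrable M (\<lambda>\<omega>. ln (cmod (szego_multiplier (al \<omega>) z (int j))))"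
  using AE_ln_multiplier_bound(1)[OF z, of j] z(2)
  by (intro integrable_const_bound[where B = "\<bar>ln (cmod z * rC / 2)\<bar> + \<bar>ln (1 / (1 - cmod z))\<bar>"]) auto

lemma integral_ln_multiplier_shift:
  assumes z: "z \<noteq> 0" "cmod z < 1"
  shows "(\<integral>\<omega>. ln (cmod (szego_multiplier (al \<omega>) z (int j))) \<partial>M) = (\<integral>\<omega>. ln (cmod (szego_multiplier (al \<omega>) z 0)) \<partial>M)"
proof (induction j)
  case (Suc j)
  have "(\<integral>\<omega>. ln (cmod (szego_multiplier (al \<omega>) z (int (Suc j)))) \<partial>M) =
      (\<integral>\<omega>. ln (cmod (szego_multiplier (al (S \<omega>)) z (int j))) \<partial>M)"
    by (intro Bochner_Integration.integral_cong refl) (simp add: multiplier_shift add.commute)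
  also have "\<dots> = (\<integral>\<omega>. ln (cmod (szego_multiplier (al \<omega>) z (int j))) \<partial>M)"
    using z(2) by (intro integral_shift) measurable
  finally show ?case using Suc by simp
qed simp

text \<open>The Lyapunov exponent inside the disc, shifted by \<open>log |z| / 2\<close> so that it is nonnegative.\<close>

definition gt :: "complex \<Rightarrow> real" where
  "gt z = ln (cmod z) / 2 - (\<integral>\<omega>. ln (cmod (szego_multiplier (al \<omega>) z 0)) \<partial>M)"

text \<open>The multiplier identity writes \<open>ln (r^2 - q)\<close> as twice the logarithm of the
  multiplier plus \<open>ln (1 - q)\<close> at \<open>S \<omega>\<close>. After
  \<open>ln_kotani_bound\<close> and averaging, the terms \<open>ln (1 - q)\<close> at \<omega> and
  at \<open>S \<omega>\<close> cancel by invariance, and \<open>2 * gt z\<close> is left.\<close>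

lemma kotani_inequality:
  assumes z: "z \<noteq> 0" "cmod z < 1"
  shows "integrable M (\<lambda>\<omega>. 1 / (1 - (cmod (schur_plus (al \<omega>) z 0))\<^sup>2))"
    and "(1 - cmod z) * (\<integral>\<omega>. 1 / (1 - (cmod (schur_plus (al \<omega>) z 0))\<^sup>2) \<partial>M) \<le> 2 * gt z"
proof -
  define r where "r = cmod z"
  have r: "0 < r" "r < 1" using z by (auto simp: r_def)
  define q where "q \<omega> = (cmod (schur_plus (al \<omega>) z 0))\<^sup>2" for \<omega>
  define l where "l \<omega> = ln (cmod (szego_multiplier (al \<omega>) z 0))" for \<omega>
  have r2: "r\<^sup>2 < 1" using r by (simp add: power_less_one_iff)
  have q: "0 \<le> q \<omega>" "q \<omega> \<le> r\<^sup>2" if "\<omega> \<in> space M" for \<omega>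
    using norm_schur_plus_le[of "al \<omega>" z 0, OF al_less[OF that] z(2)] unfolding q_def r_def
    by (auto intro: power_mono)
  have [measurable]: "q \<in> borel_measurable M" unfolding q_def using z(2) by measurable
  have [measurable]: "l \<in> borel_measurable M" unfolding l_def using z(2) by measurable
  have il: "integrable M l" unfolding l_def using integrable_ln_multiplier[OF z, of 0] by simp
  have i1: "integrable M (\<lambda>\<omega>. ln (1 - q \<omega>))"
  proof (rule integrable_const_bound[where B = "\<bar>ln (1 - r\<^sup>2)\<bar>"])
    show "AE \<omega> in M. norm (ln (1 - q \<omega>)) \<le> \<bar>ln (1 - r\<^sup>2)\<bar>"
    proof (rule AE_I2)
      fix \<omega> assume "\<omega> \<in> space M"
      then have "0 \<le> q \<omega>" "q \<omega> \<le> r\<^sup>2" using q by auto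
      then have "ln (1 - r\<^sup>2) \<le> ln (1 - q \<omega>)" "ln (1 - q \<omega>) \<le> 0" using r2 by auto
      then show "norm (ln (1 - q \<omega>)) \<le> \<bar>ln (1 - r\<^sup>2)\<bar>" by simp
    qed
  qed measurable
  show i3: "integrable M (\<lambda>\<omega>. 1 / (1 - (cmod (schur_plus (al \<omega>) z 0))\<^sup>2))"
    unfolding q_def[symmetric]
  proof (rule integrable_const_bound[where B = "1 / (1 - r\<^sup>2)"])
    show "AE \<omega> in M. norm (1 / (1 - q \<omega>)) \<le> 1 / (1 - r\<^sup>2)"
    proof (rule AE_I2)
      fix \<omega> assume "\<omega> \<in> space M"
      then have "0 \<le> q \<omega>" "q \<omega> \<le> r\<^sup>2" using q by auto
      then show "norm (1 / (1 - q \<omega>)) \<le> 1 / (1 - r\<^sup>2)" using r2 by (simp add: frac_le)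
    qed
  qed measurable
  have qS: "q (S \<omega>) = (cmod (schur_plus (al \<omega>) z 1))\<^sup>2" if "\<omega> \<in> space M" for \<omega>
    using schur_plus_shift[of "al \<omega>" z 0] by (simp add: q_def al_shift[OF that])
  have pw: "AE \<omega> in M. (1 - r) / (1 - q \<omega>) \<le> ln r + ln (1 - q \<omega>) - (2 * l \<omega> + ln (1 - q (S \<omega>)))"
    using AE_ln_multiplier_bound(2)[OF z, of 0] AE_space
  proof eventually_elim
    case (elim \<omega>)
    have lt: "\<And>n. cmod (al \<omega> n) < 1" using al_less elim by simp
    have id: "(cmod (szego_multiplier (al \<omega>) z 0))\<^sup>2 * (1 - q (S \<omega>)) = r\<^sup>2 - q \<omega>"
      using szego_multiplier_norm_identity[of "al \<omega>" z 0, OF lt z(2)] qS[OF elim(2)] by (simp add: q_def r_def)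
    have q1: "0 < 1 - q (S \<omega>)" using q[OF S_space[OF elim(2)]] r2 by linarith
    have m: "0 < cmod (szego_multiplier (al \<omega>) z 0)" using elim by simp
    then have pos: "0 < r\<^sup>2 - q \<omega>" unfolding id[symmetric] using q1 by simp
    have "ln (r\<^sup>2 - q \<omega>) = ln ((cmod (szego_multiplier (al \<omega>) z 0))\<^sup>2) + ln (1 - q (S \<omega>))"
      unfolding id[symmetric] using m q1 by (intro ln_mult_pos) auto
    also have "ln ((cmod (szego_multiplier (al \<omega>) z 0))\<^sup>2) = 2 * l \<omega>"
      using m by (simp add: l_def ln_realpow)
    finally show ?case
      using ln_kotani_bound[OF r q(1)[OF elim(2)]] pos by simp
  qed
  have i1S: "integrable M (\<lambda>\<omega>. ln (1 - q (S \<omega>)))"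
    using integrable_distr[OF S_meas, of "\<lambda>\<omega>. ln (1 - q \<omega>)"] i1 invariant by simp
  have "(1 - r) * (\<integral>\<omega>. 1 / (1 - q \<omega>) \<partial>M) = (\<integral>\<omega>. (1 - r) / (1 - q \<omega>) \<partial>M)"
    by (subst integral_mult_right_zero[symmetric]) simp
  also have "\<dots> \<le> (\<integral>\<omega>. ln r + ln (1 - q \<omega>) - (2 * l \<omega> + ln (1 - q (S \<omega>))) \<partial>M)"
  proof (rule integral_mono_AE[OF _ _ pw])
    have "integrable M (\<lambda>\<omega>. (1 - r) * (1 / (1 - q \<omega>)))"
      using i3 unfolding q_def by (rule integrable_mult_right)
    then show "integrable M (\<lambda>\<omega>. (1 - r) / (1 - q \<omega>))" by simp
    show "integrable M (\<lambda>\<omega>. ln r + ln (1 - q \<omega>) - (2 * l \<omega> + ln (1 - q (S \<omega>))))"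
      using il i1 i1S by simp
  qed
  also have "\<dots> = ln r + (\<integral>\<omega>. ln (1 - q \<omega>) \<partial>M) - (2 * (\<integral>\<omega>. l \<omega> \<partial>M) + (\<integral>\<omega>. ln (1 - q (S \<omega>)) \<partial>M))"
    using il i1 i1S by (simp add: prob_space)
  also have "(\<integral>\<omega>. ln (1 - q (S \<omega>)) \<partial>M) = (\<integral>\<omega>. ln (1 - q \<omega>) \<partial>M)"
    by (rule integral_shift) measurable
  finally show "(1 - cmod z) * (\<integral>\<omega>. 1 / (1 - (cmod (schur_plus (al \<omega>) z 0))\<^sup>2) \<partial>M) \<le> 2 * gt z"
    by (simp add: gt_def q_def l_def r_def)
qed

section \<open>Averages of the logarithmic norm of the cocycle\<close>

definition lcoc :: "complex \<Rightarrow> nat \<Rightarrow> 'a \<Rightarrow> real" where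
  "lcoc z n \<omega> = ln (onorm (\<lambda>v. szego_cocycle (al \<omega>) z n *v v))"

lemma meas_cocycle: "(\<lambda>\<omega>. szego_cocycle (al \<omega>) z n) \<in> borel_measurable M"
proof (rule borel_measurable_matrix2)
  have sm [measurable]: "(\<lambda>\<omega>. szego_matrix z (al \<omega> m) $ i $ j) \<in> borel_measurable M" for m i j
    using exhaust_2[of i] exhaust_2[of j] by (auto simp: szego_matrix_entries)
  show "(\<lambda>\<omega>. szego_cocycle (al \<omega>) z n $ i $ j) \<in> borel_measurable M" for i j
  proof (induction n arbitrary: i j)
    case (Suc n)
    note [measurable] = Suc
    show ?case unfolding szego_cocycle.simps matmul2 by measurable
  qed simp
qed

lemma meas_lcoc [measurable]: "lcoc z n \<in> borel_measurable M"
proof -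
  have "(\<lambda>\<omega>. onorm (\<lambda>v. szego_cocycle (al \<omega>) z n *v v)) \<in> borel_measurable M"
    by (rule measurable_compose[OF meas_cocycle borel_measurable_continuous_onI[OF continuous_onorm_matrix]])
  then show ?thesis unfolding lcoc_def by measurable
qed

lemma onorm_cocycle_bounds:
  assumes z: "z \<noteq> 0" "cmod z \<le> 1" and \<omega>: "\<omega> \<in> space M" "\<And>j. cmod (al \<omega> (int j)) \<le> C"
  shows "cmod z ^ n \<le> (onorm (\<lambda>v. szego_cocycle (al \<omega>) z n *v v))\<^sup>2"
    and "onorm (\<lambda>v. szego_cocycle (al \<omega>) z n *v v) \<le> (2 / rC) ^ n"
    and "0 < onorm (\<lambda>v. szego_cocycle (al \<omega>) z n *v v)"
proof -
  have lt: "\<And>n. cmod (al \<omega> n) < 1" using al_less[OF \<omega>(1)] .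
  show lo: "cmod z ^ n \<le> (onorm (\<lambda>v. szego_cocycle (al \<omega>) z n *v v))\<^sup>2"
    using det_le_onorm_squared[of "szego_cocycle (al \<omega>) z n"] det_szego_cocycle[of "al \<omega>" z n, OF lt]
    by (simp add: norm_power)
  have "0 < cmod z ^ n" using z by simp
  then have "0 < (onorm (\<lambda>v. szego_cocycle (al \<omega>) z n *v v))\<^sup>2" using lo by linarith
  then show "0 < onorm (\<lambda>v. szego_cocycle (al \<omega>) z n *v v)"
    using onorm_pos_le[OF bounded_linear_matvec, of "szego_cocycle (al \<omega>) z n"] by (simp add: less_le)
  show "onorm (\<lambda>v. szego_cocycle (al \<omega>) z n *v v) \<le> (2 / rC) ^ n"
  proof (induction n)
    case 0
    have "onorm (\<lambda>v. (mat 1 :: complex^2^2) *v v) \<le> 1" by (rule onorm_le) simp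
    then show ?case by simp
  next
    case (Suc n)
    have "onorm (\<lambda>v. szego_cocycle (al \<omega>) z (Suc n) *v v) \<le>
      onorm (\<lambda>v. szego_matrix z (al \<omega> (int n)) *v v) * onorm (\<lambda>v. szego_cocycle (al \<omega>) z n *v v)"
      by (simp add: onorm_matmul_le)
    also have "\<dots> \<le> (2 / rC) * (2 / rC) ^ n"
    proof (intro mult_mono Suc)
      have "onorm (\<lambda>v. szego_matrix z (al \<omega> (int n)) *v v) \<le> 2 / rho (al \<omega> (int n))"
        by (rule onorm_szego_matrix_le[OF lt z(2)])
      also have "\<dots> \<le> 2 / rC" using rC_pos rho_ge_rC[OF \<omega>(2)[of n]]
        by (intro divide_left_mono mult_pos_pos) linarith+
      finally show "onorm (\<lambda>v. szego_matrix z (al \<omega> (int n)) *v v) \<le> 2 / rC" .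
    qed (use rC_pos onorm_pos_le[OF bounded_linear_matvec] in auto)
    finally show ?case by simp
  qed
qed

lemma AE_all_al_le: "AE \<omega> in M. \<forall>j. cmod (al \<omega> (int j)) \<le> C"
  using AE_al_le by (simp add: AE_all_countable)

lemma AE_lcoc_bound:
  assumes z: "\<delta> \<le> cmod z" "0 < \<delta>" "cmod z \<le> 1"
  shows "AE \<omega> in M. \<bar>lcoc z n \<omega>\<bar> \<le> real n * (\<bar>ln \<delta>\<bar> + \<bar>ln (2 / rC)\<bar>)"
  using AE_all_al_le AE_space
proof eventually_elim
  case (elim \<omega>)
  have z0: "z \<noteq> 0" using z by auto
  define nA where "nA = onorm (\<lambda>v. szego_cocycle (al \<omega>) z n *v v)"
  have b: "cmod z ^ n \<le> nA\<^sup>2" "nA \<le> (2 / rC) ^ n" "0 < nA"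
    using onorm_cocycle_bounds[OF z0 z(3) elim(2), of n] elim(1) by (auto simp: nA_def)
  have "ln (\<delta> ^ n) \<le> ln (nA\<^sup>2)"
    using b z by (subst ln_le_cancel_iff) (auto intro: order_trans[OF power_mono])
  then have "real n * ln \<delta> \<le> 2 * ln nA" using b z by (simp add: ln_realpow)
  moreover have "ln nA \<le> ln ((2 / rC) ^ n)" using b rC_pos by (subst ln_le_cancel_iff) auto
  moreover have "ln ((2 / rC) ^ n) = real n * ln (2 / rC)" using rC_pos by (simp add: ln_realpow)
  moreover have "real n * (- \<bar>ln \<delta>\<bar>) \<le> real n * ln \<delta>" by (rule mult_left_mono) auto
  moreover have "real n * ln (2 / rC) \<le> real n * \<bar>ln (2 / rC)\<bar>" by (rule mult_left_mono) auto
  moreover have "0 \<le> real n * \<bar>ln \<delta>\<bar>" "0 \<le> real n * \<bar>ln (2 / rC)\<bar>" by auto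
  ultimately have "ln nA \<le> real n * \<bar>ln \<delta>\<bar> + real n * \<bar>ln (2 / rC)\<bar>"
    "- ln nA \<le> real n * \<bar>ln \<delta>\<bar> + real n * \<bar>ln (2 / rC)\<bar>"
    by linarith+
  then show ?case unfolding lcoc_def nA_def[symmetric] distrib_left by (rule abs_leI)
qed

lemma integrable_lcoc:
  assumes "z \<noteq> 0" "cmod z \<le> 1"
  shows "integrable M (lcoc z n)"
  using AE_lcoc_bound[of "cmod z" z n] assms
  by (intro integrable_const_bound[where B = "real n * (\<bar>ln (cmod z)\<bar> + \<bar>ln (2 / rC)\<bar>)"]) auto

text \<open>The cocycle has determinant \<open>z ^ n\<close> and scales the contracted direction by
  the product of the multipliers, so it must stretch another direction accordingly;
  \<open>ln 2\<close> pays for the length of \<open>(1, schur_plus)\<close>. The bound is stated for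
  each \<open>n\<close> so that the circle can be approached at fixed \<open>n\<close>, where
  \<open>lcoc\<close> is continuous, without any continuity of \<open>gt\<close>.\<close>

lemma gt_le_lcoc:
  assumes z: "z \<noteq> 0" "cmod z < 1" and n: "n > 0"
  shows "gt z \<le> 1 / real n * (\<integral>\<omega>. lcoc z n \<omega> \<partial>M) + ln 2 / real n - ln (cmod z) / 2"
proof -
  define l where "l j \<omega> = ln (cmod (szego_multiplier (al \<omega>) z (int j)))" for j \<omega>
  have il: "integrable M (l j)" for j unfolding l_def by (rule integrable_ln_multiplier[OF z])
  have "AE \<omega> in M. \<forall>j. 0 < cmod (szego_multiplier (al \<omega>) z (int j))"
    using AE_ln_multiplier_bound(2)[OF z] by (simp add: AE_all_countable)
  then have "AE \<omega> in M. real n * ln (cmod z) \<le> lcoc z n \<omega> + ln 2 + (\<Sum>j<n. l j \<omega>)"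
    using AE_all_al_le AE_space
  proof eventually_elim
    case (elim \<omega>)
    have lt: "\<And>n. cmod (al \<omega> n) < 1" using al_less[OF elim(3)] .
    define nA where "nA = onorm (\<lambda>v. szego_cocycle (al \<omega>) z n *v v)"
    define v :: "complex^2" where "v = vector [1, schur_plus (al \<omega>) z 0]"
    define P where "P = (\<Prod>j<n. szego_multiplier (al \<omega>) z (int j))"
    have nA: "0 < nA" unfolding nA_def using onorm_cocycle_bounds(3)[OF z(1) less_imp_le[OF z(2)] elim(3)] elim(2) by simp
    have P: "0 < cmod P" "ln (cmod P) = (\<Sum>j<n. l j \<omega>)"
      unfolding P_def l_def prod_norm[symmetric] using elim(1) by (auto intro!: prod_pos ln_prod)
    have "1 \<le> norm v" by (simp add: norm_complex_vec2 v_def)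
    moreover have "norm (szego_cocycle (al \<omega>) z n *v v) \<le> cmod P * 2"
    proof -
      have "norm (szego_cocycle (al \<omega>) z n *v v) = cmod P * norm (vector [1, schur_plus (al \<omega>) z (int n)] :: complex^2)"
        unfolding v_def szego_cocycle_schur_plus[of "al \<omega>" z n, OF lt z(2)] P_def[symmetric]
        by (rule norm_scalar_vec2)
      also have "norm (vector [1, schur_plus (al \<omega>) z (int n)] :: complex^2) \<le> 2"
      proof -
        have "(cmod (schur_plus (al \<omega>) z (int n)))\<^sup>2 \<le> 1"
          using norm_schur_plus_le1[of "al \<omega>" z "int n", OF lt z(2)] by (simp add: power_le_one)
        then show ?thesis by (simp add: norm_complex_vec2 real_le_lsqrt)
      qed
      finally show ?thesis by (simp add: mult_left_mono)
    qed
    moreover have "cmod z ^ n * norm v \<le> nA * norm (szego_cocycle (al \<omega>) z n *v v)"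
      using det_times_norm_le_onorm[of "szego_cocycle (al \<omega>) z n" v] det_szego_cocycle[of "al \<omega>" z n, OF lt]
      by (simp add: norm_power nA_def)
    moreover have "cmod z ^ n * 1 \<le> cmod z ^ n * norm v" using \<open>1 \<le> norm v\<close> by (intro mult_left_mono) auto
    moreover have "nA * norm (szego_cocycle (al \<omega>) z n *v v) \<le> nA * (cmod P * 2)"
      using calculation(2) nA by (intro mult_left_mono) auto
    ultimately have "cmod z ^ n \<le> nA * (cmod P * 2)" by linarith
    then have "ln (cmod z ^ n) \<le> ln (nA * (cmod P * 2))" using z nA P by (subst ln_le_cancel_iff) auto
    also have "\<dots> = ln nA + (ln (cmod P) + ln 2)" using nA P by (simp add: ln_mult)
    finally show ?case using z P(2) by (simp add: ln_realpow lcoc_def nA_def)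
  qed
  then have "(\<integral>\<omega>. real n * ln (cmod z) \<partial>M) \<le> (\<integral>\<omega>. lcoc z n \<omega> + ln 2 + (\<Sum>j<n. l j \<omega>) \<partial>M)"
    using il integrable_lcoc[OF z(1) less_imp_le[OF z(2)], of n] by (intro integral_mono_AE) auto
  also have "\<dots> = (\<integral>\<omega>. lcoc z n \<omega> \<partial>M) + ln 2 + (\<Sum>j<n. \<integral>\<omega>. l j \<omega> \<partial>M)"
    using il integrable_lcoc[OF z(1) less_imp_le[OF z(2)], of n] by (simp add: prob_space)
  also have "(\<Sum>j<n. \<integral>\<omega>. l j \<omega> \<partial>M) = real n * (\<integral>\<omega>. l 0 \<omega> \<partial>M)"
    using integral_ln_multiplier_shift[OF z] by (simp add: l_def)
  finally have "real n * (ln (cmod z) - (\<integral>\<omega>. l 0 \<omega> \<partial>M)) \<le> (\<integral>\<omega>. lcoc z n \<omega> \<partial>M) + ln 2"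
    by (simp add: prob_space algebra_simps)
  then have "ln (cmod z) - (\<integral>\<omega>. l 0 \<omega> \<partial>M) \<le> ((\<integral>\<omega>. lcoc z n \<omega> \<partial>M) + ln 2) / real n"
    using n by (simp add: field_simps)
  then show ?thesis by (simp add: gt_def l_def add_divide_distrib)
qed

text \<open>For fixed \<open>n\<close> the entries of the cocycle are continuous in
  \<open>z\<close>. Its determinant bounds the norm below and the product of the factors bounds it
  above, both uniformly for \<open>|z| \<ge> 1 / 2\<close>, which provides the domination.\<close>

lemma lcoc_radial_limit:
  assumes \<zeta>: "cmod \<zeta> = 1" and t: "\<And>k. 1 / 2 \<le> t k" "\<And>k. t k \<le> 1" "t \<longlonglongrightarrow> 1"
  shows "(\<lambda>k. \<integral>\<omega>. lcoc (of_real (t k) * \<zeta>) n \<omega> \<partial>M) \<longlonglongrightarrow> (\<integral>\<omega>. lcoc \<zeta> n \<omega> \<partial>M)"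
proof (rule integral_dominated_convergence[where w = "\<lambda>_. real n * (\<bar>ln (1 / 2)\<bar> + \<bar>ln (2 / rC)\<bar>)"])
  show "AE \<omega> in M. norm (lcoc (of_real (t k) * \<zeta>) n \<omega>) \<le> real n * (\<bar>ln (1 / 2)\<bar> + \<bar>ln (2 / rC)\<bar>)" for k
    using AE_lcoc_bound[of "1 / 2" "of_real (t k) * \<zeta>" n] t(1,2)[of k] \<zeta> by (simp add: norm_mult)
  show "AE \<omega> in M. (\<lambda>k. lcoc (of_real (t k) * \<zeta>) n \<omega>) \<longlonglongrightarrow> lcoc \<zeta> n \<omega>"
    using AE_all_al_le AE_space
  proof eventually_elim
    case (elim \<omega>)
    have tz: "(\<lambda>k. of_real (t k) * \<zeta>) \<longlonglongrightarrow> of_real 1 * \<zeta>" by (intro tendsto_intros t)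
    have sm: "(\<lambda>k. szego_matrix (of_real (t k) * \<zeta>) a $ i $ j) \<longlonglongrightarrow> szego_matrix \<zeta> a $ i $ j" for a i j
    proof -
      have "(\<lambda>k. of_real (t k) * \<zeta>) \<longlonglongrightarrow> \<zeta>" using tz by simp
      moreover have "i = 1 \<or> i = 2" "j = 1 \<or> j = 2" using exhaust_2 by auto
      ultimately show ?thesis
        unfolding divide_inverse by (elim disjE) (auto simp: szego_matrix_entries divide_inverse intro!: tendsto_intros)
    qed
    have ent: "(\<lambda>k. szego_cocycle (al \<omega>) (of_real (t k) * \<zeta>) m $ i $ j) \<longlonglongrightarrow> szego_cocycle (al \<omega>) \<zeta> m $ i $ j" for m i j
    proof (induction m arbitrary: i j)
      case (Suc m)
      show ?case unfolding szego_cocycle.simps matmul2 by (intro tendsto_add tendsto_mult sm Suc)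
    qed simp
    have mat: "(\<lambda>k. szego_cocycle (al \<omega>) (of_real (t k) * \<zeta>) n) \<longlonglongrightarrow> szego_cocycle (al \<omega>) \<zeta> n"
      by (intro vec_tendstoI ent)
    have "(\<lambda>k. onorm (\<lambda>v. szego_cocycle (al \<omega>) (of_real (t k) * \<zeta>) n *v v)) \<longlonglongrightarrow> onorm (\<lambda>v. szego_cocycle (al \<omega>) \<zeta> n *v v)"
      by (rule continuous_on_tendsto_compose[OF continuous_onorm_matrix mat]) auto
    moreover have "0 < onorm (\<lambda>v. szego_cocycle (al \<omega>) \<zeta> n *v v)"
      using onorm_cocycle_bounds(3)[of \<zeta> \<omega> n] elim \<zeta> by fastforce
    ultimately show ?case unfolding lcoc_def by (intro tendsto_ln) auto
  qed
qed measurable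

text \<open>On the circle the determinant has modulus \<open>1\<close>, so \<open>lcoc\<close> is
  nonnegative, and invariance makes its means subadditive. Hence the hypothesis on
  \<open>lim\<close> gives convergence to \<open>0\<close>.\<close>

lemma lyapunov_zero_limit:
  assumes \<zeta>: "cmod \<zeta> = 1" and "lyapunov_exponent M al \<zeta> = 0"
  shows "(\<lambda>n. 1 / real n * (\<integral>\<omega>. lcoc \<zeta> n \<omega> \<partial>M)) \<longlonglongrightarrow> 0"
proof -
  define u where "u n = (\<integral>\<omega>. lcoc \<zeta> n \<omega> \<partial>M)" for n
  have z: "\<zeta> \<noteq> 0" "cmod \<zeta> \<le> 1" using \<zeta> by auto
  have int: "integrable M (lcoc \<zeta> n)" for n by (rule integrable_lcoc[OF z])
  have "convergent (\<lambda>n. 1 / real n * u n)"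
  proof (rule fekete_convergent)
    show "0 \<le> u n" for n
      unfolding u_def
    proof (rule integral_nonneg_AE)
      show "AE \<omega> in M. 0 \<le> lcoc \<zeta> n \<omega>"
        using AE_all_al_le AE_space
      proof eventually_elim
        case (elim \<omega>)
        then have "1 \<le> (onorm (\<lambda>v. szego_cocycle (al \<omega>) \<zeta> n *v v))\<^sup>2" "0 < onorm (\<lambda>v. szego_cocycle (al \<omega>) \<zeta> n *v v)"
          using onorm_cocycle_bounds[OF z, of \<omega> n] \<zeta> by auto
        then have "1 \<le> onorm (\<lambda>v. szego_cocycle (al \<omega>) \<zeta> n *v v)"
          using power2_le_imp_le[of 1 "onorm (\<lambda>v. szego_cocycle (al \<omega>) \<zeta> n *v v)"] by simp
        then show ?case by (simp add: lcoc_def)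
      qed
    qed
    show "u (m + n) \<le> u m + u n" for m n
    proof -
      have it: "(\<integral>\<omega>. lcoc \<zeta> n ((S ^^ m) \<omega>) \<partial>M) = u n \<and> integrable M (\<lambda>\<omega>. lcoc \<zeta> n ((S ^^ m) \<omega>))" for m
      proof (induction m)
        case (Suc m)
        have Sm: "(S ^^ m) \<in> measurable M M"
          using iterate_meas[of "int m"] by (simp add: int_iterate_def[abs_def])
        have [measurable]: "(\<lambda>\<omega>. lcoc \<zeta> n ((S ^^ m) \<omega>)) \<in> borel_measurable M"
          by (rule measurable_compose[OF Sm meas_lcoc])
        have "(\<lambda>\<omega>. lcoc \<zeta> n ((S ^^ Suc m) \<omega>)) = (\<lambda>\<omega>. lcoc \<zeta> n ((S ^^ m) (S \<omega>)))"
          by (simp add: funpow_swap1)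
        then show ?case
          using integral_shift[of "\<lambda>\<omega>. lcoc \<zeta> n ((S ^^ m) \<omega>)"] Suc
            integrable_distr[OF S_meas, of "\<lambda>\<omega>. lcoc \<zeta> n ((S ^^ m) \<omega>)"] invariant by simp
      qed (simp add: u_def int)
      have alm: "al ((S ^^ m) \<omega>) = (\<lambda>j. al \<omega> (j + int m))" if "\<omega> \<in> space M" for \<omega> m
        using that
      proof (induction m arbitrary: \<omega>)
        case (Suc m)
        have "al ((S ^^ Suc m) \<omega>) = al ((S ^^ m) (S \<omega>))" by (simp add: funpow_swap1)
        also have "\<dots> = (\<lambda>j. al (S \<omega>) (j + int m))" using Suc S_space by simp
        finally show ?case using al_shift[OF Suc.prems] by (simp add: add_ac)
      qed simp
      have "u (m + n) \<le> (\<integral>\<omega>. lcoc \<zeta> m \<omega> + lcoc \<zeta> n ((S ^^ m) \<omega>) \<partial>M)"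
        unfolding u_def
      proof (rule integral_mono_AE)
        show "AE \<omega> in M. lcoc \<zeta> (m + n) \<omega> \<le> lcoc \<zeta> m \<omega> + lcoc \<zeta> n ((S ^^ m) \<omega>)"
          using AE_all_al_le AE_space
        proof eventually_elim
          case (elim \<omega>)
          have Sm: "(S ^^ m) \<omega> \<in> space M"
            using iterate_meas[of "int m", THEN measurable_space, OF elim(2)] by (simp add: int_iterate_def)
          have C': "cmod (al ((S ^^ m) \<omega>) (int j)) \<le> C" for j
            using elim(1)[rule_format, of "j + m"] by (simp add: alm[OF elim(2)])
          have p: "0 < onorm (\<lambda>v. szego_cocycle (al \<omega>) \<zeta> k *v v)" for k
            using onorm_cocycle_bounds(3)[OF z elim(2), of k] elim(1) by simp
          have p': "0 < onorm (\<lambda>v. szego_cocycle (al ((S ^^ m) \<omega>)) \<zeta> n *v v)"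
            using onorm_cocycle_bounds(3)[OF z Sm C', of n] .
          have "onorm (\<lambda>v. szego_cocycle (al \<omega>) \<zeta> (m + n) *v v) \<le>
            onorm (\<lambda>v. szego_cocycle (al ((S ^^ m) \<omega>)) \<zeta> n *v v) * onorm (\<lambda>v. szego_cocycle (al \<omega>) \<zeta> m *v v)"
            unfolding szego_cocycle_add alm[OF elim(2)] by (rule onorm_matmul_le)
          then have "lcoc \<zeta> (m + n) \<omega> \<le> ln (onorm (\<lambda>v. szego_cocycle (al ((S ^^ m) \<omega>)) \<zeta> n *v v) * onorm (\<lambda>v. szego_cocycle (al \<omega>) \<zeta> m *v v))"
            unfolding lcoc_def using p p' by (subst ln_le_cancel_iff) auto
          also have "\<dots> = lcoc \<zeta> n ((S ^^ m) \<omega>) + lcoc \<zeta> m \<omega>"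
            unfolding lcoc_def using p[of m] p' by (rule ln_mult_pos[rotated])
          finally show ?case by simp
        qed
      qed (use int it[of m] in auto)
      also have "\<dots> = u m + u n" using int it[of m] by (simp add: u_def)
      finally show ?thesis .
    qed
  qed
  then have "(\<lambda>n. 1 / real n * u n) \<longlonglongrightarrow> lim (\<lambda>n. 1 / real n * u n)"
    by (simp add: convergent_LIMSEQ_iff)
  moreover have "lim (\<lambda>n. 1 / real n * u n) = 0"
    using assms(2) by (simp add: lyapunov_exponent_def u_def lcoc_def)
  ultimately show ?thesis by (simp add: u_def)
qed

end

section \<open>Radial increments of the Lyapunov exponent\<close>

lemma one_minus_schur_mult:
  assumes "cmod s \<le> R" "cmod t \<le> 1" "R < 1"
  shows "1 - R \<le> cmod (1 - s * t)" "cmod (1 - s * t) \<le> 2" "1 - s * t \<noteq> 0"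
proof -
  have st: "cmod (s * t) \<le> R"
  proof -
    have "0 \<le> R" using assms(1) norm_ge_zero[of s] by linarith
    then have "cmod s * cmod t \<le> R * 1" using assms by (intro mult_mono) auto
    then show ?thesis by (simp add: norm_mult)
  qed
  then show lo: "1 - R \<le> cmod (1 - s * t)" using norm_triangle_ineq2[of 1 "s * t"] by simp
  show "cmod (1 - s * t) \<le> 2" using st assms norm_triangle_ineq4[of 1 "s * t"] by simp
  show "1 - s * t \<noteq> 0" using lo assms by auto
qed

context cmv_system
begin

text \<open>Dividing the Wronskian identity for \<open>(z, z')\<close> by the one for
  \<open>(z, z)\<close> removes \<open>\<mu>\<close>. There remain the ratio of the multipliers, a
  coboundary made of the factors \<open>1 - s * t\<close>, and \<open>1 + h * V'\<close>, with
  \<open>V'\<close> a mixed Green function whose \<open>schur_plus\<close> is taken at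
  \<open>z'\<close>. Replacing \<open>V'\<close> by the Green function at \<open>z\<close> costs
  another factor \<open>h\<close> by the Lipschitz bound.\<close>

lemma multiplier_ratio_bound:
  assumes \<omega>: "\<omega> \<in> space M" and \<zeta>: "cmod \<zeta> = 1" and r: "1 / 2 \<le> r" "r < r'" "r' \<le> R" "R < 1"
    and pos: "0 < cmod (szego_multiplier (al \<omega>) (of_real r * \<zeta>) 0)" "0 < cmod (szego_multiplier (al \<omega>) (of_real r' * \<zeta>) 0)"
  defines "c \<equiv> \<lambda>\<omega>. ln (cmod (1 - schur_plus (al \<omega>) (of_real r' * \<zeta>) 0 * schur_minus (al \<omega>) (of_real r * \<zeta>) 0))
      - ln (cmod (1 - schur_plus (al \<omega>) (of_real r * \<zeta>) 0 * schur_minus (al \<omega>) (of_real r * \<zeta>) 0))"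
    and "h \<equiv> r' / r - 1"
  shows "ln (cmod (szego_multiplier (al \<omega>) (of_real r' * \<zeta>) 0)) - ln (cmod (szego_multiplier (al \<omega>) (of_real r * \<zeta>) 0)) + c (S \<omega>) - c \<omega>
    \<le> h * Re (1 / (1 - schur_prod (al \<omega>) (of_real r * \<zeta>))) + (2 / (1 - R) ^ 3 + 1 / (1 - R)\<^sup>2) * h\<^sup>2"
proof -
  define z where "z = of_real r * \<zeta>"
  define z' where "z' = of_real r' * \<zeta>"
  have zn: "cmod z = r" "cmod z' = r'" using r \<zeta> by (auto simp: z_def z'_def norm_mult)
  have z1: "cmod z < 1" "cmod z' < 1" "z \<noteq> 0" using zn r by auto
  have lt: "\<And>n. cmod (al \<omega> n) < 1" using al_less[OF \<omega>] .
  define s where "s n = schur_plus (al \<omega>) z n" for n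
  define s' where "s' n = schur_plus (al \<omega>) z' n" for n
  define t where "t n = schur_minus (al \<omega>) z n" for n
  define l where "l = szego_multiplier (al \<omega>) z 0"
  define l' where "l' = szego_multiplier (al \<omega>) z' 0"
  define \<mu> where "\<mu> = (1 - al \<omega> 0 * schur_back (al \<omega>) z 0) / complex_of_real (rho (al \<omega> 0))"
  have h: "0 < h" "h \<le> 1" "r' - r \<le> h"
  proof -
    show "0 < h" "h \<le> 1" using r unfolding h_def by (auto simp: field_simps)
    have "h * r = r' - r" using r by (simp add: h_def field_simps)
    moreover have "h * r \<le> h * 1" using r \<open>0 < h\<close> by (intro mult_left_mono) auto
    ultimately show "r' - r \<le> h" by simp
  qed
  have bd: "cmod (s n) \<le> R" "cmod (s' n) \<le> R" "cmod (t n) \<le> 1" for n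
    using norm_schur_plus_le[of "al \<omega>" z n, OF lt z1(1)] norm_schur_plus_le[of "al \<omega>" z' n, OF lt z1(2)]
      norm_schur_minus_le[of "al \<omega>" z n, OF lt z1(1)] zn r by (auto simp: s_def s'_def t_def)
  note b1 = one_minus_schur_mult[OF bd(1) bd(3) r(4)]
  note b2 = one_minus_schur_mult[OF bd(2) bd(3) r(4)]
  have id': "l' * \<mu> * (1 - s' 1 * t 1) = z * (1 - s' 0 * t 0) + (z' - z)"
    using szego_wronskian_identity(1)[of "al \<omega>" z z' 0, OF lt z1(1,2)]
    by (simp add: l'_def \<mu>_def s'_def t_def)
  have id: "l * \<mu> * (1 - s 1 * t 1) = z * (1 - s 0 * t 0)"
    using szego_wronskian_identity(1)[of "al \<omega>" z z 0, OF lt z1(1,1)]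
    by (simp add: l_def \<mu>_def s_def t_def)
  have mu: "\<mu> \<noteq> 0"
    using szego_wronskian_identity(2)[of "al \<omega>" z z 0, OF lt z1(1,1)] by (simp add: \<mu>_def)
  define V where "V = 1 / (1 - s 0 * t 0)"
  define V' where "V' = 1 / (1 - s' 0 * t 0)"
  \<comment> \<open>Along a radius the increment is a positive multiple of \<open>z\<close>;
    therefore the real part of the Green function, and no other combination, governs the
    change.\<close>
  have zz: "z' - z = z * of_real h"
    using r by (simp add: z_def z'_def h_def algebra_simps)
  have f': "l' * \<mu> * (1 - s' 1 * t 1) = z * (1 - s' 0 * t 0) * (1 + of_real h * V')"
    unfolding id' zz V'_def using b2(3)[of 0 0] by (simp add: field_simps)
  have lp: "0 < cmod l" "0 < cmod l'" using pos by (auto simp: l_def l'_def z_def z'_def)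
  have nz: "1 + of_real h * V' \<noteq> 0"
  proof
    assume "1 + of_real h * V' = 0"
    then have "l' * \<mu> * (1 - s' 1 * t 1) = 0" using f' by simp
    then show False using lp mu b2(3)[of 1 1] by auto
  qed
  have logs: "ln (cmod (a * b * d)) = ln (cmod a) + ln (cmod b) + ln (cmod d)" if "a \<noteq> 0" "b \<noteq> 0" "d \<noteq> 0" for a b d
    using that by (simp add: norm_mult ln_mult)
  have L': "ln (cmod l') + ln (cmod \<mu>) + ln (cmod (1 - s' 1 * t 1)) =
      ln (cmod z) + ln (cmod (1 - s' 0 * t 0)) + ln (cmod (1 + of_real h * V'))"
    using arg_cong[OF f', of "\<lambda>u. ln (cmod u)"] lp mu b2(3) nz z1(3) by (subst (asm) logs, simp, simp, simp, subst (asm) logs) auto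
  have L: "ln (cmod l) + ln (cmod \<mu>) + ln (cmod (1 - s 1 * t 1)) = ln (cmod z) + ln (cmod (1 - s 0 * t 0))"
  proof -
    have "ln (cmod l) + ln (cmod \<mu>) + ln (cmod (1 - s 1 * t 1)) = ln (cmod (z * (1 - s 0 * t 0)))"
      unfolding id[symmetric] by (rule logs[symmetric]) (use lp mu b1(3) in auto)
    then show ?thesis using z1(3) b1(3)[of 0 0] by (simp add: norm_mult ln_mult)
  qed
  have cS: "c (S \<omega>) = ln (cmod (1 - s' 1 * t 1)) - ln (cmod (1 - s 1 * t 1))"
    using schur_plus_shift[of "al \<omega>" z 0] schur_plus_shift[of "al \<omega>" z' 0] schur_minus_shift[of "al \<omega>" z 0]
    by (simp add: c_def al_shift[OF \<omega>] s_def s'_def t_def z_def z'_def)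
  have c0: "c \<omega> = ln (cmod (1 - s' 0 * t 0)) - ln (cmod (1 - s 0 * t 0))"
    by (simp add: c_def s_def s'_def t_def z_def z'_def)
  have "ln (cmod l') - ln (cmod l) + c (S \<omega>) - c \<omega> = ln (cmod (1 + of_real h * V'))"
    using L L' unfolding cS c0 by linarith
  also have "\<dots> \<le> Re (of_real h * V') + (cmod (of_real h * V'))\<^sup>2 / 2"
    by (rule ln_norm_one_plus_le) (use nz in \<open>metis add.commute add.inverse_inverse add_eq_0_iff\<close>)
  also have "\<dots> = h * Re V' + h\<^sup>2 * (cmod V')\<^sup>2 / 2"
    by (simp add: norm_mult power_mult_distrib)
  also have "\<dots> \<le> h * (Re V + 2 / (1 - R) ^ 3 * h) + h\<^sup>2 * (1 / (1 - R))\<^sup>2"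
  proof (rule add_mono)
    have V'b: "cmod V' \<le> 1 / (1 - R)" unfolding V'_def norm_divide using b2(1)[of 0 0] r by (simp add: frac_le)
    have Vb: "cmod V \<le> 1 / (1 - R)" unfolding V_def norm_divide using b1(1)[of 0 0] r by (simp add: frac_le)
    have "V' - V = (s' 0 - s 0) * t 0 * V' * V"
      unfolding V_def V'_def using b1(3)[of 0 0] b2(3)[of 0 0] by (simp add: field_simps)
    then have "cmod (V' - V) = cmod (s' 0 - s 0) * cmod (t 0) * cmod V' * cmod V"
      by (simp only: norm_mult)
    also have "\<dots> \<le> (2 / (1 - R) * h) * 1 * (1 / (1 - R)) * (1 / (1 - R))"
    proof (intro mult_mono V'b Vb bd(3))
      have hol: "(\<lambda>z. schur_plus (al \<omega>) z 0) holomorphic_on ball 0 1"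
        unfolding schur_plus_def by (rule holomorphic_schur_lim[OF lt])
      have "cmod (s' 0 - s 0) \<le> 2 / (1 - R) * cmod (z' - z)"
        unfolding s_def s'_def
        by (rule bounded_holomorphic_Lipschitz[OF hol norm_schur_plus_le1[of "al \<omega>", OF lt] r(4)])
           (use zn r in auto)
      also have "cmod (z' - z) = r' - r"
      proof -
        have "z' - z = of_real (r' - r) * \<zeta>" by (simp add: z_def z'_def algebra_simps)
        then show ?thesis using \<zeta> r by (simp only: norm_mult norm_of_real) simp
      qed
      also have "2 / (1 - R) * (r' - r) \<le> 2 / (1 - R) * h" using h(3) r by (intro mult_left_mono) auto
      finally show "cmod (s' 0 - s 0) \<le> 2 / (1 - R) * h" .
    qed (use r h in \<open>auto intro!: mult_nonneg_nonneg\<close>)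
    also have "\<dots> = 2 / (1 - R) ^ 3 * h" by (simp add: power3_eq_cube)
    finally have "Re V' - Re V \<le> 2 / (1 - R) ^ 3 * h"
      using complex_Re_le_cmod[of "V' - V"] by simp
    then show "h * Re V' \<le> h * (Re V + 2 / (1 - R) ^ 3 * h)" using h by (intro mult_left_mono) auto
    have "(cmod V')\<^sup>2 \<le> (1 / (1 - R))\<^sup>2" using V'b by (intro power_mono) auto
    then have "h\<^sup>2 * (cmod V')\<^sup>2 \<le> h\<^sup>2 * (1 / (1 - R))\<^sup>2" by (intro mult_left_mono) auto
    moreover have "0 \<le> h\<^sup>2 * (cmod V')\<^sup>2" by simp
    ultimately show "h\<^sup>2 * (cmod V')\<^sup>2 / 2 \<le> h\<^sup>2 * (1 / (1 - R))\<^sup>2" by linarith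
  qed
  also have "\<dots> = h * Re V + (2 / (1 - R) ^ 3 + 1 / (1 - R)\<^sup>2) * h\<^sup>2"
    by (simp add: algebra_simps power2_eq_square power_divide)
  finally show ?thesis
    by (simp add: l_def l'_def V_def s_def t_def z_def z'_def schur_prod_def)
qed

text \<open>The assumption \<open>V\<close> encodes that the Poisson integral of \<open>k\<close> at
  \<open>of_real r * \<zeta>\<close> is at most \<open>N\<close>, since the Green function is half
  of one plus the Caratheodory function. The summand \<open>1 / 2\<close> is cancelled to first
  order by the term \<open>ln (cmod z) / 2\<close> in \<open>gt\<close>, so the increment is
  controlled by \<open>N\<close> alone.\<close>

lemma gt_difference_bound:
  assumes \<zeta>: "cmod \<zeta> = 1" and r: "1 / 2 \<le> r" "r < r'" "r' \<le> R" "R < 1" and N: "0 \<le> N"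
    and V: "(\<integral>\<omega>. Re (1 / (1 - schur_prod (al \<omega>) (of_real r * \<zeta>))) \<partial>M) \<le> (1 + N) / 2"
  shows "gt (of_real r * \<zeta>) - gt (of_real r' * \<zeta>) \<le> N * (r' - r) + 4 * (2 / (1 - R) ^ 3 + 1 / (1 - R)\<^sup>2 + 1) * (r' - r)\<^sup>2"
proof -
  define z where "z = of_real r * \<zeta>"
  define z' where "z' = of_real r' * \<zeta>"
  have zn: "cmod z = r" "cmod z' = r'" using r \<zeta> by (auto simp: z_def z'_def norm_mult)
  have z1: "cmod z < 1" "cmod z' < 1" "z \<noteq> 0" "z' \<noteq> 0" using zn r by auto
  define h where "h = r' / r - 1"
  define K where "K = 2 / (1 - R) ^ 3 + 1 / (1 - R)\<^sup>2"
  have h: "0 < h" "h \<le> 1" "h \<le> 2 * (r' - r)"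
  proof -
    show "0 < h" "h \<le> 1" using r unfolding h_def by (auto simp: field_simps)
    have "h * r = r' - r" using r by (simp add: h_def field_simps)
    moreover have "h * (1 / 2) \<le> h * r" using r \<open>0 < h\<close> by (intro mult_left_mono) auto
    ultimately show "h \<le> 2 * (r' - r)" by simp
  qed
  define c where "c \<omega> = ln (cmod (1 - schur_plus (al \<omega>) z' 0 * schur_minus (al \<omega>) z 0))
      - ln (cmod (1 - schur_plus (al \<omega>) z 0 * schur_minus (al \<omega>) z 0))" for \<omega>
  define l where "l \<omega> = ln (cmod (szego_multiplier (al \<omega>) z 0))" for \<omega>
  define l' where "l' \<omega> = ln (cmod (szego_multiplier (al \<omega>) z' 0))" for \<omega>
  define V where "V \<omega> = Re (1 / (1 - schur_prod (al \<omega>) z))" for \<omega>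
  have [measurable]: "c \<in> borel_measurable M" unfolding c_def using z1 by measurable
  have st: "1 - R \<le> cmod (1 - schur_plus (al \<omega>) u 0 * schur_minus (al \<omega>) z 0)"
    "cmod (1 - schur_plus (al \<omega>) u 0 * schur_minus (al \<omega>) z 0) \<le> 2" if "\<omega> \<in> space M" "u = z \<or> u = z'" for \<omega> u
  proof -
    have "cmod u < 1" "cmod u \<le> R" using that(2) zn r by auto
    then have "cmod (schur_plus (al \<omega>) u 0) \<le> R" using norm_schur_plus_le[of "al \<omega>" u 0, OF al_less[OF that(1)]] by simp
    then show "1 - R \<le> cmod (1 - schur_plus (al \<omega>) u 0 * schur_minus (al \<omega>) z 0)"
      "cmod (1 - schur_plus (al \<omega>) u 0 * schur_minus (al \<omega>) z 0) \<le> 2"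
      using one_minus_schur_mult[OF _ norm_schur_minus_le[of "al \<omega>" z 0, OF al_less[OF that(1)] z1(1)] r(4)] by auto
  qed
  have ic: "integrable M c"
  proof (rule integrable_const_bound[where B = "2 * (\<bar>ln (1 - R)\<bar> + ln 2)"])
    show "AE \<omega> in M. norm (c \<omega>) \<le> 2 * (\<bar>ln (1 - R)\<bar> + ln 2)"
    proof (rule AE_I2)
      fix \<omega> assume \<omega>: "\<omega> \<in> space M"
      have "\<bar>ln (cmod (1 - schur_plus (al \<omega>) u 0 * schur_minus (al \<omega>) z 0))\<bar> \<le> \<bar>ln (1 - R)\<bar> + ln 2"
        if u: "u = z \<or> u = z'" for u
      proof -
        have "ln (1 - R) \<le> ln (cmod (1 - schur_plus (al \<omega>) u 0 * schur_minus (al \<omega>) z 0))"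
          "ln (cmod (1 - schur_plus (al \<omega>) u 0 * schur_minus (al \<omega>) z 0)) \<le> ln 2"
          using st[OF \<omega> u] r by (auto intro!: ln_le_cancel_iff[THEN iffD2])
        moreover have "0 \<le> ln (2::real)" by simp
        ultimately show ?thesis by linarith
      qed
      from this[of z] this[of z'] show "norm (c \<omega>) \<le> 2 * (\<bar>ln (1 - R)\<bar> + ln 2)"
        by (simp add: c_def)
    qed
  qed measurable
  have icS: "integrable M (\<lambda>\<omega>. c (S \<omega>))"
    using integrable_distr[OF S_meas, of c] ic invariant by simp
  have il: "integrable M l" "integrable M l'"
    unfolding l_def l'_def using integrable_ln_multiplier[OF z1(3,1), of 0] integrable_ln_multiplier[OF z1(4,2), of 0] by auto
  have iV: "integrable M V"
  proof (rule integrable_const_bound[where B = "1 / (1 - R)"])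
    show "AE \<omega> in M. norm (V \<omega>) \<le> 1 / (1 - R)"
    proof (rule AE_I2)
      fix \<omega> assume \<omega>: "\<omega> \<in> space M"
      have "\<bar>V \<omega>\<bar> \<le> cmod (1 / (1 - schur_prod (al \<omega>) z))" unfolding V_def by (rule abs_Re_le_cmod)
      also have "\<dots> \<le> 1 / (1 - R)"
        using st(1)[OF \<omega>, of z] r by (simp add: norm_divide schur_prod_def frac_le)
      finally show "norm (V \<omega>) \<le> 1 / (1 - R)" by simp
    qed
    show "V \<in> borel_measurable M" unfolding V_def using z1 by measurable
  qed
  have "AE \<omega> in M. l' \<omega> - l \<omega> + c (S \<omega>) - c \<omega> \<le> h * V \<omega> + K * h\<^sup>2"
    using AE_ln_multiplier_bound(2)[OF z1(3,1), of 0] AE_ln_multiplier_bound(2)[OF z1(4,2), of 0] AE_space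
  proof eventually_elim
    case (elim \<omega>)
    then show ?case
      using multiplier_ratio_bound[OF elim(3) \<zeta> r] by (simp add: l_def l'_def c_def V_def K_def h_def z_def z'_def)
  qed
  then have "(\<integral>\<omega>. l' \<omega> - l \<omega> + c (S \<omega>) - c \<omega> \<partial>M) \<le> (\<integral>\<omega>. h * V \<omega> + K * h\<^sup>2 \<partial>M)"
    using il ic icS iV by (intro integral_mono_AE) auto
  then have "(\<integral>\<omega>. l' \<omega> \<partial>M) - (\<integral>\<omega>. l \<omega> \<partial>M) + (\<integral>\<omega>. c (S \<omega>) \<partial>M) - (\<integral>\<omega>. c \<omega> \<partial>M) \<le> h * (\<integral>\<omega>. V \<omega> \<partial>M) + K * h\<^sup>2"
    using il ic icS iV by (simp add: prob_space)
  moreover have "(\<integral>\<omega>. c (S \<omega>) \<partial>M) = (\<integral>\<omega>. c \<omega> \<partial>M)" by (rule integral_shift) measurable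
  moreover have "h * (\<integral>\<omega>. V \<omega> \<partial>M) \<le> h * ((1 + N) / 2)"
    using V h by (intro mult_left_mono) (auto simp: V_def z_def)
  moreover have "h - h\<^sup>2 \<le> ln (1 + h)" using h by (intro ln_one_plus_pos_lower_bound) auto
  moreover have "ln (1 + h) = ln r' - ln r" using r by (simp add: h_def ln_div)
  moreover have "gt z - gt z' = (ln r - ln r') / 2 + ((\<integral>\<omega>. l' \<omega> \<partial>M) - (\<integral>\<omega>. l \<omega> \<partial>M))"
    by (simp add: gt_def l_def l'_def zn diff_divide_distrib)
  ultimately have "gt z - gt z' \<le> N / 2 * h + (K + 1 / 2) * h\<^sup>2" by (simp add: field_simps)
  also have "\<dots> \<le> N / 2 * (2 * (r' - r)) + (K + 1) * (2 * (r' - r))\<^sup>2"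
  proof (intro add_mono mult_mono power_mono)
    show "0 \<le> K + 1" using r by (simp add: K_def)
  qed (use h N r in auto)
  also have "\<dots> = N * (r' - r) + 4 * (K + 1) * (r' - r)\<^sup>2" 
    by (simp add: field_simps power2_eq_square)
  finally show ?thesis by (simp add: z_def z'_def K_def)
qed

text \<open>The increments bound \<open>gt\<close> at \<open>r\<close> by its value at
  \<open>r'\<close> plus \<open>N * (r' - r)\<close>, and \<open>gt_le_lcoc\<close> bounds the
  latter value by a mean of \<open>lcoc\<close>. Sending first \<open>r'\<close> to \<open>1\<close>
  and then \<open>n\<close> to infinity leaves \<open>N * (1 - r)\<close>. This factor
  \<open>1 - r\<close> is exactly the one on the left of Kotani's inequality.\<close>

lemma green_function_bound:
  assumes \<zeta>: "cmod \<zeta> = 1" and lyap: "lyapunov_exponent M al \<zeta> = 0" and N: "0 \<le> N"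
    and V: "\<And>t. 1 / 2 \<le> t \<Longrightarrow> t < 1 \<Longrightarrow> (\<integral>\<omega>. Re (1 / (1 - schur_prod (al \<omega>) (of_real t * \<zeta>))) \<partial>M) \<le> (1 + N) / 2"
    and r: "1 / 2 \<le> r" "r < 1"
  shows "(\<integral>\<^sup>+\<omega>. ennreal (cmod (1 / (1 - schur_prod (al \<omega>) (of_real r * \<zeta>)))) \<partial>M) \<le> ennreal (4 * N)"
proof -
  have tele: "gt (of_real r * \<zeta>) \<le> gt (of_real r' * \<zeta>) + N * (r' - r)" if "r < r'" "r' < 1" for r'
  proof -
    have "gt (of_real r * \<zeta>) - gt (of_real r' * \<zeta>) \<le> N * (r' - r)"
    \<comment> \<open>The quadratic coefficient explodes as \<open>r'\<close> tends to
      \<open>1\<close>. That is harmless, because the telescoping removes it while \<open>r'\<close>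
      is still fixed.\<close>
    proof (rule quadratic_error_telescope[where g = "\<lambda>t. gt (of_real t * \<zeta>)" and K = "4 * (2 / (1 - r') ^ 3 + 1 / (1 - r')\<^sup>2 + 1)"])
      fix x y assume "r \<le> x" "x < y" "y \<le> r'"
      then show "gt (of_real x * \<zeta>) - gt (of_real y * \<zeta>) \<le> N * (y - x) + 4 * (2 / (1 - r') ^ 3 + 1 / (1 - r')\<^sup>2 + 1) * (y - x)\<^sup>2"
        using r that by (intro gt_difference_bound \<zeta> N V) auto
    qed (use that in simp)
    then show ?thesis by simp
  qed
  define t where "t k = 1 - (1 - r) / real (Suc (Suc k))" for k
  have t: "r < t k" "t k < 1" "1 / 2 \<le> t k" for k
  proof -
    define e where "e = (1 - r) / real (Suc (Suc k))"
    have "e \<le> (1 - r) / 2" unfolding e_def using r by (intro divide_left_mono) auto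
    then have "2 * e \<le> 1 - r" by simp
    moreover have "0 < e" unfolding e_def using r by simp
    moreover have "t k = 1 - e" by (simp add: t_def e_def)
    ultimately show "r < t k" "t k < 1" "1 / 2 \<le> t k" using r by (simp_all add: field_simps)
  qed
  have tlim: "t \<longlonglongrightarrow> 1"
  proof -
    have "(\<lambda>k. 1 - (1 - r) / real (Suc (Suc k))) \<longlonglongrightarrow> 1 - 0"
      by (intro tendsto_diff tendsto_const LIMSEQ_Suc[OF LIMSEQ_Suc[OF lim_const_over_n]])
    then show ?thesis by (simp add: t_def[abs_def])
  qed
  have bound: "gt (of_real r * \<zeta>) \<le> 1 / real n * (\<integral>\<omega>. lcoc \<zeta> n \<omega> \<partial>M) + ln 2 / real n + N * (1 - r)" if n: "n > 0" for n
  proof -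
    have le: "gt (of_real r * \<zeta>) \<le> 1 / real n * (\<integral>\<omega>. lcoc (of_real (t k) * \<zeta>) n \<omega> \<partial>M) + ln 2 / real n - ln (t k) / 2 + N * (t k - r)" for k
    proof -
      have nz: "of_real (t k) * \<zeta> \<noteq> 0" "cmod (of_real (t k) * \<zeta>) = t k" using t[of k] \<zeta> by (auto simp: norm_mult)
      have "gt (of_real (t k) * \<zeta>) \<le> 1 / real n * (\<integral>\<omega>. lcoc (of_real (t k) * \<zeta>) n \<omega> \<partial>M) + ln 2 / real n - ln (t k) / 2"
        using gt_le_lcoc[OF nz(1) _ n] t[of k] unfolding nz(2) by simp
      then show ?thesis using tele[OF t(1,2)[of k]] by linarith
    qed
    have "(\<lambda>k. 1 / real n * (\<integral>\<omega>. lcoc (of_real (t k) * \<zeta>) n \<omega> \<partial>M) + ln 2 / real n - ln (t k) / 2 + N * (t k - r))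
      \<longlonglongrightarrow> 1 / real n * (\<integral>\<omega>. lcoc \<zeta> n \<omega> \<partial>M) + ln 2 / real n - ln 1 / 2 + N * (1 - r)"
      by (intro tendsto_intros lcoc_radial_limit \<zeta> tlim t(3) less_imp_le[OF t(2)]) auto
    from LIMSEQ_le_const[OF this] le show ?thesis by simp
  qed
  have "(\<lambda>n. 1 / real (Suc n) * (\<integral>\<omega>. lcoc \<zeta> (Suc n) \<omega> \<partial>M) + ln 2 / real (Suc n) + N * (1 - r)) \<longlonglongrightarrow> 0 + 0 + N * (1 - r)"
    by (intro tendsto_add tendsto_const LIMSEQ_Suc[OF lyapunov_zero_limit[OF \<zeta> lyap]] LIMSEQ_Suc[OF lim_const_over_n])
  from LIMSEQ_le_const[OF this] have "gt (of_real r * \<zeta>) \<le> 0 + 0 + N * (1 - r)"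
    using bound by blast
  then have g: "gt (of_real r * \<zeta>) \<le> N * (1 - r)" by simp
  define z where "z = of_real r * \<zeta>"
  have zn: "cmod z = r" "cmod z < 1" "z \<noteq> 0" using r \<zeta> by (auto simp: z_def norm_mult)
  note kot = kotani_inequality[OF zn(3,2)]
  have "(1 - r) * (\<integral>\<omega>. 1 / (1 - (cmod (schur_plus (al \<omega>) z 0))\<^sup>2) \<partial>M) \<le> (1 - r) * (2 * N)"
  proof -
    have "2 * gt z \<le> (1 - r) * (2 * N)" using g by (simp add: z_def algebra_simps)
    then show ?thesis using kot(2) unfolding zn(1) by linarith
  qed
  then have I: "(\<integral>\<omega>. 1 / (1 - (cmod (schur_plus (al \<omega>) z 0))\<^sup>2) \<partial>M) \<le> 2 * N" using r by simp
  have "(\<integral>\<^sup>+\<omega>. ennreal (cmod (1 / (1 - schur_prod (al \<omega>) z))) \<partial>M) \<le>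
      (\<integral>\<^sup>+\<omega>. ennreal (2 * (1 / (1 - (cmod (schur_plus (al \<omega>) z 0))\<^sup>2))) \<partial>M)"
  proof (intro nn_integral_mono ennreal_leI)
    fix \<omega> assume \<omega>: "\<omega> \<in> space M"
    define s where "s = cmod (schur_plus (al \<omega>) z 0)"
    have s: "0 \<le> s" "s < 1" using norm_schur_plus_le[of "al \<omega>" z 0, OF al_less[OF \<omega>] zn(2)] zn by (auto simp: s_def)
    \<comment> \<open>As \<open>schur_minus\<close> is bounded by \<open>1\<close>, the Green
      function is at most \<open>1 / (1 - s)\<close>, hence at most \<open>2 / (1 - s^2)\<close>.
      With the bound \<open>2 * N\<close> on the mean of \<open>1 / (1 - s^2)\<close> this produces
      \<open>4 * N\<close>.\<close>
    have "1 - s \<le> cmod (1 - schur_prod (al \<omega>) z)"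
      using norm_schur_prod_le[of "al \<omega>" z, OF al_less[OF \<omega>] zn(2)] norm_triangle_ineq2[of 1 "schur_prod (al \<omega>) z"]
      by (simp add: s_def)
    then have "cmod (1 / (1 - schur_prod (al \<omega>) z)) \<le> 1 / (1 - s)"
      using s by (simp add: norm_divide frac_le)
    also have "\<dots> = (1 + s) / (1 - s\<^sup>2)"
    proof -
      have "1 - s\<^sup>2 = (1 - s) * (1 + s)" by (simp add: power2_eq_square algebra_simps)
      then show ?thesis using s by simp
    qed
    also have "\<dots> \<le> 2 / (1 - s\<^sup>2)" using s by (intro divide_right_mono) (auto simp: power_le_one)
    finally show "cmod (1 / (1 - schur_prod (al \<omega>) z)) \<le> 2 * (1 / (1 - (cmod (schur_plus (al \<omega>) z 0))\<^sup>2))"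
      by (simp add: s_def)
  qed
  also have "\<dots> = ennreal (\<integral>\<omega>. 2 * (1 / (1 - (cmod (schur_plus (al \<omega>) z 0))\<^sup>2)) \<partial>M)"
  proof (rule nn_integral_eq_integral)
    show "integrable M (\<lambda>\<omega>. 2 * (1 / (1 - (cmod (schur_plus (al \<omega>) z 0))\<^sup>2)))" using kot(1) by (rule integrable_mult_right)
    show "AE \<omega> in M. 0 \<le> 2 * (1 / (1 - (cmod (schur_plus (al \<omega>) z 0))\<^sup>2))"
    proof (rule AE_I2)
      fix \<omega> assume \<omega>: "\<omega> \<in> space M"
      have "cmod (schur_plus (al \<omega>) z 0) \<le> 1" using norm_schur_plus_le1[of "al \<omega>" z 0, OF al_less[OF \<omega>] zn(2)] .
      then show "0 \<le> 2 * (1 / (1 - (cmod (schur_plus (al \<omega>) z 0))\<^sup>2))" by (simp add: power_le_one)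
    qed
  qed
  also have "(\<integral>\<omega>. 2 * (1 / (1 - (cmod (schur_plus (al \<omega>) z 0))\<^sup>2)) \<partial>M) = 2 * (\<integral>\<omega>. 1 / (1 - (cmod (schur_plus (al \<omega>) z 0))\<^sup>2) \<partial>M)"
    by (rule integral_mult_right_zero)
  also have "ennreal \<dots> \<le> ennreal (4 * N)" using I by (intro ennreal_leI) simp
  finally show ?thesis by (simp add: z_def)
qed

end

section \<open>Averages of truncated Caratheodory functions\<close>

text \<open>Parseval reduces the claim to
  \<open>(r ^ n - r' ^ n)^2 \<le> (r ^ n)^2 - (r' ^ n)^2\<close> for each Taylor coefficient.
  Bounded monotone square means then make radial values Cauchy in mean square, which stands in for
  the theorem on radial limits.\<close>

lemma holomorphic_L2_increment:
  fixes f :: "complex \<Rightarrow> complex"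
  assumes f: "f holomorphic_on ball 0 1" and le: "\<And>z. cmod z < 1 \<Longrightarrow> cmod (f z) \<le> 1"
    and r: "0 \<le> r'" "r' \<le> r" "r < 1"
  shows "(\<integral>\<zeta>. (cmod (f (of_real r * \<zeta>) - f (of_real r' * \<zeta>)))\<^sup>2 \<partial>arc_length) \<le>
    (\<integral>\<zeta>. (cmod (f (of_real r * \<zeta>)))\<^sup>2 \<partial>arc_length) - (\<integral>\<zeta>. (cmod (f (of_real r' * \<zeta>)))\<^sup>2 \<partial>arc_length)"
proof -
  define a where "a n = (deriv ^^ n) f 0 / fact n" for n
  define R where "R = (1 + r) / 2"
  have R: "0 < R" "R < 1" "r < R" using r by (auto simp: R_def)
  have an: "cmod (a n) \<le> 1 / R ^ n" for n
  proof -
    have "cmod ((deriv ^^ n) f 0) \<le> fact n * 1 / R ^ n"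
    proof (rule Cauchy_inequality)
      show "f holomorphic_on ball 0 R" using f R by (auto intro: holomorphic_on_subset)
      have "cball 0 R \<subseteq> ball (0::complex) 1" using R by auto
      then show "continuous_on (cball 0 R) f"
        using f by (meson holomorphic_on_imp_continuous_on holomorphic_on_subset)
    qed (use R le in auto)
    then show ?thesis by (simp add: a_def norm_divide field_simps)
  qed
  have sm: "summable (\<lambda>n. norm (a n * of_real x ^ n))" if "0 \<le> x" "x \<le> r" for x
  proof (rule summable_comparison_test')
    show "summable (\<lambda>n. (r / R) ^ n)" using R r by (intro summable_geometric) auto
    fix n :: nat
    have "norm (a n * of_real x ^ n) = cmod (a n) * x ^ n" using that by (simp add: norm_mult norm_power)
    also have "\<dots> \<le> 1 / R ^ n * r ^ n" using an[of n] that R by (intro mult_mono power_mono) auto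
    finally show "norm (norm (a n * of_real x ^ n)) \<le> (r / R) ^ n" by (simp add: power_divide)
  qed
  have smr: "summable (\<lambda>n. norm (a n * of_real r ^ n))" "summable (\<lambda>n. norm (a n * of_real r' ^ n))"
    using sm[of r] sm[of r'] r by auto
  have smd: "summable (\<lambda>n. norm (a n * of_real r ^ n - a n * of_real r' ^ n))"
    by (rule summable_comparison_test'[OF summable_add[OF smr]]) (simp add: norm_triangle_ineq4)
  have ser: "(\<lambda>n. (a n * of_real x ^ n) * \<zeta> ^ n) sums f (of_real x * \<zeta>)" if "0 \<le> x" "x \<le> r" "cmod \<zeta> = 1" for x \<zeta>
  proof -
    have "(\<lambda>n. a n * (of_real x * \<zeta> - 0) ^ n) sums f (of_real x * \<zeta>)"
      unfolding a_def using that r by (intro holomorphic_power_series[OF f]) (simp add: norm_mult)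
    then show ?thesis by (simp add: power_mult_distrib mult.assoc)
  qed
  have serd: "(\<lambda>n. (a n * of_real r ^ n - a n * of_real r' ^ n) * \<zeta> ^ n) sums (f (of_real r * \<zeta>) - f (of_real r' * \<zeta>))"
    if "cmod \<zeta> = 1" for \<zeta>
    using sums_diff[OF ser[of r \<zeta>] ser[of r' \<zeta>]] r that by (simp add: left_diff_distrib)
  have I: "(\<integral>\<zeta>. (cmod (g \<zeta>))\<^sup>2 \<partial>arc_length) = 2 * pi * (\<Sum>n. (cmod (b n))\<^sup>2)"
    if "summable (\<lambda>n. norm (b n))" "\<And>\<zeta>. cmod \<zeta> = 1 \<Longrightarrow> (\<lambda>n. b n * \<zeta> ^ n) sums g \<zeta>" for b g
  proof -
    have "(\<integral>\<zeta>. (cmod (g \<zeta>))\<^sup>2 \<partial>arc_length) = (\<integral>\<zeta>. (cmod (\<Sum>n. b n * \<zeta> ^ n))\<^sup>2 \<partial>arc_length)"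
      using that(2) by (intro Bochner_Integration.integral_cong) (auto simp: sums_iff)
    then show ?thesis using parseval_series(2)[OF that(1)] by simp
  qed
  have Ir: "(\<integral>\<zeta>. (cmod (f (of_real r * \<zeta>)))\<^sup>2 \<partial>arc_length) = 2 * pi * (\<Sum>n. (cmod (a n * of_real r ^ n))\<^sup>2)"
    by (rule I[OF smr(1)]) (use ser r in auto)
  have Ir': "(\<integral>\<zeta>. (cmod (f (of_real r' * \<zeta>)))\<^sup>2 \<partial>arc_length) = 2 * pi * (\<Sum>n. (cmod (a n * of_real r' ^ n))\<^sup>2)"
    by (rule I[OF smr(2)]) (use ser r in auto)
  have Id: "(\<integral>\<zeta>. (cmod (f (of_real r * \<zeta>) - f (of_real r' * \<zeta>)))\<^sup>2 \<partial>arc_length) =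
      2 * pi * (\<Sum>n. (cmod (a n * of_real r ^ n - a n * of_real r' ^ n))\<^sup>2)"
    by (rule I[OF smd serd])
  have "(\<Sum>n. (cmod (a n * of_real r ^ n - a n * of_real r' ^ n))\<^sup>2) \<le>
      (\<Sum>n. (cmod (a n * of_real r ^ n))\<^sup>2 - (cmod (a n * of_real r' ^ n))\<^sup>2)"
  proof (rule suminf_le)
    fix n
    have p: "0 \<le> r' ^ n" "r' ^ n \<le> r ^ n" using r by (auto intro: power_mono)
    have "a n * of_real r ^ n - a n * of_real r' ^ n = a n * of_real (r ^ n - r' ^ n)" by (simp add: algebra_simps)
    then have "(cmod (a n * of_real r ^ n - a n * of_real r' ^ n))\<^sup>2 = (cmod (a n))\<^sup>2 * (r ^ n - r' ^ n)\<^sup>2"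
      by (simp only: norm_mult norm_of_real power_mult_distrib power2_abs)
    also have "\<dots> \<le> (cmod (a n))\<^sup>2 * ((r ^ n)\<^sup>2 - (r' ^ n)\<^sup>2)"
    proof (rule mult_left_mono)
      have "0 \<le> 2 * r' ^ n * (r ^ n - r' ^ n)" using p by (intro mult_nonneg_nonneg) auto
      then show "(r ^ n - r' ^ n)\<^sup>2 \<le> (r ^ n)\<^sup>2 - (r' ^ n)\<^sup>2" by (simp add: power2_eq_square algebra_simps)
    qed simp
    also have "\<dots> = (cmod (a n * of_real r ^ n))\<^sup>2 - (cmod (a n * of_real r' ^ n))\<^sup>2"
      by (simp add: norm_mult norm_power power_mult_distrib right_diff_distrib power_even_abs flip: power_mult)
    finally show "(cmod (a n * of_real r ^ n - a n * of_real r' ^ n))\<^sup>2 \<le>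
      (cmod (a n * of_real r ^ n))\<^sup>2 - (cmod (a n * of_real r' ^ n))\<^sup>2" .
  qed (intro parseval_series(1)[OF smd] summable_diff parseval_series(1)[OF smr(1)] parseval_series(1)[OF smr(2)])+
  also have "\<dots> = (\<Sum>n. (cmod (a n * of_real r ^ n))\<^sup>2) - (\<Sum>n. (cmod (a n * of_real r' ^ n))\<^sup>2)"
    by (intro suminf_diff[symmetric] parseval_series(1)[OF smr(1)] parseval_series(1)[OF smr(2)])
  finally show ?thesis unfolding Ir Ir' Id right_diff_distrib[symmetric] by simp
qed

lemma measurable_circle_id [measurable]: "(\<lambda>x. x) \<in> borel_measurable circle_borel"
  by (rule borel_measurable_circle_borel) simp

lemma measurable_circle_fst [measurable]: "fst \<in> borel_measurable (circle_borel \<Otimes>\<^sub>M N)"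
  by (rule measurable_compose[OF measurable_fst measurable_circle_id])

lemma measurable_circle_snd [measurable]: "snd \<in> borel_measurable (N \<Otimes>\<^sub>M circle_borel)"
  by (rule measurable_compose[OF measurable_snd measurable_circle_id])

lemma measurable_poisson_pair [measurable]:
  "(\<lambda>p. poisson (of_real r * fst p) (snd p)) \<in> borel_measurable (circle_borel \<Otimes>\<^sub>M circle_borel)"
  unfolding poisson_def by measurable

lemma nn_integral_poisson: "cmod z < 1 \<Longrightarrow> (\<integral>\<^sup>+\<zeta>. ennreal (poisson z \<zeta>) \<partial>arc_length) = ennreal (2 * pi)"
proof -
  assume z: "cmod z < 1"
  have i: "integrable arc_length (poisson z)"
    by (rule integrable_arc_continuous[OF poisson_continuous[OF z]])
  have "complex_of_real (\<integral>\<zeta>. poisson z \<zeta> \<partial>arc_length) = 2 * pi"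
    using poisson_formula[of "\<lambda>_. 1" 0 z] z by simp
  then have "(\<integral>\<zeta>. poisson z \<zeta> \<partial>arc_length) = 2 * pi" by (metis of_real_eq_iff)
  then show ?thesis
    using i z by (subst nn_integral_eq_integral) (auto simp: poisson_nonneg)
qed

lemma poisson_mass_far:
  assumes \<tau>: "cmod \<tau> = 1" and r: "0 \<le> r" "r < 1" and d: "0 < \<delta>" and X: "X \<in> sets circle_borel"
    and far: "\<And>\<zeta>. \<zeta> \<in> X \<Longrightarrow> \<delta> \<le> cmod (\<tau> - \<zeta>)"
  shows "(\<integral>\<^sup>+\<zeta>\<in>X. ennreal (poisson (of_real r * \<zeta>) \<tau>) \<partial>arc_length) \<le> ennreal (16 * pi * (1 - r) / \<delta>\<^sup>2)"
proof -
  have "(\<integral>\<^sup>+\<zeta>\<in>X. ennreal (poisson (of_real r * \<zeta>) \<tau>) \<partial>arc_length) \<le> (\<integral>\<^sup>+\<zeta>. ennreal (8 * (1 - r) / \<delta>\<^sup>2) \<partial>arc_length)"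
    using far poisson_far[OF _ \<tau> r d]
    by (intro nn_integral_mono) (auto simp: indicator_def intro!: ennreal_leI)
  also have "\<dots> = ennreal (8 * (1 - r) / \<delta>\<^sup>2) * ennreal (2 * pi)"
    by (simp add: emeasure_arc_length_space)
  also have "\<dots> = ennreal (16 * pi * (1 - r) / \<delta>\<^sup>2)"
    using r by (subst ennreal_mult[symmetric]) (auto simp: field_simps)
  finally show ?thesis .
qed

lemma poisson_mass_le:
  assumes \<tau>: "cmod \<tau> = 1" and r: "0 \<le> r" "r < 1"
  shows "(\<integral>\<^sup>+\<zeta>\<in>X. ennreal (poisson (of_real r * \<zeta>) \<tau>) \<partial>arc_length) \<le> ennreal (2 * pi)"
proof -
  have "(\<integral>\<^sup>+\<zeta>\<in>X. ennreal (poisson (of_real r * \<zeta>) \<tau>) \<partial>arc_length) \<le> (\<integral>\<^sup>+\<zeta>. ennreal (poisson (of_real r * \<tau>) \<zeta>) \<partial>arc_length)"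
    using poisson_symmetric[OF _ \<tau>, of _ r] by (intro nn_integral_mono) (auto simp: indicator_def)
  also have "\<dots> = ennreal (2 * pi)" using r \<tau> by (intro nn_integral_poisson) (simp add: norm_mult)
  finally show ?thesis .
qed

text \<open>\<open>infdist\<close> from the empty set is \<open>0\<close>, so for positive
  \<open>\<delta>\<close> the neighbourhood of \<open>{}\<close> is the whole circle. Empty sets are
  therefore treated apart wherever neighbourhoods shrink.\<close>

definition circle_nbhd :: "complex set \<Rightarrow> real \<Rightarrow> complex set" where
  "circle_nbhd A \<delta> = {\<xi> \<in> sphere 0 1. infdist \<xi> A < \<delta>}"

lemma measurable_infdist_circle [measurable]: "(\<lambda>x. infdist x A) \<in> borel_measurable circle_borel"
  by (intro borel_measurable_circle_continuous continuous_intros)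

lemma sets_circle_nbhd [measurable]: "circle_nbhd A \<delta> \<in> sets circle_borel"
proof -
  have "circle_nbhd A \<delta> = {\<xi> \<in> space circle_borel. infdist \<xi> A < \<delta>}" by (simp add: circle_nbhd_def)
  also have "\<dots> \<in> sets circle_borel" by measurable
  finally show ?thesis .
qed

lemma circle_closed_sets: "closed A \<Longrightarrow> A \<subseteq> sphere 0 1 \<Longrightarrow> A \<in> sets circle_borel"
  by (auto simp: sets_circle_borel_iff)

lemma circle_nbhd_INT:
  assumes "closed A" "A \<noteq> {}" "A \<subseteq> sphere 0 1" "c > 0"
  shows "(\<Inter>n. circle_nbhd A (c / real (Suc n))) = A"
proof (intro equalityI subsetI)
  fix x assume x: "x \<in> (\<Inter>n. circle_nbhd A (c / real (Suc n)))"
  have "infdist x A \<le> 0"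
  proof (rule LIMSEQ_le_const)
    show "(\<lambda>n. c / real (Suc n)) \<longlonglongrightarrow> 0" by (rule LIMSEQ_Suc[OF lim_const_over_n])
    have "infdist x A \<le> c / real (Suc n)" for n using x by (auto simp: circle_nbhd_def less_imp_le)
    then show "\<exists>N. \<forall>n\<ge>N. infdist x A \<le> c / real (Suc n)" by blast
  qed
  then have "infdist x A = 0" using infdist_nonneg[of x A] by linarith
  then show "x \<in> A" using in_closed_iff_infdist_zero[OF assms(1,2)] by simp
next
  fix x assume "x \<in> A"
  then show "x \<in> (\<Inter>n. circle_nbhd A (c / real (Suc n)))" using assms by (auto simp: circle_nbhd_def)
qed

text \<open>An abstraction of \<open>schur_prod\<close>. The bound by \<open>|z|\<close> makes each
  function vanish at \<open>0\<close>, which normalises the mean \<open>H\<close> there;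
  measurability is joint on each circle of radius less than \<open>1\<close>.\<close>

locale schur_family = prob_space M for M :: "'a measure" +
  fixes w :: "'a \<Rightarrow> complex \<Rightarrow> complex"
  assumes hol: "\<omega> \<in> space M \<Longrightarrow> w \<omega> holomorphic_on ball 0 1"
    and w_le: "\<omega> \<in> space M \<Longrightarrow> cmod z < 1 \<Longrightarrow> cmod (w \<omega> z) \<le> cmod z"
    and w_meas: "0 \<le> r \<Longrightarrow> r < 1 \<Longrightarrow> (\<lambda>p. w (fst p) (of_real r * snd p)) \<in> borel_measurable (M \<Otimes>\<^sub>M circle_borel)"
begin

definition cay :: "real \<Rightarrow> complex \<Rightarrow> complex" where
  "cay \<kappa> u = (1 + of_real \<kappa> * u) / (1 - of_real \<kappa> * u)"

lemma cay_nonneg: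
  assumes "0 \<le> \<kappa>" "\<kappa> \<le> 1" "cmod u \<le> 1"
  shows "0 \<le> Re (cay \<kappa> u)"
proof -
  define v where "v = of_real \<kappa> * u"
  have v: "cmod v \<le> 1" using mult_mono[of \<kappa> 1 "cmod u" 1] assms by (simp add: v_def norm_mult)
  have "Re ((1 + v) / (1 - v)) = (1 - (cmod v)\<^sup>2) / (cmod (1 - v))\<^sup>2"
    unfolding Re_divide cmod_power2 by (simp add: power2_eq_square algebra_simps)
  moreover have "0 \<le> (1 - (cmod v)\<^sup>2) / (cmod (1 - v))\<^sup>2" using v by (simp add: power_le_one)
  ultimately show ?thesis unfolding cay_def v_def by simp
qed

text \<open>The first bound is uniform in \<kappa> because
  \<open>|1 - u| \<le> 2 * |1 - \<kappa> u|\<close> on the closed disc; it dominates the passage of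
  \<kappa> to \<open>1\<close>. The second is uniform in \<open>u\<close> and serves the radial
  limit at fixed \<kappa>.\<close>

lemma cay_bound:
  assumes "0 \<le> \<kappa>" "\<kappa> \<le> 1" "cmod u \<le> 1"
  shows "u \<noteq> 1 \<Longrightarrow> cmod (cay \<kappa> u) \<le> 4 * cmod (1 / (1 - u))"
    and "\<kappa> < 1 \<Longrightarrow> cmod (cay \<kappa> u) \<le> 2 / (1 - \<kappa>)"
proof -
  define v where "v = of_real \<kappa> * u"
  have v: "cmod v \<le> \<kappa>" using mult_left_mono[of "cmod u" 1 \<kappa>] assms by (simp add: v_def norm_mult)
  have n: "cmod (1 + v) \<le> 2" using norm_triangle_ineq[of 1 v] v assms by simp
  have lo: "1 - \<kappa> \<le> cmod (1 - v)" using norm_triangle_ineq2[of 1 v] v by simp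
  show "cmod (cay \<kappa> u) \<le> 2 / (1 - \<kappa>)" if "\<kappa> < 1"
    unfolding cay_def v_def[symmetric] norm_divide using n lo that by (intro frac_le) auto
  assume u: "u \<noteq> 1"
  have "1 - u = (1 - v) - of_real (1 - \<kappa>) * u" by (simp add: v_def algebra_simps)
  then have "cmod (1 - u) \<le> cmod (1 - v) + cmod (of_real (1 - \<kappa>) * u)" by (simp only: norm_triangle_ineq4)
  also have "cmod (of_real (1 - \<kappa>) * u) \<le> 1 - \<kappa>"
    using mult_left_mono[of "cmod u" 1 "1 - \<kappa>"] assms by (simp add: norm_mult del: of_real_diff)
  finally have "cmod (1 - u) \<le> 2 * cmod (1 - v)" using lo by simp
  moreover have u0: "0 < cmod (1 - u)" using u by simp
  ultimately have "4 / (2 * cmod (1 - v)) \<le> 4 / cmod (1 - u)" by (intro divide_left_mono mult_pos_pos) linarith+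
  then have "2 / cmod (1 - v) \<le> 4 / cmod (1 - u)" by simp
  moreover have "cmod (1 + v) / cmod (1 - v) \<le> 2 / cmod (1 - v)" using n by (intro divide_right_mono) auto
  ultimately show "cmod (cay \<kappa> u) \<le> 4 * cmod (1 / (1 - u))"
    unfolding cay_def v_def[symmetric] norm_divide by simp
qed

lemma cay_measurable [measurable]: "cay \<kappa> \<in> borel_measurable borel"
  unfolding cay_def by measurable

definition H :: "real \<Rightarrow> complex \<Rightarrow> ennreal" where
  "H \<kappa> z = (\<integral>\<^sup>+\<omega>. ennreal (Re (cay \<kappa> (w \<omega> z))) \<partial>M)"

lemma w_less: "\<omega> \<in> space M \<Longrightarrow> cmod z < 1 \<Longrightarrow> cmod (w \<omega> z) < 1"
  using w_le[of \<omega> z] by linarith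

lemma denom_nonzero: "\<omega> \<in> space M \<Longrightarrow> cmod z < 1 \<Longrightarrow> 0 \<le> \<kappa> \<Longrightarrow> \<kappa> \<le> 1 \<Longrightarrow> 1 - of_real \<kappa> * w \<omega> z \<noteq> 0"
proof -
  assume a: "\<omega> \<in> space M" "cmod z < 1" "0 \<le> \<kappa>" "\<kappa> \<le> 1"
  have "cmod (of_real \<kappa> * w \<omega> z) < 1"
    using w_less[OF a(1,2)] mult_right_mono[of \<kappa> 1 "cmod (w \<omega> z)"] a by (simp add: norm_mult)
  then show ?thesis by auto
qed

lemma cay_holomorphic:
  assumes "\<omega> \<in> space M" "0 \<le> \<kappa>" "\<kappa> \<le> 1"
  shows "(\<lambda>z. cay \<kappa> (w \<omega> z)) holomorphic_on ball 0 1"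
  unfolding cay_def using assms hol[OF assms(1)] by (intro holomorphic_intros) (use denom_nonzero[OF assms(1) _ assms(2,3)] in auto)

lemma joint_meas [measurable]:
  assumes "0 \<le> r" "r < 1"
  shows "(\<lambda>p. Re (cay \<kappa> (w (fst p) (of_real r * snd p)))) \<in> borel_measurable (M \<Otimes>\<^sub>M circle_borel)"
proof -
  have "(\<lambda>p. cay \<kappa> (w (fst p) (of_real r * snd p))) \<in> borel_measurable (M \<Otimes>\<^sub>M circle_borel)"
    by (rule measurable_compose[OF w_meas[OF assms] cay_measurable])
  then show ?thesis by measurable
qed

lemma joint_meas_swap:
  assumes "0 \<le> r" "r < 1"
  shows "(\<lambda>p. Re (cay \<kappa> (w (snd p) (of_real r * fst p)))) \<in> borel_measurable (circle_borel \<Otimes>\<^sub>M M)"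
  using measurable_compose[OF measurable_pair_swap' joint_meas[OF assms, of \<kappa>]]
  by (simp add: case_prod_beta')

lemma H_meas [measurable]:
  assumes "0 \<le> r" "r < 1"
  shows "(\<lambda>\<zeta>. H \<kappa> (of_real r * \<zeta>)) \<in> borel_measurable circle_borel"
  unfolding H_def
proof (rule borel_measurable_nn_integral)
  have [measurable]: "(\<lambda>p. Re (cay \<kappa> (w (snd p) (of_real r * fst p)))) \<in> borel_measurable (circle_borel \<Otimes>\<^sub>M M)"
    by (rule joint_meas_swap[OF assms])
  show "(\<lambda>(\<zeta>, \<omega>). ennreal (Re (cay \<kappa> (w \<omega> (of_real r * \<zeta>))))) \<in> borel_measurable (circle_borel \<Otimes>\<^sub>M M)"
    unfolding case_prod_beta' by measurable
qed

lemma slice_meas: "cmod z < 1 \<Longrightarrow> (\<lambda>\<omega>. w \<omega> z) \<in> borel_measurable M"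
proof -
  assume z: "cmod z < 1"
  define \<zeta> where "\<zeta> = (if z = 0 then 1 else z / of_real (cmod z))"
  have e: "z = of_real (cmod z) * \<zeta>" "\<zeta> \<in> sphere 0 1" by (auto simp: \<zeta>_def norm_divide)
  have "(\<lambda>\<omega>. w \<omega> (of_real (cmod z) * \<zeta>)) \<in> borel_measurable M"
    using measurable_compose[OF measurable_Pair2'[of \<zeta> circle_borel M] w_meas[of "cmod z"]] e(2) z by simp
  then show ?thesis using e(1) by simp
qed

lemma nn_integral_poisson_cay:
  assumes \<omega>: "\<omega> \<in> space M" and z: "cmod z < 1" and r: "0 \<le> r" "r < 1" and \<kappa>: "0 \<le> \<kappa>" "\<kappa> \<le> 1"
  shows "(\<integral>\<^sup>+\<zeta>. ennreal (poisson z \<zeta>) * ennreal (Re (cay \<kappa> (w \<omega> (of_real r * \<zeta>)))) \<partial>arc_length) =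
    ennreal (2 * pi) * ennreal (Re (cay \<kappa> (w \<omega> (of_real r * z))))"
proof -
  define g where "g = (\<lambda>z. cay \<kappa> (w \<omega> z))"
  have g: "g holomorphic_on ball 0 1" unfolding g_def by (rule cay_holomorphic[OF \<omega> \<kappa>])
  have in_ball: "of_real r * \<zeta> \<in> ball 0 1" if "cmod \<zeta> \<le> 1" for \<zeta> :: complex
    using that r mult_left_mono[of "cmod \<zeta>" 1 r] by (simp add: norm_mult)
  have gc: "continuous_on (sphere 0 1) (\<lambda>\<zeta>. g (of_real r * \<zeta>))"
    by (rule continuous_on_compose2[OF holomorphic_on_imp_continuous_on[OF g]])
       (use in_ball in \<open>auto intro!: continuous_intros\<close>)
  have g0: "0 \<le> Re (g (of_real r * \<zeta>))" if "cmod \<zeta> \<le> 1" for \<zeta>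
    unfolding g_def using in_ball[OF that] w_less[OF \<omega>, of "of_real r * \<zeta>"] by (intro cay_nonneg \<kappa>) auto
  have cont: "continuous_on (sphere 0 1) (\<lambda>\<zeta>. complex_of_real (poisson z \<zeta>) * g (of_real r * \<zeta>))"
    by (intro continuous_intros gc poisson_continuous z)
  have int: "integrable arc_length (\<lambda>\<zeta>. complex_of_real (poisson z \<zeta>) * g (of_real r * \<zeta>))"
    by (rule integrable_arc_continuous[OF cont])
  have "(\<integral>\<^sup>+\<zeta>. ennreal (poisson z \<zeta>) * ennreal (Re (g (of_real r * \<zeta>))) \<partial>arc_length) =
      (\<integral>\<^sup>+\<zeta>. ennreal (Re (complex_of_real (poisson z \<zeta>) * g (of_real r * \<zeta>))) \<partial>arc_length)"
    using z g0 by (intro nn_integral_cong) (simp add: ennreal_mult poisson_nonneg)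
  also have "\<dots> = ennreal (\<integral>\<zeta>. Re (complex_of_real (poisson z \<zeta>) * g (of_real r * \<zeta>)) \<partial>arc_length)"
    using int z g0 by (intro nn_integral_eq_integral integrable_Re) (auto simp: poisson_nonneg)
  also have "(\<integral>\<zeta>. Re (complex_of_real (poisson z \<zeta>) * g (of_real r * \<zeta>)) \<partial>arc_length) = Re (2 * pi * g (of_real r * z))"
    using integral_Re[OF int] poisson_formula[OF g r z] by simp
  also have "ennreal (Re (2 * pi * g (of_real r * z))) = ennreal (2 * pi) * ennreal (Re (g (of_real r * z)))"
    using g0[of z] z by (subst ennreal_mult[symmetric]) auto
  finally show ?thesis by (simp add: g_def)
qed

text \<open>A mean of nonnegative harmonic functions is harmonic; with values in
  \<open>ennreal\<close> the two integrals are exchanged without an integrability condition.\<close>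

lemma H_poisson:
  assumes z: "cmod z < 1" and r: "0 \<le> r" "r < 1" and \<kappa>: "0 \<le> \<kappa>" "\<kappa> \<le> 1"
  shows "(\<integral>\<^sup>+\<zeta>. ennreal (poisson z \<zeta>) * H \<kappa> (of_real r * \<zeta>) \<partial>arc_length) = ennreal (2 * pi) * H \<kappa> (of_real r * z)"
proof -
  interpret P: pair_sigma_finite arc_length M ..
  have ms [measurable]: "(\<lambda>p. Re (cay \<kappa> (w (snd p) (of_real r * fst p)))) \<in> borel_measurable (arc_length \<Otimes>\<^sub>M M)"
    using joint_meas_swap[OF r, of \<kappa>] by (subst measurable_cong_sets[OF sets_pair_measure_cong[OF sets_arc_length refl] refl])
  have mp [measurable]: "poisson z \<in> borel_measurable arc_length"
    unfolding borel_measurable_arc_length by (rule borel_measurable_circle_continuous[OF poisson_continuous[OF z]])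
  have slice [measurable]: "(\<lambda>\<omega>. Re (cay \<kappa> (w \<omega> (of_real r * \<zeta>)))) \<in> borel_measurable M" if "cmod \<zeta> = 1" for \<zeta>
    using measurable_compose[OF measurable_Pair1'[of \<zeta> circle_borel M] joint_meas_swap[OF r, of \<kappa>]] that by simp
  have rz: "cmod (of_real r * z) < 1" using r z mult_left_mono[of "cmod z" 1 r] by (simp add: norm_mult)
  have slz: "(\<lambda>\<omega>. Re (cay \<kappa> (w \<omega> (of_real r * z)))) \<in> borel_measurable M"
    using slice_meas[OF rz] by measurable
  have "(\<integral>\<^sup>+\<zeta>. ennreal (poisson z \<zeta>) * H \<kappa> (of_real r * \<zeta>) \<partial>arc_length) =
     (\<integral>\<^sup>+\<zeta>. \<integral>\<^sup>+\<omega>. ennreal (poisson z \<zeta>) * ennreal (Re (cay \<kappa> (w \<omega> (of_real r * \<zeta>)))) \<partial>M \<partial>arc_length)"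
    unfolding H_def by (intro nn_integral_cong nn_integral_cmult[symmetric]) auto
  also have "\<dots> = (\<integral>\<^sup>+\<omega>. \<integral>\<^sup>+\<zeta>. ennreal (poisson z \<zeta>) * ennreal (Re (cay \<kappa> (w \<omega> (of_real r * \<zeta>)))) \<partial>arc_length \<partial>M)"
    by (rule P.Fubini'[symmetric]) (unfold case_prod_beta', measurable)
  also have "\<dots> = (\<integral>\<^sup>+\<omega>. ennreal (2 * pi) * ennreal (Re (cay \<kappa> (w \<omega> (of_real r * z)))) \<partial>M)"
    by (intro nn_integral_cong nn_integral_poisson_cay z r \<kappa>)
  also have "\<dots> = ennreal (2 * pi) * H \<kappa> (of_real r * z)"
    unfolding H_def using slz by (intro nn_integral_cmult) auto
  finally show ?thesis .
qed

lemma w_0: "\<omega> \<in> space M \<Longrightarrow> w \<omega> 0 = 0"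
  using w_le[of \<omega> 0] by simp

lemma H_0: "H \<kappa> 0 = 1"
proof -
  have "H \<kappa> 0 = (\<integral>\<^sup>+\<omega>. ennreal 1 \<partial>M)"
    unfolding H_def by (intro nn_integral_cong) (simp add: w_0 cay_def)
  then show ?thesis by (simp add: emeasure_space_1)
qed

lemma H_total:
  assumes r: "0 \<le> r" "r < 1" and \<kappa>: "0 \<le> \<kappa>" "\<kappa> \<le> 1"
  shows "(\<integral>\<^sup>+\<zeta>. H \<kappa> (of_real r * \<zeta>) \<partial>arc_length) = ennreal (2 * pi)"
proof -
  have "(\<integral>\<^sup>+\<zeta>. H \<kappa> (of_real r * \<zeta>) \<partial>arc_length) = (\<integral>\<^sup>+\<zeta>. ennreal (poisson 0 \<zeta>) * H \<kappa> (of_real r * \<zeta>) \<partial>arc_length)"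
    by (intro nn_integral_cong) (simp add: poisson_def)
  then show ?thesis using H_poisson[OF _ r \<kappa>, of 0] by (simp add: H_0)
qed

text \<open>Values at radius \<open>r'\<close> are Poisson averages, with parameter
  \<open>r' / r\<close>, of values at radius \<open>r\<close>. Points outside the doubled
  neighbourhood are at distance at least \<open>\<delta>\<close> from the original one and
  contribute only the error term, because \<open>H\<close> has total mass \<open>2 * pi\<close> on
  every circle.\<close>

lemma H_smoothing:
  assumes r: "0 \<le> r'" "r' < r" "r < 1" and \<kappa>: "0 \<le> \<kappa>" "\<kappa> \<le> 1" and d: "0 < \<delta>"
  shows "(\<integral>\<^sup>+\<zeta>\<in>circle_nbhd A \<delta>. H \<kappa> (of_real r' * \<zeta>) \<partial>arc_length) \<le>
    (\<integral>\<^sup>+\<xi>\<in>circle_nbhd A (2 * \<delta>). H \<kappa> (of_real r * \<xi>) \<partial>arc_length) + ennreal (16 * pi * (1 - r' / r) / \<delta>\<^sup>2)"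
proof -
  interpret P: pair_sigma_finite arc_length arc_length ..
  define q where "q = r' / r"
  have q: "0 \<le> q" "q < 1" using r by (auto simp: q_def)
  have rr: "0 \<le> r" using r by simp
  have qr: "of_real r * (of_real q * \<zeta>) = of_real r' * \<zeta>" for \<zeta> :: complex using r by (simp add: q_def)
  note [measurable] = H_meas[OF rr r(3), of \<kappa>]
  have mp [measurable]: "(\<lambda>p. poisson (of_real q * fst p) (snd p)) \<in> borel_measurable (arc_length \<Otimes>\<^sub>M arc_length)"
    using measurable_poisson_pair[of q] by (subst measurable_cong_sets[OF sets_pair_measure_cong[OF sets_arc_length sets_arc_length] refl])
  let ?D = "circle_nbhd A \<delta>" and ?D2 = "circle_nbhd A (2 * \<delta>)"
  have [measurable]: "(\<lambda>\<zeta>. poisson (of_real q * \<zeta>) \<xi>) \<in> borel_measurable circle_borel" for \<xi>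
    unfolding poisson_def by measurable
  have pc: "poisson (of_real q * \<zeta>) \<in> borel_measurable arc_length" if "cmod \<zeta> = 1" for \<zeta>
    unfolding borel_measurable_arc_length
    by (intro borel_measurable_circle_continuous poisson_continuous) (use that q in \<open>simp add: norm_mult\<close>)
  have pm: "(\<lambda>\<zeta>. indicator ?D \<zeta> * ennreal (poisson (\<zeta> * of_real q) x)) \<in> borel_measurable arc_length" for x
    unfolding poisson_def borel_measurable_arc_length by measurable
  have "ennreal (2 * pi) * (\<integral>\<^sup>+\<zeta>\<in>?D. H \<kappa> (of_real r' * \<zeta>) \<partial>arc_length) =
      (\<integral>\<^sup>+\<zeta>. (ennreal (2 * pi) * H \<kappa> (of_real r * (of_real q * \<zeta>))) * indicator ?D \<zeta> \<partial>arc_length)"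
    unfolding qr using H_meas[of r' \<kappa>] r by (subst nn_integral_cmult[symmetric]) (auto simp: mult_ac)
  also have "\<dots> = (\<integral>\<^sup>+\<zeta>. (\<integral>\<^sup>+\<xi>. ennreal (poisson (of_real q * \<zeta>) \<xi>) * H \<kappa> (of_real r * \<xi>) \<partial>arc_length) * indicator ?D \<zeta> \<partial>arc_length)"
  proof (intro nn_integral_cong)
    fix \<zeta> assume "\<zeta> \<in> space arc_length"
    then have "cmod (of_real q * \<zeta>) < 1" using q by (simp add: norm_mult)
    from H_poisson[OF this rr r(3) \<kappa>]
    show "ennreal (2 * pi) * H \<kappa> (of_real r * (of_real q * \<zeta>)) * indicator ?D \<zeta> =
      (\<integral>\<^sup>+\<xi>. ennreal (poisson (of_real q * \<zeta>) \<xi>) * H \<kappa> (of_real r * \<xi>) \<partial>arc_length) * indicator ?D \<zeta>" by simp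
  qed
  also have "\<dots> = (\<integral>\<^sup>+\<zeta>. \<integral>\<^sup>+\<xi>. ennreal (poisson (of_real q * \<zeta>) \<xi>) * H \<kappa> (of_real r * \<xi>) * indicator ?D \<zeta> \<partial>arc_length \<partial>arc_length)"
    using pc by (intro nn_integral_cong nn_integral_multc[symmetric]) auto
  also have "\<dots> = (\<integral>\<^sup>+\<xi>. \<integral>\<^sup>+\<zeta>. ennreal (poisson (of_real q * \<zeta>) \<xi>) * H \<kappa> (of_real r * \<xi>) * indicator ?D \<zeta> \<partial>arc_length \<partial>arc_length)"
    by (rule P.Fubini'[symmetric]) (unfold case_prod_beta', measurable)
  also have "\<dots> = (\<integral>\<^sup>+\<xi>. H \<kappa> (of_real r * \<xi>) * (\<integral>\<^sup>+\<zeta>\<in>?D. ennreal (poisson (of_real q * \<zeta>) \<xi>) \<partial>arc_length) \<partial>arc_length)"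
    using pm by (intro nn_integral_cong, subst nn_integral_cmult[symmetric]) (auto simp: mult_ac)
  also have "\<dots> \<le> (\<integral>\<^sup>+\<xi>. ennreal (2 * pi) * (H \<kappa> (of_real r * \<xi>) * indicator ?D2 \<xi>) + ennreal (16 * pi * (1 - q) / \<delta>\<^sup>2) * H \<kappa> (of_real r * \<xi>) \<partial>arc_length)"
  proof (intro nn_integral_mono)
    fix \<xi> assume "\<xi> \<in> space arc_length"
    then have \<xi>: "cmod \<xi> = 1" by simp
    show "H \<kappa> (of_real r * \<xi>) * (\<integral>\<^sup>+\<zeta>\<in>?D. ennreal (poisson (of_real q * \<zeta>) \<xi>) \<partial>arc_length) \<le>
      ennreal (2 * pi) * (H \<kappa> (of_real r * \<xi>) * indicator ?D2 \<xi>) + ennreal (16 * pi * (1 - q) / \<delta>\<^sup>2) * H \<kappa> (of_real r * \<xi>)"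
    proof (cases "\<xi> \<in> ?D2")
      case True
      have "H \<kappa> (of_real r * \<xi>) * (\<integral>\<^sup>+\<zeta>\<in>?D. ennreal (poisson (of_real q * \<zeta>) \<xi>) \<partial>arc_length) \<le> H \<kappa> (of_real r * \<xi>) * ennreal (2 * pi)"
        by (intro mult_left_mono poisson_mass_le[OF \<xi> q]) auto
      also have "\<dots> \<le> H \<kappa> (of_real r * \<xi>) * ennreal (2 * pi) + ennreal (16 * pi * (1 - q) / \<delta>\<^sup>2) * H \<kappa> (of_real r * \<xi>)"
        by simp
      finally show ?thesis using True by (simp add: mult_ac)
    next
      case False
      have "(\<integral>\<^sup>+\<zeta>\<in>?D. ennreal (poisson (of_real q * \<zeta>) \<xi>) \<partial>arc_length) \<le> ennreal (16 * pi * (1 - q) / \<delta>\<^sup>2)"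
      proof (rule poisson_mass_far[OF \<xi> q d])
        fix \<zeta> assume "\<zeta> \<in> ?D"
        then show "\<delta> \<le> cmod (\<xi> - \<zeta>)"
          using False \<xi> infdist_triangle[of \<xi> A \<zeta>] by (auto simp: circle_nbhd_def dist_norm)
      qed measurable
      then have "H \<kappa> (of_real r * \<xi>) * (\<integral>\<^sup>+\<zeta>\<in>?D. ennreal (poisson (of_real q * \<zeta>) \<xi>) \<partial>arc_length) \<le>
          H \<kappa> (of_real r * \<xi>) * ennreal (16 * pi * (1 - q) / \<delta>\<^sup>2)" by (intro mult_left_mono) auto
      then show ?thesis using False by (simp add: mult_ac)
    qed
  qed
  also have "\<dots> = ennreal (2 * pi) * (\<integral>\<^sup>+\<xi>\<in>?D2. H \<kappa> (of_real r * \<xi>) \<partial>arc_length) + ennreal (16 * pi * (1 - q) / \<delta>\<^sup>2) * ennreal (2 * pi)"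
    by (subst nn_integral_add) (auto simp: nn_integral_cmult H_total[OF rr r(3) \<kappa>])
  also have "\<dots> = ennreal (2 * pi) * ((\<integral>\<^sup>+\<xi>\<in>?D2. H \<kappa> (of_real r * \<xi>) \<partial>arc_length) + ennreal (16 * pi * (1 - q) / \<delta>\<^sup>2))"
    by (simp add: distrib_left mult_ac)
  finally show ?thesis
    unfolding q_def by (subst (asm) ennreal_mult_le_mult_iff) auto
qed

end

lemma nn_integral_fatou_le:
  fixes L :: ennreal
  assumes "\<And>n. u n \<in> borel_measurable N" and "AE x in N. v x \<le> liminf (\<lambda>n. u n x)"
    and "\<And>n. (\<integral>\<^sup>+x. u n x \<partial>N) \<le> c n" and "c \<longlonglongrightarrow> L"
  shows "(\<integral>\<^sup>+x. v x \<partial>N) \<le> L"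
proof -
  have "(\<integral>\<^sup>+x. v x \<partial>N) \<le> (\<integral>\<^sup>+x. liminf (\<lambda>n. u n x) \<partial>N)" by (rule nn_integral_mono_AE[OF assms(2)])
  also have "\<dots> \<le> liminf (\<lambda>n. \<integral>\<^sup>+x. u n x \<partial>N)" by (rule nn_integral_liminf[OF assms(1)])
  also have "\<dots> \<le> liminf c" by (intro Liminf_mono always_eventually allI assms(3))
  also have "\<dots> = L" by (rule lim_imp_Liminf[OF trivial_limit_sequentially assms(4)])
  finally show ?thesis .
qed

lemma tendsto_le_liminf:
  fixes l :: ennreal
  shows "u \<longlonglongrightarrow> l \<Longrightarrow> l \<le> liminf u"
  using lim_imp_Liminf[OF trivial_limit_sequentially, of u l] by simp

lemma tendsto_inverse_ennreal: "u \<longlonglongrightarrow> l \<Longrightarrow> (\<lambda>n. inverse (u n :: ennreal)) \<longlonglongrightarrow> inverse l"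
  using continuous_on_tendsto_compose[OF continuous_on_inverse_ennreal[OF continuous_on_id, of UNIV], of u l sequentially]
  by simp

text \<open>\<xi> is within \<open>3 * D\<close> of the evaluation point, while the numerator
  \<open>1 - (1 - D)^2\<close> is at least \<open>D\<close>.\<close>

lemma poisson_nearest_lower:
  assumes \<xi>: "cmod \<xi> = 1" and \<theta>: "cmod \<theta> = 1" and D: "0 < D" "D \<le> 1" and near: "cmod (\<xi> - \<theta>) < 2 * D"
  shows "1 / (9 * D) \<le> poisson (of_real (1 - D) * \<theta>) \<xi>"
proof -
  have "\<xi> - of_real (1 - D) * \<theta> = (\<xi> - \<theta>) + of_real D * \<theta>" by (simp add: algebra_simps)
  then have "cmod (\<xi> - of_real (1 - D) * \<theta>) \<le> cmod (\<xi> - \<theta>) + cmod (of_real D * \<theta>)" by (simp only: norm_triangle_ineq)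
  then have u: "cmod (\<xi> - of_real (1 - D) * \<theta>) \<le> 3 * D" using near \<theta> D by (simp add: norm_mult)
  have nz: "cmod (of_real (1 - D) * \<theta>) = 1 - D" using D \<theta> by (simp add: norm_mult del: of_real_diff)
  have "0 < cmod (\<xi> - of_real (1 - D) * \<theta>)"
    using norm_triangle_ineq2[of \<xi> "of_real (1 - D) * \<theta>"] nz \<xi> D by linarith
  then have "D / (3 * D)\<^sup>2 \<le> (1 - (1 - D)\<^sup>2) / (cmod (\<xi> - of_real (1 - D) * \<theta>))\<^sup>2"
    using u D mult_left_mono[of D 1 D] by (intro frac_le power_mono) (auto simp: power2_eq_square algebra_simps)
  also have "\<dots> = poisson (of_real (1 - D) * \<theta>) \<xi>" unfolding poisson_def nz ..
  finally show ?thesis using D by (simp add: power2_eq_square field_simps)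
qed

context schur_family
begin

lemma cay_le_inverse:
  assumes "0 \<le> \<kappa>" "\<kappa> \<le> 1" "cmod u \<le> 1"
  shows "ennreal (Re (cay \<kappa> u)) \<le> 4 * inverse (ennreal (cmod (1 - u)))"
proof (cases "u = 1")
  case False
  then have p: "0 < cmod (1 - u)" by simp
  have "Re (cay \<kappa> u) \<le> 4 * inverse (cmod (1 - u))"
    using complex_Re_le_cmod[of "cay \<kappa> u"] cay_bound(1)[OF assms False] by (simp add: norm_divide inverse_eq_divide)
  then have "ennreal (Re (cay \<kappa> u)) \<le> ennreal (4 * inverse (cmod (1 - u)))" by (rule ennreal_leI)
  also have "\<dots> = 4 * inverse (ennreal (cmod (1 - u)))" using p by (simp add: inverse_ennreal ennreal_mult)
  finally show ?thesis .
qed (simp add: ennreal_mult_top)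

text \<open>The value \<infinity> of \<open>inverse 0\<close> in \<open>ennreal\<close> keeps the
  integrand continuous, so Fatou's lemma carries the bound over to limits in \<zeta> and to boundary
  values. The radii start at \<open>1/2\<close> as in \<open>green_function_bound\<close>.\<close>

definition good :: "real \<Rightarrow> complex set" where
  "good B = {\<zeta> \<in> sphere 0 1. \<forall>r\<in>{1/2..<1}. (\<integral>\<^sup>+\<omega>. inverse (ennreal (cmod (1 - w \<omega> (of_real r * \<zeta>)))) \<partial>M) \<le> ennreal B}"

lemma good_circle: "good B \<subseteq> sphere 0 1"
  by (auto simp: good_def)

text \<open>Closedness gives each point outside a positive distance to the set and a nearest point
  in it, the two ingredients of the gap estimate.\<close>

lemma closed_good: "closed (good B)"
  unfolding closed_sequential_limits
proof (intro allI impI, elim conjE)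
  fix x l assume x: "\<forall>n. x n \<in> good B" and l: "x \<longlonglongrightarrow> l"
  have l1: "l \<in> sphere 0 1"
    using closed_sequentially[OF closed_sphere _ l] x good_circle by blast
  have "(\<integral>\<^sup>+\<omega>. inverse (ennreal (cmod (1 - w \<omega> (of_real r * l)))) \<partial>M) \<le> ennreal B" if r: "1/2 \<le> r" "r < 1" for r
  proof (rule nn_integral_fatou_le)
    show "(\<lambda>\<omega>. inverse (ennreal (cmod (1 - w \<omega> (of_real r * x n))))) \<in> borel_measurable M" for n
    proof -
      have [measurable]: "(\<lambda>\<omega>. w \<omega> (of_real r * x n)) \<in> borel_measurable M"
        using x good_circle r by (intro slice_meas) (auto simp: norm_mult good_def)
      show ?thesis by measurable
    qed
    show "(\<integral>\<^sup>+\<omega>. inverse (ennreal (cmod (1 - w \<omega> (of_real r * x n)))) \<partial>M) \<le> ennreal B" for n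
      using x r by (auto simp: good_def)
    show "AE \<omega> in M. inverse (ennreal (cmod (1 - w \<omega> (of_real r * l)))) \<le>
        liminf (\<lambda>n. inverse (ennreal (cmod (1 - w \<omega> (of_real r * x n)))))"
    proof (intro AE_I2 tendsto_le_liminf tendsto_inverse_ennreal tendsto_ennrealI tendsto_norm tendsto_diff tendsto_const)
      fix \<omega> assume \<omega>: "\<omega> \<in> space M"
      have "isCont (w \<omega>) (of_real r * l)"
        using holomorphic_on_imp_continuous_on[OF hol[OF \<omega>]] l1 r
        by (subst (asm) continuous_on_eq_continuous_at) (auto simp: norm_mult)
      moreover have "(\<lambda>n. of_real r * x n) \<longlonglongrightarrow> of_real r * l" by (intro tendsto_intros l)
      ultimately show "(\<lambda>n. w \<omega> (of_real r * x n)) \<longlonglongrightarrow> w \<omega> (of_real r * l)" by (rule isCont_tendsto_compose)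
    qed
  qed simp
  then show "l \<in> good B" using l1 by (auto simp: good_def)
qed

lemma good_sets [measurable]: "good B \<in> sets circle_borel"
  by (rule circle_closed_sets[OF closed_good good_circle])

lemma H_good:
  assumes "\<zeta> \<in> good B" "1/2 \<le> r" "r < 1" "0 \<le> \<kappa>" "\<kappa> \<le> 1"
  shows "H \<kappa> (of_real r * \<zeta>) \<le> 4 * ennreal B"
proof -
  have z: "cmod (of_real r * \<zeta>) < 1" using assms by (auto simp: good_def norm_mult)
  note [measurable] = slice_meas[OF z]
  have "H \<kappa> (of_real r * \<zeta>) \<le> (\<integral>\<^sup>+\<omega>. 4 * inverse (ennreal (cmod (1 - w \<omega> (of_real r * \<zeta>)))) \<partial>M)"
    unfolding H_def using w_less[OF _ z] assms by (intro nn_integral_mono cay_le_inverse) (auto simp: less_imp_le)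
  also have "\<dots> = 4 * (\<integral>\<^sup>+\<omega>. inverse (ennreal (cmod (1 - w \<omega> (of_real r * \<zeta>)))) \<partial>M)"
    by (rule nn_integral_cmult) measurable
  also have "\<dots> \<le> 4 * ennreal B" using assms by (intro mult_left_mono) (auto simp: good_def)
  finally show ?thesis .
qed

text \<open>A point \<open>\<eta>\<close> in a gap of the good set sees its nearest good point \<open>\<theta>\<close> at distance \<open>D\<close>; on the arc of
  length comparable to \<open>D\<close> around \<open>\<eta>\<close> the Poisson kernel at \<open>(1 - D) \<theta>\<close> is at least \<open>1 / (9 D)\<close>.\<close>

lemma gap_estimate:
  assumes A: "A \<subseteq> good B" "A \<noteq> {}" and d: "0 < \<delta>" "2 * \<delta> \<le> 1 / 4" and r: "3 / 4 \<le> r" "r < 1" and \<kappa>: "0 \<le> \<kappa>" "\<kappa> \<le> 1"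
  shows "(\<integral>\<^sup>+\<xi>\<in>circle_nbhd A \<delta> - good B. H \<kappa> (of_real r * \<xi>) \<partial>arc_length) \<le>
    ennreal (216 * pi) * ennreal B * emeasure arc_length (circle_nbhd A (2 * \<delta>) - good B)"
proof -
  interpret P: pair_sigma_finite arc_length arc_length ..
  let ?G = "good B" and ?X = "circle_nbhd A \<delta> - good B" and ?Y = "circle_nbhd A (2 * \<delta>) - good B"
  let ?d = "\<lambda>\<xi>. infdist \<xi> (good B)"
  \<comment> \<open>Each gap point \<xi> is spread over the points \<eta> closer than half its
    distance \<open>d\<close> to the good set. The weight \<open>2 / d\<close> makes the spread mass
    at least one, as an arc of chord radius \<open>d / 2\<close> is at least that long. Exchanging
    the integrals then lets \<eta> choose a nearest good point.\<close>
  let ?K = "\<lambda>\<xi> \<eta>. (if cmod (\<eta> - \<xi>) < ?d \<xi> / 2 then 1 else 0) * (ennreal (2 / ?d \<xi>) * (H \<kappa> (of_real r * \<xi>) * indicator ?X \<xi>) * indicator ?Y \<eta>) :: ennreal"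
  have r0: "0 \<le> r" using r by simp
  note [measurable] = H_meas[OF r0 r(2), of \<kappa>]
  have G: "closed ?G" "?G \<noteq> {}" using closed_good A by auto
  have dpos: "0 < ?d x" if "x \<notin> ?G" for x
    using in_closed_iff_infdist_zero[OF G, of x] that infdist_nonneg[of x ?G] by linarith
  have dle: "?d x \<le> infdist x A" for x
    by (rule infdist_mono) (use A in auto)
  have "(\<integral>\<^sup>+\<xi>\<in>?X. H \<kappa> (of_real r * \<xi>) \<partial>arc_length) \<le> (\<integral>\<^sup>+\<xi>. \<integral>\<^sup>+\<eta>. ?K \<xi> \<eta> \<partial>arc_length \<partial>arc_length)"
  proof (rule nn_integral_mono)
    fix \<xi> assume "\<xi> \<in> space arc_length"
    then have \<xi>: "cmod \<xi> = 1" by simp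
    show "H \<kappa> (of_real r * \<xi>) * indicator ?X \<xi> \<le> (\<integral>\<^sup>+\<eta>. ?K \<xi> \<eta> \<partial>arc_length)"
    proof (cases "\<xi> \<in> ?X")
      case True
      then have d0: "0 < ?d \<xi>" and d1: "?d \<xi> < \<delta>" using dpos dle[of \<xi>] by (auto simp: circle_nbhd_def)
      have near: "\<eta> \<in> ?Y" if "cmod \<eta> = 1" "cmod (\<eta> - \<xi>) < ?d \<xi> / 2" for \<eta>
      proof -
        have "?d \<xi> \<le> ?d \<eta> + dist \<xi> \<eta>" "infdist \<eta> A \<le> infdist \<xi> A + dist \<eta> \<xi>" by (rule infdist_triangle)+
        moreover have "infdist \<xi> A < \<delta>" using True by (simp add: circle_nbhd_def)
        ultimately have "0 < ?d \<eta>" "infdist \<eta> A < 2 * \<delta>" using that d0 d1 by (auto simp: dist_norm norm_minus_commute)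
        then show ?thesis using that G by (auto simp: circle_nbhd_def)
      qed
      have "H \<kappa> (of_real r * \<xi>) = ennreal (2 / ?d \<xi>) * H \<kappa> (of_real r * \<xi>) * ennreal (?d \<xi> / 2)"
      proof -
        have "ennreal (2 / ?d \<xi>) * ennreal (?d \<xi> / 2) = 1" using d0 by (simp flip: ennreal_mult)
        then show ?thesis by (simp add: mult.commute mult.left_commute)
      qed
      also have "\<dots> \<le> ennreal (2 / ?d \<xi>) * H \<kappa> (of_real r * \<xi>) * emeasure arc_length (ball \<xi> (?d \<xi> / 2) \<inter> sphere 0 1)"
        using arc_ball_lower[of \<xi> "?d \<xi> / 2"] \<xi> d0 d1 d by (intro mult_left_mono) auto
      also have "\<dots> = (\<integral>\<^sup>+\<eta>. ennreal (2 / ?d \<xi>) * H \<kappa> (of_real r * \<xi>) * indicator (ball \<xi> (?d \<xi> / 2) \<inter> sphere 0 1) \<eta> \<partial>arc_length)"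
        using circle_ball_sets by (intro nn_integral_cmult_indicator[symmetric]) simp
      also have "\<dots> \<le> (\<integral>\<^sup>+\<eta>. ?K \<xi> \<eta> \<partial>arc_length)"
        using near True by (intro nn_integral_mono) (auto simp: indicator_def dist_norm norm_minus_commute)
      finally show ?thesis using True by simp
    qed simp
  qed
  also have "\<dots> = (\<integral>\<^sup>+\<eta>. \<integral>\<^sup>+\<xi>. ?K \<xi> \<eta> \<partial>arc_length \<partial>arc_length)"
  proof (rule P.Fubini'[symmetric])
    have [measurable]: "(\<lambda>p. H \<kappa> (of_real r * fst p)) \<in> borel_measurable (circle_borel \<Otimes>\<^sub>M circle_borel)"
      by (rule measurable_compose[OF measurable_fst H_meas[OF r0 r(2)]])
    have [measurable]: "(\<lambda>p. ?d (fst p)) \<in> borel_measurable (circle_borel \<Otimes>\<^sub>M circle_borel)"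
      by (rule measurable_compose[OF measurable_fst measurable_infdist_circle])
    show "(\<lambda>(\<xi>, \<eta>). ?K \<xi> \<eta>) \<in> borel_measurable (arc_length \<Otimes>\<^sub>M arc_length)"
      unfolding measurable_cong_sets[OF sets_pair_measure_cong[OF sets_arc_length sets_arc_length] refl] case_prod_beta'
      by measurable
  qed
  also have "\<dots> \<le> (\<integral>\<^sup>+\<eta>. ennreal (216 * pi) * ennreal B * indicator ?Y \<eta> \<partial>arc_length)"
  proof (rule nn_integral_mono)
    fix \<eta> assume "\<eta> \<in> space arc_length"
    then have \<eta>: "cmod \<eta> = 1" by simp
    show "(\<integral>\<^sup>+\<xi>. ?K \<xi> \<eta> \<partial>arc_length) \<le> ennreal (216 * pi) * ennreal B * indicator ?Y \<eta>"
    proof (cases "\<eta> \<in> ?Y")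
      case True
      define D where "D = ?d \<eta>"
      have D: "0 < D" "D < 1 / 4" using True dpos dle[of \<eta>] d by (auto simp: circle_nbhd_def D_def)
      obtain \<theta> where \<theta>: "\<theta> \<in> ?G" "D = dist \<eta> \<theta>"
        using infdist_attains_inf[OF G, of \<eta>] by (auto simp: D_def)
      have \<theta>1: "cmod \<theta> = 1" using subsetD[OF good_circle \<theta>(1)] by simp
      have z: "cmod (of_real (1 - D) * \<theta>) < 1" using D \<theta>1 by (simp add: norm_mult del: of_real_diff)
      have pm [measurable]: "poisson (of_real (1 - D) * \<theta>) \<in> borel_measurable circle_borel"
        by (rule borel_measurable_circle_continuous[OF poisson_continuous[OF z]])
      have "(\<integral>\<^sup>+\<xi>. ?K \<xi> \<eta> \<partial>arc_length) \<le> (\<integral>\<^sup>+\<xi>. 27 * (ennreal (poisson (of_real (1 - D) * \<theta>) \<xi>) * H \<kappa> (of_real r * \<xi>)) \<partial>arc_length)"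
      proof (rule nn_integral_mono)
        fix \<xi> assume "\<xi> \<in> space arc_length"
        then have \<xi>: "cmod \<xi> = 1" by simp
        show "?K \<xi> \<eta> \<le> 27 * (ennreal (poisson (of_real (1 - D) * \<theta>) \<xi>) * H \<kappa> (of_real r * \<xi>))"
        proof (cases "cmod (\<eta> - \<xi>) < ?d \<xi> / 2")
          case near: True
          have t: "?d \<eta> \<le> ?d \<xi> + dist \<eta> \<xi>" "?d \<xi> \<le> ?d \<eta> + dist \<xi> \<eta>" by (rule infdist_triangle)+
          \<comment> \<open>The points \<xi> that matter lie within \<open>D\<close> of \<eta> and
            have distance more than \<open>2 * D / 3\<close> to the good set. Their weight is thus
            below \<open>3 / D = 27 / (9 * D)\<close>, that is, below \<open>27\<close> times the
            Poisson kernel.\<close>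
          have b: "2 * D < 3 * ?d \<xi>" "cmod (\<eta> - \<xi>) < D"
            using near t by (auto simp: D_def dist_norm norm_minus_commute)
          have "cmod (\<xi> - \<theta>) \<le> cmod (\<eta> - \<xi>) + dist \<eta> \<theta>"
            using norm_triangle_ineq[of "\<xi> - \<eta>" "\<eta> - \<theta>"] by (simp add: dist_norm norm_minus_commute)
          then have "cmod (\<xi> - \<theta>) < 2 * D" using b \<theta>(2) by simp
          then have "1 / (9 * D) \<le> poisson (of_real (1 - D) * \<theta>) \<xi>"
            using D by (intro poisson_nearest_lower \<xi> \<theta>1) auto
          moreover have "2 / ?d \<xi> \<le> 27 * (1 / (9 * D))" using b D by (simp add: field_simps)
          ultimately have "2 / ?d \<xi> \<le> 27 * poisson (of_real (1 - D) * \<theta>) \<xi>" by linarith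
          then have "ennreal (2 / ?d \<xi>) \<le> 27 * ennreal (poisson (of_real (1 - D) * \<theta>) \<xi>)"
            using z by (subst ennreal_numeral[symmetric], subst ennreal_mult[symmetric]) (auto intro!: ennreal_leI poisson_nonneg)
          then have "ennreal (2 / ?d \<xi>) * H \<kappa> (of_real r * \<xi>) \<le> 27 * ennreal (poisson (of_real (1 - D) * \<theta>) \<xi>) * H \<kappa> (of_real r * \<xi>)"
            by (rule mult_right_mono) simp
          moreover have "?K \<xi> \<eta> \<le> ennreal (2 / ?d \<xi>) * H \<kappa> (of_real r * \<xi>)" by (auto simp: indicator_def)
          ultimately show ?thesis by (simp add: mult.assoc)
        qed simp
      qed
      also have "\<dots> = 27 * (\<integral>\<^sup>+\<xi>. ennreal (poisson (of_real (1 - D) * \<theta>) \<xi>) * H \<kappa> (of_real r * \<xi>) \<partial>arc_length)"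
        by (rule nn_integral_cmult) measurable
      also have "\<dots> = 27 * (ennreal (2 * pi) * H \<kappa> (of_real (r * (1 - D)) * \<theta>))"
        unfolding H_poisson[OF z r0 r(2) \<kappa>] by (simp add: mult.assoc)
      also have "\<dots> \<le> 27 * (ennreal (2 * pi) * (4 * ennreal B))"
      proof (intro mult_left_mono H_good \<theta> \<kappa>)
        \<comment> \<open>\<open>3/4 * 3/4 = 9/16\<close>: the thresholds on \<open>r\<close> and
          \<open>D\<close> are such that \<open>r * (1 - D)\<close> stays in the range of radii
          covered by \<open>good\<close>.\<close>
        show "1 / 2 \<le> r * (1 - D)" using mult_mono[of "3/4" r "3/4" "1 - D"] D r by simp
        have "r * (1 - D) \<le> 1 * (1 - D)" using D r by (intro mult_right_mono) auto
        then show "r * (1 - D) < 1" by (rule order.strict_trans1) (use D in simp)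
      qed auto
      also have "\<dots> = ennreal (216 * pi) * ennreal B"
      proof -
        have "ennreal (216 * pi) = ennreal 27 * (ennreal (2 * pi) * ennreal 4)"
          by (simp flip: ennreal_mult del: ennreal_numeral)
        then show ?thesis by (simp add: mult_ac)
      qed
      finally show ?thesis using True by simp
    qed simp
  qed
  also have "\<dots> = ennreal (216 * pi) * ennreal B * emeasure arc_length ?Y"
    by (rule nn_integral_cmult_indicator) simp
  finally show ?thesis .
qed

text \<open>The square mean over both variables increases with the radius and is bounded, so by
  \<open>holomorphic_L2_increment\<close> the radial values are Cauchy in mean square, hence in
  mean, and a subsequence is Cauchy almost everywhere. Working on the product space makes the radii
  the same for all pairs. They start at \<open>3 / 4\<close> to suit the gap estimate.\<close>

lemma radial_subsequence:
  obtains \<rho> :: "nat \<Rightarrow> real" where "\<And>j. 3 / 4 \<le> \<rho> j" "\<And>j. \<rho> j < 1" "\<rho> \<longlonglongrightarrow> 1"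
    "AE p in arc_length \<Otimes>\<^sub>M M. Cauchy (\<lambda>j. w (snd p) (of_real (\<rho> j) * fst p))"
proof -
  interpret P: pair_sigma_finite arc_length M ..
  interpret Q: finite_measure "arc_length \<Otimes>\<^sub>M M"
    by (rule finite_measure_pair_measure[OF finite_measure_axioms arc.finite_measure_axioms])
  define r where "r n = 1 - 1 / real (n + 4)" for n
  have r: "3 / 4 \<le> r n" "r n < 1" "0 \<le> r n" for n by (auto simp: r_def field_simps)
  have r_mono: "r m \<le> r n" if "m \<le> n" for m n using that by (auto simp: r_def intro!: divide_left_mono)
  have r_lim: "r \<longlonglongrightarrow> 1" unfolding r_def
    using tendsto_diff[OF tendsto_const LIMSEQ_ignore_initial_segment[OF lim_const_over_n[of 1], of 4], of 1] by simp
  define W where "W n p = w (snd p) (of_real (r n) * fst p)" for n and p :: "complex \<times> 'a"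
  have W_meas [measurable]: "W n \<in> borel_measurable (arc_length \<Otimes>\<^sub>M M)" for n
    using measurable_compose[OF measurable_pair_swap' w_meas[OF r(3,2)[of n]]]
    unfolding W_def by (subst measurable_cong_sets[OF sets_pair_measure_cong[OF sets_arc_length refl] refl]) (simp add: case_prod_beta')
  have W_le: "cmod (W n p) \<le> 1" if "p \<in> space (arc_length \<Otimes>\<^sub>M M)" for n p
    using that w_less[of "snd p" "of_real (r n) * fst p"] r[of n] by (auto simp: W_def space_pair_measure norm_mult)
  have bdd: "integrable (arc_length \<Otimes>\<^sub>M M) g" if "g \<in> borel_measurable (arc_length \<Otimes>\<^sub>M M)"
     "\<And>p. p \<in> space (arc_length \<Otimes>\<^sub>M M) \<Longrightarrow> norm (g p) \<le> b" for g :: "complex \<times> 'a \<Rightarrow> 'c::{banach,second_countable_topology}" and b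
    using that by (intro Q.integrable_const_bound[of _ b]) auto
  have W_int: "integrable (arc_length \<Otimes>\<^sub>M M) (W n)" for n using W_le by (intro bdd) auto
  have sq_int: "integrable (arc_length \<Otimes>\<^sub>M M) (\<lambda>p. (cmod (W n p))\<^sup>2)" for n
    using W_le by (intro bdd[of _ 1]) (auto intro: power_le_one)
  have d_le: "cmod (W n p - W m p) \<le> 2" if "p \<in> space (arc_length \<Otimes>\<^sub>M M)" for n m p
    using norm_triangle_ineq4[of "W n p" "W m p"] W_le[OF that, of n] W_le[OF that, of m] by linarith
  have dif_int: "integrable (arc_length \<Otimes>\<^sub>M M) (\<lambda>p. (cmod (W n p - W m p))\<^sup>2)" for n m
  proof (intro bdd[of _ "2\<^sup>2"])
    show "norm ((cmod (W n p - W m p))\<^sup>2) \<le> 2\<^sup>2" if "p \<in> space (arc_length \<Otimes>\<^sub>M M)" for p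
      using d_le[OF that, of n m] by (simp only: real_norm_def abs_power2 power_mono norm_ge_zero)
  qed measurable
  define J where "J n = (\<integral>p. (cmod (W n p))\<^sup>2 \<partial>(arc_length \<Otimes>\<^sub>M M))" for n
  have fub: "(\<integral>p. g p \<partial>(arc_length \<Otimes>\<^sub>M M)) = (\<integral>\<omega>. (\<integral>\<zeta>. g (\<zeta>, \<omega>) \<partial>arc_length) \<partial>M)"
    "integrable M (\<lambda>\<omega>. \<integral>\<zeta>. g (\<zeta>, \<omega>) \<partial>arc_length)"
    if "integrable (arc_length \<Otimes>\<^sub>M M) g" for g :: "complex \<times> 'a \<Rightarrow> real"
    using P.integral_snd[of "\<lambda>x y. g (x, y)"] P.integrable_snd[of "\<lambda>x y. g (x, y)"] that by auto
  have inc: "(\<integral>p. (cmod (W n p - W m p))\<^sup>2 \<partial>(arc_length \<Otimes>\<^sub>M M)) \<le> J n - J m" if "m \<le> n" for m n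
  proof -
    have "(\<integral>p. (cmod (W n p - W m p))\<^sup>2 \<partial>(arc_length \<Otimes>\<^sub>M M)) = (\<integral>\<omega>. (\<integral>\<zeta>. (cmod (W n (\<zeta>, \<omega>) - W m (\<zeta>, \<omega>)))\<^sup>2 \<partial>arc_length) \<partial>M)"
      by (rule fub(1)[OF dif_int])
    also have "\<dots> \<le> (\<integral>\<omega>. (\<integral>\<zeta>. (cmod (W n (\<zeta>, \<omega>)))\<^sup>2 \<partial>arc_length) - (\<integral>\<zeta>. (cmod (W m (\<zeta>, \<omega>)))\<^sup>2 \<partial>arc_length) \<partial>M)"
    proof (rule integral_mono[OF fub(2)[OF dif_int] Bochner_Integration.integrable_diff[OF fub(2)[OF sq_int] fub(2)[OF sq_int]]])
      fix \<omega> assume \<omega>: "\<omega> \<in> space M"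
      show "(\<integral>\<zeta>. (cmod (W n (\<zeta>, \<omega>) - W m (\<zeta>, \<omega>)))\<^sup>2 \<partial>arc_length) \<le>
          (\<integral>\<zeta>. (cmod (W n (\<zeta>, \<omega>)))\<^sup>2 \<partial>arc_length) - (\<integral>\<zeta>. (cmod (W m (\<zeta>, \<omega>)))\<^sup>2 \<partial>arc_length)"
        unfolding W_def fst_conv snd_conv
        using w_less[OF \<omega>] by (intro holomorphic_L2_increment hol[OF \<omega>] r r_mono[OF that]) (simp add: less_imp_le)
    qed
    also have "\<dots> = J n - J m"
      unfolding J_def fub(1)[OF sq_int] by (rule Bochner_Integration.integral_diff[OF fub(2)[OF sq_int] fub(2)[OF sq_int]])
    finally show ?thesis .
  qed
  have "J m \<le> J n" if "m \<le> n" for m n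
  proof -
    have "0 \<le> (\<integral>p. (cmod (W n p - W m p))\<^sup>2 \<partial>(arc_length \<Otimes>\<^sub>M M))" by simp
    then show ?thesis using inc[OF that] by linarith
  qed
  then have "incseq J" by (simp add: incseq_def)
  moreover have "J n \<le> (\<integral>p. 1 \<partial>(arc_length \<Otimes>\<^sub>M M))" for n
    unfolding J_def using W_le by (intro integral_mono sq_int) (auto intro: power_le_one)
  ultimately obtain L where L: "J \<longlonglongrightarrow> L" using incseq_convergent by metis
  define T where "T = measure (arc_length \<Otimes>\<^sub>M M) (space (arc_length \<Otimes>\<^sub>M M))"
  have T0: "0 \<le> T" by (simp add: T_def)
  have L1: "\<exists>N. \<forall>i\<ge>N. \<forall>j\<ge>N. (\<integral>p. norm (W i p - W j p) \<partial>(arc_length \<Otimes>\<^sub>M M)) < e" if e: "0 < e" for e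
  proof -
    define c where "c = e / (2 * (T + 1))"
    have c: "0 < c" "c * T < e / 2" using e T0 by (auto simp: c_def field_simps)
    obtain N where N: "\<And>m n. N \<le> m \<Longrightarrow> N \<le> n \<Longrightarrow> norm (J m - J n) < c * (e / 2)"
      using CauchyD[OF LIMSEQ_imp_Cauchy[OF L], of "c * (e / 2)"] c(1) e by auto
    have *: "(\<integral>p. norm (W i p - W j p) \<partial>(arc_length \<Otimes>\<^sub>M M)) < e" if ij: "N \<le> j" "j \<le> i" for i j
    proof -
      have "(\<integral>p. norm (W i p - W j p) \<partial>(arc_length \<Otimes>\<^sub>M M)) \<le> (\<integral>p. c + (cmod (W i p - W j p))\<^sup>2 / c \<partial>(arc_length \<Otimes>\<^sub>M M))"
      proof (rule integral_mono)
        show "integrable (arc_length \<Otimes>\<^sub>M M) (\<lambda>p. norm (W i p - W j p))" by (intro integrable_norm Bochner_Integration.integrable_diff W_int)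
        show "integrable (arc_length \<Otimes>\<^sub>M M) (\<lambda>p. c + (cmod (W i p - W j p))\<^sup>2 / c)"
          by (intro Bochner_Integration.integrable_add integrable_divide_zero dif_int) auto
        fix p
        \<comment> \<open>Splitting at \<open>x = c\<close> passes from square means to means;
          \<open>c\<close> is chosen so small that its own share stays below
          \<open>e / 2\<close>.\<close>
        have "x \<le> c + x\<^sup>2 / c" if "0 \<le> x" for x
        proof (cases "x \<le> c")
          case True then show ?thesis using c(1) by (smt (verit) divide_nonneg_pos zero_le_power2)
        next
          case False
          then have "x * c \<le> x * x" using that by (intro mult_left_mono) auto
          then show ?thesis using c(1) by (simp add: field_simps power2_eq_square) (smt (verit) mult_pos_pos)
        qed
        then show "norm (W i p - W j p) \<le> c + (cmod (W i p - W j p))\<^sup>2 / c" by simp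
      qed
      also have "\<dots> = c * T + (\<integral>p. (cmod (W i p - W j p))\<^sup>2 \<partial>(arc_length \<Otimes>\<^sub>M M)) / c"
        using dif_int[of i j] by (simp add: T_def)
      also have "\<dots> < e / 2 + e / 2"
      proof (rule add_less_le_mono[OF c(2)])
        have "(\<integral>p. (cmod (W i p - W j p))\<^sup>2 \<partial>(arc_length \<Otimes>\<^sub>M M)) \<le> c * (e / 2)"
          using inc[OF ij(2)] abs_ge_self[of "J i - J j"] N[OF order_trans[OF ij] ij(1)] unfolding real_norm_def by linarith
        then show "(\<integral>p. (cmod (W i p - W j p))\<^sup>2 \<partial>(arc_length \<Otimes>\<^sub>M M)) / c \<le> e / 2"
          using c(1) by (simp add: field_simps)
      qed
      finally show ?thesis by simp
    qed
    have "(\<integral>p. norm (W i p - W j p) \<partial>(arc_length \<Otimes>\<^sub>M M)) < e" if "N \<le> i" "N \<le> j" for i j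
    proof (cases "j \<le> i")
      case False
      then have "(\<integral>p. norm (W j p - W i p) \<partial>(arc_length \<Otimes>\<^sub>M M)) < e" using * that by simp
      then show ?thesis by (simp add: norm_minus_commute)
    qed (use * that in simp)
    then show ?thesis by blast
  qed
  obtain s where s: "strict_mono s" "AE p in arc_length \<Otimes>\<^sub>M M. Cauchy (\<lambda>i. W (s i) p)"
    using cauchy_L1_AE_cauchy_subseq[OF W_int L1] by blast
  show thesis
  proof
    show "3 / 4 \<le> r (s j)" "r (s j) < 1" for j by (rule r)+
    show "(\<lambda>j. r (s j)) \<longlonglongrightarrow> 1" using LIMSEQ_subseq_LIMSEQ[OF r_lim s(1)] by (simp add: o_def)
    show "AE p in arc_length \<Otimes>\<^sub>M M. Cauchy (\<lambda>j. w (snd p) (of_real (r (s j)) * fst p))" using s(2) by (simp add: W_def)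
  qed
qed

end

section \<open>Measures compared with their Poisson integrals\<close>

lemma nn_integral_poisson_swap:
  assumes \<nu>: "prob_space \<nu>" "sets \<nu> = sets circle_borel" and [measurable]: "X \<in> sets circle_borel"
  shows "(\<integral>\<^sup>+\<zeta>\<in>X. (\<integral>\<^sup>+\<tau>. ennreal (poisson (of_real r * \<zeta>) \<tau>) \<partial>\<nu>) \<partial>arc_length) =
    (\<integral>\<^sup>+\<tau>. (\<integral>\<^sup>+\<zeta>\<in>X. ennreal (poisson (of_real r * \<zeta>) \<tau>) \<partial>arc_length) \<partial>\<nu>)"
proof -
  interpret \<nu>: prob_space \<nu> by fact
  interpret P: pair_sigma_finite arc_length \<nu> ..
  have [measurable]: "(\<lambda>\<tau>. poisson (of_real r * \<zeta>) \<tau>) \<in> borel_measurable \<nu>" for \<zeta>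
    unfolding measurable_cong_sets[OF \<nu>(2) refl] poisson_def by measurable
  have "(\<integral>\<^sup>+\<zeta>\<in>X. (\<integral>\<^sup>+\<tau>. ennreal (poisson (of_real r * \<zeta>) \<tau>) \<partial>\<nu>) \<partial>arc_length) =
      (\<integral>\<^sup>+\<zeta>. \<integral>\<^sup>+\<tau>. ennreal (poisson (of_real r * \<zeta>) \<tau>) * indicator X \<zeta> \<partial>\<nu> \<partial>arc_length)"
    by (intro nn_integral_cong nn_integral_multc[symmetric]) measurable
  also have "\<dots> = (\<integral>\<^sup>+\<tau>. (\<integral>\<^sup>+\<zeta>\<in>X. ennreal (poisson (of_real r * \<zeta>) \<tau>) \<partial>arc_length) \<partial>\<nu>)"
  proof (rule P.Fubini'[symmetric])
    show "(\<lambda>(\<zeta>, \<tau>). ennreal (poisson (of_real r * \<zeta>) \<tau>) * indicator X \<zeta>) \<in> borel_measurable (arc_length \<Otimes>\<^sub>M \<nu>)"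
      unfolding measurable_cong_sets[OF sets_pair_measure_cong[OF sets_arc_length \<nu>(2)] refl] case_prod_beta'
      by measurable
  qed
  finally show ?thesis .
qed

text \<open>Integrated over \<zeta> in \<open>X\<close>, the kernel at \<tau> has mass at most
  \<open>2 * pi\<close> in any case, and little mass unless \<tau> is near \<open>X\<close>. The
  factor \<open>2 * pi\<close> stays because arc length is not normalised.\<close>

lemma poisson_integral_le_nbhd:
  assumes \<nu>: "prob_space \<nu>" "sets \<nu> = sets circle_borel" and X: "X \<in> sets circle_borel"
    and r: "0 \<le> r" "r < 1" and d: "0 < \<delta>"
  shows "(\<integral>\<^sup>+\<zeta>\<in>X. (\<integral>\<^sup>+\<tau>. ennreal (poisson (of_real r * \<zeta>) \<tau>) \<partial>\<nu>) \<partial>arc_length) \<le>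
    ennreal (2 * pi) * emeasure \<nu> (circle_nbhd X \<delta>) + ennreal (16 * pi * (1 - r) / \<delta>\<^sup>2)"
proof -
  interpret \<nu>: prob_space \<nu> by fact
  have sp: "space \<nu> = sphere 0 1" using sets_eq_imp_space_eq[OF \<nu>(2)] by simp
  have [measurable]: "circle_nbhd X \<delta> \<in> sets \<nu>" using \<nu>(2) sets_circle_nbhd by simp
  have "(\<integral>\<^sup>+\<tau>. (\<integral>\<^sup>+\<zeta>\<in>X. ennreal (poisson (of_real r * \<zeta>) \<tau>) \<partial>arc_length) \<partial>\<nu>) \<le>
      (\<integral>\<^sup>+\<tau>. ennreal (2 * pi) * indicator (circle_nbhd X \<delta>) \<tau> + ennreal (16 * pi * (1 - r) / \<delta>\<^sup>2) \<partial>\<nu>)"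
  proof (rule nn_integral_mono)
    fix \<tau> assume "\<tau> \<in> space \<nu>"
    then have \<tau>: "cmod \<tau> = 1" using sp by simp
    show "(\<integral>\<^sup>+\<zeta>\<in>X. ennreal (poisson (of_real r * \<zeta>) \<tau>) \<partial>arc_length) \<le>
        ennreal (2 * pi) * indicator (circle_nbhd X \<delta>) \<tau> + ennreal (16 * pi * (1 - r) / \<delta>\<^sup>2)"
    proof (cases "\<tau> \<in> circle_nbhd X \<delta>")
      case True
      then show ?thesis using poisson_mass_le[OF \<tau> r, of X] by (simp add: add_increasing2)
    next
      case False
      have "\<delta> \<le> cmod (\<tau> - \<zeta>)" if "\<zeta> \<in> X" for \<zeta>
        using False \<tau> infdist_le[OF that, of \<tau>] by (simp add: circle_nbhd_def dist_norm)
      from poisson_mass_far[OF \<tau> r d X this] show ?thesis using False by simp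
    qed
  qed
  also have "\<dots> = ennreal (2 * pi) * emeasure \<nu> (circle_nbhd X \<delta>) + ennreal (16 * pi * (1 - r) / \<delta>\<^sup>2)"
    by (subst nn_integral_add) (auto simp: nn_integral_cmult_indicator \<nu>.emeasure_space_1)
  finally show ?thesis unfolding nn_integral_poisson_swap[OF \<nu> X] .
qed

lemma closed_le_poisson_integral:
  assumes \<nu>: "prob_space \<nu>" "sets \<nu> = sets circle_borel" and A: "A \<in> sets circle_borel"
    and r: "0 \<le> r" "r < 1" and d: "0 < \<delta>"
  shows "ennreal (2 * pi) * emeasure \<nu> A \<le>
    (\<integral>\<^sup>+\<zeta>\<in>circle_nbhd A \<delta>. (\<integral>\<^sup>+\<tau>. ennreal (poisson (of_real r * \<zeta>) \<tau>) \<partial>\<nu>) \<partial>arc_length) + ennreal (16 * pi * (1 - r) / \<delta>\<^sup>2)"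
proof -
  interpret \<nu>: prob_space \<nu> by fact
  interpret P: pair_sigma_finite arc_length \<nu> ..
  have sp: "space \<nu> = sphere 0 1" using sets_eq_imp_space_eq[OF \<nu>(2)] by simp
  have A': "A \<in> sets \<nu>" using \<nu>(2) A by simp
  let ?X = "circle_nbhd A \<delta>"
  have [measurable]: "(\<lambda>\<zeta>. poisson (of_real r * \<zeta>) \<tau>) \<in> borel_measurable circle_borel" for \<tau>
    unfolding poisson_def by measurable
  have m: "(\<lambda>\<tau>. \<integral>\<^sup>+\<zeta>\<in>?X. ennreal (poisson (of_real r * \<zeta>) \<tau>) \<partial>arc_length) \<in> borel_measurable \<nu>"
    unfolding measurable_cong_sets[OF \<nu>(2) refl]
  proof (rule arc.borel_measurable_nn_integral)
    have [measurable]: "(\<lambda>p. poisson (of_real r * snd p) (fst p)) \<in> borel_measurable (circle_borel \<Otimes>\<^sub>M circle_borel)"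
      unfolding poisson_def by measurable
    show "(\<lambda>(\<tau>, \<zeta>). ennreal (poisson (of_real r * \<zeta>) \<tau>) * indicator ?X \<zeta>) \<in> borel_measurable (circle_borel \<Otimes>\<^sub>M arc_length)"
      unfolding measurable_cong_sets[OF sets_pair_measure_cong[OF refl sets_arc_length] refl] case_prod_beta'
      by measurable
  qed
  have "ennreal (2 * pi) * emeasure \<nu> A = (\<integral>\<^sup>+\<tau>. ennreal (2 * pi) * indicator A \<tau> \<partial>\<nu>)"
    by (rule nn_integral_cmult_indicator[symmetric, OF A'])
  also have "\<dots> \<le> (\<integral>\<^sup>+\<tau>. (\<integral>\<^sup>+\<zeta>\<in>?X. ennreal (poisson (of_real r * \<zeta>) \<tau>) \<partial>arc_length) + ennreal (16 * pi * (1 - r) / \<delta>\<^sup>2) \<partial>\<nu>)"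
  proof (rule nn_integral_mono)
    fix \<tau> assume "\<tau> \<in> space \<nu>"
    then have \<tau>: "cmod \<tau> = 1" using sp by simp
    show "ennreal (2 * pi) * indicator A \<tau> \<le> (\<integral>\<^sup>+\<zeta>\<in>?X. ennreal (poisson (of_real r * \<zeta>) \<tau>) \<partial>arc_length) + ennreal (16 * pi * (1 - r) / \<delta>\<^sup>2)"
    proof (cases "\<tau> \<in> A")
      case True
      have "ennreal (2 * pi) = (\<integral>\<^sup>+\<zeta>. ennreal (poisson (of_real r * \<tau>) \<zeta>) \<partial>arc_length)"
        using r \<tau> by (intro nn_integral_poisson[symmetric]) (simp add: norm_mult)
      also have "\<dots> = (\<integral>\<^sup>+\<zeta>. ennreal (poisson (of_real r * \<zeta>) \<tau>) * indicator ?X \<zeta> + ennreal (poisson (of_real r * \<zeta>) \<tau>) * indicator (sphere 0 1 - ?X) \<zeta> \<partial>arc_length)"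
        using poisson_symmetric[OF _ \<tau>, of _ r] by (intro nn_integral_cong) (auto simp: indicator_def)
      also have "\<dots> = (\<integral>\<^sup>+\<zeta>\<in>?X. ennreal (poisson (of_real r * \<zeta>) \<tau>) \<partial>arc_length) + (\<integral>\<^sup>+\<zeta>\<in>sphere 0 1 - ?X. ennreal (poisson (of_real r * \<zeta>) \<tau>) \<partial>arc_length)"
        by (rule nn_integral_add) (use sets.top[of circle_borel] in simp_all)
      also have "(\<integral>\<^sup>+\<zeta>\<in>sphere 0 1 - ?X. ennreal (poisson (of_real r * \<zeta>) \<tau>) \<partial>arc_length) \<le> ennreal (16 * pi * (1 - r) / \<delta>\<^sup>2)"
      proof (rule poisson_mass_far[OF \<tau> r d])
        show "sphere 0 1 - ?X \<in> sets circle_borel" using sets.Diff[OF sets.top[of circle_borel] sets_circle_nbhd[of A \<delta>]] by simp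
        fix \<zeta> assume "\<zeta> \<in> sphere 0 1 - ?X"
        then show "\<delta> \<le> cmod (\<tau> - \<zeta>)"
          using infdist_le[OF True, of \<zeta>] by (auto simp: circle_nbhd_def dist_norm norm_minus_commute)
      qed
      finally show ?thesis using True by simp
    qed simp
  qed
  also have "\<dots> = (\<integral>\<^sup>+\<tau>. (\<integral>\<^sup>+\<zeta>\<in>?X. ennreal (poisson (of_real r * \<zeta>) \<tau>) \<partial>arc_length) \<partial>\<nu>) + ennreal (16 * pi * (1 - r) / \<delta>\<^sup>2)"
    using m by (subst nn_integral_add) (auto simp: \<nu>.emeasure_space_1)
  finally show ?thesis unfolding nn_integral_poisson_swap[OF \<nu> sets_circle_nbhd] .
qed

text \<open>Two consequences of the Lebesgue decomposition, made ready for closed test sets: the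
  density is dominated everywhere, and it is the whole measure off the null set carrying the
  singular part.\<close>

lemma ac_density_closed:
  assumes ac: "is_ac_density \<nu> h"
  obtains B where "B \<in> null_sets arc_length"
    "\<And>A. A \<in> sets circle_borel \<Longrightarrow> (\<integral>\<^sup>+\<zeta>\<in>A. ennreal (h \<zeta>) \<partial>arc_length) \<le> emeasure \<nu> A"
    "\<And>A. A \<in> sets circle_borel \<Longrightarrow> A \<inter> B = {} \<Longrightarrow> emeasure \<nu> A = (\<integral>\<^sup>+\<zeta>\<in>A. ennreal (h \<zeta>) \<partial>arc_length)"
proof -
  obtain \<sigma> B where \<sigma>: "sets \<sigma> = sets circle_borel" "B \<in> null_sets arc_length" "emeasure \<sigma> (space \<sigma> - B) = 0"
    "\<And>A. A \<in> sets circle_borel \<Longrightarrow> emeasure \<nu> A = emeasure (density arc_length (\<lambda>z. ennreal (h z))) A + emeasure \<sigma> A"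
    using ac unfolding is_ac_density_def by blast
  have h [measurable]: "h \<in> borel_measurable circle_borel" using ac by (simp add: is_ac_density_def)
  have dens: "emeasure (density arc_length (\<lambda>z. ennreal (h z))) A = (\<integral>\<^sup>+\<zeta>\<in>A. ennreal (h \<zeta>) \<partial>arc_length)" if "A \<in> sets circle_borel" for A
    using that by (subst emeasure_density) auto
  have sp: "space \<sigma> = sphere 0 1" using sets_eq_imp_space_eq[OF \<sigma>(1)] by simp
  show thesis
  proof (rule that[OF \<sigma>(2)])
    fix A assume A: "A \<in> sets circle_borel"
    show "(\<integral>\<^sup>+\<zeta>\<in>A. ennreal (h \<zeta>) \<partial>arc_length) \<le> emeasure \<nu> A" using \<sigma>(4)[OF A] dens[OF A] by simp
    assume AB: "A \<inter> B = {}"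
    have "B \<in> sets \<sigma>" using \<sigma>(1,2) by (auto simp: null_sets_def)
    then have "emeasure \<sigma> A \<le> emeasure \<sigma> (space \<sigma> - B)"
      using A AB sp \<sigma>(1) by (intro emeasure_mono) (auto simp: sets_circle_borel_iff)
    then show "emeasure \<nu> A = (\<integral>\<^sup>+\<zeta>\<in>A. ennreal (h \<zeta>) \<partial>arc_length)" using \<sigma>(3) \<sigma>(4)[OF A] dens[OF A] by simp
  qed
qed

lemma decseq_circle_nbhd: "decseq (\<lambda>n. circle_nbhd A (c / real (Suc n)))" if "0 < c"
proof (rule decseq_SucI)
  fix n
  have "c / real (Suc (Suc n)) \<le> c / real (Suc n)" using that by (intro divide_left_mono) auto
  then show "circle_nbhd A (c / real (Suc (Suc n))) \<subseteq> circle_nbhd A (c / real (Suc n))" by (auto simp: circle_nbhd_def)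
qed

lemma emeasure_circle_nbhd_tendsto:
  assumes A: "closed A" "A \<noteq> {}" "A \<subseteq> sphere 0 1" and c: "0 < c" and N: "sets N = sets circle_borel" and X: "X \<in> sets circle_borel"
    and fin: "emeasure N (circle_nbhd A c \<inter> X) < \<infinity>"
  shows "(\<lambda>n. emeasure N (circle_nbhd A (c / real (Suc n)) \<inter> X)) \<longlonglongrightarrow> emeasure N (A \<inter> X)"
proof -
  let ?D = "\<lambda>n. circle_nbhd A (c / real (Suc n)) \<inter> X"
  have dec: "decseq ?D" using decseq_circle_nbhd[OF c, of A] by (auto simp: decseq_def)
  have s: "?D n \<in> sets N" for n using N X sets.Int[OF sets_circle_nbhd X] by simp
  have "emeasure N (?D n) \<le> emeasure N (circle_nbhd A c \<inter> X)" for n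
    using s[of 0] decseqD[OF dec, of 0 n] by (intro emeasure_mono) auto
  then have "emeasure N (?D n) \<noteq> \<infinity>" for n using fin by (metis infinity_ennreal_def less_top leD)
  from Lim_emeasure_decseq[OF _ dec this] s
  have "(\<lambda>n. emeasure N (?D n)) \<longlonglongrightarrow> emeasure N (\<Inter>n. ?D n)" by blast
  moreover have "(\<Inter>n. ?D n) = A \<inter> X" using circle_nbhd_INT[OF A c] by blast
  ultimately show ?thesis by simp
qed

section \<open>Boundary values\<close>

locale radial_family = schur_family M w for M :: "'a measure" and w +
  fixes \<rho> :: "nat \<Rightarrow> real"
  assumes \<rho>: "\<And>j. 3 / 4 \<le> \<rho> j" "\<And>j. \<rho> j < 1" "\<rho> \<longlonglongrightarrow> 1"
    and Cauchy_w: "AE p in arc_length \<Otimes>\<^sub>M M. Cauchy (\<lambda>j. w (snd p) (of_real (\<rho> j) * fst p))"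
begin

definition W0 :: "complex \<times> 'a \<Rightarrow> complex" where
  "W0 p = lim (\<lambda>j. w (snd p) (of_real (\<rho> j) * fst p))"

lemma \<rho>_nonneg: "0 \<le> \<rho> j" using \<rho>(1)[of j] by simp

sublocale P: pair_sigma_finite arc_length M ..

lemma w_meas_swap:
  assumes r: "0 \<le> r" "r < 1"
  shows "(\<lambda>p. w (snd p) (of_real r * fst p)) \<in> borel_measurable (arc_length \<Otimes>\<^sub>M M)"
  using measurable_compose[OF measurable_pair_swap' w_meas[OF r]]
  by (subst measurable_cong_sets[OF sets_pair_measure_cong[OF sets_arc_length refl] refl]) (simp add: case_prod_beta')

lemma W_meas [measurable]: "(\<lambda>p. w (snd p) (of_real (\<rho> j) * fst p)) \<in> borel_measurable (arc_length \<Otimes>\<^sub>M M)"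
  by (rule w_meas_swap[OF \<rho>_nonneg \<rho>(2)])

lemma W0_meas [measurable]: "W0 \<in> borel_measurable (arc_length \<Otimes>\<^sub>M M)"
  unfolding W0_def[abs_def] by (rule borel_measurable_lim_metric) measurable

lemma w_radial_less: "p \<in> space (arc_length \<Otimes>\<^sub>M M) \<Longrightarrow> 0 \<le> r \<Longrightarrow> r < 1 \<Longrightarrow> cmod (w (snd p) (of_real r * fst p)) < 1"
  by (rule w_less) (auto simp: space_pair_measure norm_mult)

lemma AE_W0:
  "AE p in arc_length \<Otimes>\<^sub>M M. (\<lambda>j. w (snd p) (of_real (\<rho> j) * fst p)) \<longlonglongrightarrow> W0 p \<and> cmod (W0 p) \<le> 1"
  using Cauchy_w AE_space
proof eventually_elim
  case (elim p)
  have c: "(\<lambda>j. w (snd p) (of_real (\<rho> j) * fst p)) \<longlonglongrightarrow> W0 p"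
    unfolding W0_def using elim(1) by (simp add: Cauchy_convergent_iff convergent_LIMSEQ_iff)
  moreover have "cmod (W0 p) \<le> 1"
  proof (rule LIMSEQ_le_const2[OF tendsto_norm[OF c]])
    show "\<exists>N. \<forall>n\<ge>N. cmod (w (snd p) (of_real (\<rho> n) * fst p)) \<le> 1"
      using w_radial_less[OF elim(2) \<rho>_nonneg \<rho>(2)] by (auto intro: less_imp_le)
  qed
  ultimately show ?case ..
qed

lemma nn_integral_H:
  assumes r: "0 \<le> r" "r < 1" and X: "X \<in> sets circle_borel"
  shows "(\<integral>\<^sup>+\<zeta>\<in>X. H \<kappa> (of_real r * \<zeta>) \<partial>arc_length) =
    (\<integral>\<^sup>+p. ennreal (Re (cay \<kappa> (w (snd p) (of_real r * fst p)))) * indicator X (fst p) \<partial>(arc_length \<Otimes>\<^sub>M M))"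
proof -
  note [measurable] = w_meas_swap[OF r] X
  have "(\<integral>\<^sup>+p. ennreal (Re (cay \<kappa> (w (snd p) (of_real r * fst p)))) * indicator X (fst p) \<partial>(arc_length \<Otimes>\<^sub>M M)) =
      (\<integral>\<^sup>+\<zeta>. \<integral>\<^sup>+\<omega>. ennreal (Re (cay \<kappa> (w \<omega> (of_real r * \<zeta>)))) * indicator X \<zeta> \<partial>M \<partial>arc_length)"
    by (subst nn_integral_fst[symmetric]) auto
  also have "\<dots> = (\<integral>\<^sup>+\<zeta>\<in>X. H \<kappa> (of_real r * \<zeta>) \<partial>arc_length)"
  proof (rule nn_integral_cong)
    fix \<zeta> assume "\<zeta> \<in> space arc_length"
    then have [measurable]: "(\<lambda>\<omega>. w \<omega> (of_real r * \<zeta>)) \<in> borel_measurable M"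
      using r by (intro slice_meas) (simp add: norm_mult)
    show "(\<integral>\<^sup>+\<omega>. ennreal (Re (cay \<kappa> (w \<omega> (of_real r * \<zeta>)))) * indicator X \<zeta> \<partial>M) = H \<kappa> (of_real r * \<zeta>) * indicator X \<zeta>"
      unfolding H_def by (rule nn_integral_multc) measurable
  qed
  finally show ?thesis by simp
qed

lemma tendsto_Re_cay:
  assumes "(\<lambda>n. c n * u n) \<longlonglongrightarrow> l" and "l \<noteq> 1" and "\<And>n. c n = complex_of_real (\<kappa> n)" and "l = of_real \<kappa>' * u'"
  shows "(\<lambda>n. ennreal (Re (cay (\<kappa> n) (u n)))) \<longlonglongrightarrow> ennreal (Re (cay \<kappa>' u'))"
proof -
  have "(\<lambda>n. (1 + c n * u n) / (1 - c n * u n)) \<longlonglongrightarrow> (1 + l) / (1 - l)"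
    using assms(1,2) by (intro tendsto_intros) auto
  then show ?thesis unfolding cay_def assms(3,4) by (intro tendsto_ennrealI tendsto_Re)
qed

text \<open>For \<open>\<kappa> < 1\<close> the damped functions are bounded, so limit and mean may
  be exchanged over every measurable \<open>X\<close>, whether or not it lies in a good set.\<close>

lemma H_boundary_limit:
  assumes \<kappa>: "0 \<le> \<kappa>" "\<kappa> < 1" and [measurable]: "X \<in> sets circle_borel"
  shows "(\<lambda>j. \<integral>\<^sup>+\<zeta>\<in>X. H \<kappa> (of_real (\<rho> j) * \<zeta>) \<partial>arc_length) \<longlonglongrightarrow>
    (\<integral>\<^sup>+p. ennreal (Re (cay \<kappa> (W0 p))) * indicator X (fst p) \<partial>(arc_length \<Otimes>\<^sub>M M))"
proof -
  interpret Q: finite_measure "arc_length \<Otimes>\<^sub>M M"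
    by (rule finite_measure_pair_measure[OF finite_measure_axioms arc.finite_measure_axioms])
  show ?thesis
    unfolding nn_integral_H[OF \<rho>_nonneg \<rho>(2) assms(3)]
  proof (rule nn_integral_dominated_convergence[where w = "\<lambda>_. ennreal (2 / (1 - \<kappa>))"])
    show "AE p in arc_length \<Otimes>\<^sub>M M. ennreal (Re (cay \<kappa> (w (snd p) (of_real (\<rho> j) * fst p)))) * indicator X (fst p) \<le> ennreal (2 / (1 - \<kappa>))" for j
    proof (rule AE_I2)
      fix p assume "p \<in> space (arc_length \<Otimes>\<^sub>M M)"
      then have "cmod (w (snd p) (of_real (\<rho> j) * fst p)) \<le> 1"
        using w_radial_less[OF _ \<rho>_nonneg \<rho>(2)] by (simp add: less_imp_le)
      then have "Re (cay \<kappa> (w (snd p) (of_real (\<rho> j) * fst p))) \<le> 2 / (1 - \<kappa>)"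
        using \<kappa> by (intro order_trans[OF complex_Re_le_cmod cay_bound(2)]) auto
      then show "ennreal (Re (cay \<kappa> (w (snd p) (of_real (\<rho> j) * fst p)))) * indicator X (fst p) \<le> ennreal (2 / (1 - \<kappa>))"
        by (auto simp: indicator_def intro: ennreal_leI)
    qed
    show "AE p in arc_length \<Otimes>\<^sub>M M. (\<lambda>j. ennreal (Re (cay \<kappa> (w (snd p) (of_real (\<rho> j) * fst p)))) * indicator X (fst p)) \<longlonglongrightarrow>
        ennreal (Re (cay \<kappa> (W0 p))) * indicator X (fst p)"
      using AE_W0
    proof eventually_elim
      case (elim p)
      have n1: "of_real \<kappa> * W0 p \<noteq> 1"
      proof
        assume "of_real \<kappa> * W0 p = 1"
        then have "\<kappa> * cmod (W0 p) = 1" using \<kappa> by (metis norm_mult norm_of_real norm_one abs_of_nonneg)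
        then show False using elim \<kappa> mult_left_mono[of "cmod (W0 p)" 1 \<kappa>] by simp
      qed
      have "(\<lambda>j. ennreal (Re (cay \<kappa> (w (snd p) (of_real (\<rho> j) * fst p))))) \<longlonglongrightarrow> ennreal (Re (cay \<kappa> (W0 p)))"
        using elim by (intro tendsto_Re_cay[OF tendsto_mult[OF tendsto_const] n1 refl refl]) auto
      then show ?case by (cases "fst p \<in> X") auto
    qed
    show "(\<integral>\<^sup>+p. ennreal (2 / (1 - \<kappa>)) \<partial>(arc_length \<Otimes>\<^sub>M M)) < \<infinity>"
      using less_top[THEN iffD1, OF Q.emeasure_finite[of "space (arc_length \<Otimes>\<^sub>M M)"]] by (simp add: ennreal_mult_less_top)
  qed measurable
qed

text \<open>Fatou's lemma gives finiteness, not convergence. This is enough to exclude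
  \<open>W0 p = 1\<close> almost everywhere over the good set and to supply the dominating function
  for \<kappa> tending to \<open>1\<close>.\<close>

lemma nn_integral_inverse_good:
  "(\<integral>\<^sup>+p. inverse (ennreal (cmod (1 - W0 p))) * indicator (good B) (fst p) \<partial>(arc_length \<Otimes>\<^sub>M M)) \<le> ennreal B * ennreal (2 * pi)"
proof (rule nn_integral_fatou_le)
  let ?u = "\<lambda>j p. inverse (ennreal (cmod (1 - w (snd p) (of_real (\<rho> j) * fst p)))) * indicator (good B) (fst p)"
  show "?u j \<in> borel_measurable (arc_length \<Otimes>\<^sub>M M)" for j by measurable
  show "AE p in arc_length \<Otimes>\<^sub>M M. inverse (ennreal (cmod (1 - W0 p))) * indicator (good B) (fst p) \<le> liminf (\<lambda>j. ?u j p)"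
    using AE_W0
  proof eventually_elim
    case (elim p)
    have "(\<lambda>j. inverse (ennreal (cmod (1 - w (snd p) (of_real (\<rho> j) * fst p))))) \<longlonglongrightarrow> inverse (ennreal (cmod (1 - W0 p)))"
      using elim by (intro tendsto_inverse_ennreal tendsto_ennrealI tendsto_intros) auto
    then show ?case by (intro tendsto_le_liminf) (cases "fst p \<in> good B"; simp)
  qed
  show "(\<integral>\<^sup>+p. ?u j p \<partial>(arc_length \<Otimes>\<^sub>M M)) \<le> ennreal B * ennreal (2 * pi)" for j
  proof -
    have "(\<integral>\<^sup>+p. ?u j p \<partial>(arc_length \<Otimes>\<^sub>M M)) = (\<integral>\<^sup>+\<zeta>. \<integral>\<^sup>+\<omega>. ?u j (\<zeta>, \<omega>) \<partial>M \<partial>arc_length)"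
      by (rule nn_integral_fst[symmetric]) measurable
    also have "\<dots> \<le> (\<integral>\<^sup>+\<zeta>. ennreal B \<partial>arc_length)"
    proof (rule nn_integral_mono)
      fix \<zeta> show "(\<integral>\<^sup>+\<omega>. ?u j (\<zeta>, \<omega>) \<partial>M) \<le> ennreal B"
        using \<rho>(1)[of j] \<rho>(2)[of j] by (cases "\<zeta> \<in> good B") (auto simp: good_def)
    qed
    finally show ?thesis by (simp add: emeasure_arc_length_space)
  qed
qed simp

lemma nn_integral_inverse_finite:
  "(\<integral>\<^sup>+p. inverse (ennreal (cmod (1 - W0 p))) * indicator (good B) (fst p) \<partial>(arc_length \<Otimes>\<^sub>M M)) < \<infinity>"
  using nn_integral_inverse_good[of B] by (rule order.strict_trans1) (simp add: ennreal_mult_less_top)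

lemma AE_W0_neq_1: "AE p in arc_length \<Otimes>\<^sub>M M. fst p \<in> good B \<longrightarrow> W0 p \<noteq> 1"
proof -
  have "AE p in arc_length \<Otimes>\<^sub>M M. inverse (ennreal (cmod (1 - W0 p))) * indicator (good B) (fst p) \<noteq> \<infinity>"
    using nn_integral_inverse_finite[of B] by (intro nn_integral_PInf_AE) auto
  then show ?thesis by eventually_elim auto
qed

lemma cay_boundary_limit:
  assumes [measurable]: "X \<in> sets circle_borel" and X: "X \<subseteq> good B" and \<kappa>: "\<And>n. 0 \<le> \<kappa> n" "\<And>n. \<kappa> n \<le> 1" "\<kappa> \<longlonglongrightarrow> 1"
  shows "(\<lambda>n. \<integral>\<^sup>+p. ennreal (Re (cay (\<kappa> n) (W0 p))) * indicator X (fst p) \<partial>(arc_length \<Otimes>\<^sub>M M)) \<longlonglongrightarrow>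
    (\<integral>\<^sup>+p. ennreal (Re (cay 1 (W0 p))) * indicator X (fst p) \<partial>(arc_length \<Otimes>\<^sub>M M))"
proof (rule nn_integral_dominated_convergence[where w = "\<lambda>p. 4 * (inverse (ennreal (cmod (1 - W0 p))) * indicator (good B) (fst p))"])
  show "AE p in arc_length \<Otimes>\<^sub>M M. ennreal (Re (cay (\<kappa> n) (W0 p))) * indicator X (fst p) \<le> 4 * (inverse (ennreal (cmod (1 - W0 p))) * indicator (good B) (fst p))" for n
    using AE_W0
  proof eventually_elim
    case (elim p)
    then show ?case using cay_le_inverse[OF \<kappa>(1,2), of "W0 p" n] X by (auto simp: indicator_def)
  qed
  show "AE p in arc_length \<Otimes>\<^sub>M M. (\<lambda>n. ennreal (Re (cay (\<kappa> n) (W0 p))) * indicator X (fst p)) \<longlonglongrightarrow> ennreal (Re (cay 1 (W0 p))) * indicator X (fst p)"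
    using AE_W0_neq_1[of B]
  proof eventually_elim
    case (elim p)
    show ?case
    proof (cases "fst p \<in> X")
      case True
      then have n1: "W0 p \<noteq> 1" using elim X by auto
      have "(\<lambda>n. complex_of_real (\<kappa> n) * W0 p) \<longlonglongrightarrow> of_real 1 * W0 p" by (intro tendsto_intros \<kappa>(3))
      from tendsto_Re_cay[OF this _ refl refl] n1 show ?thesis using True by simp
    qed simp
  qed
  show "(\<integral>\<^sup>+p. 4 * (inverse (ennreal (cmod (1 - W0 p))) * indicator (good B) (fst p)) \<partial>(arc_length \<Otimes>\<^sub>M M)) < \<infinity>"
    using nn_integral_inverse_finite[of B] by (subst nn_integral_cmult) (auto simp: ennreal_mult_less_top)
qed measurable

text \<open>The order of limits matters: the outer radius goes to \<open>1\<close> at fixed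
  \<open>\<kappa> < 1\<close>, and only then does \<kappa> go to \<open>1\<close>; the gap term and
  the smoothing error do not depend on \<kappa>. The neighbourhood doubles twice, once in the
  smoothing and once in the gap estimate.\<close>

lemma good_nbhd_bound:
  assumes A: "A \<subseteq> good B" "A \<noteq> {}" and d: "0 < \<delta>" "4 * \<delta> \<le> 1 / 4" and r: "0 \<le> r" "r < 1"
  shows "(\<integral>\<^sup>+\<zeta>\<in>circle_nbhd A \<delta>. H 1 (of_real r * \<zeta>) \<partial>arc_length) \<le>
    (\<integral>\<^sup>+p. ennreal (Re (cay 1 (W0 p))) * indicator (circle_nbhd A (2 * \<delta>) \<inter> good B) (fst p) \<partial>(arc_length \<Otimes>\<^sub>M M)) +
    ennreal (216 * pi) * ennreal B * emeasure arc_length (circle_nbhd A (4 * \<delta>) - good B) + ennreal (16 * pi * (1 - r) / \<delta>\<^sup>2)"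
proof -
  define X where "X = circle_nbhd A (2 * \<delta>) \<inter> good B"
  have X [measurable]: "X \<in> sets circle_borel" by (simp add: X_def)
  define g where "g = ennreal (216 * pi) * ennreal B * emeasure arc_length (circle_nbhd A (4 * \<delta>) - good B)"
  define I where "I \<kappa> = (\<integral>\<^sup>+p. ennreal (Re (cay \<kappa> (W0 p))) * indicator X (fst p) \<partial>(arc_length \<Otimes>\<^sub>M M))" for \<kappa>
  have step: "(\<integral>\<^sup>+\<zeta>\<in>circle_nbhd A \<delta>. H \<kappa> (of_real r * \<zeta>) \<partial>arc_length) \<le> I \<kappa> + g + ennreal (16 * pi * (1 - r) / \<delta>\<^sup>2)"
    if \<kappa>: "0 \<le> \<kappa>" "\<kappa> < 1" for \<kappa>
  proof (rule tendsto_lowerbound)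
    have "(\<lambda>j. ennreal (16 * pi * (1 - r / \<rho> j) / \<delta>\<^sup>2)) \<longlonglongrightarrow> ennreal (16 * pi * (1 - r / 1) / \<delta>\<^sup>2)"
      by (intro tendsto_ennrealI tendsto_intros \<rho>(3)) (use d in auto)
    then show "(\<lambda>j. (\<integral>\<^sup>+\<zeta>\<in>X. H \<kappa> (of_real (\<rho> j) * \<zeta>) \<partial>arc_length) + g + ennreal (16 * pi * (1 - r / \<rho> j) / \<delta>\<^sup>2)) \<longlonglongrightarrow>
        I \<kappa> + g + ennreal (16 * pi * (1 - r) / \<delta>\<^sup>2)"
      unfolding I_def by (intro tendsto_add tendsto_const H_boundary_limit \<kappa> X) simp
    have "\<forall>\<^sub>F j in sequentially. r < \<rho> j" using order_tendstoD(1)[OF \<rho>(3) r(2)] .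
    then show "\<forall>\<^sub>F j in sequentially. (\<integral>\<^sup>+\<zeta>\<in>circle_nbhd A \<delta>. H \<kappa> (of_real r * \<zeta>) \<partial>arc_length) \<le>
        (\<integral>\<^sup>+\<zeta>\<in>X. H \<kappa> (of_real (\<rho> j) * \<zeta>) \<partial>arc_length) + g + ennreal (16 * pi * (1 - r / \<rho> j) / \<delta>\<^sup>2)"
    proof eventually_elim
      case (elim j)
      note [measurable] = H_meas[OF \<rho>_nonneg \<rho>(2), of \<kappa> j]
      let ?Y = "circle_nbhd A (2 * \<delta>) - good B"
      have "(\<integral>\<^sup>+\<xi>\<in>circle_nbhd A (2 * \<delta>). H \<kappa> (of_real (\<rho> j) * \<xi>) \<partial>arc_length) =
          (\<integral>\<^sup>+\<xi>. H \<kappa> (of_real (\<rho> j) * \<xi>) * indicator X \<xi> + H \<kappa> (of_real (\<rho> j) * \<xi>) * indicator ?Y \<xi> \<partial>arc_length)"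
        by (intro nn_integral_cong) (auto simp: indicator_def X_def)
      also have "\<dots> = (\<integral>\<^sup>+\<xi>\<in>X. H \<kappa> (of_real (\<rho> j) * \<xi>) \<partial>arc_length) + (\<integral>\<^sup>+\<xi>\<in>?Y. H \<kappa> (of_real (\<rho> j) * \<xi>) \<partial>arc_length)"
        by (rule nn_integral_add) measurable
      also have "\<dots> \<le> (\<integral>\<^sup>+\<xi>\<in>X. H \<kappa> (of_real (\<rho> j) * \<xi>) \<partial>arc_length) + g"
        using gap_estimate[OF A _ _ \<rho>(1,2)[of j], of "2 * \<delta>" \<kappa>] d \<kappa> by (intro add_left_mono) (simp add: g_def)
      finally have "(\<integral>\<^sup>+\<xi>\<in>circle_nbhd A (2 * \<delta>). H \<kappa> (of_real (\<rho> j) * \<xi>) \<partial>arc_length) \<le> (\<integral>\<^sup>+\<xi>\<in>X. H \<kappa> (of_real (\<rho> j) * \<xi>) \<partial>arc_length) + g" .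
      from add_right_mono[OF this]
      show ?case using H_smoothing[OF r(1) elim \<rho>(2), of \<kappa> \<delta> A] \<kappa> d by (meson less_imp_le order_trans)
    qed
  qed simp
  define \<kappa> where "\<kappa> n = 1 - 1 / real (n + 2)" for n
  have \<kappa>: "0 \<le> \<kappa> n" "\<kappa> n < 1" "\<kappa> n \<le> 1" for n by (auto simp: \<kappa>_def)
  have \<kappa>_lim: "\<kappa> \<longlonglongrightarrow> 1" unfolding \<kappa>_def
    using tendsto_diff[OF tendsto_const LIMSEQ_ignore_initial_segment[OF lim_const_over_n[of 1], of 2], of 1] by simp
  note [measurable] = w_meas_swap[OF r]
  have "(\<integral>\<^sup>+p. ennreal (Re (cay 1 (w (snd p) (of_real r * fst p)))) * indicator (circle_nbhd A \<delta>) (fst p) \<partial>(arc_length \<Otimes>\<^sub>M M)) \<le>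
      I 1 + g + ennreal (16 * pi * (1 - r) / \<delta>\<^sup>2)"
  \<comment> \<open>Inside the disc the left side passes to \<open>\<kappa> = 1\<close> by Fatou's
    lemma. The right side converges by domination, which is where the restriction of
    \<open>X\<close> to the good set counts.\<close>
  proof (rule nn_integral_fatou_le)
    let ?u = "\<lambda>n p. ennreal (Re (cay (\<kappa> n) (w (snd p) (of_real r * fst p)))) * indicator (circle_nbhd A \<delta>) (fst p)"
    show "?u n \<in> borel_measurable (arc_length \<Otimes>\<^sub>M M)" for n by measurable
    show "(\<integral>\<^sup>+p. ?u n p \<partial>(arc_length \<Otimes>\<^sub>M M)) \<le> I (\<kappa> n) + g + ennreal (16 * pi * (1 - r) / \<delta>\<^sup>2)" for n
      using step[OF \<kappa>(1,2)[of n]] unfolding nn_integral_H[OF r sets_circle_nbhd] .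
    show "(\<lambda>n. I (\<kappa> n) + g + ennreal (16 * pi * (1 - r) / \<delta>\<^sup>2)) \<longlonglongrightarrow> I 1 + g + ennreal (16 * pi * (1 - r) / \<delta>\<^sup>2)"
      unfolding I_def by (intro tendsto_add tendsto_const cay_boundary_limit[of X B] X \<kappa> \<kappa>_lim) (simp add: X_def)
    show "AE p in arc_length \<Otimes>\<^sub>M M. ennreal (Re (cay 1 (w (snd p) (of_real r * fst p)))) * indicator (circle_nbhd A \<delta>) (fst p) \<le> liminf (\<lambda>n. ?u n p)"
    proof (intro AE_I2 tendsto_le_liminf)
      fix p assume p: "p \<in> space (arc_length \<Otimes>\<^sub>M M)"
      have "w (snd p) (of_real r * fst p) \<noteq> 1" using w_radial_less[OF p r] by auto
      moreover have "(\<lambda>n. complex_of_real (\<kappa> n) * w (snd p) (of_real r * fst p)) \<longlonglongrightarrow> of_real 1 * w (snd p) (of_real r * fst p)"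
        by (intro tendsto_intros \<kappa>_lim)
      ultimately have "(\<lambda>n. ennreal (Re (cay (\<kappa> n) (w (snd p) (of_real r * fst p))))) \<longlonglongrightarrow> ennreal (Re (cay 1 (w (snd p) (of_real r * fst p))))"
        using tendsto_Re_cay[OF _ _ refl refl, of \<kappa> "\<lambda>_. w (snd p) (of_real r * fst p)" 1] by simp
      then show "(\<lambda>n. ?u n p) \<longlonglongrightarrow> ennreal (Re (cay 1 (w (snd p) (of_real r * fst p)))) * indicator (circle_nbhd A \<delta>) (fst p)"
        by (cases "fst p \<in> circle_nbhd A \<delta>") auto
    qed
  qed
  then show ?thesis unfolding nn_integral_H[OF r sets_circle_nbhd] I_def g_def X_def .
qed

definition F0 :: "complex \<Rightarrow> ennreal" where
  "F0 \<zeta> = (\<integral>\<^sup>+\<omega>. ennreal (Re (cay 1 (W0 (\<zeta>, \<omega>)))) \<partial>M)"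

lemma F0_meas [measurable]: "F0 \<in> borel_measurable circle_borel"
  unfolding F0_def[abs_def] borel_measurable_arc_length[symmetric]
  by (rule borel_measurable_nn_integral) (unfold case_prod_beta', measurable)

lemma nn_integral_F0:
  assumes [measurable]: "X \<in> sets circle_borel"
  shows "(\<integral>\<^sup>+p. ennreal (Re (cay 1 (W0 p))) * indicator X (fst p) \<partial>(arc_length \<Otimes>\<^sub>M M)) = (\<integral>\<^sup>+\<zeta>\<in>X. F0 \<zeta> \<partial>arc_length)"
proof -
  have "(\<integral>\<^sup>+p. ennreal (Re (cay 1 (W0 p))) * indicator X (fst p) \<partial>(arc_length \<Otimes>\<^sub>M M)) =
      (\<integral>\<^sup>+\<zeta>. \<integral>\<^sup>+\<omega>. ennreal (Re (cay 1 (W0 (\<zeta>, \<omega>)))) * indicator X \<zeta> \<partial>M \<partial>arc_length)"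
    by (subst nn_integral_fst[symmetric]) auto
  also have "\<dots> = (\<integral>\<^sup>+\<zeta>\<in>X. F0 \<zeta> \<partial>arc_length)"
    unfolding F0_def by (intro nn_integral_cong nn_integral_multc) measurable
  finally show ?thesis .
qed

text \<open>Two successive limits: the radius goes to \<open>1\<close> at fixed
  \<open>\<delta>\<close> and removes the error terms, then \<open>\<delta>\<close> goes to
  \<open>0\<close>. As \<open>A\<close> lies in the good set, its neighbourhoods minus the good set
  decrease to the empty set, so the gap term dies.\<close>

lemma closed_good_le_F0:
  assumes k: "prob_space k" "sets k = sets circle_borel"
    and kP: "\<And>z. cmod z < 1 \<Longrightarrow> (\<integral>\<^sup>+\<tau>. ennreal (poisson z \<tau>) \<partial>k) = H 1 z"
    and A: "closed A" "A \<subseteq> good B"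
  shows "ennreal (2 * pi) * emeasure k A \<le> (\<integral>\<^sup>+\<zeta>\<in>A. F0 \<zeta> \<partial>arc_length)"
proof (cases "A = {}")
  case False
  have A1: "A \<subseteq> sphere 0 1" using A(2) good_circle by blast
  have As [measurable]: "A \<in> sets circle_borel" by (rule circle_closed_sets[OF A(1) A1])
  define Q where "Q = density arc_length F0"
  have Q: "sets Q = sets circle_borel" "\<And>X. X \<in> sets circle_borel \<Longrightarrow> emeasure Q X = (\<integral>\<^sup>+\<zeta>\<in>X. F0 \<zeta> \<partial>arc_length)"
    by (auto simp: Q_def emeasure_density)
  define g where "g \<delta> = ennreal (216 * pi) * ennreal B * emeasure arc_length (circle_nbhd A (4 * \<delta>) - good B)" for \<delta>
  have 1: "ennreal (2 * pi) * emeasure k A \<le> emeasure Q (circle_nbhd A (2 * \<delta>) \<inter> good B) + g \<delta>" if d: "0 < \<delta>" "4 * \<delta> \<le> 1 / 4" for \<delta>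
  proof (rule LIMSEQ_le_const)
    let ?e = "\<lambda>n. ennreal (16 * pi * (1 - \<rho> n) / \<delta>\<^sup>2)"
    have "?e \<longlonglongrightarrow> ennreal (16 * pi * (1 - 1) / \<delta>\<^sup>2)"
      by (intro tendsto_ennrealI tendsto_intros \<rho>(3)) (use d in auto)
    then have e: "?e \<longlonglongrightarrow> 0" by simp
    have "(\<lambda>n. emeasure Q (circle_nbhd A (2 * \<delta>) \<inter> good B) + g \<delta> + ?e n + ?e n) \<longlonglongrightarrow>
       emeasure Q (circle_nbhd A (2 * \<delta>) \<inter> good B) + g \<delta> + 0 + 0"
      by (intro tendsto_add tendsto_const e)
    then show "(\<lambda>n. emeasure Q (circle_nbhd A (2 * \<delta>) \<inter> good B) + g \<delta> + ?e n + ?e n) \<longlonglongrightarrow>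
       emeasure Q (circle_nbhd A (2 * \<delta>) \<inter> good B) + g \<delta>" by simp
    \<comment> \<open>The error occurs twice, once for replacing \<open>k\<close> by its Poisson
      integral and once for the smoothing inside \<open>good_nbhd_bound\<close>.\<close>
    have "ennreal (2 * pi) * emeasure k A \<le> emeasure Q (circle_nbhd A (2 * \<delta>) \<inter> good B) + g \<delta> + ?e n + ?e n" for n
    proof -
      have "ennreal (2 * pi) * emeasure k A \<le> (\<integral>\<^sup>+\<zeta>\<in>circle_nbhd A \<delta>. (\<integral>\<^sup>+\<tau>. ennreal (poisson (of_real (\<rho> n) * \<zeta>) \<tau>) \<partial>k) \<partial>arc_length) + ?e n"
        by (rule closed_le_poisson_integral[OF k As \<rho>_nonneg \<rho>(2) d(1)])
      also have "(\<integral>\<^sup>+\<zeta>\<in>circle_nbhd A \<delta>. (\<integral>\<^sup>+\<tau>. ennreal (poisson (of_real (\<rho> n) * \<zeta>) \<tau>) \<partial>k) \<partial>arc_length) =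
          (\<integral>\<^sup>+\<zeta>\<in>circle_nbhd A \<delta>. H 1 (of_real (\<rho> n) * \<zeta>) \<partial>arc_length)"
        using kP \<rho>_nonneg \<rho>(2) by (intro nn_integral_cong) (simp add: norm_mult)
      also have "\<dots> \<le> emeasure Q (circle_nbhd A (2 * \<delta>) \<inter> good B) + g \<delta> + ?e n"
        using good_nbhd_bound[OF A(2) False d \<rho>_nonneg \<rho>(2), of n] unfolding g_def by (simp add: nn_integral_F0 Q(2))
      finally show ?thesis by (simp add: add_right_mono)
    qed
    then show "\<exists>N. \<forall>n\<ge>N. ennreal (2 * pi) * emeasure k A \<le> emeasure Q (circle_nbhd A (2 * \<delta>) \<inter> good B) + g \<delta> + ?e n + ?e n" by blast
  qed
  \<comment> \<open>Continuity from above along the shrinking neighbourhoods requires finite mass at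
    the first of them.\<close>
  have fin: "emeasure Q (circle_nbhd A (1/8) \<inter> good B) < \<infinity>"
  proof -
    have "emeasure Q (circle_nbhd A (1/8) \<inter> good B) =
        (\<integral>\<^sup>+p. ennreal (Re (cay 1 (W0 p))) * indicator (circle_nbhd A (1/8) \<inter> good B) (fst p) \<partial>(arc_length \<Otimes>\<^sub>M M))"
      by (simp add: Q(2) nn_integral_F0)
    also have "\<dots> \<le> (\<integral>\<^sup>+p. 4 * (inverse (ennreal (cmod (1 - W0 p))) * indicator (good B) (fst p)) \<partial>(arc_length \<Otimes>\<^sub>M M))"
    proof (rule nn_integral_mono_AE)
      show "AE p in arc_length \<Otimes>\<^sub>M M. ennreal (Re (cay 1 (W0 p))) * indicator (circle_nbhd A (1/8) \<inter> good B) (fst p) \<le>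
         4 * (inverse (ennreal (cmod (1 - W0 p))) * indicator (good B) (fst p))"
        using AE_W0
      proof eventually_elim
        case (elim p)
        then show ?case using cay_le_inverse[of 1 "W0 p"] by (auto simp: indicator_def)
      qed
    qed
    also have "\<dots> = 4 * (\<integral>\<^sup>+p. (inverse (ennreal (cmod (1 - W0 p))) * indicator (good B) (fst p)) \<partial>(arc_length \<Otimes>\<^sub>M M))"
      by (rule nn_integral_cmult) measurable
    also have "\<dots> \<le> 4 * (ennreal B * ennreal (2 * pi))" by (intro mult_left_mono nn_integral_inverse_good) simp
    also have "\<dots> < \<infinity>" by (simp add: ennreal_mult_less_top)
    finally show ?thesis .
  qed
  have "ennreal (2 * pi) * emeasure k A \<le> emeasure Q (A \<inter> good B) + ennreal (216 * pi) * ennreal B * emeasure arc_length (A \<inter> (sphere 0 1 - good B))"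
  proof (rule LIMSEQ_le_const)
    have G': "sphere 0 1 - good B \<in> sets circle_borel" using sets.Diff[OF sets.top[of circle_borel] good_sets] by simp
    have t1: "(\<lambda>n. emeasure arc_length (circle_nbhd A (1 / 4 / real (Suc n)) \<inter> (sphere 0 1 - good B))) \<longlonglongrightarrow> emeasure arc_length (A \<inter> (sphere 0 1 - good B))"
      by (rule emeasure_circle_nbhd_tendsto[OF A(1) False A1 _ sets_arc_length G']) (auto simp: arc.emeasure_finite top.not_eq_extremum[symmetric])
    have t2: "(\<lambda>n. emeasure Q (circle_nbhd A (1 / 8 / real (Suc n)) \<inter> good B)) \<longlonglongrightarrow> emeasure Q (A \<inter> good B)"
      by (rule emeasure_circle_nbhd_tendsto[OF A(1) False A1 _ Q(1) good_sets fin]) simp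
    show "(\<lambda>n. emeasure Q (circle_nbhd A (1 / 8 / real (Suc n)) \<inter> good B) +
       ennreal (216 * pi) * ennreal B * emeasure arc_length (circle_nbhd A (1 / 4 / real (Suc n)) \<inter> (sphere 0 1 - good B))) \<longlonglongrightarrow>
       emeasure Q (A \<inter> good B) + ennreal (216 * pi) * ennreal B * emeasure arc_length (A \<inter> (sphere 0 1 - good B))"
      by (intro tendsto_add t2 ennreal_tendsto_cmult t1) (simp add: ennreal_mult_less_top)
    have "ennreal (2 * pi) * emeasure k A \<le> emeasure Q (circle_nbhd A (1 / 8 / real (Suc n)) \<inter> good B) +
       ennreal (216 * pi) * ennreal B * emeasure arc_length (circle_nbhd A (1 / 4 / real (Suc n)) \<inter> (sphere 0 1 - good B))" for n
    proof -
      have e: "circle_nbhd A x - good B = circle_nbhd A x \<inter> (sphere 0 1 - good B)" for x by (auto simp: circle_nbhd_def)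
      have "1 / real (Suc n) \<le> 1" by simp
      moreover have "2 * (1 / 16 / real (Suc n)) = 1 / 8 / real (Suc n)" "4 * (1 / 16 / real (Suc n)) = 1 / 4 / real (Suc n)" by (simp_all add: field_simps)
      ultimately show ?thesis using 1[of "1 / 16 / real (Suc n)"] unfolding g_def e by simp
    qed
    then show "\<exists>N. \<forall>n\<ge>N. ennreal (2 * pi) * emeasure k A \<le> emeasure Q (circle_nbhd A (1 / 8 / real (Suc n)) \<inter> good B) +
       ennreal (216 * pi) * ennreal B * emeasure arc_length (circle_nbhd A (1 / 4 / real (Suc n)) \<inter> (sphere 0 1 - good B))" by blast
  qed
  moreover have "A \<inter> good B = A" "A \<inter> (sphere 0 1 - good B) = {}" using A(2) by auto
  ultimately show ?thesis using Q(2)[OF As] by simp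
qed (use k in simp)

text \<open>For fixed \<omega>, Fatou's lemma and shrinking neighbourhoods bound the integral of the
  boundary values over a closed set by \<open>2 * pi\<close> times its measure. On closed sets
  avoiding the carrier of the singular part that measure is the integral of the density.\<close>

lemma AE_boundary_le_ac:
  assumes \<nu>: "\<And>\<omega>. \<omega> \<in> space M \<Longrightarrow> prob_space (\<nu> \<omega>)" "\<And>\<omega>. \<omega> \<in> space M \<Longrightarrow> sets (\<nu> \<omega>) = sets circle_borel"
    and \<nu>P: "\<And>\<omega> z. \<omega> \<in> space M \<Longrightarrow> cmod z < 1 \<Longrightarrow> (\<integral>\<^sup>+\<tau>. ennreal (poisson z \<tau>) \<partial>\<nu> \<omega>) = ennreal (Re (cay 1 (w \<omega> z)))"
    and ac: "\<And>\<omega>. \<omega> \<in> space M \<Longrightarrow> is_ac_density (\<nu> \<omega>) (\<nu>_ac \<omega>)"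
  shows "AE \<omega> in M. AE \<zeta> in arc_length. ennreal (Re (cay 1 (W0 (\<zeta>, \<omega>)))) \<le> ennreal (2 * pi) * ennreal (\<nu>_ac \<omega> \<zeta>)"
proof -
  let ?c = "\<lambda>\<zeta> \<omega>. Cauchy (\<lambda>j. w \<omega> (of_real (\<rho> j) * \<zeta>))"
  have "{p \<in> space (arc_length \<Otimes>\<^sub>M M). ?c (fst p) (snd p)} \<in> sets (arc_length \<Otimes>\<^sub>M M)"
    by (rule sets_Collect_Cauchy) measurable
  from P.AE_commute[OF this] P.AE_pair[OF Cauchy_w]
  have conv_AE: "AE \<omega> in M. AE \<zeta> in arc_length. ?c \<zeta> \<omega>" by simp
  show ?thesis
  proof (rule AE_mp[OF conv_AE], rule AE_I2, rule impI)
    fix \<omega> assume \<omega>: "\<omega> \<in> space M" and conv: "AE \<zeta> in arc_length. ?c \<zeta> \<omega>"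
    let ?u = "\<lambda>\<zeta>. ennreal (Re (cay 1 (W0 (\<zeta>, \<omega>))))"
    have [measurable]: "(\<lambda>\<zeta>. W0 (\<zeta>, \<omega>)) \<in> borel_measurable circle_borel"
      using measurable_compose[OF measurable_Pair2'[OF \<omega>] W0_meas] borel_measurable_arc_length by blast
    have [measurable]: "(\<lambda>\<zeta>. w \<omega> (of_real (\<rho> j) * \<zeta>)) \<in> borel_measurable circle_borel" for j
      using measurable_compose[OF measurable_Pair2'[OF \<omega>] W_meas[of j]] borel_measurable_arc_length by simp
    have nac [measurable]: "\<nu>_ac \<omega> \<in> borel_measurable circle_borel" using ac[OF \<omega>] by (simp add: is_ac_density_def)
    have lim: "AE \<zeta> in arc_length. ?u \<zeta> \<le> liminf (\<lambda>j. ennreal (Re (cay 1 (w \<omega> (of_real (\<rho> j) * \<zeta>)))))"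
      using conv
    proof eventually_elim
      case (elim \<zeta>)
      show ?case
      proof (cases "W0 (\<zeta>, \<omega>) = 1")
        \<comment> \<open>\<open>cay 1 1\<close> is a division by zero, hence \<open>0\<close>, and
          the bound is trivial.\<close>
        case True
        then show ?thesis by (simp add: cay_def)
      next
        case False
        have "(\<lambda>j. w \<omega> (of_real (\<rho> j) * \<zeta>)) \<longlonglongrightarrow> W0 (\<zeta>, \<omega>)"
          unfolding W0_def using elim by (simp add: Cauchy_convergent_iff convergent_LIMSEQ_iff)
        then show ?thesis
          using False by (intro tendsto_le_liminf tendsto_Re_cay[where c = "\<lambda>_. 1" and l = "W0 (\<zeta>, \<omega>)"]) auto
      qed
    qed
    have nb: "(\<integral>\<^sup>+\<zeta>\<in>A. ?u \<zeta> \<partial>arc_length) \<le> ennreal (2 * pi) * emeasure (\<nu> \<omega>) (circle_nbhd A \<delta>)"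
      if [measurable]: "A \<in> sets circle_borel" and d: "0 < \<delta>" for A \<delta>
    proof (rule nn_integral_fatou_le)
      show "(\<lambda>\<zeta>. ennreal (Re (cay 1 (w \<omega> (of_real (\<rho> j) * \<zeta>)))) * indicator A \<zeta>) \<in> borel_measurable arc_length" for j by measurable
      show "AE \<zeta> in arc_length. ?u \<zeta> * indicator A \<zeta> \<le> liminf (\<lambda>j. ennreal (Re (cay 1 (w \<omega> (of_real (\<rho> j) * \<zeta>)))) * indicator A \<zeta>)"
        using lim
      proof eventually_elim
        case (elim \<zeta>) then show ?case by (cases "\<zeta> \<in> A") auto
      qed
      show "(\<integral>\<^sup>+\<zeta>\<in>A. ennreal (Re (cay 1 (w \<omega> (of_real (\<rho> j) * \<zeta>)))) \<partial>arc_length) \<le>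
          ennreal (2 * pi) * emeasure (\<nu> \<omega>) (circle_nbhd A \<delta>) + ennreal (16 * pi * (1 - \<rho> j) / \<delta>\<^sup>2)" for j
      proof -
        have "(\<integral>\<^sup>+\<zeta>\<in>A. ennreal (Re (cay 1 (w \<omega> (of_real (\<rho> j) * \<zeta>)))) \<partial>arc_length) =
            (\<integral>\<^sup>+\<zeta>\<in>A. (\<integral>\<^sup>+\<tau>. ennreal (poisson (of_real (\<rho> j) * \<zeta>) \<tau>) \<partial>\<nu> \<omega>) \<partial>arc_length)"
          using \<nu>P[OF \<omega>] \<rho>_nonneg \<rho>(2) by (intro nn_integral_cong) (simp add: norm_mult)
        then show ?thesis using poisson_integral_le_nbhd[OF \<nu>[OF \<omega>] that(1) \<rho>_nonneg \<rho>(2) d, of j] by simp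
      qed
      have "(\<lambda>j. ennreal (16 * pi * (1 - \<rho> j) / \<delta>\<^sup>2)) \<longlonglongrightarrow> ennreal (16 * pi * (1 - 1) / \<delta>\<^sup>2)"
        by (intro tendsto_ennrealI tendsto_intros \<rho>(3)) (use d in auto)
      from tendsto_add[OF tendsto_const this]
      show "(\<lambda>j. ennreal (2 * pi) * emeasure (\<nu> \<omega>) (circle_nbhd A \<delta>) + ennreal (16 * pi * (1 - \<rho> j) / \<delta>\<^sup>2)) \<longlonglongrightarrow>
          ennreal (2 * pi) * emeasure (\<nu> \<omega>) (circle_nbhd A \<delta>)" by simp
    qed
    interpret n: prob_space "\<nu> \<omega>" by (rule \<nu>(1)[OF \<omega>])
    obtain B where B: "B \<in> null_sets arc_length"
      "\<And>A. A \<in> sets circle_borel \<Longrightarrow> A \<inter> B = {} \<Longrightarrow> emeasure (\<nu> \<omega>) A = (\<integral>\<^sup>+\<zeta>\<in>A. ennreal (\<nu>_ac \<omega> \<zeta>) \<partial>arc_length)"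
      using ac_density_closed[OF ac[OF \<omega>]] by metis
    have Bs: "B \<in> sets circle_borel" using B(1) by (auto simp: null_sets_def)
    have "AE \<zeta> in arc_length. \<zeta> \<in> sphere 0 1 - B \<longrightarrow> ?u \<zeta> \<le> ennreal (2 * pi) * ennreal (\<nu>_ac \<omega> \<zeta>)"
    proof (rule AE_le_of_closed_integrals)
      show "sphere 0 1 - B \<in> sets circle_borel" using sets.Diff[OF sets.top[of circle_borel] Bs] by simp
      have "(\<integral>\<^sup>+\<zeta>. ?u \<zeta> \<partial>arc_length) = (\<integral>\<^sup>+\<zeta>\<in>sphere 0 1. ?u \<zeta> \<partial>arc_length)"
        by (intro nn_integral_cong) simp
      also have "\<dots> \<le> ennreal (2 * pi) * emeasure (\<nu> \<omega>) (circle_nbhd (sphere 0 1) 1)"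
        using sets.top[of circle_borel] by (intro nb) auto
      also have "\<dots> < \<infinity>"
        using less_top[THEN iffD1, OF n.emeasure_finite] by (simp add: ennreal_mult_less_top)
      finally show "(\<integral>\<^sup>+\<zeta>. ?u \<zeta> \<partial>arc_length) < \<infinity>" .
      fix A assume A: "closed A" "A \<subseteq> sphere 0 1 - B"
      then have A1: "A \<subseteq> sphere 0 1" and As [measurable]: "A \<in> sets circle_borel" by (auto intro: circle_closed_sets)
      show "(\<integral>\<^sup>+\<zeta>\<in>A. ?u \<zeta> \<partial>arc_length) \<le> (\<integral>\<^sup>+\<zeta>\<in>A. ennreal (2 * pi) * ennreal (\<nu>_ac \<omega> \<zeta>) \<partial>arc_length)"
      proof (cases "A = {}")
        case False
        have "(\<integral>\<^sup>+\<zeta>\<in>A. ?u \<zeta> \<partial>arc_length) \<le> ennreal (2 * pi) * emeasure (\<nu> \<omega>) (A \<inter> sphere 0 1)"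
        proof (rule LIMSEQ_le_const)
          show "(\<lambda>n. ennreal (2 * pi) * emeasure (\<nu> \<omega>) (circle_nbhd A (1 / real (Suc n)) \<inter> sphere 0 1)) \<longlonglongrightarrow>
              ennreal (2 * pi) * emeasure (\<nu> \<omega>) (A \<inter> sphere 0 1)"
            using sets.top[of circle_borel]
            by (intro ennreal_tendsto_cmult emeasure_circle_nbhd_tendsto[OF A(1) False A1]) (auto simp: \<nu>(2)[OF \<omega>] n.emeasure_finite less_top[symmetric])
          have "circle_nbhd A x \<inter> sphere 0 1 = circle_nbhd A x" for x by (auto simp: circle_nbhd_def)
          then show "\<exists>N. \<forall>n\<ge>N. (\<integral>\<^sup>+\<zeta>\<in>A. ?u \<zeta> \<partial>arc_length) \<le> ennreal (2 * pi) * emeasure (\<nu> \<omega>) (circle_nbhd A (1 / real (Suc n)) \<inter> sphere 0 1)"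
            using nb[OF As] by simp
        qed
        also have "A \<inter> sphere 0 1 = A" using A1 by auto
        also have "ennreal (2 * pi) * emeasure (\<nu> \<omega>) A = ennreal (2 * pi) * (\<integral>\<^sup>+\<zeta>\<in>A. ennreal (\<nu>_ac \<omega> \<zeta>) \<partial>arc_length)"
          using A(2) by (subst B(2)[OF As]) auto
        also have "\<dots> = (\<integral>\<^sup>+\<zeta>\<in>A. ennreal (2 * pi) * ennreal (\<nu>_ac \<omega> \<zeta>) \<partial>arc_length)"
          by (subst nn_integral_cmult[symmetric]) (auto simp: mult.assoc)
        finally show ?thesis .
      qed simp
    qed measurable
    then show "AE \<zeta> in arc_length. ?u \<zeta> \<le> ennreal (2 * pi) * ennreal (\<nu>_ac \<omega> \<zeta>)"
      using AE_not_in[OF B(1)] AE_space[of arc_length] by eventually_elim auto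
  qed
qed

end

lemma (in schur_family) closed_good_le_ac:
  assumes k: "prob_space k" "sets k = sets circle_borel"
    and kP: "\<And>z. cmod z < 1 \<Longrightarrow> (\<integral>\<^sup>+\<tau>. ennreal (poisson z \<tau>) \<partial>k) = H 1 z"
    and \<nu>: "\<And>\<omega>. \<omega> \<in> space M \<Longrightarrow> prob_space (\<nu> \<omega>)" "\<And>\<omega>. \<omega> \<in> space M \<Longrightarrow> sets (\<nu> \<omega>) = sets circle_borel"
    and \<nu>P: "\<And>\<omega> z. \<omega> \<in> space M \<Longrightarrow> cmod z < 1 \<Longrightarrow> (\<integral>\<^sup>+\<tau>. ennreal (poisson z \<tau>) \<partial>\<nu> \<omega>) = ennreal (Re (cay 1 (w \<omega> z)))"
    and ac: "\<And>\<omega>. \<omega> \<in> space M \<Longrightarrow> is_ac_density (\<nu> \<omega>) (\<nu>_ac \<omega>)"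
    and ac_meas: "(\<lambda>p. \<nu>_ac (snd p) (fst p)) \<in> borel_measurable (arc_length \<Otimes>\<^sub>M M)"
    and A: "closed A" "A \<subseteq> good B"
  shows "emeasure k A \<le> (\<integral>\<^sup>+\<zeta>\<in>A. (\<integral>\<^sup>+\<omega>. ennreal (\<nu>_ac \<omega> \<zeta>) \<partial>M) \<partial>arc_length)"
proof -
  obtain \<rho> where \<rho>: "\<And>j. 3 / 4 \<le> \<rho> j" "\<And>j. \<rho> j < 1" "\<rho> \<longlonglongrightarrow> 1"
    "AE p in arc_length \<Otimes>\<^sub>M M. Cauchy (\<lambda>j. w (snd p) (of_real (\<rho> j) * fst p))"
    using radial_subsequence by blast
  interpret R: radial_family M w \<rho> by unfold_locales (use \<rho> in auto)
  note [measurable] = ac_meas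
  have As [measurable]: "A \<in> sets circle_borel" using A good_circle by (intro circle_closed_sets) auto
  have [measurable]: "(\<lambda>\<zeta>. \<integral>\<^sup>+\<omega>. ennreal (\<nu>_ac \<omega> \<zeta>) \<partial>M) \<in> borel_measurable circle_borel"
    unfolding borel_measurable_arc_length[symmetric]
    by (rule borel_measurable_nn_integral) (unfold case_prod_beta', measurable)
  let ?Q = "\<lambda>\<zeta> \<omega>. ennreal (Re (cay 1 (R.W0 (\<zeta>, \<omega>)))) \<le> ennreal (2 * pi) * ennreal (\<nu>_ac \<omega> \<zeta>)"
  have "{p \<in> space (arc_length \<Otimes>\<^sub>M M). ?Q (fst p) (snd p)} \<in> sets (arc_length \<Otimes>\<^sub>M M)"
    unfolding prod.collapse by measurable
  from R.P.AE_commute[OF this] R.AE_boundary_le_ac[OF \<nu> \<nu>P ac]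
  have ae: "AE \<zeta> in arc_length. AE \<omega> in M. ?Q \<zeta> \<omega>" by simp
  have "ennreal (2 * pi) * emeasure k A \<le> (\<integral>\<^sup>+\<zeta>\<in>A. R.F0 \<zeta> \<partial>arc_length)" by (rule R.closed_good_le_F0[OF k kP A])
  also have "\<dots> \<le> (\<integral>\<^sup>+\<zeta>. ennreal (2 * pi) * ((\<integral>\<^sup>+\<omega>. ennreal (\<nu>_ac \<omega> \<zeta>) \<partial>M) * indicator A \<zeta>) \<partial>arc_length)"
  proof (rule nn_integral_mono_AE)
    show "AE \<zeta> in arc_length. R.F0 \<zeta> * indicator A \<zeta> \<le> ennreal (2 * pi) * ((\<integral>\<^sup>+\<omega>. ennreal (\<nu>_ac \<omega> \<zeta>) \<partial>M) * indicator A \<zeta>)"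
      using ae AE_space
    proof eventually_elim
      case (elim \<zeta>)
      have [measurable]: "(\<lambda>\<omega>. \<nu>_ac \<omega> \<zeta>) \<in> borel_measurable M"
        using measurable_compose[OF measurable_Pair1'[OF elim(2)] ac_meas] by simp
      have "R.F0 \<zeta> \<le> (\<integral>\<^sup>+\<omega>. ennreal (2 * pi) * ennreal (\<nu>_ac \<omega> \<zeta>) \<partial>M)"
        unfolding R.F0_def by (rule nn_integral_mono_AE[OF elim(1)])
      also have "\<dots> = ennreal (2 * pi) * (\<integral>\<^sup>+\<omega>. ennreal (\<nu>_ac \<omega> \<zeta>) \<partial>M)"
        by (rule nn_integral_cmult) measurable
      finally show ?case by (cases "\<zeta> \<in> A") auto
    qed
  qed
  also have "\<dots> = ennreal (2 * pi) * (\<integral>\<^sup>+\<zeta>\<in>A. (\<integral>\<^sup>+\<omega>. ennreal (\<nu>_ac \<omega> \<zeta>) \<partial>M) \<partial>arc_length)"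
    by (rule nn_integral_cmult) measurable
  finally show ?thesis by (subst (asm) ennreal_mult_le_mult_iff) auto
qed

section \<open>The density of states\<close>

lemma holomorphic_schur_prod:
  assumes \<alpha>: "\<And>n. cmod (\<alpha> n) < 1"
  shows "schur_prod \<alpha> holomorphic_on ball 0 1"
proof -
  have plus: "(\<lambda>z. schur_plus \<alpha> z 0) holomorphic_on ball 0 1"
    unfolding schur_plus_def by (rule holomorphic_schur_lim[OF \<alpha>])
  have hb: "(\<lambda>z. schur_back \<alpha> z (- 1)) holomorphic_on ball 0 1"
    unfolding schur_back_def by (rule holomorphic_schur_lim) (use \<alpha> in simp)
  have "1 - \<alpha> (- 1) * schur_back \<alpha> z (- 1) \<noteq> 0" if "z \<in> ball 0 1" for z
  proof -
    have "cmod (schur_back \<alpha> z (- 1)) \<le> 1" using norm_schur_back_le[of \<alpha> z "- 1", OF \<alpha>] that by simp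
    then have "cmod (\<alpha> (- 1) * schur_back \<alpha> z (- 1)) \<le> cmod (\<alpha> (- 1)) * 1"
      unfolding norm_mult by (rule mult_left_mono) simp
    then have "cmod (\<alpha> (- 1) * schur_back \<alpha> z (- 1)) < 1" using \<alpha>[of "- 1"] by simp
    then show ?thesis by auto
  qed
  then show ?thesis
    unfolding schur_prod_def[abs_def] schur_minus_def by (intro holomorphic_intros plus) (use hb in auto)
qed

lemma poisson_eq_Re:
  assumes "cmod \<tau> = 1" "cmod z < 1"
  shows "poisson z \<tau> = Re (2 * (\<tau> / (\<tau> - z)) - 1)"
proof -
  have nz: "\<tau> - z \<noteq> 0" using assms by auto
  then have "2 * (\<tau> / (\<tau> - z)) - 1 = (\<tau> + z) / (\<tau> - z)" by (simp add: field_simps)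
  moreover have "Re ((\<tau> + z) / (\<tau> - z)) = ((cmod \<tau>)\<^sup>2 - (cmod z)\<^sup>2) / (cmod (\<tau> - z))\<^sup>2"
    unfolding Re_divide cmod_power2 by (simp add: power2_eq_square algebra_simps)
  ultimately show ?thesis using assms by (simp add: poisson_def)
qed

lemma integrable_circle_continuous:
  fixes g :: "complex \<Rightarrow> 'b::{banach,second_countable_topology}"
  assumes \<nu>: "prob_space \<nu>" "sets \<nu> = sets circle_borel" and g: "continuous_on (sphere 0 1) g"
  shows "integrable \<nu> g"
proof -
  interpret prob_space \<nu> by fact
  have sp: "space \<nu> = sphere 0 1" using sets_eq_imp_space_eq[OF \<nu>(2)] by simp
  have "bounded (g ` sphere 0 1)" by (intro compact_imp_bounded compact_continuous_image g) simp
  then obtain b where "\<forall>x\<in>sphere 0 1. norm (g x) \<le> b" unfolding bounded_iff by blast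
  then show ?thesis
    using borel_measurable_circle_continuous[OF g] unfolding measurable_cong_sets[OF \<nu>(2)[symmetric] refl]
    by (intro integrable_const_bound[of _ b]) (auto simp: sp)
qed

text \<open>The kernel is the real part of \<open>2 * (\<tau> / (\<tau> - z)) - 1\<close>, so the
  resolvent formula turns the Poisson integral into the real part of the Caratheodory
  function.\<close>

lemma spectral_measure_poisson:
  assumes \<alpha>: "\<And>n. cmod (\<alpha> n) < 1" and sp: "is_spectral_measure (ext_cmv \<alpha>) \<nu>" and z: "cmod z < 1"
  shows "(\<integral>\<tau>. poisson z \<tau> \<partial>\<nu>) = Re ((1 + schur_prod \<alpha> z) / (1 - schur_prod \<alpha> z))"
proof -
  have \<nu>: "prob_space \<nu>" "sets \<nu> = sets circle_borel" using sp by (auto simp: is_spectral_measure_def)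
  interpret prob_space \<nu> by fact
  have space: "space \<nu> = sphere 0 1" using sets_eq_imp_space_eq[OF \<nu>(2)] by simp
  define q where "q \<tau> = \<tau> / (\<tau> - z)" for \<tau>
  have int: "integrable \<nu> q" unfolding q_def
    by (rule integrable_circle_continuous[OF \<nu>]) (use z in \<open>auto intro!: continuous_intros\<close>)
  have "(\<integral>\<tau>. poisson z \<tau> \<partial>\<nu>) = (\<integral>\<tau>. Re (2 * q \<tau> - 1) \<partial>\<nu>)"
    by (intro Bochner_Integration.integral_cong) (auto simp: space poisson_eq_Re z q_def)
  also have "\<dots> = Re (\<integral>\<tau>. 2 * q \<tau> - 1 \<partial>\<nu>)"
    using int by (intro integral_Re) simp
  also have "(\<integral>\<tau>. 2 * q \<tau> - 1 \<partial>\<nu>) = 2 * (\<integral>\<tau>. q \<tau> \<partial>\<nu>) - 1"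
    using int by (simp add: prob_space)
  also have "\<dots> = (1 + schur_prod \<alpha> z) / (1 - schur_prod \<alpha> z)"
  proof -
    have "1 - schur_prod \<alpha> z \<noteq> 0" using norm_schur_prod_less[of \<alpha> z, OF \<alpha> z] by auto
    then show ?thesis unfolding q_def spectral_measure_schur_prod[OF \<alpha> sp z] by (simp add: field_simps)
  qed
  finally show ?thesis .
qed

section \<open>Averages of a family of measures on the circle\<close>

locale averaged_measure = prob_space M for M :: "'a measure" +
  fixes \<nu> :: "'a \<Rightarrow> complex measure" and k :: "complex measure"
  assumes \<nu>: "\<And>\<omega>. \<omega> \<in> space M \<Longrightarrow> prob_space (\<nu> \<omega>)" "\<And>\<omega>. \<omega> \<in> space M \<Longrightarrow> sets (\<nu> \<omega>) = sets circle_borel"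
    and k: "prob_space k" "sets k = sets circle_borel"
    and average: "\<And>g :: complex \<Rightarrow> complex. continuous_on (sphere 0 1) g \<Longrightarrow> (\<integral>z. g z \<partial>k) = (\<integral>\<omega>. (\<integral>z. g z \<partial>\<nu> \<omega>) \<partial>M)"
begin

text \<open>Measurability of the fibre integrals is not assumed: were \<open>g\<close> not integrable, neither would \<open>1 + g\<close> be, and
  both averages would have the junk value \<open>0\<close>, although they differ by \<open>1\<close>.\<close>

lemma average_integrable:
  fixes g :: "complex \<Rightarrow> complex"
  assumes g: "continuous_on (sphere 0 1) g"
  shows "integrable M (\<lambda>\<omega>. \<integral>z. g z \<partial>\<nu> \<omega>)"
proof (rule ccontr)
  assume ni: "\<not> integrable M (\<lambda>\<omega>. \<integral>z. g z \<partial>\<nu> \<omega>)"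
  interpret k: prob_space k by (rule k)
  have e: "(\<integral>z. 1 + g z \<partial>\<nu> \<omega>) = 1 + (\<integral>z. g z \<partial>\<nu> \<omega>)" if "\<omega> \<in> space M" for \<omega>
  proof -
    interpret n: prob_space "\<nu> \<omega>" by (rule \<nu>(1)[OF that])
    show ?thesis using integrable_circle_continuous[OF \<nu>[OF that] g] by (simp add: n.prob_space)
  qed
  have "\<not> integrable M (\<lambda>\<omega>. \<integral>z. 1 + g z \<partial>\<nu> \<omega>)"
  proof
    assume "integrable M (\<lambda>\<omega>. \<integral>z. 1 + g z \<partial>\<nu> \<omega>)"
    then have "integrable M (\<lambda>\<omega>. (\<integral>z. 1 + g z \<partial>\<nu> \<omega>) - 1)" by simp
    also have "?this \<longleftrightarrow> integrable M (\<lambda>\<omega>. \<integral>z. g z \<partial>\<nu> \<omega>)" by (intro Bochner_Integration.integrable_cong) (auto simp: e)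
    finally show False using ni by simp
  qed
  then have "(\<integral>z. 1 + g z \<partial>k) = 0"
    using average[of "\<lambda>z. 1 + g z"] g by (simp add: not_integrable_integral_eq continuous_intros)
  moreover have "(\<integral>z. g z \<partial>k) = 0" using average[OF g] ni by (simp add: not_integrable_integral_eq)
  moreover have "(\<integral>z. 1 + g z \<partial>k) = 1 + (\<integral>z. g z \<partial>k)"
    using integrable_circle_continuous[OF k g] by (simp add: k.prob_space)
  ultimately show False by simp
qed

lemma average_real:
  fixes g :: "complex \<Rightarrow> real"
  assumes g: "continuous_on (sphere 0 1) g"
  shows "integrable M (\<lambda>\<omega>. \<integral>z. g z \<partial>\<nu> \<omega>)" "(\<integral>z. g z \<partial>k) = (\<integral>\<omega>. (\<integral>z. g z \<partial>\<nu> \<omega>) \<partial>M)"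
proof -
  have gc: "continuous_on (sphere 0 1) (\<lambda>z. complex_of_real (g z))" by (intro continuous_intros g)
  have e: "(\<integral>z. complex_of_real (g z) \<partial>N) = complex_of_real (\<integral>z. g z \<partial>N)" for N :: "complex measure" by simp
  show i: "integrable M (\<lambda>\<omega>. \<integral>z. g z \<partial>\<nu> \<omega>)"
    using integrable_Re[OF average_integrable[OF gc]] unfolding e by simp
  have "complex_of_real (\<integral>z. g z \<partial>k) = complex_of_real (\<integral>\<omega>. (\<integral>z. g z \<partial>\<nu> \<omega>) \<partial>M)"
    using average[OF gc] unfolding e by simp
  then show "(\<integral>z. g z \<partial>k) = (\<integral>\<omega>. (\<integral>z. g z \<partial>\<nu> \<omega>) \<partial>M)" by (simp only: of_real_eq_iff)
qed

text \<open>Each density is dominated by its own measure. The averages of these measures are then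
  compared with \<open>k\<close> through continuous cutoffs, the functions for which the averaging
  relation is given.\<close>

lemma ac_le_closed:
  assumes ac: "\<And>\<omega>. \<omega> \<in> space M \<Longrightarrow> is_ac_density (\<nu> \<omega>) (\<nu>_ac \<omega>)"
    and ac_meas: "(\<lambda>p. \<nu>_ac (snd p) (fst p)) \<in> borel_measurable (arc_length \<Otimes>\<^sub>M M)"
    and A: "closed A" "A \<subseteq> sphere 0 1"
  shows "(\<integral>\<^sup>+\<zeta>\<in>A. (\<integral>\<^sup>+\<omega>. ennreal (\<nu>_ac \<omega> \<zeta>) \<partial>M) \<partial>arc_length) \<le> emeasure k A"
proof (cases "A = {}")
  case False
  interpret k: prob_space k by (rule k)
  interpret P: pair_sigma_finite arc_length M ..
  note [measurable] = ac_meas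
  have spk: "space k = sphere 0 1" using sets_eq_imp_space_eq[OF k(2)] by simp
  have As [measurable]: "A \<in> sets circle_borel" by (rule circle_closed_sets[OF A])
  have "(\<integral>\<^sup>+\<zeta>\<in>A. (\<integral>\<^sup>+\<omega>. ennreal (\<nu>_ac \<omega> \<zeta>) \<partial>M) \<partial>arc_length) = (\<integral>\<^sup>+\<zeta>. \<integral>\<^sup>+\<omega>. ennreal (\<nu>_ac \<omega> \<zeta>) * indicator A \<zeta> \<partial>M \<partial>arc_length)"
  proof (intro nn_integral_cong nn_integral_multc[symmetric])
    fix \<zeta> assume "\<zeta> \<in> space arc_length"
    then show "(\<lambda>\<omega>. ennreal (\<nu>_ac \<omega> \<zeta>)) \<in> borel_measurable M"
      using measurable_compose[OF measurable_Pair1' ac_meas] by simp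
  qed
  also have "\<dots> = (\<integral>\<^sup>+\<omega>. \<integral>\<^sup>+\<zeta>. ennreal (\<nu>_ac \<omega> \<zeta>) * indicator A \<zeta> \<partial>arc_length \<partial>M)"
    by (rule P.Fubini'[symmetric]) (unfold case_prod_beta', measurable)
  \<comment> \<open>\<open>nn_integral_mono\<close> is applied to the measures of \<open>A\<close>
    without knowing that they depend measurably on \<omega>.\<close>
  also have "\<dots> \<le> (\<integral>\<^sup>+\<omega>. emeasure (\<nu> \<omega>) A \<partial>M)"
  proof (rule nn_integral_mono)
    fix \<omega> assume "\<omega> \<in> space M"
    from ac_density_closed[OF ac[OF this]] show "(\<integral>\<^sup>+\<zeta>\<in>A. ennreal (\<nu>_ac \<omega> \<zeta>) \<partial>arc_length) \<le> emeasure (\<nu> \<omega>) A"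
      using As by blast
  qed
  finally have 1: "(\<integral>\<^sup>+\<zeta>\<in>A. (\<integral>\<^sup>+\<omega>. ennreal (\<nu>_ac \<omega> \<zeta>) \<partial>M) \<partial>arc_length) \<le> (\<integral>\<^sup>+\<omega>. emeasure (\<nu> \<omega>) A \<partial>M)" .
  have 2: "(\<integral>\<^sup>+\<omega>. emeasure (\<nu> \<omega>) A \<partial>M) \<le> emeasure k (circle_nbhd A (1 / real (Suc n)) \<inter> sphere 0 1)" for n
  proof -
    \<comment> \<open>\<open>g\<close> is \<open>1\<close> on \<open>A\<close> and \<open>0\<close>
      from distance \<open>1 / (n + 1)\<close> on, so its integral lies between the measure of
      \<open>A\<close> and that of the neighbourhood.\<close>
    define g where "g \<tau> = max 0 (1 - real (Suc n) * infdist \<tau> A)" for \<tau>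
    have gc: "continuous_on (sphere 0 1) g" unfolding g_def by (intro continuous_intros)
    have g0: "0 \<le> g \<tau>" for \<tau> by (simp add: g_def)
    have ge: "ennreal (g \<tau>) \<le> indicator (circle_nbhd A (1 / real (Suc n)) \<inter> sphere 0 1) \<tau>" if "cmod \<tau> = 1" for \<tau>
    proof (cases "infdist \<tau> A < 1 / real (Suc n)")
      case True
      then show ?thesis using that infdist_nonneg[of \<tau> A] by (simp add: circle_nbhd_def g_def)
    next
      case False
      then have "g \<tau> = 0" by (simp add: g_def field_simps)
      then show ?thesis by simp
    qed
    have "emeasure (\<nu> \<omega>) A \<le> ennreal (\<integral>\<tau>. g \<tau> \<partial>\<nu> \<omega>)" if \<omega>: "\<omega> \<in> space M" for \<omega>
    proof -
      have "emeasure (\<nu> \<omega>) A = (\<integral>\<^sup>+\<tau>. indicator A \<tau> \<partial>\<nu> \<omega>)" using As \<nu>(2)[OF \<omega>] by simp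
      also have "\<dots> \<le> (\<integral>\<^sup>+\<tau>. ennreal (g \<tau>) \<partial>\<nu> \<omega>)"
        by (intro nn_integral_mono) (auto simp: indicator_def g_def)
      also have "\<dots> = ennreal (\<integral>\<tau>. g \<tau> \<partial>\<nu> \<omega>)"
        using g0 by (intro nn_integral_eq_integral integrable_circle_continuous[OF \<nu>[OF \<omega>] gc]) auto
      finally show ?thesis .
    qed
    then have "(\<integral>\<^sup>+\<omega>. emeasure (\<nu> \<omega>) A \<partial>M) \<le> (\<integral>\<^sup>+\<omega>. ennreal (\<integral>\<tau>. g \<tau> \<partial>\<nu> \<omega>) \<partial>M)" by (rule nn_integral_mono)
    also have "\<dots> = ennreal (\<integral>\<omega>. (\<integral>\<tau>. g \<tau> \<partial>\<nu> \<omega>) \<partial>M)"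
      using g0 by (intro nn_integral_eq_integral average_real(1)[OF gc]) auto
    also have "\<dots> = ennreal (\<integral>\<tau>. g \<tau> \<partial>k)" by (simp add: average_real(2)[OF gc])
    also have "\<dots> = (\<integral>\<^sup>+\<tau>. ennreal (g \<tau>) \<partial>k)"
      using g0 by (intro nn_integral_eq_integral[symmetric] integrable_circle_continuous[OF k gc]) auto
    also have "\<dots> \<le> (\<integral>\<^sup>+\<tau>. indicator (circle_nbhd A (1 / real (Suc n)) \<inter> sphere 0 1) \<tau> \<partial>k)"
      using ge by (intro nn_integral_mono) (auto simp: spk)
    also have "\<dots> = emeasure k (circle_nbhd A (1 / real (Suc n)) \<inter> sphere 0 1)"
      using sets_circle_nbhd[of A] sets.top[of circle_borel] by (intro nn_integral_indicator) (auto simp: k(2))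
    finally show ?thesis .
  qed
  have "(\<lambda>n. emeasure k (circle_nbhd A (1 / real (Suc n)) \<inter> sphere 0 1)) \<longlonglongrightarrow> emeasure k (A \<inter> sphere 0 1)"
    using sets.top[of circle_borel]
    by (intro emeasure_circle_nbhd_tendsto[OF A(1) False A(2)] k) (auto simp: k.emeasure_finite less_top[symmetric])
  then have "(\<integral>\<^sup>+\<omega>. emeasure (\<nu> \<omega>) A \<partial>M) \<le> emeasure k (A \<inter> sphere 0 1)"
    using 2 by (intro LIMSEQ_le_const) auto
  then show ?thesis using 1 A(2) by (simp add: Int_absorb2)
qed simp

end

theorem theorem1:
  fixes M :: "'a measure" and S :: "'a \<Rightarrow> 'a" and f :: "'a \<Rightarrow> complex" and C :: real
    and \<nu> :: "'a \<Rightarrow> complex measure" and k :: "complex measure"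
    and \<nu>_ac :: "'a \<Rightarrow> complex \<Rightarrow> real" and k_ac :: "complex \<Rightarrow> real"
  assumes "prob_space M"
    and "bimeasurable_bij M S"
    and "ergodic M S"
    and "f \<in> borel_measurable M"
    and "\<And>\<omega>. \<omega> \<in> space M \<Longrightarrow> f \<omega> \<in> ball 0 1"
    and "C < 1"
    and "AE \<omega> in M. cmod (f \<omega>) \<le> C"
    and "\<And>\<omega>. \<omega> \<in> space M \<Longrightarrow> is_spectral_measure (ext_cmv (verblunsky M S f \<omega>)) (\<nu> \<omega>)"
    and "is_density_of_states M (\<lambda>\<omega>. ext_cmv (verblunsky M S f \<omega>)) k"
    and "(\<lambda>(\<omega>, z). \<nu>_ac \<omega> z) \<in> borel_measurable (M \<Otimes>\<^sub>M circle_borel)"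
    and "\<And>\<omega>. \<omega> \<in> space M \<Longrightarrow> is_ac_density (\<nu> \<omega>) (\<nu>_ac \<omega>)"
    and "is_ac_density k k_ac"
  shows "AE z in arc_length.
           z \<in> {z. lyapunov_exponent M (verblunsky M S f) z = 0} \<inter> sphere 0 1 \<longrightarrow>
           integrable M (\<lambda>\<omega>. \<nu>_ac \<omega> z) \<and> k_ac z = (\<integral>\<omega>. \<nu>_ac \<omega> z \<partial>M)"
proof -
  interpret prob_space M by fact
  interpret cmv_system M S f C
    using assms(2-7) by unfold_locales (auto simp: ergodic_def)
  have \<nu>: "prob_space (\<nu> \<omega>)" "sets (\<nu> \<omega>) = sets circle_borel" if "\<omega> \<in> space M" for \<omega>
    using assms(8)[OF that] by (auto simp: is_spectral_measure_def)
  have k: "prob_space k" "sets k = sets circle_borel" using assms(9) by (auto simp: is_density_of_states_def)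
  interpret k: prob_space k by (rule k)
  have avg: "averaged_measure M \<nu> k"
  proof (intro averaged_measure.intro averaged_measure_axioms.intro assms(1) \<nu> k)
    fix g :: "complex \<Rightarrow> complex" assume g: "continuous_on (sphere 0 1) g"
    then have "(\<integral>z. g z \<partial>k) = (\<integral>\<omega>. ell2_inner (basis_vec 0) (cfc (ext_cmv (verblunsky M S f \<omega>)) g (basis_vec 0)) \<partial>M)"
      using assms(9) by (simp add: is_density_of_states_def)
    also have "\<dots> = (\<integral>\<omega>. (\<integral>z. g z \<partial>\<nu> \<omega>) \<partial>M)"
      using assms(8) g by (intro Bochner_Integration.integral_cong) (auto simp: is_spectral_measure_def)
    finally show "(\<integral>z. g z \<partial>k) = (\<integral>\<omega>. (\<integral>z. g z \<partial>\<nu> \<omega>) \<partial>M)" .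
  qed
  interpret averaged_measure M \<nu> k by (rule avg)
  have fam: "schur_family M (\<lambda>\<omega>. schur_prod (al \<omega>))"
  proof (intro schur_family.intro schur_family_axioms.intro assms(1))
    show "schur_prod (al \<omega>) holomorphic_on ball 0 1" if "\<omega> \<in> space M" for \<omega>
      by (rule holomorphic_schur_prod) (rule al_less[OF that])
    show "cmod (schur_prod (al \<omega>) z) \<le> cmod z" if "\<omega> \<in> space M" "cmod z < 1" for \<omega> z
      using norm_schur_prod_le[of "al \<omega>" z, OF al_less[OF that(1)] that(2)]
        norm_schur_plus_le[of "al \<omega>" z 0, OF al_less[OF that(1)] that(2)] by simp
    show "(\<lambda>p. schur_prod (al (fst p)) (of_real r * snd p)) \<in> borel_measurable (M \<Otimes>\<^sub>M circle_borel)" if "0 \<le> r" "r < 1" for r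
      by (rule measurable_schur_prod) (use that in \<open>auto simp: norm_mult space_pair_measure\<close>)
  qed
  interpret schur_family M "\<lambda>\<omega>. schur_prod (al \<omega>)" by (rule fam)
  have ac_meas: "(\<lambda>p. \<nu>_ac (snd p) (fst p)) \<in> borel_measurable (arc_length \<Otimes>\<^sub>M M)"
    using measurable_compose[OF measurable_pair_swap' assms(10)]
    by (subst measurable_cong_sets[OF sets_pair_measure_cong[OF sets_arc_length refl] refl]) (simp add: case_prod_beta')
  have pn: "(\<integral>\<^sup>+\<tau>. ennreal (poisson z \<tau>) \<partial>N) = ennreal (\<integral>\<tau>. poisson z \<tau> \<partial>N)"
    if "cmod z < 1" "prob_space N" "sets N = sets circle_borel" for z N
    using that by (intro nn_integral_eq_integral integrable_circle_continuous poisson_continuous) (auto simp: poisson_nonneg)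
  have \<nu>R: "(\<integral>\<tau>. poisson z \<tau> \<partial>\<nu> \<omega>) = Re (cay 1 (schur_prod (al \<omega>) z))" if "\<omega> \<in> space M" "cmod z < 1" for \<omega> z
    using spectral_measure_poisson[of "al \<omega>", OF al_less[OF that(1)] assms(8)[OF that(1)] that(2)] by (simp add: cay_def)
  have \<nu>P: "(\<integral>\<^sup>+\<tau>. ennreal (poisson z \<tau>) \<partial>\<nu> \<omega>) = ennreal (Re (cay 1 (schur_prod (al \<omega>) z)))" if "\<omega> \<in> space M" "cmod z < 1" for \<omega> z
    using pn[OF that(2) \<nu>[OF that(1)]] \<nu>R[OF that] by simp
  have Fint: "integrable M (\<lambda>\<omega>. Re (cay 1 (schur_prod (al \<omega>) z)))"
    and kR: "(\<integral>\<tau>. poisson z \<tau> \<partial>k) = (\<integral>\<omega>. Re (cay 1 (schur_prod (al \<omega>) z)) \<partial>M)" if z: "cmod z < 1" for z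
  proof -
    have "integrable M (\<lambda>\<omega>. \<integral>\<tau>. poisson z \<tau> \<partial>\<nu> \<omega>) \<longleftrightarrow> integrable M (\<lambda>\<omega>. Re (cay 1 (schur_prod (al \<omega>) z)))"
      using \<nu>R z by (intro Bochner_Integration.integrable_cong) auto
    then show "integrable M (\<lambda>\<omega>. Re (cay 1 (schur_prod (al \<omega>) z)))" using average_real(1)[OF poisson_continuous[OF z]] by simp
    show "(\<integral>\<tau>. poisson z \<tau> \<partial>k) = (\<integral>\<omega>. Re (cay 1 (schur_prod (al \<omega>) z)) \<partial>M)"
      unfolding average_real(2)[OF poisson_continuous[OF z]] using \<nu>R z by (intro Bochner_Integration.integral_cong) auto
  qed
  have kP: "(\<integral>\<^sup>+\<tau>. ennreal (poisson z \<tau>) \<partial>k) = H 1 z" if z: "cmod z < 1" for z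
  proof -
    have "AE \<omega> in M. 0 \<le> Re (cay 1 (schur_prod (al \<omega>) z))"
      using w_less[OF _ z] by (intro AE_I2 cay_nonneg) (auto simp: less_imp_le)
    then show ?thesis
      unfolding H_def pn[OF z k] kR[OF z] by (intro nn_integral_eq_integral[symmetric] Fint[OF z])
  qed
  define h where "h \<zeta> = (\<integral>\<^sup>+\<omega>. ennreal (\<nu>_ac \<omega> \<zeta>) \<partial>M)" for \<zeta>
  have h_meas [measurable]: "h \<in> borel_measurable circle_borel"
    unfolding h_def[abs_def] borel_measurable_arc_length[symmetric] using ac_meas
    by (intro borel_measurable_nn_integral) (simp add: case_prod_beta')
  have k_ac [measurable]: "k_ac \<in> borel_measurable circle_borel" and k_ac0: "\<And>z. cmod z = 1 \<Longrightarrow> 0 \<le> k_ac z"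
    using assms(12) by (auto simp: is_ac_density_def)
  obtain B where B: "B \<in> null_sets arc_length"
    "\<And>A. A \<in> sets circle_borel \<Longrightarrow> (\<integral>\<^sup>+\<zeta>\<in>A. ennreal (k_ac \<zeta>) \<partial>arc_length) \<le> emeasure k A"
    "\<And>A. A \<in> sets circle_borel \<Longrightarrow> A \<inter> B = {} \<Longrightarrow> emeasure k A = (\<integral>\<^sup>+\<zeta>\<in>A. ennreal (k_ac \<zeta>) \<partial>arc_length)"
    using ac_density_closed[OF assms(12)] by metis
  have total: "(\<integral>\<^sup>+\<zeta>. u \<zeta> \<partial>arc_length) < \<infinity>" if "(\<integral>\<^sup>+\<zeta>\<in>sphere 0 1. u \<zeta> \<partial>arc_length) \<le> emeasure k (sphere 0 1)" for u
  proof -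
    have "(\<integral>\<^sup>+\<zeta>. u \<zeta> \<partial>arc_length) = (\<integral>\<^sup>+\<zeta>\<in>sphere 0 1. u \<zeta> \<partial>arc_length)" by (intro nn_integral_cong) simp
    also note that
    also have "emeasure k (sphere 0 1) < \<infinity>" using less_top[THEN iffD1, OF k.emeasure_finite] by simp
    finally show ?thesis .
  qed
  have sph: "sphere 0 1 \<in> sets circle_borel" using sets.top[of circle_borel] by simp
  \<comment> \<open>This half holds almost everywhere on the circle, with no use of the exponent.
    Test sets avoid \<open>B\<close>, so that \<open>k\<close> has no singular part on them.\<close>
  have lower: "AE \<zeta> in arc_length. \<zeta> \<in> sphere 0 1 - B \<longrightarrow> h \<zeta> \<le> ennreal (k_ac \<zeta>)"
  proof (rule AE_le_of_closed_integrals)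
    show "sphere 0 1 - B \<in> sets circle_borel" using sph B(1) by (auto simp: null_sets_def)
    show "(\<integral>\<^sup>+\<zeta>. h \<zeta> \<partial>arc_length) < \<infinity>"
      unfolding h_def by (intro total ac_le_closed[OF assms(11) ac_meas]) auto
    fix A assume A: "closed A" "A \<subseteq> sphere 0 1 - B"
    then have As: "A \<subseteq> sphere 0 1" "A \<inter> B = {}" by auto
    show "(\<integral>\<^sup>+\<zeta>\<in>A. h \<zeta> \<partial>arc_length) \<le> (\<integral>\<^sup>+\<zeta>\<in>A. ennreal (k_ac \<zeta>) \<partial>arc_length)"
      using ac_le_closed[OF assms(11) ac_meas A(1) As(1)] B(3)[OF circle_closed_sets[OF A(1) As(1)] As(2)] by (simp add: h_def)
  qed measurable
  \<comment> \<open>\<open>k_ac\<close> is dominated by \<open>k\<close> on every set, and on closed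
    subsets of a good set \<open>k\<close> is dominated by the mean density.\<close>
  have upper: "AE \<zeta> in arc_length. \<zeta> \<in> good b \<longrightarrow> ennreal (k_ac \<zeta>) \<le> h \<zeta>" for b
  proof (rule AE_le_of_closed_integrals)
    show "(\<integral>\<^sup>+\<zeta>. ennreal (k_ac \<zeta>) \<partial>arc_length) < \<infinity>" by (intro total B(2) sph)
    fix A assume A: "closed A" "A \<subseteq> good b"
    then have "A \<in> sets circle_borel" using good_circle by (intro circle_closed_sets) auto
    then show "(\<integral>\<^sup>+\<zeta>\<in>A. ennreal (k_ac \<zeta>) \<partial>arc_length) \<le> (\<integral>\<^sup>+\<zeta>\<in>A. h \<zeta> \<partial>arc_length)"
      using B(2)[of A] closed_good_le_ac[OF k kP \<nu> \<nu>P assms(11) ac_meas A] unfolding h_def by auto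
  qed measurable
  \<comment> \<open>Integer bounds reduce the matter to countably many good sets, so the exceptional
    null sets of \<open>upper\<close> can be united.\<close>
  have good: "\<exists>b::nat. \<zeta> \<in> good (real b)"
    if \<zeta>: "cmod \<zeta> = 1" and lyap: "lyapunov_exponent M al \<zeta> = 0"
      and N: "\<And>r. 0 \<le> r \<Longrightarrow> r < 1 \<Longrightarrow> (\<integral>\<^sup>+\<tau>. ennreal (poisson (of_real r * \<zeta>) \<tau>) \<partial>k) \<le> ennreal N" for \<zeta> N
  proof -
    \<comment> \<open>The Green function bound asks for a nonnegative constant, and
      \<open>ennreal\<close> reads a negative \<open>N\<close> as \<open>0\<close> anyway.\<close>
    define N' where "N' = max N 0"
    have N': "0 \<le> N'" by (simp add: N'_def)
    \<comment> \<open>The Green function is half of one plus the Caratheodory function, whose mean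
      real part is the Poisson integral of \<open>k\<close>.\<close>
    have V: "(\<integral>\<omega>. Re (1 / (1 - schur_prod (al \<omega>) (of_real t * \<zeta>))) \<partial>M) \<le> (1 + N') / 2" if t: "1 / 2 \<le> t" "t < 1" for t
    proof -
      have z: "cmod (of_real t * \<zeta>) < 1" using t \<zeta> by (simp add: norm_mult)
      have "(\<integral>\<omega>. Re (1 / (1 - schur_prod (al \<omega>) (of_real t * \<zeta>))) \<partial>M) = (\<integral>\<omega>. (1 + Re (cay 1 (schur_prod (al \<omega>) (of_real t * \<zeta>)))) / 2 \<partial>M)"
      proof (intro Bochner_Integration.integral_cong refl)
        fix \<omega> assume "\<omega> \<in> space M"
        then have nz: "1 - schur_prod (al \<omega>) (of_real t * \<zeta>) \<noteq> 0" using denom_nonzero[OF _ z, of \<omega> 1] by simp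
        then have "1 / (1 - schur_prod (al \<omega>) (of_real t * \<zeta>)) = (1 + cay 1 (schur_prod (al \<omega>) (of_real t * \<zeta>))) / 2"
          by (simp add: cay_def field_simps)
        then show "Re (1 / (1 - schur_prod (al \<omega>) (of_real t * \<zeta>))) = (1 + Re (cay 1 (schur_prod (al \<omega>) (of_real t * \<zeta>)))) / 2"
          by (simp only: Re_divide_numeral plus_complex.sel one_complex.sel)
      qed
      also have "\<dots> = (1 + (\<integral>\<tau>. poisson (of_real t * \<zeta>) \<tau> \<partial>k)) / 2"
        using Fint[OF z] by (simp add: kR[OF z] prob_space)
      also have "(\<integral>\<tau>. poisson (of_real t * \<zeta>) \<tau> \<partial>k) \<le> N'"
      proof -
        have "ennreal (\<integral>\<tau>. poisson (of_real t * \<zeta>) \<tau> \<partial>k) \<le> ennreal N'"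
          using order_trans[OF N[of t] ennreal_leI[of N N']] t unfolding pn[OF z k] by (simp add: N'_def)
        then show ?thesis using N' by (simp add: ennreal_le_iff)
      qed
      finally show ?thesis by simp
    qed
    obtain b :: nat where b: "4 * N' \<le> real b" using real_arch_simple by blast
    have "(\<integral>\<^sup>+\<omega>. inverse (ennreal (cmod (1 - schur_prod (al \<omega>) (of_real r * \<zeta>)))) \<partial>M) \<le> ennreal (real b)" if r: "1 / 2 \<le> r" "r < 1" for r
    proof -
      have z: "cmod (of_real r * \<zeta>) < 1" using r \<zeta> by (simp add: norm_mult)
      have "(\<integral>\<^sup>+\<omega>. inverse (ennreal (cmod (1 - schur_prod (al \<omega>) (of_real r * \<zeta>)))) \<partial>M) =
          (\<integral>\<^sup>+\<omega>. ennreal (cmod (1 / (1 - schur_prod (al \<omega>) (of_real r * \<zeta>)))) \<partial>M)"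
      proof (intro nn_integral_cong)
        fix \<omega> assume "\<omega> \<in> space M"
        then have "0 < cmod (1 - schur_prod (al \<omega>) (of_real r * \<zeta>))" using denom_nonzero[OF _ z, of \<omega> 1] by simp
        then show "inverse (ennreal (cmod (1 - schur_prod (al \<omega>) (of_real r * \<zeta>)))) = ennreal (cmod (1 / (1 - schur_prod (al \<omega>) (of_real r * \<zeta>))))"
          by (simp add: inverse_ennreal norm_divide inverse_eq_divide)
      qed
      also have "\<dots> \<le> ennreal (4 * N')" by (rule green_function_bound[OF \<zeta> lyap N' V r])
      also have "\<dots> \<le> ennreal (real b)" using b by (rule ennreal_leI)
      finally show ?thesis .
    qed
    then have "\<zeta> \<in> good (real b)" using \<zeta> by (auto simp: good_def)
    then show ?thesis ..
  qed
  have "AE \<zeta> in arc_length. \<forall>b::nat. \<zeta> \<in> good (real b) \<longrightarrow> ennreal (k_ac \<zeta>) \<le> h \<zeta>"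
    by (subst AE_all_countable) (intro allI upper)
  then show ?thesis
    using lower AE_poisson_bounded[OF k.finite_measure_axioms k(2)] AE_not_in[OF B(1)] AE_space
  proof eventually_elim
    case (elim \<zeta>)
    then have \<zeta>: "cmod \<zeta> = 1" by simp
    show ?case
    proof (intro impI)
      assume z: "\<zeta> \<in> {z. lyapunov_exponent M al z = 0} \<inter> sphere 0 1"
      obtain N where "\<And>r. 0 \<le> r \<Longrightarrow> r < 1 \<Longrightarrow> (\<integral>\<^sup>+\<tau>. ennreal (poisson (of_real r * \<zeta>) \<tau>) \<partial>k) \<le> ennreal N" using elim(3) by blast
      then obtain b :: nat where "\<zeta> \<in> good (real b)" using good[OF \<zeta>] z by blast
      \<comment> \<open>\<open>h\<close> is an extended nonnegative integral; that it equals the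
        finite number \<open>k_ac \<zeta>\<close> yields integrability together with the
        value.\<close>
      then have eq: "h \<zeta> = ennreal (k_ac \<zeta>)" using elim \<zeta> by (intro antisym) auto
      have "(\<lambda>\<omega>. \<nu>_ac \<omega> \<zeta>) \<in> borel_measurable M"
        using measurable_compose[OF measurable_Pair1'[OF elim(5)] ac_meas] by simp
      moreover have "AE \<omega> in M. 0 \<le> \<nu>_ac \<omega> \<zeta>"
        using assms(11) \<zeta> by (intro AE_I2) (auto simp: is_ac_density_def)
      ultimately show "integrable M (\<lambda>\<omega>. \<nu>_ac \<omega> \<zeta>) \<and> k_ac \<zeta> = (\<integral>\<omega>. \<nu>_ac \<omega> \<zeta> \<partial>M)"
        using eq k_ac0[OF \<zeta>] nn_integral_eq_integrable[of "\<lambda>\<omega>. \<nu>_ac \<omega> \<zeta>" M "k_ac \<zeta>"] by (auto simp: h_def)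
    qed
  qed
qed

end
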